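(* Let $p$ be a prime and let $\mathcal F$ be a saturated fusion system over a finite $p$-group $S$. Let $(\Gamma,\theta,\Theta)$ be any fusion mapping triple on $\mathcal F^q$, where $\Gamma$ is a (finite) $p$-group or a finite group of order prime to $p$, with $\theta:S\to\Gamma$ and $\Theta:\mathrm{Mor}(\mathcal F^q)\to\mathfrak{Sub}(\Gamma)$. Then the following hold for any subgroup $H\le\Gamma$, where $S_H=\theta^{-1}(H)$. (a) $\mathcal F_H$ is a saturated fusion system over $S_H$. (b) If $\Gamma$ is a $p$-group, then a subgroup $P\le S_H$ is $\mathcal F_H$-quasicentric if and only if it is $\mathcal F$-quasicentric. Also, $\mathcal F_1^\bullet\supseteq O^p_*(\mathcal F)$. (c) If $\Gamma$ has order prime to $p$, then $S_H=S$. A subgroup $P\le S$ is $\mathcal F_H$-centric (fully centralized in $\mathcal F_H$, fully normalized in $\mathcal F_H$) if and only if it is $\mathcal F$-centric (fully centralized in $\mathcal F$, fully normalized in $\mathcal F$). Also, $\mathcal F_1^\bullet\supseteq O^{p'}_*(\mathcal F)$.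
   Context: Fusion systems. Let $S$ be a finite $p$-group. Write $c_x(g)=xgx^{-1}$; for $P,Q\le S$ let $N_S(P,Q)=\{x\in S: xPx^{-1}\le Q\}$, $\mathrm{Hom}_S(P,Q)=\{c_x|_P: x\in N_S(P,Q)\}$, $\mathrm{Aut}_S(P)=\mathrm{Hom}_S(P,P)$, and let $\mathrm{Inj}(P,Q)$ be the set of injective homomorphisms. A fusion system $\mathcal F$ over $S$ is a category whose objects are all subgroups of $S$, with $\mathrm{Hom}_S(P,Q)\subseteq\mathrm{Hom}_{\mathcal F}(P,Q)\subseteq\mathrm{Inj}(P,Q)$, and such that each morphism is the composite of an isomorphism in $\mathcal F$ followed by an inclusion. Write $\mathrm{Aut}_{\mathcal F}(P)=\mathrm{Hom}_{\mathcal F}(P,P)$. Subgroups isomorphic in $\mathcal F$ are called $\mathcal F$-conjugate. $P\le S$ is fully centralized (resp. fully normalized) in $\mathcal F$ if $|C_S(P)|\ge|C_S(P')|$ (resp. $|N_S(P)|\ge|N_S(P')|$) for all $P'$ $\mathcal F$-conjugate to $P$. $\mathcal F$ is saturated if: (I) every fully normalized $P$ is fully centralized and $\mathrm{Aut}_S(P)\in\mathrm{Syl}_p(\mathrm{Aut}_{\mathcal F}(P))$; (II) if $\varphi\in\mathrm{Hom}_{\mathcal F}(P,S)$ is such that $\varphi(P)$ is fully centralized, then $\varphi$ extends to some $\overline\varphi\in\mathrm{Hom}_{\mathcal F}(N_\varphi,S)$, where $N_\varphi=\{g\in N_S(P): \varphi c_g\varphi^{-1}\in\mathrm{Aut}_S(\varphi(P))\}$.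 $P\le S$ is $\mathcal F$-centric if $C_S(P')=Z(P')$ for all $P'$ $\mathcal F$-conjugate to $P$. For $P$ fully centralized, $C_{\mathcal F}(P)$ is the fusion system over $C_S(P)$ with $\mathrm{Hom}_{C_{\mathcal F}(P)}(Q,Q')=\{\alpha|_Q:\alpha\in\mathrm{Hom}_{\mathcal F}(QP,Q'P),\ \alpha|_P=\mathrm{Id}_P,\ \alpha(Q)\le Q'\}$. $P\le S$ is $\mathcal F$-quasicentric if for every fully centralized $P'$ which is $\mathcal F$-conjugate to $P$, $C_{\mathcal F}(P')$ is the fusion system of the $p$-group $C_S(P')$ (all morphisms are conjugations by elements of $C_S(P')$). $\mathcal F^q\subseteq\mathcal F$ is the full subcategory on the $\mathcal F$-quasicentric subgroups. Restrictive categories. A restrictive category over $S$ is a category whose objects are the subgroups of $S$, all of whose morphisms are group monomorphisms, and such that for all $P'\le P\le S$, $Q'\le Q\le S$ and each morphism $\varphi:P\to Q$ with $\varphi(P')\le Q'$, the restriction $\varphi|_{P'}:P'\to Q'$ is a morphism in the category. For a finite group $G$, $O^p(G)$ (resp. $O^{p'}(G)$) is the smallest normal subgroup of $p$-power index (resp. index prime to $p$). $O^p_*(\mathcal F)$ (resp. $O^{p'}_*(\mathcal F)$) is the smallest restrictive subcategory of $\mathcal F$ whose morphism set contains $O^p(\mathrm{Aut}_{\mathcal F}(P))$ (resp. $O^{p'}(\mathrm{Aut}_{\mathcal F}(P))$) for all $P\le S$. Fusion mapping triples. $\mathfrak{Sub}(\Gamma)$ is the set of nonempty subsets of $\Gamma$.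 A fusion mapping triple on $\mathcal F^q$ is $(\Gamma,\theta,\Theta)$, with $\Gamma$ a group, $\theta:S\to\Gamma$ a homomorphism, and $\Theta:\mathrm{Mor}(\mathcal F^q)\to\mathfrak{Sub}(\Gamma)$ a map such that for all $\mathcal F$-quasicentric $P,Q,R\le S$: (i) for all $P\xrightarrow{\varphi}Q\xrightarrow{\psi}R$ in $\mathcal F^q$ and all $x\in\Theta(\psi)$, $\Theta(\psi\varphi)=x\cdot\Theta(\varphi)$; (ii) if $P$ is fully centralized in $\mathcal F$, then $\Theta(\mathrm{Id}_P)=\theta(C_S(P))$; (iii) if $\varphi=c_g\in\mathrm{Hom}_{\mathcal F}(P,Q)$ with $g\in N_S(P,Q)$, then $\theta(g)\in\Theta(\varphi)$; (iv) for all $\varphi\in\mathrm{Hom}_{\mathcal F}(P,Q)$, $x\in\Theta(\varphi)$, $g\in P$: $x\theta(g)x^{-1}=\theta(\varphi(g))$. For $H\le\Gamma$, $\mathcal F_H^\bullet\subseteq\mathcal F$ is the smallest restrictive subcategory containing all $\varphi\in\mathrm{Mor}(\mathcal F^q)$ with $\Theta(\varphi)\cap H\ne\emptyset$, and $\mathcal F_H\subseteq\mathcal F_H^\bullet$ is the full subcategory whose objects are the subgroups of $\theta^{-1}(H)$. $\mathcal F_1^\bullet$ is the case of the trivial subgroup $H=1$. *)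

theory Defs
  imports
    "HOL-Algebra.Group_Action"
    "HOL-Algebra.Bij"
    "HOL-Computational_Algebra.Primes"
begin

section \<open>Finite group theory\<close>

definition finite_p_group :: "nat \<Rightarrow> ('a, 'm) monoid_scheme \<Rightarrow> bool" where
  "finite_p_group p G \<longleftrightarrow> group G \<and> finite (carrier G) \<and> (\<exists>n. order G = p ^ n)"

definition finite_p'_group :: "nat \<Rightarrow> ('a, 'm) monoid_scheme \<Rightarrow> bool" where
  "finite_p'_group p G \<longleftrightarrow> group G \<and> finite (carrier G) \<and> coprime (order G) p"

definition sylow_subgroup :: "nat \<Rightarrow> ('a, 'm) monoid_scheme \<Rightarrow> 'a set \<Rightarrow> bool" where
  "sylow_subgroup p G H \<longleftrightarrow> subgroup H G \<and> card H = p ^ multiplicity p (order G)"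

definition centralizer :: "('a, 'm) monoid_scheme \<Rightarrow> 'a set \<Rightarrow> 'a set" where
  "centralizer G P = {g \<in> carrier G. \<forall>x\<in>P. g \<otimes>\<^bsub>G\<^esub> x = x \<otimes>\<^bsub>G\<^esub> g}"

definition center_of :: "('a, 'm) monoid_scheme \<Rightarrow> 'a set \<Rightarrow> 'a set" where
  "center_of G P = {z \<in> P. \<forall>x\<in>P. z \<otimes>\<^bsub>G\<^esub> x = x \<otimes>\<^bsub>G\<^esub> z}"

text \<open>In a finite group the normal subgroups of \<open>p\<close>-power index, and those of index prime to
  \<open>p\<close>, are closed under intersection, so the intersections below are the smallest ones.\<close>

definition O_upper_p :: "nat \<Rightarrow> ('a, 'm) monoid_scheme \<Rightarrow> 'a set" where
  "O_upper_p p G = \<Inter> {N. N \<lhd> G \<and> (\<exists>n. card (rcosets\<^bsub>G\<^esub> N) = p ^ n)}"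

definition O_upper_p' :: "nat \<Rightarrow> ('a, 'm) monoid_scheme \<Rightarrow> 'a set" where
  "O_upper_p' p G = \<Inter> {N. N \<lhd> G \<and> coprime (card (rcosets\<^bsub>G\<^esub> N)) p}"


section \<open>Categories of subgroups\<close>

text \<open>A category whose objects are the subgroups of \<open>S\<close> and whose morphisms are group
  monomorphisms is given by its morphism sets. Morphisms are represented by functions that are
  extensional on their domain, so that equality of functions is equality of morphisms with given
  domain and codomain. Morphism sets between sets that are not objects are empty; hence
  \<open>C \<le> D\<close> (pointwise inclusion) says that \<open>C\<close> is a subcategory of \<open>D\<close>.\<close>

type_synonym 'a homs = "'a set \<Rightarrow> 'a set \<Rightarrow> ('a \<Rightarrow> 'a) set"

definition Inj :: "('a, 'm) monoid_scheme \<Rightarrow> 'a homs" where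
  "Inj S P Q = {\<phi> \<in> extensional P. subgroup P S \<and> subgroup Q S \<and>
     \<phi> \<in> mon (S\<lparr>carrier := P\<rparr>) (S\<lparr>carrier := Q\<rparr>)}"

locale subgroup_category =
  fixes S :: "('a, 'm) monoid_scheme" and C :: "'a homs"
  assumes group_S: "group S"
    and homs_Inj: "C P Q \<subseteq> Inj S P Q"
    and id_mem: "subgroup P S \<Longrightarrow> (\<lambda>x\<in>P. x) \<in> C P P"
    and comp_mem: "\<phi> \<in> C P Q \<Longrightarrow> \<psi> \<in> C Q R \<Longrightarrow> compose P \<psi> \<phi> \<in> C P R"

locale restrictive_category = subgroup_category +
  assumes restrict_mem: "\<lbrakk>\<phi> \<in> C P Q; subgroup P' S; P' \<subseteq> P; subgroup Q' S; Q' \<subseteq> Q; \<phi> ` P' \<subseteq> Q'\<rbrakk>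
    \<Longrightarrow> restrict \<phi> P' \<in> C P' Q'"

definition category_iso :: "'a homs \<Rightarrow> 'a set \<Rightarrow> 'a set \<Rightarrow> ('a \<Rightarrow> 'a) \<Rightarrow> bool" where
  "category_iso C P Q \<phi> \<longleftrightarrow> \<phi> \<in> C P Q \<and>
     (\<exists>\<psi>\<in>C Q P. compose P \<psi> \<phi> = (\<lambda>x\<in>P. x) \<and> compose Q \<phi> \<psi> = (\<lambda>x\<in>Q. x))"

definition full_subcategory :: "'a homs \<Rightarrow> ('a set \<Rightarrow> bool) \<Rightarrow> 'a homs" where
  "full_subcategory C obj P Q = {\<phi> \<in> C P Q. obj P \<and> obj Q}"

definition smallest_restrictive ::
    "('a, 'm) monoid_scheme \<Rightarrow> 'a homs \<Rightarrow> 'a homs \<Rightarrow> 'a homs" where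
  "smallest_restrictive S F X = Inf {C. restrictive_category S C \<and> C \<le> F \<and> X \<le> C}"


section \<open>Fusion systems\<close>

definition conj_map :: "('a, 'm) monoid_scheme \<Rightarrow> 'a \<Rightarrow> 'a set \<Rightarrow> 'a \<Rightarrow> 'a" where
  "conj_map S g P = (\<lambda>x\<in>P. g \<otimes>\<^bsub>S\<^esub> x \<otimes>\<^bsub>S\<^esub> inv\<^bsub>S\<^esub> g)"

definition transporter :: "('a, 'm) monoid_scheme \<Rightarrow> 'a set \<Rightarrow> 'a set \<Rightarrow> 'a set" where
  "transporter S P Q = {g \<in> carrier S. conj_map S g P ` P \<subseteq> Q}"

text \<open>The fusion system of the group \<open>S\<close> itself, with morphism sets \<open>Hom\<^sub>S(P, Q)\<close>.\<close>

definition group_fusion :: "('a, 'm) monoid_scheme \<Rightarrow> 'a homs" where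
  "group_fusion S P Q =
     {conj_map S g P | g. subgroup P S \<and> subgroup Q S \<and> g \<in> transporter S P Q}"

text \<open>Composition of extensional functions on \<open>P\<close> is the multiplication of \<^const>\<open>BijGroup\<close>.\<close>

definition Aut_group :: "'a homs \<Rightarrow> 'a set \<Rightarrow> ('a \<Rightarrow> 'a) monoid" where
  "Aut_group F P = BijGroup P\<lparr>carrier := F P P\<rparr>"

locale fusion_system = subgroup_category S F
  for p :: nat and S :: "('a, 'm) monoid_scheme" and F :: "'a homs" +
  assumes p_group_S: "finite_p_group p S"
    and group_fusion_le: "group_fusion S P Q \<subseteq> F P Q"
    and factor_iso: "\<phi> \<in> F P Q \<Longrightarrow>
      \<exists>R \<psi>. R \<subseteq> Q \<and> category_iso F P R \<psi> \<and> \<phi> = compose P (\<lambda>x\<in>R. x) \<psi>"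

definition F_conjugate :: "'a homs \<Rightarrow> 'a set \<Rightarrow> 'a set \<Rightarrow> bool" where
  "F_conjugate F P P' \<longleftrightarrow> (\<exists>\<phi>. category_iso F P P' \<phi>)"

definition fully_centralized :: "('a, 'm) monoid_scheme \<Rightarrow> 'a homs \<Rightarrow> 'a set \<Rightarrow> bool" where
  "fully_centralized S F P \<longleftrightarrow> subgroup P S \<and>
     (\<forall>P'. F_conjugate F P P' \<longrightarrow> card (centralizer S P) \<ge> card (centralizer S P'))"

definition fully_normalized :: "('a, 'm) monoid_scheme \<Rightarrow> 'a homs \<Rightarrow> 'a set \<Rightarrow> bool" where
  "fully_normalized S F P \<longleftrightarrow> subgroup P S \<and>
     (\<forall>P'. F_conjugate F P P' \<longrightarrow> card (normalizer S P) \<ge> card (normalizer S P'))"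

text \<open>\<open>N\<^sub>\<phi>\<close>, where \<open>\<phi>\<close> is regarded as an isomorphism from \<open>P\<close> onto \<open>\<phi>(P)\<close>.\<close>

definition N_phi :: "('a, 'm) monoid_scheme \<Rightarrow> 'a set \<Rightarrow> ('a \<Rightarrow> 'a) \<Rightarrow> 'a set" where
  "N_phi S P \<phi> = {g \<in> normalizer S P.
     (\<lambda>y\<in>\<phi> ` P. \<phi> (conj_map S g P (inv_into P \<phi> y))) \<in> group_fusion S (\<phi> ` P) (\<phi> ` P)}"

locale saturated_fusion_system = fusion_system +
  assumes saturated_I: "fully_normalized S F P \<Longrightarrow>
      fully_centralized S F P \<and> sylow_subgroup p (Aut_group F P) (group_fusion S P P)"
    and saturated_II: "\<lbrakk>\<phi> \<in> F P (carrier S); fully_centralized S F (\<phi> ` P)\<rbrakk> \<Longrightarrow>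
      \<exists>\<phi>'\<in>F (N_phi S P \<phi>) (carrier S). restrict \<phi>' P = \<phi>"

definition centric :: "('a, 'm) monoid_scheme \<Rightarrow> 'a homs \<Rightarrow> 'a set \<Rightarrow> bool" where
  "centric S F P \<longleftrightarrow> subgroup P S \<and>
     (\<forall>P'. F_conjugate F P P' \<longrightarrow> centralizer S P' = center_of S P')"

definition centralizer_fusion ::
    "('a, 'm) monoid_scheme \<Rightarrow> 'a homs \<Rightarrow> 'a set \<Rightarrow> 'a homs" where
  "centralizer_fusion S F P Q Q' = {restrict \<alpha> Q | \<alpha>.
     subgroup Q (S\<lparr>carrier := centralizer S P\<rparr>) \<and> subgroup Q' (S\<lparr>carrier := centralizer S P\<rparr>) \<and>
     \<alpha> \<in> F (Q <#>\<^bsub>S\<^esub> P) (Q' <#>\<^bsub>S\<^esub> P) \<and> restrict \<alpha> P = (\<lambda>x\<in>P. x) \<and> \<alpha> ` Q \<subseteq> Q'}"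

definition quasicentric :: "('a, 'm) monoid_scheme \<Rightarrow> 'a homs \<Rightarrow> 'a set \<Rightarrow> bool" where
  "quasicentric S F P \<longleftrightarrow> subgroup P S \<and>
     (\<forall>P'. F_conjugate F P P' \<and> fully_centralized S F P' \<longrightarrow>
        centralizer_fusion S F P' = group_fusion (S\<lparr>carrier := centralizer S P'\<rparr>))"

definition quasicentric_category :: "('a, 'm) monoid_scheme \<Rightarrow> 'a homs \<Rightarrow> 'a homs" where
  "quasicentric_category S F = full_subcategory F (quasicentric S F)"

definition O_p_star :: "nat \<Rightarrow> ('a, 'm) monoid_scheme \<Rightarrow> 'a homs \<Rightarrow> 'a homs" where
  "O_p_star p S F = smallest_restrictive S F
     (\<lambda>P Q. {\<phi>. P = Q \<and> subgroup P S \<and> \<phi> \<in> O_upper_p p (Aut_group F P)})"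

definition O_p'_star :: "nat \<Rightarrow> ('a, 'm) monoid_scheme \<Rightarrow> 'a homs \<Rightarrow> 'a homs" where
  "O_p'_star p S F = smallest_restrictive S F
     (\<lambda>P Q. {\<phi>. P = Q \<and> subgroup P S \<and> \<phi> \<in> O_upper_p' p (Aut_group F P)})"


section \<open>Fusion mapping triples\<close>

text \<open>A morphism \<open>\<phi>\<close> from \<open>P\<close> to \<open>Q\<close> comes with its domain and codomain, so \<open>\<Theta>(\<phi>)\<close> is written
  \<open>\<Theta> P Q \<phi>\<close>; only the values on morphisms of the quasicentric category matter.\<close>

locale fusion_mapping_triple = group_hom S \<Gamma> \<theta>
  for S :: "('a, 'm) monoid_scheme" and F :: "'a homs"
    and \<Gamma> :: "('g, 'n) monoid_scheme" and \<theta> :: "'a \<Rightarrow> 'g"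
    and \<Theta> :: "'a set \<Rightarrow> 'a set \<Rightarrow> ('a \<Rightarrow> 'a) \<Rightarrow> 'g set" +
  assumes \<Theta>_nonempty_subset: "\<phi> \<in> quasicentric_category S F P Q \<Longrightarrow>
      \<Theta> P Q \<phi> \<noteq> {} \<and> \<Theta> P Q \<phi> \<subseteq> carrier \<Gamma>"
    and \<Theta>_comp: "\<lbrakk>\<phi> \<in> quasicentric_category S F P Q; \<psi> \<in> quasicentric_category S F Q R;
      x \<in> \<Theta> Q R \<psi>\<rbrakk> \<Longrightarrow> \<Theta> P R (compose P \<psi> \<phi>) = x <#\<^bsub>\<Gamma>\<^esub> \<Theta> P Q \<phi>"
    and \<Theta>_id: "\<lbrakk>quasicentric S F P; fully_centralized S F P\<rbrakk> \<Longrightarrow>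
      \<Theta> P P (\<lambda>x\<in>P. x) = \<theta> ` centralizer S P"
    and \<Theta>_conj: "\<lbrakk>quasicentric S F P; quasicentric S F Q; g \<in> transporter S P Q\<rbrakk> \<Longrightarrow>
      \<theta> g \<in> \<Theta> P Q (conj_map S g P)"
    and \<Theta>_\<theta>: "\<lbrakk>\<phi> \<in> quasicentric_category S F P Q; x \<in> \<Theta> P Q \<phi>; g \<in> P\<rbrakk> \<Longrightarrow>
      x \<otimes>\<^bsub>\<Gamma>\<^esub> \<theta> g \<otimes>\<^bsub>\<Gamma>\<^esub> inv\<^bsub>\<Gamma>\<^esub> x = \<theta> (\<phi> g)"

definition preimage_group ::
    "('a, 'm) monoid_scheme \<Rightarrow> ('a \<Rightarrow> 'g) \<Rightarrow> 'g set \<Rightarrow> 'a set" where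
  "preimage_group S \<theta> H = {s \<in> carrier S. \<theta> s \<in> H}"

definition F_bullet :: "('a, 'm) monoid_scheme \<Rightarrow> 'a homs \<Rightarrow>
    ('a set \<Rightarrow> 'a set \<Rightarrow> ('a \<Rightarrow> 'a) \<Rightarrow> 'g set) \<Rightarrow> 'g set \<Rightarrow> 'a homs" where
  "F_bullet S F \<Theta> H = smallest_restrictive S F
     (\<lambda>P Q. {\<phi> \<in> quasicentric_category S F P Q. \<Theta> P Q \<phi> \<inter> H \<noteq> {}})"

definition F_sub :: "('a, 'm) monoid_scheme \<Rightarrow> 'a homs \<Rightarrow> ('a \<Rightarrow> 'g) \<Rightarrow>
    ('a set \<Rightarrow> 'a set \<Rightarrow> ('a \<Rightarrow> 'a) \<Rightarrow> 'g set) \<Rightarrow> 'g set \<Rightarrow> 'a homs" where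
  "F_sub S F \<theta> \<Theta> H = full_subcategory (F_bullet S F \<Theta> H)
     (\<lambda>P. subgroup P (S\<lparr>carrier := preimage_group S \<theta> H\<rparr>))"


section \<open>The infimum defines the smallest restrictive subcategory\<close>

lemma (in fusion_system) restrictive: "restrictive_category S F"
proof
  fix \<phi> P Q P' Q'
  assume \<phi>: "\<phi> \<in> F P Q" and P': "subgroup P' S" "P' \<subseteq> P"
    and Q': "subgroup Q' S" "Q' \<subseteq> Q" and im: "\<phi> ` P' \<subseteq> Q'"
  interpret group S by (rule group_S)
  have incl: "(\<lambda>x\<in>A. x) \<in> F A B" if "subgroup A S" "subgroup B S" "A \<subseteq> B" for A B
  proof -
    have "conj_map S \<one>\<^bsub>S\<^esub> A = (\<lambda>x\<in>A. x)"
      using subgroup.mem_carrier[OF that(1)] by (auto simp: conj_map_def fun_eq_iff)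
    moreover from this have "\<one>\<^bsub>S\<^esub> \<in> transporter S A B"
      using that(3) by (auto simp: transporter_def)
    ultimately have "(\<lambda>x\<in>A. x) \<in> group_fusion S A B"
      using that unfolding group_fusion_def by (metis (mono_tags, lifting) mem_Collect_eq)
    then show ?thesis using group_fusion_le by blast
  qed
  have "subgroup P S" using \<phi> homs_Inj by (auto simp: Inj_def)
  then have "compose P' \<phi> (\<lambda>x\<in>P'. x) \<in> F P' Q"
    using comp_mem[OF incl \<phi>] P' by blast
  moreover have "compose P' \<phi> (\<lambda>x\<in>P'. x) = restrict \<phi> P'"
    by (auto simp: compose_def fun_eq_iff)
  ultimately obtain R \<psi> where R: "category_iso F P' R \<psi>"
      and eq: "restrict \<phi> P' = compose P' (\<lambda>x\<in>R. x) \<psi>"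
    using factor_iso[of "restrict \<phi> P'" P' Q] by auto
  obtain \<chi> where \<psi>: "\<psi> \<in> F P' R" and \<chi>: "\<chi> \<in> F R P'" "compose R \<psi> \<chi> = (\<lambda>x\<in>R. x)"
    using R by (auto simp: category_iso_def)
  have sR: "subgroup R S" "\<chi> ` R \<subseteq> P'" "\<psi> ` P' \<subseteq> R"
    using \<psi> \<chi>(1) homs_Inj[of R P'] homs_Inj[of P' R] by (auto simp: Inj_def mon_def hom_def)
  have "R \<subseteq> \<psi> ` P'"
  proof
    fix r assume r: "r \<in> R"
    then have "\<psi> (\<chi> r) = r" using fun_cong[OF \<chi>(2), of r] by (simp add: compose_def)
    then show "r \<in> \<psi> ` P'" using r sR(2) by (metis image_eqI image_subset_iff)
  qed
  moreover have "\<psi> x = \<phi> x" if "x \<in> P'" for x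
    using fun_cong[OF eq, of x] that sR(3) by (auto simp: compose_def)
  ultimately have "R \<subseteq> Q'" using im by force
  then show "restrict \<phi> P' \<in> F P' Q'"
    unfolding eq using comp_mem[OF \<psi> incl] sR(1) Q'(1) by blast
qed

lemma smallest_restrictive:
  assumes F: "restrictive_category S F" and X: "X \<le> F"
  shows "restrictive_category S (smallest_restrictive S F X)"
    and "smallest_restrictive S F X \<le> F" and "X \<le> smallest_restrictive S F X"
    and "\<lbrakk>restrictive_category S C; C \<le> F; X \<le> C\<rbrakk> \<Longrightarrow> smallest_restrictive S F X \<le> C"
proof -
  let ?A = "{C. restrictive_category S C \<and> C \<le> F \<and> X \<le> C}"
  have mem: "\<phi> \<in> smallest_restrictive S F X P Q \<longleftrightarrow> (\<forall>C\<in>?A. \<phi> \<in> C P Q)" for \<phi> P Q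
    by (simp add: smallest_restrictive_def)
  show le: "smallest_restrictive S F X \<le> F"
    unfolding smallest_restrictive_def using F X by (intro Inf_lower) auto
  show "X \<le> smallest_restrictive S F X"
    unfolding smallest_restrictive_def by (rule Inf_greatest) auto
  show "\<lbrakk>restrictive_category S C; C \<le> F; X \<le> C\<rbrakk> \<Longrightarrow> smallest_restrictive S F X \<le> C"
    unfolding smallest_restrictive_def by (intro Inf_lower) auto
  interpret F: restrictive_category S F by (rule F)
  show "restrictive_category S (smallest_restrictive S F X)"
  proof (intro restrictive_category.intro subgroup_category.intro restrictive_category_axioms.intro)
    show "group S" by (rule F.group_S)
    show "smallest_restrictive S F X P Q \<subseteq> Inj S P Q" for P Q
      using le F.homs_Inj[of P Q] by (auto simp: le_fun_def)
    show "(\<lambda>x\<in>P. x) \<in> smallest_restrictive S F X P P" if "subgroup P S" for P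
      unfolding mem using that
      by (auto intro: subgroup_category.id_mem restrictive_category.axioms(1))
    show "compose P \<psi> \<phi> \<in> smallest_restrictive S F X P R"
      if "\<phi> \<in> smallest_restrictive S F X P Q" "\<psi> \<in> smallest_restrictive S F X Q R" for \<phi> \<psi> P Q R
      using that unfolding mem
      by (auto intro: subgroup_category.comp_mem restrictive_category.axioms(1))
    show "restrict \<phi> P' \<in> smallest_restrictive S F X P' Q'"
      if "\<phi> \<in> smallest_restrictive S F X P Q" "subgroup P' S" "P' \<subseteq> P"
        "subgroup Q' S" "Q' \<subseteq> Q" "\<phi> ` P' \<subseteq> Q'" for \<phi> P Q P' Q'
      using that unfolding mem by (auto intro: restrictive_category.restrict_mem)
  qed
qed

end

theory Submission
  imports Defs "HOL-Algebra.Sylow" "HOL-Algebra.Multiplicative_Group"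
begin

text \<open>Every morphism of \<open>F\<close> is given labels in \<open>\<Gamma>\<close>: the elements of \<open>\<Theta>(f)\<close> label a morphism \<open>f\<close>
between quasicentric subgroups, and labels multiply along composites of restrictions of such
morphisms. Write \<open>L P f x\<close> if \<open>x\<close> is a label of \<open>f\<close>, a morphism on an arbitrary subgroup \<open>P\<close>. Then
\<open>\<theta>(f(g)) = x \<theta>(g) x\<^sup>-\<^sup>1\<close>, on quasicentric subgroups there are no other labels than the elements of
\<open>\<Theta>(f)\<close>, and every morphism has a label (\<open>L_ex\<close>): a fully normalized subgroup \<open>P\<close> that is not
quasicentric is not centric, so its automorphisms extend to \<open>P C\<^sub>S(P) > P\<close>, while all other morphisms
are compared with such automorphisms by maps defined on normalizers.

Next, a Frattini argument for labels. Let \<open>D \<le> Aut\<^sub>F(Q)\<close> have a Sylow \<open>p\<close>-subgroup \<open>T\<close> consisting of conjugations by elements of \<open>S\<close>.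
If \<open>\<Gamma>\<close> is a \<open>p\<close>-group, then each label of an element of \<open>D\<close> is already a label of an element of \<open>T\<close>,
because the labelled elements of \<open>T\<close> have index prime to \<open>p\<close> among those of \<open>D\<close>. If \<open>\<Gamma>\<close> has order prime
to \<open>p\<close>, then the elements of \<open>T\<close> have the trivial label, and the usual Frattini argument applies to the normal
subgroup of automorphisms of trivial label. Either way each label of an element of \<open>D\<close> occurs on some
\<open>n \<in> D\<close> that normalizes \<open>T\<close> (\<open>frattini\<close>), and such an \<open>n\<close> extends to a larger subgroup. By induction each
morphism with a label \<open>x\<close> is \<open>\<alpha> \<circ> \<psi>\<close> with \<open>\<alpha> \<in> Aut\<^sub>F(S)\<close> labelled \<open>x\<close> and \<open>\<psi>\<close> of trivial label
(\<open>decomp_all\<close>). Therefore \<open>F_bullet\<close> of \<open>H\<close> consists of the morphisms that have a label in \<open>H\<close>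
(\<open>F_bullet_iff\<close>).

The heart of the matter is \<open>labels_extend_fn\<close>: an isomorphism \<open>f\<close> with label \<open>x\<close> onto a fully
normalized subgroup \<open>P\<close> extends to \<open>N\<^sub>f\<close> with the same label \<open>x\<close>. It is enough to extend the identity of
\<open>P\<close> with any of its labels to \<open>N\<^sub>S(P)\<close>. For quasicentric \<open>P\<close> such a label is \<open>\<theta>(c)\<close> with \<open>c \<in> C\<^sub>S(P)\<close>.
Otherwise one argues by downward induction on \<open>P\<close>. A composite of morphisms of quasicentric subgroups
that ends where it began, on \<open>P\<close>, passes only through conjugates of \<open>P\<close> on which each factor extends
properly; it follows that it suffices to lift \<open>f|\<^bsub>P\<^esub>\<close> to \<open>P C\<^sub>S(P)\<close> for a labelled \<open>f\<close> defined on some \<open>R\<close> with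
\<open>P < R \<le> N\<^sub>S(P)\<close> (\<open>PC_lifts_of_nrm\<close>, \<open>PC_lifts_frames\<close>).
If \<open>R\<close> meets \<open>C\<^sub>S(P)\<close> outside \<open>P\<close>, it may be replaced by
\<open>R \<inter> P C\<^sub>S(P)\<close>, and the claim follows from a labelled form of Alperin's theorem in \<open>C\<^sub>F(P)\<close>
(\<open>centralizer_alperin\<close>); if \<open>R \<inter> C\<^sub>S(P) \<le> P\<close>, the elements of \<open>C\<^sub>S(P)\<close>
normalizing \<open>R\<close> act on it through a \<open>p\<close>-group of automorphisms trivial on \<open>P\<close> and modulo \<open>P\<close>, and
\<open>f\<close> is compared with a fully normalized conjugate of \<open>R\<close>. From the quasicentric subgroup \<open>P C\<^sub>S(P)\<close> the
Frattini argument leads to \<open>N\<^sub>S(P)\<close>.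

In order to show that \<open>F\<^sub>H\<close> is saturated, by \<open>saturation_criterion\<close> each conjugacy class only needs one member that is fully
automized and receptive. Subgroups that are fully normalized in \<open>F\<close> are receptive in \<open>F\<^sub>H\<close> because labels
extend; they can be reached by maps of trivial label because \<open>Aut\<^sub>F(S)\<close> preserves full normalization; and
conjugations by elements of \<open>S\<close> that have a label in \<open>H\<close> are conjugations by elements of \<open>S\<^sub>H\<close> because labels
of the identity of a fully centralized \<open>P\<close> lie in \<open>\<theta>(C\<^sub>S(P))\<close> when \<open>\<Gamma>\<close> is a \<open>p\<close>-group, and \<open>S\<^sub>H = S\<close> otherwise.

For fully centralized \<open>P\<close>, being quasicentric means that the morphisms
that fix \<open>P\<close> pointwise, on subgroups between \<open>P\<close> and \<open>P C\<^sub>S(P)\<close>, are conjugations by elements of \<open>C\<^sub>S(P)\<close>. For a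
\<open>p\<close>-group \<open>\<Gamma>\<close> this property passes from \<open>F\<close> to \<open>F\<^sub>H\<close> by correcting labels, and back since a power of each
automorphism fixing \<open>P\<close> has the trivial label: it follows that the automorphisms of \<open>R\<close> fixing \<open>P\<close> form a
\<open>p\<close>-group, which for fully automized \<open>R\<close> consists of conjugations, and Alperin's theorem applies. When \<open>\<Gamma>\<close> has
order prime to \<open>p\<close>, every \<open>F\<close>-conjugate is the image of an \<open>F\<^sub>H\<close>-conjugate under \<open>Aut\<^sub>F(S)\<close>, which preserves centralizers and
normalizers. Finally, the automorphisms of \<open>P\<close> of trivial label form a normal subgroup of \<open>Aut\<^sub>F(P)\<close> whose
index divides \<open>|\<Gamma>|\<close> (\<open>label_kernel_normal\<close>), so it contains \<open>O\<^sup>p\<close> or \<open>O\<^sup>p'\<close>.\<close>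

section \<open>Counting in finite groups\<close>

text \<open>An orbit that is not a fixed point has length a nontrivial power of \<open>p\<close>.\<close>

lemma p_group_fixed_points:
  assumes "prime p" "group U" "finite (carrier U)" "order U = p ^ k" and X: "finite X"
    and cl: "\<And>u x. u \<in> carrier U \<Longrightarrow> x \<in> X \<Longrightarrow> act u x \<in> X"
    and one: "\<And>x. x \<in> X \<Longrightarrow> act \<one>\<^bsub>U\<^esub> x = x"
    and mult: "\<And>u v x. u \<in> carrier U \<Longrightarrow> v \<in> carrier U \<Longrightarrow> x \<in> X \<Longrightarrow> act (u \<otimes>\<^bsub>U\<^esub> v) x = act u (act v x)"
  shows "card {x \<in> X. \<forall>u\<in>carrier U. act u x = x} mod p = card X mod p"
proof -
  interpret U: group U by fact
  define Fix where "Fix = {x \<in> X. \<forall>u\<in>carrier U. act u x = x}"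
  define Y where "Y = X - Fix"
  define \<phi> where "\<phi> = (\<lambda>u. restrict (act u) Y)"
  have inv_act: "act (inv\<^bsub>U\<^esub> u) (act u x) = x" "act u (act (inv\<^bsub>U\<^esub> u) x) = x"
    if "u \<in> carrier U" "x \<in> X" for u x
    using mult[of "inv\<^bsub>U\<^esub> u" u x] mult[of u "inv\<^bsub>U\<^esub> u" x] one that by auto
  have clY: "act u x \<in> Y" if u: "u \<in> carrier U" and x: "x \<in> Y" for u x
  proof -
    have xX: "x \<in> X" using x by (auto simp: Y_def)
    have False if f: "act u x \<in> Fix"
    proof -
      have ux: "act v (act u x) = act u x" if "v \<in> carrier U" for v
        using f that by (auto simp: Fix_def)
      have "act u x = x" using ux[of "inv\<^bsub>U\<^esub> u"] inv_act u xX by simp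
      then show False using f x by (auto simp: Y_def)
    qed
    then show ?thesis using cl u xX by (auto simp: Y_def)
  qed
  have YX: "Y \<subseteq> X" by (auto simp: Y_def)
  have bij: "\<phi> u \<in> Bij Y" if u: "u \<in> carrier U" for u
  proof -
    have "bij_betw (\<phi> u) Y Y"
      by (rule bij_betw_byWitness[where f' = "act (inv\<^bsub>U\<^esub> u)"])
         (use u inv_act clY YX in \<open>auto simp: \<phi>_def\<close>)
    then show ?thesis by (simp add: Bij_def \<phi>_def)
  qed
  have "\<phi> \<in> hom U (BijGroup Y)"
    unfolding hom_def using bij mult YX clY
    by (auto simp: BijGroup_def \<phi>_def compose_def fun_eq_iff subset_iff)
  then interpret A: group_action U Y \<phi>
    unfolding group_action_def group_hom_def group_hom_axioms_def
    using assms(2) group_BijGroup by blast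
  have dvd: "p dvd card c" if c: "c \<in> orbits U Y \<phi>" for c
  proof -
    obtain y where y: "y \<in> Y" "c = orbit U \<phi> y" using c by (auto simp: orbits_def)
    have "card c * card (stabilizer U \<phi> y) = p ^ k"
      using A.orbit_stabilizer_theorem y assms by auto
    then have "card c dvd p ^ k" by (metis dvd_triv_left)
    then obtain j where j: "card c = p ^ j" using assms(1) divides_primepow_nat by blast
    have "j \<noteq> 0"
    proof
      assume "j = 0"
      then have "card c = 1" using j by simp
      moreover have "y \<in> c" using A.orbit_refl y by simp
      ultimately have "c = {y}" by (metis card_1_singletonE singletonD)
      moreover have "act u y \<in> c" if "u \<in> carrier U" for u
        using that y unfolding orbit_def \<phi>_def by auto
      ultimately have "\<forall>u\<in>carrier U. act u y = y" by blast
      then show False using y by (auto simp: Y_def Fix_def)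
    qed
    then show ?thesis using j by simp
  qed
  have "finite Y" using X YX finite_subset by blast
  then have "p dvd card Y"
    using dvd_partition[of "orbits U Y \<phi>" p] A.orbits_coverture A.disjoint_union dvd by metis
  moreover have "card X = card Fix + card Y"
  proof -
    have "X = Fix \<union> Y" "Fix \<inter> Y = {}" by (auto simp: Y_def Fix_def)
    then show ?thesis using X by (metis card_Un_disjoint finite_Un)
  qed
  ultimately show ?thesis unfolding Fix_def[symmetric] by auto
qed

context group begin

text \<open>\<open>U\<close> acts on the right cosets of \<open>T\<close> by \<open>c \<mapsto> c u\<^sup>-\<^sup>1\<close>.\<close>

lemma card_fixed_cosets:
  assumes "prime p" "finite (carrier G)" "subgroup U G" "card U = p ^ k" "subgroup T G"
  shows "card {c \<in> rcosets T. \<forall>u\<in>U. c #> u = c} mod p = card (rcosets T) mod p"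
proof -
  interpret U: group "G\<lparr>carrier := U\<rparr>" using assms subgroup_imp_group by auto
  have TG: "T \<subseteq> carrier G" and UG: "U \<subseteq> carrier G" using assms subgroup.subset by auto
  have cG: "c \<subseteq> carrier G" if "c \<in> rcosets T" for c
    using that r_coset_subset_G[OF TG] by (auto simp: RCOSETS_def)
  have iU: "inv\<^bsub>G\<lparr>carrier := U\<rparr>\<^esub> u = inv u" if "u \<in> U" for u
    using that assms(3) m_inv_consistent by auto
  have "card {c \<in> rcosets T. \<forall>u\<in>carrier (G\<lparr>carrier := U\<rparr>). c #> inv u = c} mod p = card (rcosets T) mod p"
  proof (rule p_group_fixed_points[where k=k])
    show "finite (rcosets T)"
      by (rule finite_UnionD) (use assms rcosets_part_G[OF assms(5)] in simp)
    show "c #> inv u \<in> rcosets T" if "u \<in> carrier (G\<lparr>carrier := U\<rparr>)" "c \<in> rcosets T" for u c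
      using that TG UG by (fastforce simp: RCOSETS_def coset_mult_assoc)
    show "c #> inv (u \<otimes>\<^bsub>G\<lparr>carrier := U\<rparr>\<^esub> v) = c #> inv v #> inv u"
      if "u \<in> carrier (G\<lparr>carrier := U\<rparr>)" "v \<in> carrier (G\<lparr>carrier := U\<rparr>)" "c \<in> rcosets T" for u v c
      using that UG cG by (simp add: coset_mult_assoc inv_mult_group subset_iff)
    show "finite (carrier (G\<lparr>carrier := U\<rparr>))" using UG assms finite_subset by auto
  qed (use assms cG U.is_group in \<open>auto simp: order_def coset_mult_one\<close>)
  moreover have "(\<forall>u\<in>U. c #> inv u = c) \<longleftrightarrow> (\<forall>u\<in>U. c #> u = c)" for c
  proof -
    have "u = inv (inv u)" "inv u \<in> U" if "u \<in> U" for u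
      using that UG subgroup.m_inv_closed[OF assms(3)] by auto
    then show ?thesis by metis
  qed
  ultimately show ?thesis by simp
qed

lemma fixed_coset:
  assumes "subgroup T G" "subgroup U G" "g \<in> carrier G" "\<forall>u\<in>U. T #> g #> u = T #> g" "u \<in> U"
  shows "g \<otimes> u \<otimes> inv g \<in> T"
proof -
  have u: "u \<in> carrier G" using assms subgroup.mem_carrier by metis
  have "T #> (g \<otimes> u) = T #> g" using assms u subgroup.subset coset_mult_assoc by metis
  then have "g \<otimes> u \<in> T #> g" using assms u by (metis m_closed rcos_self)
  then obtain t where "t \<in> T" "g \<otimes> u = t \<otimes> g" by (auto simp: r_coset_def)
  moreover have "t \<in> carrier G" using \<open>t \<in> T\<close> subgroup.mem_carrier[OF assms(1)] by blast
  ultimately show ?thesis using assms(3) by (simp add: m_assoc)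
qed

text \<open>The number of cosets \<open>T g\<close> fixed by \<open>U\<close> is congruent to the index of \<open>T\<close> modulo \<open>p\<close>, so it is not
zero; and \<open>T g\<close> is fixed by \<open>U\<close> iff \<open>g U g\<^sup>-\<^sup>1 \<le> T\<close>.\<close>

lemma p_subgroup_conj_into:
  assumes "prime p" "finite (carrier G)" "subgroup U G" "card U = p ^ k" "subgroup T G"
    and "\<not> p dvd card (rcosets T)"
  obtains g where "g \<in> carrier G" "\<And>u. u \<in> U \<Longrightarrow> g \<otimes> u \<otimes> inv g \<in> T"
proof -
  have "card {c \<in> rcosets T. \<forall>u\<in>U. c #> u = c} mod p \<noteq> 0"
    using card_fixed_cosets[OF assms(1-5)] assms(6) by (simp add: dvd_eq_mod_eq_0)
  then have "{c \<in> rcosets T. \<forall>u\<in>U. c #> u = c} \<noteq> {}" by (metis card.empty mod_0)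
  then obtain c where c: "c \<in> rcosets T" "\<forall>u\<in>U. c #> u = c"  by blast
  then obtain g where "g \<in> carrier G" "c = T #> g" by (auto simp: RCOSETS_def)
  then show ?thesis using that fixed_coset assms c by blast
qed

text \<open>The cosets of \<open>P\<close> in \<open>K\<close> that are fixed by \<open>P\<close> are those contained in the normalizer. Their number is
divisible by \<open>p\<close>, and \<open>P\<close> itself is one of them.\<close>

lemma normalizers_grow:
  assumes "prime p" "finite (carrier G)" "order G = p ^ n" "subgroup P G" "subgroup K G" "P \<subset> K"
  obtains g where "g \<in> K" "g \<notin> P" "\<And>x. x \<in> P \<Longrightarrow> g \<otimes> x \<otimes> inv g \<in> P"
proof -
  interpret K: group "G\<lparr>carrier := K\<rparr>" using assms subgroup_imp_group by auto
  have PK: "subgroup P (G\<lparr>carrier := K\<rparr>)" using assms subgroup_incl by auto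
  have fK: "finite K" using assms subgroup.subset finite_subset by metis
  have "card (rcosets P) * card P = order G" "card (rcosets K) * card K = order G"
    using lagrange assms by auto
  then have "card P dvd p ^ n" "card K dvd p ^ n" using assms by (metis dvd_triv_right)+
  then obtain k l where k: "card P = p ^ k" and l: "card K = p ^ l" using assms(1) divides_primepow_nat by metis
  have lag: "card (rcosets\<^bsub>G\<lparr>carrier := K\<rparr>\<^esub> P) * card P = card K"
    using K.lagrange[OF PK] by (simp add: order_def)
  have "card P < card K" using assms(6) fK psubset_card_mono by blast
  then have "card (rcosets\<^bsub>G\<lparr>carrier := K\<rparr>\<^esub> P) \<noteq> 1" using lag by auto
  moreover have "card (rcosets\<^bsub>G\<lparr>carrier := K\<rparr>\<^esub> P) dvd p ^ l" using lag l by (metis dvd_triv_left)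
  then obtain j where "card (rcosets\<^bsub>G\<lparr>carrier := K\<rparr>\<^esub> P) = p ^ j"
    using assms(1) divides_primepow_nat by blast
  ultimately have "p dvd card (rcosets\<^bsub>G\<lparr>carrier := K\<rparr>\<^esub> P)" by (cases j) auto
  moreover have "card {c \<in> rcosets\<^bsub>G\<lparr>carrier := K\<rparr>\<^esub> P. \<forall>u\<in>P. c #>\<^bsub>G\<lparr>carrier := K\<rparr>\<^esub> u = c} mod p
      = card (rcosets\<^bsub>G\<lparr>carrier := K\<rparr>\<^esub> P) mod p" (is "card ?X mod p = _")
    by (rule K.card_fixed_cosets[OF assms(1) _ PK k PK]) (use fK in simp)
  ultimately have "p dvd card ?X" by (simp add: dvd_eq_mod_eq_0)
  moreover have P1: "P \<in> ?X"
  proof -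
    have "P = P #>\<^bsub>G\<lparr>carrier := K\<rparr>\<^esub> \<one>"
      using K.coset_mult_one[of P] subgroup.subset[OF PK] by simp
    then have "P \<in> rcosets\<^bsub>G\<lparr>carrier := K\<rparr>\<^esub> P"
      unfolding RCOSETS_def using K.one_closed by auto
    then show ?thesis using subgroup.mem_carrier[OF PK] K.coset_join2[OF _ PK] by auto
  qed
  moreover have "finite (rcosets\<^bsub>G\<lparr>carrier := K\<rparr>\<^esub> P)"
    by (rule finite_UnionD) (use fK K.rcosets_part_G[OF PK] in simp)
  then have "finite ?X" by simp
  ultimately have "?X \<noteq> {P}" using assms(1) by (auto simp: prime_nat_iff)
  then obtain c where c: "c \<in> ?X" "c \<noteq> P" using P1 by blast
  then obtain g where g: "g \<in> K" "c = P #>\<^bsub>G\<lparr>carrier := K\<rparr>\<^esub> g" by (auto simp: RCOSETS_def)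
  have "g \<notin> P" using c g K.coset_join2[OF _ PK] by auto
  moreover have "g \<otimes> u \<otimes> inv g \<in> P" if "u \<in> P" for u
    using K.fixed_coset[OF PK PK _ _ that, of g] c g m_inv_consistent[OF assms(5)] by auto
  ultimately show ?thesis using that g by blast
qed

lemma order_image_times_kernel:
  assumes "group_hom G H h" "finite (carrier G)"
  shows "order G = card (h ` carrier G) * card {g \<in> carrier G. h g = \<one>\<^bsub>H\<^esub>}"
proof -
  interpret h: group_hom G H h by fact
  have fib: "card {g \<in> carrier G. h g = y} = card {g \<in> carrier G. h g = \<one>\<^bsub>H\<^esub>}"
    if y: "y \<in> h ` carrier G" for y
  proof -
    obtain a where a: "a \<in> carrier G" "y = h a" using y by auto
    show ?thesis
      by (rule bij_betw_same_card[OF bij_betw_byWitness[where f = "\<lambda>g. inv a \<otimes> g" and f' = "\<lambda>g. a \<otimes> g"]])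
         (use a in \<open>auto simp: m_assoc[symmetric]\<close>)
  qed
  have "carrier G = (\<Union>y\<in>h ` carrier G. {g \<in> carrier G. h g = y})" by auto
  then have "order G = card (\<Union>y\<in>h ` carrier G. {g \<in> carrier G. h g = y})" by (simp add: order_def)
  also have "\<dots> = (\<Sum>y\<in>h ` carrier G. card {g \<in> carrier G. h g = y})"
    by (rule card_UN_disjoint) (use assms in auto)
  also have "\<dots> = (\<Sum>y\<in>h ` carrier G. card {g \<in> carrier G. h g = \<one>\<^bsub>H\<^esub>})" using fib by simp
  finally show ?thesis by simp
qed

lemma card_subgroup_dvd:
  assumes "subgroup K G" shows "card K dvd order G"
  using lagrange[OF assms] by (metis dvd_triv_right)

text \<open>A Sylow subgroup for a prime divisor \<open>q \<noteq> p\<close> of the order would contain a nontrivial element whose order is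
a power of both \<open>p\<close> and \<open>q\<close>.\<close>

lemma prime_power_orders_imp_p_group:
  assumes "prime p" "finite (carrier G)" "\<And>x. x \<in> carrier G \<Longrightarrow> x [^] (p ^ m) = \<one>"
  shows "\<exists>n. order G = p ^ n"
proof -
  have "q = p" if q: "prime q" "q dvd order G" for q
  proof -
    define a where "a = multiplicity q (order G)"
    have o: "order G \<noteq> 0" using assms order_gt_0_iff_finite by simp
    have "order G = q ^ a * (order G div q ^ a)" by (simp add: a_def multiplicity_dvd)
    then obtain H where H: "subgroup H G" "card H = q ^ a"
      using sylow_thm[OF q(1) is_group] assms(2) by blast
    have "a > 0" unfolding a_def using o q by (simp add: prime_multiplicity_gt_zero_iff)
    then have "card H > 1" using H q prime_gt_1_nat by (metis one_less_power)
    then have "H \<noteq> {\<one>}" by auto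
    then obtain x where x: "x \<in> H" "x \<noteq> \<one>"
      using subgroup.one_closed[OF H(1)] by blast
    have xG: "x \<in> carrier G" using x H subgroup.mem_carrier by metis
    interpret H: group "G\<lparr>carrier := H\<rparr>" using H subgroup_imp_group by auto
    have "x [^]\<^bsub>G\<lparr>carrier := H\<rparr>\<^esub> order (G\<lparr>carrier := H\<rparr>) = \<one>"
      using H.pow_order_eq_1[of x] x by simp
    then have "x [^] (q ^ a) = \<one>" using H by (simp add: order_def nat_pow_consistent[symmetric])
    then have "ord x dvd q ^ a" "ord x dvd p ^ m" using pow_eq_id xG assms(3) by blast+
    then obtain i j where ij: "ord x = q ^ i" "ord x = p ^ j" using assms(1) q(1) divides_primepow_nat by metis
    have "ord x \<noteq> 1" using pow_ord_eq_1[OF xG] x xG by (metis nat_pow_eone)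
    then show ?thesis using ij assms(1) q(1)
      by (metis power_0 neq0_conv prime_dvd_power primes_dvd_imp_eq dvd_power)
  qed
  moreover have o: "order G \<noteq> 0" using assms order_gt_0_iff_finite by simp
  ultimately have "prime_factors (order G) \<subseteq> {p}" by (auto simp: prime_factors_dvd)
  then have "(\<Prod>q\<in>prime_factors (order G). q ^ multiplicity q (order G)) = p ^ multiplicity p (order G)"
    using assms(1) by (cases "prime_factors (order G) = {}") (auto simp: subset_singleton_iff not_dvd_imp_multiplicity_0 prime_factors_multiplicity)
  then show ?thesis using prime_factorization_nat[of "order G"] o by (metis neq0_conv)
qed

end

text \<open>The index of \<open>h(T)\<close> in \<open>h(G)\<close> divides the index of \<open>T\<close> in \<open>G\<close>, and it is a power of \<open>p\<close>.\<close>

lemma (in group) image_of_subgroup_of_p'_index: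
  assumes h: "group_hom G H h" and G: "finite (carrier G)" and H: "order H = p ^ n" and p: "prime p"
    and T: "subgroup T G" "\<not> p dvd card (rcosets T)"
  shows "h ` T = h ` carrier G"
proof -
  interpret h: group_hom G H h by fact
  have fH: "finite (carrier H)" using H p h.H.order_gt_0_iff_finite by (metis prime_gt_0_nat zero_less_power)
  have TG: "T \<subseteq> carrier G" using T subgroup.subset by blast
  define K where "K = {g \<in> carrier G. h g = \<one>\<^bsub>H\<^esub>}"
  have K: "subgroup K G" using h.subgroup_kernel by (simp add: K_def kernel_def)
  interpret T: group "G\<lparr>carrier := T\<rparr>" using subgroup_imp_group[OF T(1)] .
  interpret K: group "G\<lparr>carrier := K\<rparr>" using subgroup_imp_group[OF K] .
  have hT: "group_hom (G\<lparr>carrier := T\<rparr>) H h"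
    by unfold_locales (use subsetD[OF TG] in \<open>auto simp: hom_def\<close>)
  have 1: "order G = card (h ` carrier G) * card K"
    using order_image_times_kernel[OF h G] by (simp add: K_def)
  have 2: "card T = card (h ` T) * card (T \<inter> K)"
  proof -
    have "{g \<in> T. h g = \<one>\<^bsub>H\<^esub>} = T \<inter> K" using TG by (auto simp: K_def)
    then show ?thesis using T.order_image_times_kernel[OF hT] G TG finite_subset by (auto simp: order_def)
  qed
  have 3: "order G = card (rcosets T) * card T" using lagrange[OF T(1)] by simp
  have "subgroup (T \<inter> K) (G\<lparr>carrier := K\<rparr>)"
    using subgroups_Inter_pair[OF T(1) K] subgroup_incl[OF _ K] by auto
  then obtain r where r: "card K = card (T \<inter> K) * r"
    using K.card_subgroup_dvd by (auto simp: order_def)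
  have sub: "subgroup (h ` carrier G) H" "subgroup (h ` T) H"
    using h.img_is_subgroup h.subgroup_img_is_subgroup[OF T(1)] by auto
  have "card (h ` carrier G) dvd p ^ n" "card (h ` T) dvd p ^ n"
    using h.H.card_subgroup_dvd sub H by metis+
  then obtain i j where ij: "card (h ` carrier G) = p ^ i" "card (h ` T) = p ^ j"
    using p divides_primepow_nat by metis
  have "p ^ j \<le> p ^ i" using ij G TG by (metis card_mono finite_imageI image_mono)
  then have ji: "j \<le> i" using prime_gt_1_nat[OF p] by simp
  have pos: "card (T \<inter> K) > 0" "p ^ j > 0"
    using T K G TG p subgroup.one_closed[OF T(1)] subgroup.one_closed[OF K] finite_subset
    by (auto simp: card_gt_0_iff prime_gt_0_nat)
  have "card (rcosets T) * (p ^ j * card (T \<inter> K)) = p ^ i * (card (T \<inter> K) * r)"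
    using 1 2 3 r ij by simp
  also have "p ^ i = p ^ j * p ^ (i - j)" using ji by (simp flip: power_add)
  finally have "card (rcosets T) = p ^ (i - j) * r" using pos p by (auto simp: algebra_simps dest: prime_gt_0_nat)
  then have "i - j = 0" using T(2) by (metis dvd_mult2 dvd_power not_gr_zero)
  then have "card (h ` T) = card (h ` carrier G)" using ij ji by simp
  then show ?thesis using G TG by (metis card_subset_eq finite_imageI image_mono)
qed

section \<open>Conjugation, normalizers and centralizers\<close>

context group begin

definition cj :: "'a \<Rightarrow> 'a \<Rightarrow> 'a" where "cj g x = g \<otimes> x \<otimes> inv g"

definition nrm :: "'a set \<Rightarrow> 'a set" where "nrm P = {g \<in> carrier G. \<forall>x\<in>P. cj g x \<in> P}"

definition cen :: "'a set \<Rightarrow> 'a set" where "cen P = {g \<in> carrier G. \<forall>x\<in>P. cj g x = x}"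

lemma cj_closed [simp]: "g \<in> carrier G \<Longrightarrow> x \<in> carrier G \<Longrightarrow> cj g x \<in> carrier G"
  by (simp add: cj_def)

lemma cj_mult: "g \<in> carrier G \<Longrightarrow> x \<in> carrier G \<Longrightarrow> y \<in> carrier G \<Longrightarrow> cj g (x \<otimes> y) = cj g x \<otimes> cj g y"
  by (simp add: cj_def m_assoc) (simp flip: m_assoc)

lemma cj_inv: "g \<in> carrier G \<Longrightarrow> x \<in> carrier G \<Longrightarrow> cj g (inv x) = inv (cj g x)"
  by (simp add: cj_def m_assoc inv_mult_group)

lemma cj_cj: "g \<in> carrier G \<Longrightarrow> h \<in> carrier G \<Longrightarrow> x \<in> carrier G \<Longrightarrow> cj (g \<otimes> h) x = cj g (cj h x)"
  by (simp add: cj_def m_assoc inv_mult_group)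

lemma cj_one [simp]: "x \<in> carrier G \<Longrightarrow> cj \<one> x = x"
  by (simp add: cj_def)

lemma cj_inv_cj [simp]: "g \<in> carrier G \<Longrightarrow> x \<in> carrier G \<Longrightarrow> cj (inv g) (cj g x) = x"
  by (simp flip: cj_cj)

lemma cj_cj_inv [simp]: "g \<in> carrier G \<Longrightarrow> x \<in> carrier G \<Longrightarrow> cj g (cj (inv g) x) = x"
  by (simp flip: cj_cj)

lemma cj_inj: "g \<in> carrier G \<Longrightarrow> x \<in> carrier G \<Longrightarrow> y \<in> carrier G \<Longrightarrow> cj g x = cj g y \<Longrightarrow> x = y"
  by (metis cj_inv_cj)

lemma cj_eq_iff: "g \<in> carrier G \<Longrightarrow> x \<in> carrier G \<Longrightarrow> cj g x = x \<longleftrightarrow> g \<otimes> x = x \<otimes> g"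
  by (metis cj_def inv_solve_right m_closed)

lemma cj_sym: "g \<in> carrier G \<Longrightarrow> x \<in> carrier G \<Longrightarrow> cj g x = x \<longleftrightarrow> cj x g = g"
  by (metis cj_eq_iff)

lemma cj_cj_cj: "g \<in> carrier G \<Longrightarrow> h \<in> carrier G \<Longrightarrow> x \<in> carrier G \<Longrightarrow> cj (cj g h) (cj g x) = cj g (cj h x)"
  by (simp add: cj_def[of h] cj_def[of "cj g h"] cj_mult cj_inv)

lemma subgroup_cj: "subgroup P G \<Longrightarrow> g \<in> P \<Longrightarrow> x \<in> P \<Longrightarrow> cj g x \<in> P"
  by (simp add: cj_def subgroup.m_closed subgroup.m_inv_closed)

lemma cen_carrier: "g \<in> cen P \<Longrightarrow> g \<in> carrier G" by (simp add: cen_def)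
lemma nrm_carrier: "g \<in> nrm P \<Longrightarrow> g \<in> carrier G" by (simp add: nrm_def)
lemma cen_cj: "g \<in> cen P \<Longrightarrow> x \<in> P \<Longrightarrow> cj g x = x" by (simp add: cen_def)
lemma nrm_cj: "g \<in> nrm P \<Longrightarrow> x \<in> P \<Longrightarrow> cj g x \<in> P" by (simp add: nrm_def)

lemma cen_subset_nrm: "cen P \<subseteq> nrm P" by (auto simp: cen_def nrm_def)

lemma cen_antimono: "P \<subseteq> Q \<Longrightarrow> cen Q \<subseteq> cen P" by (auto simp: cen_def)

lemma subgroup_subset_nrm: "subgroup P G \<Longrightarrow> P \<subseteq> nrm P"
  using subgroup_cj subgroup.mem_carrier by (fastforce simp: nrm_def)

lemma centralizer_eq_cen: "P \<subseteq> carrier G \<Longrightarrow> centralizer G P = cen P"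
  by (auto simp: centralizer_def cen_def cj_eq_iff subset_iff)

lemma cj_image_nrm:
  assumes "finite P" "P \<subseteq> carrier G" "g \<in> nrm P"
  shows "cj g ` P = P"
proof (rule card_subset_eq)
  show "card (cj g ` P) = card P"
    by (rule card_image) (meson assms cj_inj inj_onI nrm_carrier subsetD)
qed (use assms nrm_cj in auto)

lemma subgroup_cen: "P \<subseteq> carrier G \<Longrightarrow> subgroup (cen P) G"
  by (rule subgroupI) (auto simp: cen_def cj_cj subset_iff exI[of _ \<one>], metis cj_inv_cj)

lemma subgroup_nrm:
  assumes "finite P" "P \<subseteq> carrier G"
  shows "subgroup (nrm P) G"
proof (rule subgroupI)
  show "nrm P \<noteq> {}" using assms by (auto simp: nrm_def intro!: exI[of _ \<one>])
  show "inv a \<in> nrm P" if a: "a \<in> nrm P" for a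
  proof -
    have "cj (inv a) x \<in> P" if x: "x \<in> P" for x
    proof -
      have "x \<in> cj a ` P" using cj_image_nrm[OF assms a] x by simp
      then obtain y where "y \<in> P" "x = cj a y" by auto
      then show ?thesis using assms nrm_carrier[OF a] by (simp add: subset_iff)
    qed
    then show ?thesis using nrm_carrier[OF a] by (simp add: nrm_def)
  qed
qed (use assms in \<open>auto simp: nrm_def cj_cj subset_iff\<close>)

lemma normalizer_eq_nrm:
  assumes "finite P" "P \<subseteq> carrier G"
  shows "normalizer G P = nrm P"
proof -
  have im: "g <# P #> inv g = cj g ` P" for g
    by (auto simp: l_coset_def r_coset_def cj_def)
  have "g \<in> nrm P" if "g \<in> carrier G" "cj g ` P = P" for g
    using that by (auto simp: nrm_def)
  then show ?thesis
    using assms cj_image_nrm[OF assms] nrm_carrier nrm_cj by (auto simp: normalizer_def stabilizer_def im)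
qed

lemma cj_nrm_cen:
  assumes P: "finite P" "P \<subseteq> carrier G" and g: "g \<in> nrm P" and c: "c \<in> cen P"
  shows "cj g c \<in> cen P"
proof -
  have "cj (cj g c) x = x" if "x \<in> P" for x
  proof -
    have "x \<in> cj g ` P" using cj_image_nrm[OF P g] that by simp
    then obtain y where y: "y \<in> P" "x = cj g y" by auto
    have "y \<in> carrier G" using y P by auto
    then have "cj (cj g c) (cj g y) = cj g (cj c y)"
      by (rule cj_cj_cj[OF nrm_carrier[OF g] cen_carrier[OF c]])
    then show ?thesis using cen_cj[OF c y(1)] y(2) by simp
  qed
  then show ?thesis using nrm_carrier[OF g] cen_carrier[OF c] by (simp add: cen_def)
qed

lemma subgroup_set_mult:
  assumes P: "subgroup P G" and C: "subgroup C G" and n: "C \<subseteq> nrm P"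
  shows "subgroup (P <#> C) G"
proof (rule subgroupI)
  have PG: "P \<subseteq> carrier G" and CG: "C \<subseteq> carrier G" using P C subgroup.subset by auto
  show "P <#> C \<subseteq> carrier G" using PG CG by (auto simp: set_mult_def)
  show "P <#> C \<noteq> {}" using subgroup.one_closed[OF P] subgroup.one_closed[OF C] by (auto simp: set_mult_def)
  have swap: "c \<otimes> x \<in> P <#> C" if "c \<in> C" "x \<in> P" for c x
  proof -
    have "cj c x \<in> P" using that n nrm_cj by blast
    moreover have "c \<in> carrier G" "x \<in> carrier G" using that PG CG by auto
    then have "c \<otimes> x = cj c x \<otimes> c" by (simp add: cj_def m_assoc)
    ultimately have "cj c x \<in> P" "c \<otimes> x = cj c x \<otimes> c" by auto
    then show ?thesis using that by (auto simp: set_mult_def)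
  qed
  show "inv a \<in> P <#> C" if a: "a \<in> P <#> C" for a
  proof -
    obtain x c where xc: "x \<in> P" "c \<in> C" "a = x \<otimes> c" using a by (auto simp: set_mult_def)
    then have "inv a = inv c \<otimes> inv x" using PG CG by (auto simp: inv_mult_group subset_iff)
    then show ?thesis using swap xc P C by (simp add: subgroup.m_inv_closed)
  qed
  show "a \<otimes> b \<in> P <#> C" if ab: "a \<in> P <#> C" "b \<in> P <#> C" for a b
  proof -
    obtain x c y d where xc: "x \<in> P" "c \<in> C" "a = x \<otimes> c" "y \<in> P" "d \<in> C" "b = y \<otimes> d"
      using ab by (auto simp: set_mult_def)
    obtain z e where ze: "z \<in> P" "e \<in> C" "c \<otimes> y = z \<otimes> e" using swap[OF xc(2,4)] by (auto simp: set_mult_def)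
    have m: "x \<in> carrier G" "c \<in> carrier G" "y \<in> carrier G" "d \<in> carrier G" "z \<in> carrier G" "e \<in> carrier G"
      using xc ze PG CG by auto
    have "a \<otimes> b = x \<otimes> (c \<otimes> y) \<otimes> d" using xc m by (simp add: m_assoc)
    also have "\<dots> = (x \<otimes> z) \<otimes> (e \<otimes> d)" using ze m by (simp add: m_assoc)
    finally show ?thesis using xc ze P C by (auto simp: set_mult_def intro!: subgroup.m_closed)
  qed
qed

lemma set_mult_left: "subgroup P G \<Longrightarrow> subgroup C G \<Longrightarrow> P \<subseteq> P <#> C"
  using subgroup.one_closed[of C G] subgroup.mem_carrier[of P G] by (force simp: set_mult_def)

lemma set_mult_right: "subgroup P G \<Longrightarrow> subgroup C G \<Longrightarrow> C \<subseteq> P <#> C"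
  using subgroup.one_closed[of P G] subgroup.mem_carrier[of C G] by (force simp: set_mult_def)

lemma set_mult_least: "subgroup K G \<Longrightarrow> P \<subseteq> K \<Longrightarrow> C \<subseteq> K \<Longrightarrow> P <#> C \<subseteq> K"
  by (auto simp: set_mult_def intro: subgroup.m_closed)

end

section \<open>Fusion systems through total functions\<close>

locale prime_fusion_system = fusion_system p S F
  for p :: nat and S :: "('a, 'm) monoid_scheme" (structure) and F :: "'a homs" +
  assumes prime_p: "prime p"

sublocale prime_fusion_system \<subseteq> group S by (rule group_S)

context prime_fusion_system begin

lemma finite_S: "finite (carrier S)" and order_S: "\<exists>n. order S = p ^ n"
  using p_group_S by (auto simp: finite_p_group_def)

lemma sub_carrier: "subgroup P S \<Longrightarrow> x \<in> P \<Longrightarrow> x \<in> carrier S"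
  by (rule subgroup.mem_carrier)

lemma sub_finite: "subgroup P S \<Longrightarrow> finite P"
  using finite_S subgroup.subset finite_subset by metis

lemma card_p_power:
  assumes "subgroup P S" shows "\<exists>k. card P = p ^ k"
  using card_subgroup_dvd[OF assms] order_S divides_primepow_nat[OF prime_p] by metis

lemma cenS: "subgroup P S \<Longrightarrow> subgroup (cen P) S"
  by (simp add: subgroup_cen subgroup.subset)

lemma nrmS: "subgroup P S \<Longrightarrow> subgroup (nrm P) S"
  by (simp add: subgroup_nrm subgroup.subset sub_finite)

lemma nrm_image: "subgroup P S \<Longrightarrow> g \<in> nrm P \<Longrightarrow> cj g ` P = P"
  by (simp add: cj_image_nrm sub_finite subgroup.subset)

lemma nrm_cen: "subgroup P S \<Longrightarrow> g \<in> nrm P \<Longrightarrow> c \<in> cen P \<Longrightarrow> cj g c \<in> cen P"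
  by (simp add: cj_nrm_cen sub_finite subgroup.subset)

lemma nrm_grows:
  assumes "subgroup P S" "subgroup K S" "P \<subset> K"
  obtains g where "g \<in> K" "g \<notin> P" "g \<in> nrm P"
proof -
  obtain n where "order S = p ^ n" using order_S by blast
  then obtain g where "g \<in> K" "g \<notin> P" "\<And>x. x \<in> P \<Longrightarrow> g \<otimes> x \<otimes> inv g \<in> P"
    using normalizers_grow[OF prime_p finite_S _ assms] by metis
  then show ?thesis using that sub_carrier[OF assms(2)] by (auto simp: nrm_def cj_def)
qed

text \<open>A morphism on \<open>P\<close> is handled as a total function with arbitrary values outside \<open>P\<close>, and with codomain \<open>S\<close>.
In this form restrictions of \<open>f\<close> are \<open>f\<close> itself and composites are composites of functions. Nothing is lost:
\<open>F_eq_mor\<close> recovers all morphism sets.\<close>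

definition mor :: "'a set \<Rightarrow> ('a \<Rightarrow> 'a) \<Rightarrow> bool" where
  "mor P f \<longleftrightarrow> restrict f P \<in> F P (carrier S)"

lemma F_D:
  assumes "\<phi> \<in> F P Q"
  shows "\<phi> \<in> extensional P" "subgroup P S" "subgroup Q S" "\<phi> ` P \<subseteq> Q" "inj_on \<phi> P"
    and "\<And>x y. x \<in> P \<Longrightarrow> y \<in> P \<Longrightarrow> \<phi> (x \<otimes> y) = \<phi> x \<otimes> \<phi> y"
  using homs_Inj[of P Q] assms by (auto simp: Inj_def mon_def hom_def)

lemma incl_F: "subgroup A S \<Longrightarrow> subgroup B S \<Longrightarrow> A \<subseteq> B \<Longrightarrow> (\<lambda>x\<in>A. x) \<in> F A B"
  using restrictive_category.restrict_mem[OF restrictive id_mem[of B]]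
  by (smt (verit) id_mem image_ident image_restrict_eq order_refl restrict_restrict inf.absorb2 restrictive restrictive_category.restrict_mem)

lemma F_eq_mor:
  assumes "subgroup Q S"
  shows "\<phi> \<in> F P Q \<longleftrightarrow> \<phi> \<in> extensional P \<and> mor P \<phi> \<and> \<phi> ` P \<subseteq> Q"
proof
  assume \<phi>: "\<phi> \<in> F P Q"
  have "compose P (\<lambda>x\<in>Q. x) \<phi> \<in> F P (carrier S)"
    using comp_mem[OF \<phi> incl_F[OF assms subgroup_self]] subgroup.subset[OF assms] by blast
  moreover have "compose P (\<lambda>x\<in>Q. x) \<phi> = restrict \<phi> P"
    using F_D[OF \<phi>] by (auto simp: compose_def fun_eq_iff)
  ultimately show "\<phi> \<in> extensional P \<and> mor P \<phi> \<and> \<phi> ` P \<subseteq> Q"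
    using F_D[OF \<phi>] by (simp add: mor_def)
next
  assume a: "\<phi> \<in> extensional P \<and> mor P \<phi> \<and> \<phi> ` P \<subseteq> Q"
  then have "\<phi> \<in> extensional P" "restrict \<phi> P \<in> F P (carrier S)" by (simp_all add: mor_def)
  then have "\<phi> \<in> F P (carrier S)" by (metis extensional_restrict)
  then have "restrict \<phi> P \<in> F P Q"
    using restrictive_category.restrict_mem[OF restrictive, of \<phi> P "carrier S" P Q] F_D[of \<phi> P "carrier S"]
      assms a subgroup.subset[OF assms] by blast
  then show "\<phi> \<in> F P Q" using a by (simp add: extensional_restrict)
qed

lemma mor_cong: "mor P f \<Longrightarrow> (\<And>x. x \<in> P \<Longrightarrow> f x = g x) \<Longrightarrow> mor P g"
  unfolding mor_def by (metis restrict_ext)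

lemma mor_subgroup: "mor P f \<Longrightarrow> subgroup P S"
  unfolding mor_def by (rule F_D)

lemma mor_carrier: "mor P f \<Longrightarrow> x \<in> P \<Longrightarrow> f x \<in> carrier S"
  using F_D(4)[of "restrict f P" P "carrier S"] by (auto simp: mor_def)

lemma mor_mult:
  assumes "mor P f" "x \<in> P" "y \<in> P" shows "f (x \<otimes> y) = f x \<otimes> f y"
  using F_D(6)[of "restrict f P" P "carrier S" x y] assms mor_subgroup[OF assms(1)]
  by (simp add: mor_def subgroup.m_closed)

lemma mor_inj: "mor P f \<Longrightarrow> inj_on f P"
  using F_D(5)[of "restrict f P" P "carrier S"] by (simp add: mor_def inj_on_restrict_eq)

lemma mor_one: assumes "mor P f" shows "f \<one> = \<one>"
proof -
  have 1: "\<one> \<in> P" using mor_subgroup[OF assms] by (rule subgroup.one_closed)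
  then show ?thesis using mor_mult[OF assms 1 1] mor_carrier[OF assms 1] by simp
qed

lemma mor_m_inv: assumes "mor P f" "x \<in> P" shows "f (inv x) = inv (f x)"
proof -
  have i: "inv x \<in> P" using mor_subgroup[OF assms(1)] assms(2) by (rule subgroup.m_inv_closed)
  have "f (inv x) \<otimes> f x = \<one>"
    using mor_mult[OF assms(1) i assms(2)] mor_one[OF assms(1)] sub_carrier[OF mor_subgroup[OF assms(1)] assms(2)] by simp
  then show ?thesis using mor_carrier[OF assms(1)] i assms(2) by (simp add: inv_equality)
qed

lemma mor_cj: assumes "mor P f" "g \<in> P" "x \<in> P" shows "f (cj g x) = cj (f g) (f x)"
  using mor_subgroup[OF assms(1)] assms
  by (simp add: cj_def mor_mult mor_m_inv subgroup.m_closed subgroup.m_inv_closed)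

lemma mor_image: assumes "mor P f" shows "subgroup (f ` P) S"
proof -
  have P: "subgroup P S" using assms by (rule mor_subgroup)
  show ?thesis
  proof (rule subgroupI)
    show "f ` P \<subseteq> carrier S" using mor_carrier[OF assms] by auto
    show "f ` P \<noteq> {}" using subgroup.one_closed[OF P] by auto
    show "inv a \<in> f ` P" if a: "a \<in> f ` P" for a
    proof -
      obtain x where "x \<in> P" "a = f x" using a by auto
      then have "inv x \<in> P" "inv a = f (inv x)" using mor_m_inv[OF assms] subgroup.m_inv_closed[OF P] by auto
      then show ?thesis by simp
    qed
    show "a \<otimes> b \<in> f ` P" if ab: "a \<in> f ` P" "b \<in> f ` P" for a b
    proof -
      obtain x y where "x \<in> P" "a = f x" "y \<in> P" "b = f y" using ab by auto
      then have "x \<otimes> y \<in> P" "a \<otimes> b = f (x \<otimes> y)" using mor_mult[OF assms] subgroup.m_closed[OF P] by auto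
      then show ?thesis by simp
    qed
  qed
qed

lemma mor_card: "mor P f \<Longrightarrow> card (f ` P) = card P"
  by (simp add: card_image mor_inj)

lemma mor_restrict:
  assumes "mor P f" "subgroup Q S" "Q \<subseteq> P" shows "mor Q f"
proof -
  have "restrict (restrict f P) Q \<in> F Q (carrier S)"
    using restrictive_category.restrict_mem[OF restrictive, of "restrict f P" P "carrier S" Q "carrier S"]
      assms mor_carrier[OF assms(1)] subgroup_self by (auto simp: mor_def)
  then show ?thesis using assms(3) by (simp add: mor_def inf.absorb2)
qed

lemma mor_comp:
  assumes f: "mor P f" and g: "mor Q g" and "f ` P \<subseteq> Q" shows "mor P (\<lambda>x. g (f x))"
proof -
  have "restrict f P \<in> F P Q" using F_eq_mor[OF mor_subgroup[OF g], of "restrict f P" P] f assms(3)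
    by (auto intro: mor_cong)
  then have "compose P (restrict g Q) (restrict f P) \<in> F P (carrier S)"
    using comp_mem g unfolding mor_def by blast
  moreover have "compose P (restrict g Q) (restrict f P) = restrict (\<lambda>x. g (f x)) P"
    using assms(3) by (auto simp: compose_def fun_eq_iff)
  ultimately show ?thesis by (simp add: mor_def)
qed

lemma mor_id: "subgroup P S \<Longrightarrow> (\<And>x. x \<in> P \<Longrightarrow> f x = x) \<Longrightarrow> mor P f"
proof -
  assume "subgroup P S" and f: "\<And>x. x \<in> P \<Longrightarrow> f x = x"
  moreover have "restrict f P = (\<lambda>x\<in>P. x)" using f by auto
  ultimately show ?thesis using incl_F[of P "carrier S"] by (simp add: mor_def subgroup_self subgroup.subset)
qed

lemma mor_cj_elem: assumes "subgroup P S" "g \<in> carrier S" shows "mor P (cj g)"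
proof -
  have "conj_map S g P \<in> group_fusion S P (carrier S)"
    using assms by (auto simp: group_fusion_def transporter_def conj_map_def subgroup_self sub_carrier)
  moreover have "conj_map S g P = restrict (cj g) P" by (auto simp: conj_map_def cj_def)
  ultimately show ?thesis using group_fusion_le by (auto simp: mor_def)
qed

text \<open>The factorization axiom says that \<open>f\<close> is an isomorphism onto its image.\<close>

lemma mor_inv_into: assumes "mor P f" shows "mor (f ` P) (inv_into P f)"
proof -
  have "restrict f P \<in> F P (carrier S)" using assms by (simp add: mor_def)
  then obtain R \<psi> where R: "category_iso F P R \<psi>" and eq: "restrict f P = compose P (\<lambda>x\<in>R. x) \<psi>"
    using factor_iso by blast
  obtain \<chi> where \<psi>: "\<psi> \<in> F P R" and \<chi>: "\<chi> \<in> F R P" "compose P \<chi> \<psi> = (\<lambda>x\<in>P. x)" "compose R \<psi> \<chi> = (\<lambda>x\<in>R. x)"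
    using R by (auto simp: category_iso_def)
  have f: "f x = \<psi> x" if "x \<in> P" for x
    using fun_cong[OF eq, of x] that F_D(4)[OF \<psi>] by (auto simp: compose_def)
  have "R \<subseteq> f ` P"
  proof
    fix r assume r: "r \<in> R"
    then have "\<psi> (\<chi> r) = r" using fun_cong[OF \<chi>(3), of r] by (simp add: compose_def)
    moreover have "\<chi> r \<in> P" using r F_D(4)[OF \<chi>(1)] by auto
    ultimately show "r \<in> f ` P" using f by (metis image_eqI)
  qed
  then have fR: "f ` P = R" using f F_D(4)[OF \<psi>] by auto
  have "mor R \<chi>" using \<chi>(1) F_eq_mor F_D(3) by blast
  moreover have "\<chi> y = inv_into P f y" if y: "y \<in> R" for y
  proof -
    obtain x where x: "x \<in> P" "y = f x" using y fR by auto
    then have "\<chi> y = x" using fun_cong[OF \<chi>(2), of x] f by (simp add: compose_def)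
    then show ?thesis using x mor_inj[OF assms] by simp
  qed
  ultimately show ?thesis unfolding fR by (rule mor_cong)
qed

lemma inv_into_image: "mor P f \<Longrightarrow> inv_into P f ` (f ` P) = P"
  by (simp add: mor_inj)

lemma F_conjugate_iff: "F_conjugate F P P' \<longleftrightarrow> (\<exists>f. mor P f \<and> f ` P = P')"
proof
  assume "F_conjugate F P P'"
  then obtain \<phi> \<psi> where *: "\<phi> \<in> F P P'" "\<psi> \<in> F P' P" "compose P' \<phi> \<psi> = (\<lambda>x\<in>P'. x)"
    by (auto simp: F_conjugate_def category_iso_def)
  have "P' \<subseteq> \<phi> ` P"
  proof
    fix y assume y: "y \<in> P'"
    then have "\<phi> (\<psi> y) = y" using fun_cong[OF *(3), of y] by (simp add: compose_def)
    then show "y \<in> \<phi> ` P" using y F_D(4)[OF *(2)] by (metis image_eqI image_subset_iff)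
  qed
  then show "\<exists>f. mor P f \<and> f ` P = P'" using *(1) F_eq_mor F_D[OF *(1)] by blast
next
  assume "\<exists>f. mor P f \<and> f ` P = P'"
  then obtain f where f: "mor P f" "f ` P = P'" by blast
  let ?\<phi> = "restrict f P" and ?\<psi> = "restrict (inv_into P f) P'"
  have "?\<phi> \<in> F P P'" using F_eq_mor[of P' ?\<phi> P] mor_image[OF f(1)] f by (auto intro: mor_cong)
  moreover have "?\<psi> \<in> F P' P"
    using F_eq_mor[of P ?\<psi> P'] mor_inv_into[OF f(1)] mor_subgroup[OF f(1)] f inv_into_image[OF f(1)]
    by (auto intro: mor_cong)
  moreover have "compose P ?\<psi> ?\<phi> = (\<lambda>x\<in>P. x)" "compose P' ?\<phi> ?\<psi> = (\<lambda>x\<in>P'. x)"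
    using f mor_inj[OF f(1)] by (auto simp: compose_def fun_eq_iff f_inv_into_f inv_into_into)
  ultimately show "F_conjugate F P P'" unfolding F_conjugate_def category_iso_def by blast
qed

lemma ex_image_all: "(\<forall>P'. (\<exists>f. mor P f \<and> f ` P = P') \<longrightarrow> X P') \<longleftrightarrow> (\<forall>f. mor P f \<longrightarrow> X (f ` P))"
  by blast

lemma fully_centralized_iff:
  "fully_centralized S F P \<longleftrightarrow> subgroup P S \<and> (\<forall>f. mor P f \<longrightarrow> card (cen (f ` P)) \<le> card (cen P))"
proof -
  have "centralizer S Q = cen Q" if "subgroup Q S" for Q
    using that centralizer_eq_cen subgroup.subset by blast
  then have "card (centralizer S (f ` P)) = card (cen (f ` P))" if "mor P f" for f using that mor_image by simp
  then show ?thesis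
    unfolding fully_centralized_def F_conjugate_iff ex_image_all using \<open>\<And>Q. subgroup Q S \<Longrightarrow> centralizer S Q = cen Q\<close> by auto
qed

lemma fully_normalized_iff:
  "fully_normalized S F P \<longleftrightarrow> subgroup P S \<and> (\<forall>f. mor P f \<longrightarrow> card (nrm (f ` P)) \<le> card (nrm P))"
proof -
  have "normalizer S Q = nrm Q" if "subgroup Q S" for Q
    by (rule normalizer_eq_nrm[OF sub_finite[OF that] subgroup.subset[OF that]])
  then have "card (normalizer S (f ` P)) = card (nrm (f ` P))" if "mor P f" for f using that mor_image by simp
  then show ?thesis
    unfolding fully_normalized_def F_conjugate_iff ex_image_all using \<open>\<And>Q. subgroup Q S \<Longrightarrow> normalizer S Q = nrm Q\<close> by auto
qed

text \<open>The subgroup \<open>N\<^sub>\<phi>\<close> of the extension axiom, with \<open>f\<close> regarded as an isomorphism onto its image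
(\<open>N_phi_eq\<close>).\<close>

definition Nx :: "'a set \<Rightarrow> ('a \<Rightarrow> 'a) \<Rightarrow> 'a set" where
  "Nx P f = {g \<in> nrm P. \<exists>h\<in>nrm (f ` P). \<forall>x\<in>P. f (cj g x) = cj h (f x)}"

lemma Nx_cong:
  assumes "\<And>x. x \<in> P \<Longrightarrow> f x = f' x"
  shows "Nx P f = Nx P f'"
proof -
  have "f ` P = f' ` P" using assms by (rule image_cong[OF refl])
  moreover have "f (cj g x) = f' (cj g x)" if "g \<in> nrm P" "x \<in> P" for g x
    using assms nrm_cj[OF that(1)] that(2) by auto
  ultimately show ?thesis unfolding Nx_def using assms by auto
qed

lemma group_fusion_self:
  assumes "subgroup P S"
  shows "group_fusion S P P = (\<lambda>g. restrict (cj g) P) ` nrm P"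
proof -
  have "conj_map S g P = restrict (cj g) P" for g unfolding conj_map_def cj_def ..
  then show ?thesis
    using assms by (force simp: group_fusion_def transporter_def nrm_def image_def)
qed

lemma N_phi_eq:
  assumes f: "mor P f"
  shows "N_phi S P f = Nx P f"
proof -
  have P: "subgroup P S" and fP: "subgroup (f ` P) S" using f mor_subgroup mor_image by auto
  have "(\<lambda>y\<in>f ` P. f (conj_map S g P (inv_into P f y))) = restrict (cj h) (f ` P) \<longleftrightarrow> (\<forall>x\<in>P. f (cj g x) = cj h (f x))"
    for g h
    using mor_inj[OF f] by (auto simp: fun_eq_iff conj_map_def cj_def restrict_def)
  then show ?thesis
    unfolding N_phi_def Nx_def group_fusion_self[OF fP]
    using normalizer_eq_nrm[OF sub_finite[OF P] subgroup.subset[OF P]] by (auto simp: image_def)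
qed

lemma Nx_subgroup:
  assumes f: "mor P f" shows "subgroup (Nx P f) S"
proof -
  have P: "subgroup P S" and fP: "subgroup (f ` P) S" using f mor_subgroup mor_image by auto
  note N = nrmS[OF P] and N' = nrmS[OF fP]
  show ?thesis
  proof (rule subgroupI)
    show "Nx P f \<subseteq> carrier S" by (auto simp: Nx_def nrm_def)
    have "\<one> \<in> Nx P f" using subgroup.one_closed[OF N] subgroup.one_closed[OF N'] sub_carrier[OF P] mor_carrier[OF f]
      by (auto simp: Nx_def intro!: bexI[of _ \<one>])
    then show "Nx P f \<noteq> {}" by blast
    show "inv a \<in> Nx P f" if a: "a \<in> Nx P f" for a
    proof -
      obtain h where h: "a \<in> nrm P" "h \<in> nrm (f ` P)" "\<forall>x\<in>P. f (cj a x) = cj h (f x)" using a by (auto simp: Nx_def)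
      have "f (cj (inv a) x) = cj (inv h) (f x)" if x: "x \<in> P" for x
      proof -
        have "x \<in> cj a ` P" using nrm_image[OF P h(1)] x by simp
        then obtain y where y: "y \<in> P" "x = cj a y" by auto
        have yc: "y \<in> carrier S" "f y \<in> carrier S" using y mor_carrier[OF f] sub_carrier[OF P] by auto
        have "f (cj (inv a) x) = f y" using y yc nrm_carrier[OF h(1)] by simp
        moreover have "cj (inv h) (f x) = f y" using y yc h nrm_carrier[OF h(2)] by simp
        ultimately show ?thesis by simp
      qed
      then show ?thesis using h subgroup.m_inv_closed[OF N] subgroup.m_inv_closed[OF N'] by (auto simp: Nx_def)
    qed
    show "a \<otimes> b \<in> Nx P f" if ab: "a \<in> Nx P f" "b \<in> Nx P f" for a b
    proof -
      obtain h k where h: "a \<in> nrm P" "h \<in> nrm (f ` P)" "\<forall>x\<in>P. f (cj a x) = cj h (f x)"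
        "b \<in> nrm P" "k \<in> nrm (f ` P)" "\<forall>x\<in>P. f (cj b x) = cj k (f x)" using ab by (auto simp: Nx_def)
      have "f (cj (a \<otimes> b) x) = cj (h \<otimes> k) (f x)" if x: "x \<in> P" for x
        using x h nrm_carrier sub_carrier[OF P] mor_carrier[OF f] nrm_cj[OF h(4) x] by (simp add: cj_cj)
      then show ?thesis using h subgroup.m_closed[OF N] subgroup.m_closed[OF N'] by (auto simp: Nx_def)
    qed
  qed
qed

lemma Nx_superset: assumes f: "mor P f" shows "P \<subseteq> Nx P f"
proof -
  have P: "subgroup P S" and fP: "subgroup (f ` P) S" using f mor_subgroup mor_image by auto
  have "g \<in> Nx P f" if g: "g \<in> P" for g
  proof -
    have "f g \<in> nrm (f ` P)" "g \<in> nrm P" using g subgroup_subset_nrm[OF P] subgroup_subset_nrm[OF fP] by auto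
    then show ?thesis using mor_cj[OF f g] unfolding Nx_def by blast
  qed
  then show ?thesis by blast
qed

lemma cen_Nx: assumes f: "mor P f" shows "cen P \<subseteq> Nx P f"
proof -
  have fP: "subgroup (f ` P) S" using f mor_image by auto
  have "\<one> \<in> nrm (f ` P)" using subgroup.one_closed[OF nrmS[OF fP]] .
  then show ?thesis using cen_subset_nrm cen_cj mor_carrier[OF f] by (fastforce simp: Nx_def intro!: bexI[of _ \<one>])
qed

subsection \<open>Automorphism groups\<close>

lemma aut_iff: "subgroup P S \<Longrightarrow> a \<in> F P P \<longleftrightarrow> a \<in> extensional P \<and> mor P a \<and> a ` P = P"
  by (metis F_eq_mor card_subset_eq mor_card order_refl sub_finite)

lemma aut_restrict: "mor P f \<Longrightarrow> f ` P = P \<Longrightarrow> restrict f P \<in> F P P"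
  using aut_iff[OF mor_subgroup, of P f "restrict f P"] by (auto intro: mor_cong)

lemma F_sub_Bij: "subgroup P S \<Longrightarrow> F P P \<subseteq> Bij P"
  using aut_iff mor_inj by (auto simp: Bij_def bij_betw_def)

lemma Aut_mult: "subgroup P S \<Longrightarrow> a \<in> F P P \<Longrightarrow> b \<in> F P P \<Longrightarrow> a \<otimes>\<^bsub>Aut_group F P\<^esub> b = compose P a b"
  using F_sub_Bij by (fastforce simp: Aut_group_def BijGroup_def)

lemma Aut_carrier [simp]: "carrier (Aut_group F P) = F P P"
  by (simp add: Aut_group_def)

lemma Aut_one [simp]: "\<one>\<^bsub>Aut_group F P\<^esub> = (\<lambda>x\<in>P. x)"
  by (simp add: Aut_group_def BijGroup_def)

lemma inv_into_aut: assumes "subgroup P S" "a \<in> F P P" shows "restrict (inv_into P a) P \<in> F P P"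
proof -
  have a: "mor P a" "a ` P = P" using assms aut_iff by auto
  then show ?thesis using mor_inv_into[OF a(1)] inv_into_image[OF a(1)] aut_restrict by simp
qed

lemma Aut_group: assumes P: "subgroup P S" shows "group (Aut_group F P)"
proof -
  interpret B: group "BijGroup P" by (rule group_BijGroup)
  have FB: "F P P \<subseteq> Bij P" by (rule F_sub_Bij[OF P])
  have "subgroup (F P P) (BijGroup P)"
  proof (rule B.subgroupI)
    show "F P P \<subseteq> carrier (BijGroup P)" using FB by (simp add: BijGroup_def)
    show "F P P \<noteq> {}" using id_mem[OF P] by blast
    show "inv\<^bsub>BijGroup P\<^esub> a \<in> F P P" if "a \<in> F P P" for a
      using that FB inv_into_aut[OF P] by (simp add: inv_BijGroup subset_iff)
    show "a \<otimes>\<^bsub>BijGroup P\<^esub> b \<in> F P P" if "a \<in> F P P" "b \<in> F P P" for a b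
      using that FB comp_mem by (simp add: BijGroup_def subset_iff)
  qed
  then show ?thesis unfolding Aut_group_def by (rule B.subgroup_imp_group)
qed

lemma Aut_finite: assumes P: "subgroup P S" shows "finite (F P P)"
proof (rule finite_subset)
  show "F P P \<subseteq> P \<rightarrow>\<^sub>E P" using F_D(1,4)[of _ P P] by (auto simp: PiE_def)
  show "finite (P \<rightarrow>\<^sub>E P)" using sub_finite[OF P] by (simp add: finite_PiE)
qed

lemma Aut_inv:
  assumes P: "subgroup P S" and a: "a \<in> F P P"
  shows "inv\<^bsub>Aut_group F P\<^esub> a = restrict (inv_into P a) P"
proof -
  interpret A: group "Aut_group F P" by (rule Aut_group[OF P])
  show ?thesis
  proof (rule A.inv_equality)
    show "restrict (inv_into P a) P \<otimes>\<^bsub>Aut_group F P\<^esub> a = \<one>\<^bsub>Aut_group F P\<^esub>"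
      unfolding Aut_mult[OF P inv_into_aut[OF P a] a]
      using a aut_iff[OF P] mor_inj by (auto simp: compose_def fun_eq_iff)
  qed (use a inv_into_aut[OF P a] in auto)
qed

lemma Aut_conj:
  assumes P: "subgroup P S" and a: "a \<in> F P P" and u: "u \<in> F P P"
  shows "a \<otimes>\<^bsub>Aut_group F P\<^esub> u \<otimes>\<^bsub>Aut_group F P\<^esub> inv\<^bsub>Aut_group F P\<^esub> a = (\<lambda>y\<in>P. a (u (inv_into P a y)))"
proof -
  have "inv_into P a y \<in> P" if "y \<in> P" for y
    using that aut_iff[OF P, of a] a inv_into_into[of y a P] by simp
  moreover have "compose P a u \<in> F P P" by (rule comp_mem[OF u a])
  ultimately show ?thesis
    using a u inv_into_aut[OF P a] by (auto simp: Aut_inv[OF P a] Aut_mult[OF P] compose_def fun_eq_iff)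
qed

lemma aut_subgroupI:
  assumes P: "subgroup P S" and D: "D \<subseteq> F P P" "(\<lambda>x\<in>P. x) \<in> D"
    and m: "\<And>a b. a \<in> D \<Longrightarrow> b \<in> D \<Longrightarrow> compose P a b \<in> D"
    and i: "\<And>a. a \<in> D \<Longrightarrow> restrict (inv_into P a) P \<in> D"
  shows "subgroup D (Aut_group F P)"
proof -
  interpret A: group "Aut_group F P" by (rule Aut_group[OF P])
  show ?thesis
    by (rule A.subgroupI) (use D m i Aut_inv[OF P] Aut_mult[OF P] in \<open>auto simp: subset_iff\<close>)
qed

text \<open>For \<open>X = N\<^sub>S(P)\<close> this is \<open>Aut\<^sub>S(P)\<close>.\<close>

definition conj_auts :: "'a set \<Rightarrow> 'a set \<Rightarrow> ('a \<Rightarrow> 'a) set" where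
  "conj_auts P X = (\<lambda>g. restrict (cj g) P) ` X"

lemma Aut_S_eq: "subgroup P S \<Longrightarrow> group_fusion S P P = conj_auts P (nrm P)"
  by (simp add: group_fusion_self conj_auts_def)

lemma conj_auts_in_F: assumes P: "subgroup P S" and "X \<subseteq> nrm P" shows "conj_auts P X \<subseteq> F P P"
  using assms nrm_image[OF P] mor_cj_elem[OF P] nrm_carrier aut_restrict by (auto simp: conj_auts_def subset_iff)

lemma conj_auts_p_subgroup:
  assumes P: "subgroup P S" and X: "subgroup X S" "X \<subseteq> nrm P"
  shows "subgroup (conj_auts P X) (Aut_group F P)" "\<exists>k. card (conj_auts P X) = p ^ k"
proof -
  interpret A: group "Aut_group F P" by (rule Aut_group[OF P])
  interpret X: group "S\<lparr>carrier := X\<rparr>" using X subgroup_imp_group by blast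
  have hom: "(\<lambda>g. restrict (cj g) P) \<in> hom (S\<lparr>carrier := X\<rparr>) (Aut_group F P)"
  proof -
    have FX: "restrict (cj g) P \<in> F P P" if "g \<in> X" for g
      using conj_auts_in_F[OF P X(2)] that by (auto simp: conj_auts_def)
    have "restrict (cj (g \<otimes> h)) P = compose P (restrict (cj g) P) (restrict (cj h) P)" if "g \<in> X" "h \<in> X" for g h
    proof -
      have "g \<in> nrm P" "h \<in> nrm P" "g \<in> carrier S" "h \<in> carrier S" using that X nrm_carrier by auto
      then show ?thesis using nrm_cj sub_carrier[OF P] by (auto simp: compose_def fun_eq_iff cj_cj)
    qed
    then show ?thesis using FX Aut_mult[OF P] by (auto simp: hom_def)
  qed
  then interpret h: group_hom "S\<lparr>carrier := X\<rparr>" "Aut_group F P" "\<lambda>g. restrict (cj g) P"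
    by unfold_locales
  show "subgroup (conj_auts P X) (Aut_group F P)" using h.img_is_subgroup by (simp add: conj_auts_def)
  have "card (conj_auts P X) dvd card X"
    using X.order_image_times_kernel[OF h.group_hom_axioms] sub_finite[OF X(1)] by (simp add: order_def conj_auts_def)
  then show "\<exists>k. card (conj_auts P X) = p ^ k"
    using card_p_power[OF X(1)] divides_primepow_nat[OF prime_p] by metis
qed

text \<open>The map \<open>c\<close> is conjugation by the isomorphism \<open>f\<close>. It carries \<open>p\<close>-subgroups and Sylow subgroups of
\<open>Aut\<^sub>F(R)\<close> to those of \<open>Aut\<^sub>F(f(R))\<close>, and is used through its last property.\<close>

lemma conj_aut_hom:
  assumes f: "mor R f"
  defines "c \<equiv> \<lambda>u. restrict (\<lambda>y. f (u (inv_into R f y))) (f ` R)"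
  shows "group_hom (Aut_group F R) (Aut_group F (f ` R)) c" "inj_on c (F R R)"
    "\<And>u x. u \<in> F R R \<Longrightarrow> x \<in> R \<Longrightarrow> c u (f x) = f (u x)"
proof -
  have R: "subgroup R S" and fR: "subgroup (f ` R) S" using f mor_subgroup mor_image by auto
  interpret A: group "Aut_group F R" by (rule Aut_group[OF R])
  interpret B: group "Aut_group F (f ` R)" by (rule Aut_group[OF fR])
  show ap: "c u (f x) = f (u x)" if "u \<in> F R R" "x \<in> R" for u x
    using that mor_inj[OF f] by (simp add: c_def)
  have uR: "u x \<in> R" if "u \<in> F R R" "x \<in> R" for u x using that F_D(4) by blast
  have cF: "c u \<in> F (f ` R) (f ` R)" if u: "u \<in> F R R" for u
  proof -
    have u': "mor R u" "u ` R = R" using u aut_iff[OF R] by auto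
    have "mor (f ` R) (\<lambda>y. u (inv_into R f y))" using mor_comp[OF mor_inv_into[OF f] u'(1)] inv_into_image[OF f] by simp
    moreover have "(\<lambda>y. u (inv_into R f y)) ` f ` R = u ` inv_into R f ` f ` R" by (simp only: image_image)
    then have uR': "(\<lambda>y. u (inv_into R f y)) ` f ` R = R" using inv_into_image[OF f] u' by simp
    ultimately have m: "mor (f ` R) (\<lambda>y. f (u (inv_into R f y)))"
      using mor_comp[OF _ f, of "f ` R" "\<lambda>y. u (inv_into R f y)"] by simp
    have "(\<lambda>y. f (u (inv_into R f y))) ` f ` R = f ` (\<lambda>y. u (inv_into R f y)) ` f ` R" by (simp only: image_image)
    also have "\<dots> = f ` R" using uR' by simp
    finally show ?thesis unfolding c_def using aut_restrict[OF m] by simp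
  qed
  have "c \<in> hom (Aut_group F R) (Aut_group F (f ` R))"
  proof (rule homI)
    show "c (u \<otimes>\<^bsub>Aut_group F R\<^esub> v) = c u \<otimes>\<^bsub>Aut_group F (f ` R)\<^esub> c v"
      if "u \<in> carrier (Aut_group F R)" "v \<in> carrier (Aut_group F R)" for u v
    proof -
      have uv: "u \<in> F R R" "v \<in> F R R" using that by auto
      have "c (compose R u v) = compose (f ` R) (c u) (c v)"
      proof
        fix y show "c (compose R u v) y = compose (f ` R) (c u) (c v) y"
        proof (cases "y \<in> f ` R")
          case True
          then obtain x where x: "x \<in> R" "y = f x" by auto
          show ?thesis using x ap uv uR comp_mem[OF uv(2,1)] by (simp add: compose_def)
        qed (simp add: c_def compose_def)
      qed
      then show ?thesis using Aut_mult[OF R uv] Aut_mult[OF fR cF[OF uv(1)] cF[OF uv(2)]] by simp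
    qed
  qed (use cF in auto)
  then show "group_hom (Aut_group F R) (Aut_group F (f ` R)) c" by unfold_locales
  show "inj_on c (F R R)"
  proof (rule inj_onI)
    fix u v assume uv: "u \<in> F R R" "v \<in> F R R" "c u = c v"
    show "u = v"
    proof (rule extensionalityI)
      show "u \<in> extensional R" "v \<in> extensional R" using uv F_D(1) by auto
      fix x assume x: "x \<in> R"
      then have "f (u x) = f (v x)" using ap uv by metis
      then show "u x = v x" using mor_inj[OF f] uR uv x by (meson inj_onD)
    qed
  qed
qed

end

section \<open>Sylow subgroups\<close>

lemma sylow_index:
  assumes "prime p" "group A" "finite (carrier A)" "sylow_subgroup p A T"
  shows "\<not> p dvd card (rcosets\<^bsub>A\<^esub> T)"
proof
  interpret A: group A by fact
  assume "p dvd card (rcosets\<^bsub>A\<^esub> T)"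
  moreover have T: "subgroup T A" "card T = p ^ multiplicity p (order A)" using assms by (auto simp: sylow_subgroup_def)
  moreover have "card (rcosets\<^bsub>A\<^esub> T) * card T = order A" by (rule A.lagrange[OF T(1)])
  ultimately have "p ^ Suc (multiplicity p (order A)) dvd order A"
    by (metis dvd_refl mult_dvd_mono power_Suc)
  moreover have "order A \<noteq> 0" using assms A.order_gt_0_iff_finite by simp
  ultimately show False using assms(1) by (metis Suc_n_not_le_n not_prime_unit multiplicity_geI)
qed

lemma sylow_exists:
  assumes "prime p" "group A" "finite (carrier A)"
  obtains T where "sylow_subgroup p A T"
proof -
  have "order A = p ^ multiplicity p (order A) * (order A div p ^ multiplicity p (order A))"
    by (simp add: multiplicity_dvd)
  then show ?thesis using sylow_thm[OF assms(1,2) _ assms(3)] that unfolding sylow_subgroup_def by metis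
qed

lemma p_subgroup_card_le_sylow:
  assumes "prime p" "group A" "finite (carrier A)" "subgroup T A" "card T = p ^ k"
  shows "card T \<le> p ^ multiplicity p (order A)"
proof -
  interpret A: group A by fact
  have "p ^ k dvd order A" using A.card_subgroup_dvd assms by metis
  moreover have "order A \<noteq> 0" using assms A.order_gt_0_iff_finite by simp
  ultimately have "k \<le> multiplicity p (order A)" using assms(1) by (metis not_prime_unit multiplicity_geI)
  then show ?thesis using power_increasing[OF _ prime_ge_1_nat[OF assms(1)]] assms(5) by simp
qed

lemma sylow_if_card_ge:
  assumes "prime p" "group A" "finite (carrier A)" "subgroup T A" "card T = p ^ k"
    and "sylow_subgroup p A U" "card U \<le> card T"
  shows "sylow_subgroup p A T"
  using assms p_subgroup_card_le_sylow[OF assms(1-5)] by (auto simp: sylow_subgroup_def)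

section \<open>A saturation criterion\<close>

context prime_fusion_system begin

lemma mor_nrm:
  assumes h: "mor K h" and Q: "Q \<subseteq> K" and g: "g \<in> K" "g \<in> nrm Q"
  shows "h g \<in> nrm (h ` Q)"
proof -
  have "cj (h g) (h x) \<in> h ` Q" if "x \<in> Q" for x
    using mor_cj[OF h g(1), of x] nrm_cj[OF g(2) that] Q that by (metis imageI subsetD)
  then show ?thesis using mor_carrier[OF h g(1)] by (auto simp: nrm_def)
qed

lemma mor_cen:
  assumes h: "mor K h" and Q: "Q \<subseteq> K" and g: "g \<in> K" "g \<in> cen Q"
  shows "h g \<in> cen (h ` Q)"
proof -
  have "cj (h g) (h x) = h x" if "x \<in> Q" for x
    using mor_cj[OF h g(1), of x] cen_cj[OF g(2) that] Q that by auto
  then show ?thesis using mor_carrier[OF h g(1)] by (auto simp: cen_def)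
qed

text \<open>The extension axiom for all isomorphisms onto \<open>P\<close>, without reference to the size of centralizers. In
a saturated system the fully centralized subgroups have this property.\<close>

definition receptive :: "'a set \<Rightarrow> bool" where
  "receptive P \<longleftrightarrow> (\<forall>Q f. mor Q f \<longrightarrow> f ` Q = P \<longrightarrow> (\<exists>h. mor (Nx Q f) h \<and> (\<forall>x\<in>Q. h x = f x)))"

text \<open>The Sylow condition that a saturated system imposes on fully normalized subgroups.\<close>

definition automized :: "'a set \<Rightarrow> bool" where
  "automized P \<longleftrightarrow> sylow_subgroup p (Aut_group F P) (conj_auts P (nrm P))"

text \<open>Sylow's theorem in \<open>D\<close>, pulled back along \<open>f\<close>: the \<open>p\<close>-group \<open>f U f\<^sup>-\<^sup>1 \<le> D\<close> is conjugate in \<open>D\<close> to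
a subgroup of \<open>T\<close>.\<close>

lemma conj_into_sylow:
  assumes f: "mor R f" and D: "subgroup D (Aut_group F (f ` R))"
    and T: "sylow_subgroup p (Aut_group F (f ` R)\<lparr>carrier := D\<rparr>) T"
    and U: "subgroup U (Aut_group F R)" "card U = p ^ k"
    and UD: "\<And>u. u \<in> U \<Longrightarrow> restrict (\<lambda>y. f (u (inv_into R f y))) (f ` R) \<in> D"
  obtains a where "a \<in> D" "\<And>u. u \<in> U \<Longrightarrow> \<exists>t\<in>T. \<forall>x\<in>R. a (f (u x)) = t (a (f x))"
proof -
  define c where "c = (\<lambda>u. restrict (\<lambda>y. f (u (inv_into R f y))) (f ` R))"
  note c = conj_aut_hom(1,2)[OF f, folded c_def]
  have c_apply: "c u (f x) = f (u x)" if "u \<in> F R R" "x \<in> R" for u x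
    using conj_aut_hom(3)[OF f that] by (simp add: c_def)
  have R: "subgroup R S" and fR: "subgroup (f ` R) S" using f mor_subgroup mor_image by auto
  interpret A: group "Aut_group F (f ` R)" by (rule Aut_group[OF fR])
  interpret D: group "Aut_group F (f ` R)\<lparr>carrier := D\<rparr>" using A.subgroup_imp_group[OF D] .
  interpret c: group_hom "Aut_group F R" "Aut_group F (f ` R)" c by (rule c(1))
  have DF: "D \<subseteq> F (f ` R) (f ` R)" using subgroup.subset[OF D] by simp
  have fD: "finite D" using DF Aut_finite[OF fR] finite_subset by blast
  have UF: "U \<subseteq> F R R" using subgroup.subset[OF U(1)] by simp
  have cUD: "c ` U \<subseteq> D" using UD by (auto simp: c_def)
  have TD: "subgroup T (Aut_group F (f ` R)\<lparr>carrier := D\<rparr>)" using T by (simp add: sylow_subgroup_def)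
  have TsD: "T \<subseteq> D" using subgroup.subset[OF TD] by simp
  have "subgroup (c ` U) (Aut_group F (f ` R))" by (rule c.subgroup_img_is_subgroup[OF U(1)])
  then have "subgroup (c ` U) (Aut_group F (f ` R)\<lparr>carrier := D\<rparr>)" using A.subgroup_incl[OF _ D cUD] by blast
  moreover have "card (c ` U) = p ^ k" using U(2) card_image inj_on_subset[OF c(2) UF] by metis
  moreover have "\<not> p dvd card (rcosets\<^bsub>Aut_group F (f ` R)\<lparr>carrier := D\<rparr>\<^esub> T)"
    by (rule sylow_index[OF prime_p D.is_group _ T]) (use fD in simp)
  ultimately obtain a where a: "a \<in> D"
      "\<And>v. v \<in> c ` U \<Longrightarrow> a \<otimes>\<^bsub>Aut_group F (f ` R)\<^esub> v \<otimes>\<^bsub>Aut_group F (f ` R)\<^esub> inv\<^bsub>Aut_group F (f ` R)\<lparr>carrier := D\<rparr>\<^esub> a \<in> T"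
    using D.p_subgroup_conj_into[OF prime_p _ _ _ TD, of "c ` U" k] fD by auto
  have aF: "a \<in> F (f ` R) (f ` R)" using a DF by auto
  have "\<exists>t\<in>T. \<forall>x\<in>R. a (f (u x)) = t (a (f x))" if u: "u \<in> U" for u
  proof
    define t where "t = a \<otimes>\<^bsub>Aut_group F (f ` R)\<^esub> c u \<otimes>\<^bsub>Aut_group F (f ` R)\<^esub> inv\<^bsub>Aut_group F (f ` R)\<^esub> a"
    show "t \<in> T" using a u A.m_inv_consistent[OF D a(1)] by (auto simp: t_def)
    have cu: "c u \<in> F (f ` R) (f ` R)" using cUD DF u by auto
    have "t \<otimes>\<^bsub>Aut_group F (f ` R)\<^esub> a = a \<otimes>\<^bsub>Aut_group F (f ` R)\<^esub> c u"
      unfolding t_def using aF cu A.inv_closed[of a] A.m_assoc[of "a \<otimes>\<^bsub>Aut_group F (f ` R)\<^esub> c u"] A.m_closed[of a "c u"]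
        A.r_one[of "a \<otimes>\<^bsub>Aut_group F (f ` R)\<^esub> c u"]
      by simp
    moreover have "t \<in> F (f ` R) (f ` R)" using \<open>t \<in> T\<close> TsD DF by auto
    ultimately have eq: "compose (f ` R) t a = compose (f ` R) a (c u)"
      using Aut_mult[OF fR] aF cu by simp
    show "\<forall>x\<in>R. a (f (u x)) = t (a (f x))"
    proof
      fix x assume x: "x \<in> R"
      have "t (a (f x)) = a (c u (f x))" using fun_cong[OF eq, of "f x"] x by (simp add: compose_def)
      then show "a (f (u x)) = t (a (f x))" using c_apply UF u x by auto
    qed
  qed
  then show ?thesis using that a(1) by blast
qed

text \<open>This is \<open>conj_into_sylow\<close> for the full automorphism group of \<open>f(R)\<close>, with the conjugating automorphism
absorbed into \<open>f'\<close>.\<close>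

lemma automized_absorbs:
  assumes f: "mor R f" and T: "automized (f ` R)" and U: "subgroup U (Aut_group F R)" "card U = p ^ k"
  obtains f' where "mor R f'" "f' ` R = f ` R"
    "\<And>u. u \<in> U \<Longrightarrow> \<exists>g\<in>nrm (f ` R). \<forall>x\<in>R. f' (u x) = cj g (f' x)"
proof -
  let ?A = "Aut_group F (f ` R)"
  have R: "subgroup R S" and fR: "subgroup (f ` R) S" using f mor_subgroup mor_image by auto
  interpret A: group ?A by (rule Aut_group[OF fR])
  interpret c: group_hom "Aut_group F R" ?A "\<lambda>u. restrict (\<lambda>y. f (u (inv_into R f y))) (f ` R)"
    by (rule conj_aut_hom[OF f])
  have e: "?A\<lparr>carrier := F (f ` R) (f ` R)\<rparr> = ?A" by (simp add: Aut_group_def)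
  have UF: "U \<subseteq> F R R" using subgroup.subset[OF U(1)] by simp
  obtain a where a: "a \<in> F (f ` R) (f ` R)" and
    t: "\<And>u. u \<in> U \<Longrightarrow> \<exists>t\<in>conj_auts (f ` R) (nrm (f ` R)). \<forall>x\<in>R. a (f (u x)) = t (a (f x))"
  proof (rule conj_into_sylow[OF f _ _ U])
    show "subgroup (F (f ` R) (f ` R)) ?A" using A.subgroup_self by simp
    show "sylow_subgroup p (?A\<lparr>carrier := F (f ` R) (f ` R)\<rparr>) (conj_auts (f ` R) (nrm (f ` R)))"
      using T unfolding e automized_def .
    show "(\<lambda>y\<in>f ` R. f (u (inv_into R f y))) \<in> F (f ` R) (f ` R)" if "u \<in> U" for u
      using c.hom_closed[of u] that UF by auto
  qed (use that in blast)
  have a': "mor (f ` R) a" "a ` f ` R = f ` R" using a aut_iff[OF fR] by auto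
  show ?thesis
  proof (rule that[of "\<lambda>x. a (f x)"])
    show "mor R (\<lambda>x. a (f x))" by (rule mor_comp[OF f a'(1)]) simp
    have "(\<lambda>x. a (f x)) ` R = a ` f ` R" by (simp only: image_image)
    then show im: "(\<lambda>x. a (f x)) ` R = f ` R" using a' by simp
    show "\<exists>g\<in>nrm (f ` R). \<forall>x\<in>R. a (f (u x)) = cj g (a (f x))" if u: "u \<in> U" for u
      using t[OF u] im by (fastforce simp: conj_auts_def)
  qed
qed

text \<open>Apply \<open>automized_absorbs\<close> to \<open>U = Aut\<^sub>S(R)\<close>: the new map \<open>f'\<close> has \<open>N\<^bsub>f'\<^esub> = N\<^sub>S(R)\<close>, and \<open>f(R)\<close> is
receptive. Such maps defined on \<open>N\<^sub>S(R)\<close> are called frames of \<open>R\<close>.\<close>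

lemma frame_to_good:
  assumes f: "mor R f" and P: "automized (f ` R)" "receptive (f ` R)"
  obtains h where "mor (nrm R) h" "h ` R = f ` R"
proof -
  have R: "subgroup R S" using f mor_subgroup by auto
  obtain k where k: "card (conj_auts R (nrm R)) = p ^ k" using conj_auts_p_subgroup(2)[OF R nrmS[OF R]] by auto
  obtain f' where f': "mor R f'" "f' ` R = f ` R"
    "\<And>u. u \<in> conj_auts R (nrm R) \<Longrightarrow> \<exists>g\<in>nrm (f ` R). \<forall>x\<in>R. f' (u x) = cj g (f' x)"
    using automized_absorbs[OF f P(1) conj_auts_p_subgroup(1)[OF R nrmS[OF R] order_refl] k] by metis
  have "g \<in> Nx R f'" if g: "g \<in> nrm R" for g
    using f'(3)[of "restrict (cj g) R"] g f'(2) by (auto simp: Nx_def conj_auts_def)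
  then have "nrm R \<subseteq> Nx R f'" by blast
  moreover obtain h where h: "mor (Nx R f') h" "\<forall>x\<in>R. h x = f' x"
    using P(2) f' unfolding receptive_def by blast
  ultimately have "mor (nrm R) h" using mor_restrict nrmS[OF R] by blast
  moreover have "h ` R = f ` R" using h f' by (metis image_cong)
  ultimately show ?thesis using that by blast
qed

lemma mor_card_image_le:
  assumes h: "mor K h" and Q: "Q \<subseteq> K"
  shows "nrm Q \<subseteq> K \<Longrightarrow> card (nrm Q) \<le> card (nrm (h ` Q))"
    and "cen Q \<subseteq> K \<Longrightarrow> card (cen Q) \<le> card (cen (h ` Q))"
proof -
  have K: "subgroup K S" using h mor_subgroup by auto
  have hc: "finite (nrm (h ` Q))" "finite (cen (h ` Q))"
    using finite_S finite_subset nrm_carrier cen_carrier by (meson subsetI)+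
  show "card (nrm Q) \<le> card (nrm (h ` Q))" if "nrm Q \<subseteq> K"
    by (rule card_inj_on_le[where f = h]) (use mor_nrm[OF h Q] that mor_inj[OF h] inj_on_subset hc in auto)
  show "card (cen Q) \<le> card (cen (h ` Q))" if "cen Q \<subseteq> K"
    by (rule card_inj_on_le[where f = h]) (use mor_cen[OF h Q] that mor_inj[OF h] inj_on_subset hc in auto)
qed

text \<open>Frames embed the normalizer and the centralizer of any conjugate into those of \<open>P\<close>.\<close>

lemma good_imp_full:
  assumes P: "subgroup P S" and "automized P" "receptive P"
  shows "fully_normalized S F P" "fully_centralized S F P"
proof -
  have "card (nrm (f ` P)) \<le> card (nrm P) \<and> card (cen (f ` P)) \<le> card (cen P)" if f: "mor P f" for f
  proof -
    let ?R = "f ` P"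
    have R: "subgroup ?R S" using f mor_image by auto
    have i: "mor ?R (inv_into P f)" "inv_into P f ` ?R = P" using mor_inv_into[OF f] inv_into_image[OF f] by auto
    obtain h where h: "mor (nrm ?R) h" "h ` ?R = P" using frame_to_good[OF i(1)] assms i(2) by metis
    have "?R \<subseteq> nrm ?R" "cen ?R \<subseteq> nrm ?R" using subgroup_subset_nrm[OF R] cen_subset_nrm by auto
    then show ?thesis using mor_card_image_le[OF h(1), of ?R] h(2) by simp
  qed
  then show "fully_normalized S F P" "fully_centralized S F P"
    using P by (auto simp: fully_normalized_iff fully_centralized_iff)
qed

lemma card_image_eq_surj:
  assumes "h ` A \<subseteq> B" "inj_on h A" "finite B" "card B \<le> card A"
  shows "h ` A = B"
  using assms by (simp add: card_seteq card_image)

text \<open>The injection \<open>h\<close> maps \<open>C\<^sub>S(P)\<close> into \<open>C\<^sub>S(h(P))\<close>, which is not larger.\<close>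

lemma fc_image_cen:
  assumes fc: "fully_centralized S F P" and h: "mor K h" and K: "P \<subseteq> K" "cen P \<subseteq> K"
  shows "h ` cen P = cen (h ` P)"
proof (rule card_image_eq_surj)
  have hP: "mor P h" by (rule mor_restrict[OF h _ K(1)]) (use fc in \<open>simp add: fully_centralized_def\<close>)
  show "h ` cen P \<subseteq> cen (h ` P)" using mor_cen[OF h K(1)] K(2) by blast
  show "inj_on h (cen P)" using mor_inj[OF h] K(2) inj_on_subset by blast
  show "finite (cen (h ` P))" using sub_finite cenS mor_image[OF hP] by blast
  show "card (cen (h ` P)) \<le> card (cen P)" using fc hP by (simp add: fully_centralized_iff)
qed

lemma Aut_order_conj:
  assumes f: "mor R f" shows "order (Aut_group F (f ` R)) = order (Aut_group F R)"
proof -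
  have le: "card (F R R) \<le> card (F (f ` R) (f ` R))" if f: "mor R f" for R f
  proof (rule card_inj_on_le[OF conj_aut_hom(2)[OF f]])
    interpret c: group_hom "Aut_group F R" "Aut_group F (f ` R)" "\<lambda>u. restrict (\<lambda>y. f (u (inv_into R f y))) (f ` R)"
      by (rule conj_aut_hom(1)[OF f])
    show "(\<lambda>u. restrict (\<lambda>y. f (u (inv_into R f y))) (f ` R)) ` F R R \<subseteq> F (f ` R) (f ` R)"
      using c.hom_closed by auto
    show "finite (F (f ` R) (f ` R))" using Aut_finite mor_image f by blast
  qed
  show ?thesis using le[OF f] le[OF mor_inv_into[OF f]] inv_into_image[OF f] by (simp add: order_def)
qed

text \<open>Let \<open>h\<close> be a frame from a subgroup to a good member of its class. If \<open>P\<close> is fully normalized, then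
\<open>h\<close> maps \<open>N\<^sub>S(P)\<close> onto \<open>N\<^sub>S(h(P))\<close> by counting, so both parts of the first axiom are inherited from
\<open>h(P)\<close>. For the second axiom, let \<open>Q = \<phi>(P)\<close> be fully centralized and \<open>h\<close> a frame of \<open>Q\<close>. Then \<open>h \<phi>\<close> extends
by receptivity, and the extension maps \<open>N\<^sub>\<phi>\<close> into \<open>h(N\<^sub>S(Q))\<close>, so that it can be composed with \<open>h\<^sup>-\<^sup>1\<close>.\<close>

theorem saturation_criterion:
  assumes good: "\<And>Q. subgroup Q S \<Longrightarrow> \<exists>f. mor Q f \<and> automized (f ` Q) \<and> receptive (f ` Q)"
  shows "saturated_fusion_system p S F"
proof (intro saturated_fusion_system.intro saturated_fusion_system_axioms.intro)
  show "fusion_system p S F" by (rule fusion_system_axioms)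
  have frame: "\<exists>h. mor (nrm Q) h \<and> automized (h ` Q) \<and> receptive (h ` Q)" if "subgroup Q S" for Q
    using good[OF that] frame_to_good by metis
  show "fully_centralized S F P \<and> sylow_subgroup p (Aut_group F P) (group_fusion S P P)"
    if fn: "fully_normalized S F P" for P
  proof -
    have P: "subgroup P S" using fn by (simp add: fully_normalized_def)
    obtain h where h: "mor (nrm P) h" "automized (h ` P)" "receptive (h ` P)" using frame[OF P] by blast
    have PN: "P \<subseteq> nrm P" "cen P \<subseteq> nrm P" using subgroup_subset_nrm[OF P] cen_subset_nrm by auto
    have hP: "mor P h" using mor_restrict[OF h(1) P PN(1)] .
    have hP': "subgroup (h ` P) S" using mor_image[OF hP] .
    have i: "mor (h ` P) (inv_into P h)" "inv_into P h ` h ` P = P" using mor_inv_into[OF hP] inv_into_image[OF hP] by auto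
    have fin: "finite (nrm (h ` P))" "finite (cen (h ` P))" "finite (cen P)"
      using sub_finite nrmS cenS hP' P by auto
    have "card (nrm (h ` P)) \<le> card (nrm P)" using fn hP by (simp add: fully_normalized_iff)
    then have hN: "h ` nrm P = nrm (h ` P)"
      using card_image_eq_surj[OF _ mor_inj[OF h(1)] fin(1)] mor_nrm[OF h(1) PN(1)] by blast
    have "cen (h ` P) \<subseteq> h ` cen P"
    proof
      fix y assume y: "y \<in> cen (h ` P)"
      then obtain g where g: "g \<in> nrm P" "y = h g" using hN cen_subset_nrm by blast
      have "cj g x = x" if x: "x \<in> P" for x
      proof -
        have "h (cj g x) = h x" using mor_cj[OF h(1) g(1), of x] x PN cen_cj[OF y] g by auto
        moreover have "cj g x \<in> P" using nrm_cj[OF g(1) x] .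
        ultimately show ?thesis using mor_inj[OF hP] x by (meson inj_onD)
      qed
      then show "y \<in> h ` cen P" using g nrm_carrier by (auto simp: cen_def)
    qed
    then have "card (cen (h ` P)) \<le> card (cen P)"
      using card_mono[OF finite_imageI[OF fin(3)]] card_image_le[OF fin(3)] order_trans by blast
    moreover have "card (cen (f ` P)) \<le> card (cen (h ` P))" if f: "mor P f" for f
    proof -
      have "mor (h ` P) (\<lambda>x. f (inv_into P h x))" using mor_comp[OF i(1) f] i(2) by simp
      moreover have "(\<lambda>x. f (inv_into P h x)) ` h ` P = f ` inv_into P h ` h ` P" by (simp only: image_image)
      ultimately show ?thesis using good_imp_full(2)[OF hP' h(2,3)] i(2) by (metis fully_centralized_iff)
    qed
    ultimately have fc: "fully_centralized S F P" using P by (fastforce simp: fully_centralized_iff)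
    define c where "c = (\<lambda>u. restrict (\<lambda>y. h (u (inv_into P h y))) (h ` P))"
    have c: "c u (h x) = h (u x)" if "u \<in> F P P" "x \<in> P" for u x
      using conj_aut_hom(3)[OF hP that] by (simp add: c_def)
    have sub: "conj_auts P (nrm P) \<subseteq> F P P" using conj_auts_in_F[OF P] by simp
    have "conj_auts (h ` P) (nrm (h ` P)) \<subseteq> c ` conj_auts P (nrm P)"
    proof
      fix t assume "t \<in> conj_auts (h ` P) (nrm (h ` P))"
      then obtain y where y: "y \<in> h ` nrm P" "t = restrict (cj y) (h ` P)" unfolding conj_auts_def hN by auto
      then obtain g where g: "g \<in> nrm P" "t = restrict (cj (h g)) (h ` P)" by auto
      have gF: "restrict (cj g) P \<in> F P P" using g sub by (auto simp: conj_auts_def)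
      have "t = c (restrict (cj g) P)"
      proof
        fix y show "t y = c (restrict (cj g) P) y"
        proof (cases "y \<in> h ` P")
          case True
          then obtain x where x: "x \<in> P" "y = h x" by auto
          then show ?thesis using c[OF gF x(1)] g mor_cj[OF h(1) g(1), of x] PN by auto
        qed (simp add: g c_def)
      qed
      then show "t \<in> c ` conj_auts P (nrm P)" using g by (auto simp: conj_auts_def)
    qed
    then have "card (conj_auts (h ` P) (nrm (h ` P))) \<le> card (conj_auts P (nrm P))"
      using Aut_finite[OF P] sub by (meson card_image_le card_mono finite_imageI finite_subset order_trans)
    moreover have "card (conj_auts (h ` P) (nrm (h ` P))) = p ^ multiplicity p (order (Aut_group F P))"
      using h(2) Aut_order_conj[OF hP] by (simp add: automized_def sylow_subgroup_def)
    moreover obtain k where k: "card (conj_auts P (nrm P)) = p ^ k" using conj_auts_p_subgroup(2)[OF P nrmS[OF P]] by auto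
    moreover have sg: "subgroup (conj_auts P (nrm P)) (Aut_group F P)" using conj_auts_p_subgroup(1)[OF P nrmS[OF P]] by auto
    ultimately have "sylow_subgroup p (Aut_group F P) (conj_auts P (nrm P))"
      using p_subgroup_card_le_sylow[OF prime_p Aut_group[OF P] _ sg k] Aut_finite[OF P]
      by (simp add: sylow_subgroup_def)
    then show ?thesis using fc Aut_S_eq[OF P] by simp
  qed
  show "\<exists>\<phi>'\<in>F (N_phi S P \<phi>) (carrier S). restrict \<phi>' P = \<phi>"
    if \<phi>: "\<phi> \<in> F P (carrier S)" and fc: "fully_centralized S F (\<phi> ` P)" for P \<phi>
  proof -
    have f: "mor P \<phi>" "\<phi> \<in> extensional P" using \<phi> F_eq_mor[OF subgroup_self] by auto
    have P: "subgroup P S" and Q: "subgroup (\<phi> ` P) S" using f mor_subgroup mor_image by auto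
    let ?Q = "\<phi> ` P"
    obtain h where h: "mor (nrm ?Q) h" "automized (h ` ?Q)" "receptive (h ` ?Q)" using frame[OF Q] by blast
    have QN: "?Q \<subseteq> nrm ?Q" "cen ?Q \<subseteq> nrm ?Q" using subgroup_subset_nrm[OF Q] cen_subset_nrm by auto
    have hQ: "mor ?Q h" using mor_restrict[OF h(1) Q QN(1)] .
    define P1 where "P1 = h ` ?Q"
    have P1: "subgroup P1 S" using mor_image[OF hQ] by (simp add: P1_def)
    have hC: "h ` cen ?Q = cen P1" unfolding P1_def by (rule fc_image_cen[OF fc h(1) QN])
    define f where "f = (\<lambda>x. h (\<phi> x))"
    have mf: "mor P f" unfolding f_def by (rule mor_comp[OF \<open>mor P \<phi>\<close> hQ]) simp
    have fP: "f ` P = P1" by (auto simp: f_def P1_def)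
    obtain e where e: "mor (Nx P f) e" "\<forall>x\<in>P. e x = f x"
      using h(3) mf fP unfolding receptive_def P1_def by blast
    have PNf: "P \<subseteq> Nx P f" by (rule Nx_superset[OF mf])
    \<comment> \<open>If \<open>\<phi>\<close> carries the action of \<open>g\<close> to that of \<open>k\<close>, then \<open>e(g)\<close> and \<open>h(k)\<close> act alike on \<open>h(Q)\<close>, so they differ by an element of \<open>h(C\<^sub>S(Q))\<close>.\<close>
    have sub: "g \<in> Nx P f \<and> e g \<in> h ` nrm ?Q" if g: "g \<in> Nx P \<phi>" for g
    proof -
      obtain k where k: "g \<in> nrm P" "k \<in> nrm ?Q" "\<forall>x\<in>P. \<phi> (cj g x) = cj k (\<phi> x)" using g by (auto simp: Nx_def)
      have hk: "h k \<in> nrm P1" unfolding P1_def by (rule mor_nrm[OF h(1) QN(1) k(2,2)])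
      have fk: "\<forall>x\<in>P. f (cj g x) = cj (h k) (f x)"
        using k mor_cj[OF h(1) k(2)] QN by (auto simp: f_def)
      have gN: "g \<in> Nx P f" using k hk fk fP by (auto simp: Nx_def)
      have eg: "e g \<in> carrier S" "h k \<in> carrier S" using mor_carrier[OF e(1) gN] nrm_carrier[OF hk] by auto
      have "cj (inv (h k) \<otimes> e g) y = y" if y: "y \<in> P1" for y
      proof -
        obtain x where x: "x \<in> P" "y = f x" using y fP by auto
        have yc: "y \<in> carrier S" using y sub_carrier[OF P1] by auto
        have "cj (e g) y = f (cj g x)"
          using mor_cj[OF e(1) gN, of x] e(2) x PNf nrm_cj[OF k(1) x(1)] by auto
        then have "cj (e g) y = cj (h k) y" using fk x by simp
        then show ?thesis using eg yc by (simp add: cj_cj)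
      qed
      then have "inv (h k) \<otimes> e g \<in> cen P1" using eg by (auto simp: cen_def)
      then obtain c where c: "c \<in> cen ?Q" "inv (h k) \<otimes> e g = h c" using hC by (metis imageE)
      have cc: "h c \<in> carrier S" using mor_carrier[OF h(1)] c QN by auto
      have "e g = h k \<otimes> h c" using c(2)[symmetric] eg by (simp add: m_assoc[symmetric])
      also have "\<dots> = h (k \<otimes> c)" using mor_mult[OF h(1) k(2)] c QN by auto
      finally have "e g \<in> h ` nrm ?Q" using subgroup.m_closed[OF nrmS[OF Q] k(2)] c QN by blast
      then show ?thesis using gN by simp
    qed
    have e': "mor (Nx P \<phi>) e" by (rule mor_restrict[OF e(1) Nx_subgroup[OF \<open>mor P \<phi>\<close>]]) (use sub in blast)
    have m: "mor (Nx P \<phi>) (\<lambda>x. inv_into (nrm ?Q) h (e x))"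
      by (rule mor_comp[OF e' mor_inv_into[OF h(1)]]) (use sub in blast)
    have "restrict (restrict (\<lambda>x. inv_into (nrm ?Q) h (e x)) (Nx P \<phi>)) P = \<phi>"
    proof
      fix x show "restrict (restrict (\<lambda>x. inv_into (nrm ?Q) h (e x)) (Nx P \<phi>)) P x = \<phi> x"
      proof (cases "x \<in> P")
        case True
        then have "x \<in> Nx P \<phi>" using Nx_superset[OF \<open>mor P \<phi>\<close>] by auto
        then show ?thesis using True e(2) QN mor_inj[OF h(1)] by (auto simp: f_def)
      next
        case False
        then show ?thesis using extensional_arb[OF \<open>\<phi> \<in> extensional P\<close> False] by simp
      qed
    qed
    then show ?thesis using m unfolding N_phi_eq[OF \<open>mor P \<phi>\<close>] mor_def by blast
  qed
qed

end

section \<open>Quasicentric subgroups\<close>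

context prime_fusion_system begin

text \<open>This says that \<open>C\<^sub>F(P)\<close> is the fusion system of the group \<open>C\<^sub>S(P)\<close>, in terms of the extensions to subgroups
\<open>R = Q P\<close> of its morphisms on \<open>Q \<le> C\<^sub>S(P)\<close>; see \<open>centralizer_fusion_iff\<close>.\<close>

definition cen_trivial :: "'a set \<Rightarrow> bool" where
  "cen_trivial P \<longleftrightarrow> (\<forall>R f. P \<subseteq> R \<longrightarrow> R \<subseteq> P <#> cen P \<longrightarrow> mor R f \<longrightarrow> (\<forall>x\<in>P. f x = x) \<longrightarrow>
     (\<exists>g\<in>cen P. \<forall>x\<in>R. f x = cj g x))"

lemma subgroup_PC: "subgroup P S \<Longrightarrow> subgroup (P <#> cen P) S"
  using subgroup_set_mult cenS cen_subset_nrm by blast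

lemma P_le_PC: "subgroup P S \<Longrightarrow> P \<subseteq> P <#> cen P"
  using set_mult_left cenS by blast

lemma C_le_PC: "subgroup P S \<Longrightarrow> cen P \<subseteq> P <#> cen P"
  using set_mult_right cenS by blast

lemma PC_le_nrm: "subgroup P S \<Longrightarrow> P <#> cen P \<subseteq> nrm P"
  by (rule set_mult_least[OF nrmS subgroup_subset_nrm cen_subset_nrm])

lemma PC_decompose:
  assumes "subgroup P S" "subgroup R S" "P \<subseteq> R" "R \<subseteq> P <#> cen P" "x \<in> R"
  obtains u c where "u \<in> P" "c \<in> cen P" "c \<in> R" "x = u \<otimes> c"
proof -
  obtain u c where uc: "u \<in> P" "c \<in> cen P" "x = u \<otimes> c" using assms by (auto simp: set_mult_def)
  have "u \<in> carrier S" "c \<in> carrier S" using uc sub_carrier[OF assms(1)] cen_carrier by auto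
  then have "c = inv u \<otimes> x" using uc by (simp add: m_assoc[symmetric])
  moreover have "inv u \<otimes> x \<in> R"
    using subgroup.m_closed[OF assms(2) subgroup.m_inv_closed[OF assms(2)] assms(5)] uc(1) assms(3) by blast
  ultimately have "c \<in> R" by simp
  then show ?thesis using that uc by blast
qed

lemma mor_PC:
  assumes h: "mor R h" and P: "subgroup P S" "P \<subseteq> R" and R: "R \<subseteq> P <#> cen P"
  shows "h ` R \<subseteq> h ` P <#> cen (h ` P)"
proof
  fix y assume "y \<in> h ` R"
  then obtain x where x: "x \<in> R" "y = h x" by auto
  obtain u c where uc: "u \<in> P" "c \<in> cen P" "c \<in> R" "x = u \<otimes> c"
    using PC_decompose[OF P(1) mor_subgroup[OF h] P(2) R x(1)] by blast
  have "h c \<in> cen (h ` P)" by (rule mor_cen[OF h P(2) uc(3,2)])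
  moreover have "y = h u \<otimes> h c" using x uc P mor_mult[OF h] by auto
  ultimately show "y \<in> h ` P <#> cen (h ` P)" using uc by (auto simp: set_mult_def)
qed

text \<open>A subgroup \<open>R\<close> between \<open>P\<close> and \<open>P C\<^sub>S(P)\<close> is \<open>(R \<inter> C\<^sub>S(P)) P\<close>, and a morphism on \<open>R\<close> that fixes \<open>P\<close>
pointwise is determined by its restriction to \<open>R \<inter> C\<^sub>S(P)\<close>.\<close>

lemma centralizer_fusion_iff:
  assumes P: "subgroup P S"
  shows "centralizer_fusion S F P = group_fusion (S\<lparr>carrier := centralizer S P\<rparr>) \<longleftrightarrow> cen_trivial P"
proof -
  let ?C = "cen P" and ?SC = "S\<lparr>carrier := cen P\<rparr>"
  have cenP: "centralizer S P = ?C" using centralizer_eq_cen subgroup.subset[OF P] by blast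
  have C: "subgroup ?C S" by (rule cenS[OF P])
  have sub: "subgroup Q ?SC \<longleftrightarrow> subgroup Q S \<and> Q \<subseteq> ?C" for Q
    using incl_subgroup[OF C] subgroup_incl[OF _ C] subgroup.subset[of Q ?SC] by auto
  have QP: "subgroup (Q <#> P) S" "Q \<subseteq> Q <#> P" "P \<subseteq> Q <#> P" "Q <#> P \<subseteq> P <#> ?C" if Q: "subgroup Q S" "Q \<subseteq> ?C" for Q
  proof -
    have PnQ: "P \<subseteq> nrm Q"
    proof
      fix x assume x: "x \<in> P"
      have "cj x c = c" if "c \<in> Q" for c
        using that Q cen_cj[of c P x] x cj_sym[of c x] cen_carrier sub_carrier[OF P] by auto
      then show "x \<in> nrm Q" using x sub_carrier[OF P] by (simp add: nrm_def)
    qed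
    show "subgroup (Q <#> P) S" by (rule subgroup_set_mult[OF Q(1) P PnQ])
    show "Q \<subseteq> Q <#> P" "P \<subseteq> Q <#> P" using set_mult_left[OF Q(1) P] set_mult_right[OF Q(1) P] by auto
    show "Q <#> P \<subseteq> P <#> ?C"
      by (rule set_mult_least[OF subgroup_PC[OF P]]) (use Q C_le_PC[OF P] P_le_PC[OF P] in auto)
  qed
  have conj: "conj_map ?SC g Q = restrict (cj g) Q" if "g \<in> ?C" for g Q
    unfolding conj_map_def cj_def using m_inv_consistent[OF C that] by simp
  have gf: "\<phi> \<in> group_fusion ?SC Q Q' \<longleftrightarrow> (\<exists>g\<in>?C. \<phi> = restrict (cj g) Q \<and> subgroup Q S \<and> Q \<subseteq> ?C \<and> subgroup Q' S \<and> Q' \<subseteq> ?C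
      \<and> cj g ` Q \<subseteq> Q')" for \<phi> Q Q'
  proof -
    have "\<phi> \<in> group_fusion ?SC Q Q' \<longleftrightarrow> (\<exists>g\<in>?C. \<phi> = conj_map ?SC g Q \<and> subgroup Q S \<and> Q \<subseteq> ?C \<and> subgroup Q' S \<and> Q' \<subseteq> ?C
      \<and> conj_map ?SC g Q ` Q \<subseteq> Q')"
      unfolding group_fusion_def transporter_def by (auto simp: sub)
    also have "\<dots> \<longleftrightarrow> (\<exists>g\<in>?C. \<phi> = restrict (cj g) Q \<and> subgroup Q S \<and> Q \<subseteq> ?C \<and> subgroup Q' S \<and> Q' \<subseteq> ?C
      \<and> cj g ` Q \<subseteq> Q')"
      by (rule bex_cong[OF refl]) (simp add: conj)
    finally show ?thesis .
  qed
  have ge: "\<phi> \<in> centralizer_fusion S F P Q Q'" if \<phi>: "\<phi> \<in> group_fusion ?SC Q Q'" for \<phi> Q Q'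
  proof -
    obtain g where g: "g \<in> ?C" "\<phi> = restrict (cj g) Q" "subgroup Q S" "Q \<subseteq> ?C" "subgroup Q' S" "Q' \<subseteq> ?C" "cj g ` Q \<subseteq> Q'"
      using \<phi>[unfolded gf] by (elim bexE conjE) (rule that; assumption)
    have gc: "g \<in> carrier S" using g cen_carrier by auto
    note Q = QP[OF g(3,4)] and Q' = QP[OF g(5,6)]
    let ?\<alpha> = "restrict (cj g) (Q <#> P)"
    have "mor (Q <#> P) ?\<alpha>" using mor_cong[OF mor_cj_elem[OF Q(1) gc]] by simp
    moreover have "cj g ` (Q <#> P) \<subseteq> Q' <#> P"
    proof
      fix y assume "y \<in> cj g ` (Q <#> P)"
      then obtain q x where "q \<in> Q" "x \<in> P" "y = cj g (q \<otimes> x)" by (auto simp: set_mult_def)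
      moreover from this have "cj g q \<in> Q'" "cj g x = x" "q \<in> carrier S" "x \<in> carrier S"
        using g cen_cj sub_carrier[OF P] sub_carrier[OF g(3)] by auto
      ultimately show "y \<in> Q' <#> P" using gc by (auto simp: cj_mult set_mult_def)
    qed
    ultimately have "?\<alpha> \<in> F (Q <#> P) (Q' <#> P)" using F_eq_mor[OF Q'(1)] by auto
    moreover have "restrict ?\<alpha> P = (\<lambda>x\<in>P. x)" using Q(3) cen_cj[OF g(1)] by (auto simp: fun_eq_iff)
    moreover have "\<phi> = restrict ?\<alpha> Q" using g Q by (auto simp: fun_eq_iff)
    moreover have "?\<alpha> ` Q \<subseteq> Q'" using g Q by auto
    ultimately show ?thesis unfolding centralizer_fusion_def cenP using sub g by blast
  qed
  show ?thesis
  proof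
    assume eq: "centralizer_fusion S F P = group_fusion (S\<lparr>carrier := centralizer S P\<rparr>)"
    show "cen_trivial P"
      unfolding cen_trivial_def
    proof (intro allI impI)
      fix R f assume R: "P \<subseteq> R" "R \<subseteq> P <#> ?C" and f: "mor R f" and fP: "\<forall>x\<in>P. f x = x"
      have sR: "subgroup R S" using f mor_subgroup by auto
      define Q where "Q = R \<inter> ?C"
      have Q: "subgroup Q S" "Q \<subseteq> ?C" using subgroups_Inter_pair[OF sR C] by (auto simp: Q_def)
      have fPP: "f ` P = P" using fP by force
      have fQ: "mor Q f" using mor_restrict[OF f Q(1)] by (auto simp: Q_def)
      have Q': "subgroup (f ` Q) S" "f ` Q \<subseteq> ?C" using mor_image[OF fQ] mor_cen[OF f R(1)] fPP by (auto simp: Q_def)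
      note q = QP[OF Q] and q' = QP[OF Q']
      have QR: "Q <#> P \<subseteq> R" by (rule set_mult_least[OF sR]) (use R in \<open>auto simp: Q_def\<close>)
      let ?\<alpha> = "restrict f (Q <#> P)"
      have "mor (Q <#> P) ?\<alpha>" using mor_cong[OF mor_restrict[OF f q(1) QR]] by simp
      moreover have "f ` (Q <#> P) \<subseteq> f ` Q <#> P"
      proof
        fix y assume "y \<in> f ` (Q <#> P)"
        then obtain a x where ax: "a \<in> Q" "x \<in> P" "y = f (a \<otimes> x)" by (auto simp: set_mult_def)
        then have "y = f a \<otimes> x" using mor_mult[OF f, of a x] R fP by (auto simp: Q_def)
        then show "y \<in> f ` Q <#> P" using ax by (auto simp: set_mult_def)
      qed
      ultimately have "?\<alpha> \<in> F (Q <#> P) (f ` Q <#> P)" using F_eq_mor[OF q'(1)] by auto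
      moreover have "restrict ?\<alpha> P = (\<lambda>x\<in>P. x)" using q(3) fP by (auto simp: fun_eq_iff)
      moreover have "?\<alpha> ` Q \<subseteq> f ` Q" using q by auto
      ultimately have "restrict ?\<alpha> Q \<in> centralizer_fusion S F P Q (f ` Q)"
        unfolding centralizer_fusion_def cenP using sub Q Q' by blast
      then have "restrict ?\<alpha> Q \<in> group_fusion ?SC Q (f ` Q)" using eq cenP by simp
      then obtain g where g: "g \<in> ?C" "restrict ?\<alpha> Q = restrict (cj g) Q" using gf by auto
      have fg: "f x = cj g x" if x: "x \<in> Q" for x
        using fun_cong[OF g(2), of x] x q(2) by (auto simp: restrict_def split: if_splits)
      have "f x = cj g x" if x: "x \<in> R" for x
      proof -
        obtain u c where uc: "u \<in> P" "c \<in> ?C" "c \<in> R" "x = u \<otimes> c"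
          using PC_decompose[OF P sR R x] by blast
        have "f x = u \<otimes> cj g c" using uc mor_mult[OF f, of u c] R fP fg[of c] by (auto simp: Q_def)
        moreover have "cj g x = u \<otimes> cj g c"
          using uc cen_cj[OF g(1)] cen_carrier[OF g(1)] cen_carrier[OF uc(2)] sub_carrier[OF P] by (simp add: cj_mult)
        ultimately show ?thesis by simp
      qed
      then show "\<exists>g\<in>?C. \<forall>x\<in>R. f x = cj g x" using g by blast
    qed
  next
    assume triv: "cen_trivial P"
    have le: "\<phi> \<in> group_fusion ?SC Q Q'" if \<phi>: "\<phi> \<in> centralizer_fusion S F P Q Q'" for \<phi> Q Q'
    proof -
      obtain \<alpha> where \<alpha>: "\<phi> = restrict \<alpha> Q" "subgroup Q S" "Q \<subseteq> ?C" "subgroup Q' S" "Q' \<subseteq> ?C"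
        "\<alpha> \<in> F (Q <#> P) (Q' <#> P)" "restrict \<alpha> P = (\<lambda>x\<in>P. x)" "\<alpha> ` Q \<subseteq> Q'"
        using \<phi> unfolding centralizer_fusion_def cenP sub by blast
      note q = QP[OF \<alpha>(2,3)] and q' = QP[OF \<alpha>(4,5)]
      have "mor (Q <#> P) \<alpha>" using \<alpha>(6) F_eq_mor[OF q'(1)] by blast
      moreover have "\<alpha> x = x" if "x \<in> P" for x using fun_cong[OF \<alpha>(7), of x] that by simp
      ultimately obtain g where g: "g \<in> ?C" "\<forall>x\<in>Q <#> P. \<alpha> x = cj g x"
        using triv q unfolding cen_trivial_def by blast
      then have ag: "\<alpha> x = cj g x" if "x \<in> Q" for x using that q(2) by blast
      have "\<phi> = restrict (cj g) Q" using \<alpha>(1) ag by (simp add: restrict_def fun_eq_iff)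
      moreover have "cj g ` Q \<subseteq> Q'" using \<alpha>(8) ag by auto
      ultimately have "\<phi> = restrict (cj g) Q" "cj g ` Q \<subseteq> Q'" by auto
      then show ?thesis unfolding gf using g \<alpha> by blast
    qed
    show "centralizer_fusion S F P = group_fusion (S\<lparr>carrier := centralizer S P\<rparr>)"
      unfolding cenP by (intro ext set_eqI) (use le ge in blast)
  qed
qed

lemma quasicentric_iff:
  "quasicentric S F P \<longleftrightarrow> subgroup P S \<and> (\<forall>f. mor P f \<longrightarrow> fully_centralized S F (f ` P) \<longrightarrow> cen_trivial (f ` P))"
  unfolding quasicentric_def F_conjugate_iff using centralizer_fusion_iff mor_image by metis

lemma quasicentric_conj:
  assumes q: "quasicentric S F P" and f: "mor P f" shows "quasicentric S F (f ` P)"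
proof -
  have "cen_trivial (g ` f ` P)" if g: "mor (f ` P) g" "fully_centralized S F (g ` f ` P)" for g
  proof -
    have "mor P (\<lambda>x. g (f x))" by (rule mor_comp[OF f g(1)]) simp
    moreover have "(\<lambda>x. g (f x)) ` P = g ` f ` P" by (simp only: image_image)
    ultimately show ?thesis using q g(2) by (metis quasicentric_iff)
  qed
  then show ?thesis using mor_image[OF f] by (simp add: quasicentric_iff)
qed

text \<open>Conjugating by \<open>h\<close> turns a morphism that fixes \<open>P\<close> into one that fixes \<open>h(P)\<close>. The latter is conjugation by an
element of \<open>C\<^sub>S(h(P)) = h(C\<^sub>S(P))\<close>.\<close>

lemma cen_trivial_transport:
  assumes P: "subgroup P S" and h: "mor (P <#> cen P) h" and hC: "h ` cen P = cen (h ` P)" and t: "cen_trivial (h ` P)"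
  shows "cen_trivial P"
  unfolding cen_trivial_def
proof (intro allI impI)
  let ?N = "P <#> cen P"
  fix R f assume R: "P \<subseteq> R" "R \<subseteq> ?N" and f: "mor R f" and fP: "\<forall>x\<in>P. f x = x"
  have sR: "subgroup R S" using f mor_subgroup by auto
  have hR: "mor R h" by (rule mor_restrict[OF h sR R(2)])
  have fPP: "f ` P = P" using fP by force
  have fR: "f ` R \<subseteq> ?N" using mor_PC[OF f P R] fPP by simp
  let ?i = "inv_into R h"
  have 1: "mor (h ` R) (\<lambda>y. f (?i y))" using mor_comp[OF mor_inv_into[OF hR] f] inv_into_image[OF hR] by simp
  have 2: "mor (h ` R) (\<lambda>y. h (f (?i y)))"
    by (rule mor_comp[OF 1 h]) (use fR inv_into_into[of _ h R] in blast)
  have ii: "?i (h x) = x" if "x \<in> R" for x using mor_inj[OF hR] that by simp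
  have "h (f (?i y)) = y" if "y \<in> h ` P" for y using that ii fP R(1) by force
  then have "\<exists>g\<in>cen (h ` P). \<forall>y\<in>h ` R. h (f (?i y)) = cj g y"
    using t[unfolded cen_trivial_def, rule_format, OF image_mono[OF R(1)] mor_PC[OF hR P R] 2] by simp
  then obtain g' where g': "g' \<in> h ` cen P" "\<forall>y\<in>h ` R. h (f (?i y)) = cj g' y" unfolding hC by blast
  then obtain g where g: "g \<in> cen P" "\<forall>y\<in>h ` R. h (f (?i y)) = cj (h g) y" by blast
  have gN: "g \<in> ?N" using g C_le_PC[OF P] by auto
  have "f x = cj g x" if x: "x \<in> R" for x
  proof -
    have "h (f x) = cj (h g) (h x)" using g(2) x ii by auto
    also have "\<dots> = h (cj g x)" using mor_cj[OF h gN, of x] x R by auto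
    finally have "h (f x) = h (cj g x)" .
    moreover have "f x \<in> ?N" "cj g x \<in> ?N" using fR x R subgroup_cj[OF subgroup_PC[OF P] gN] by auto
    ultimately show ?thesis using mor_inj[OF h] by (meson inj_onD)
  qed
  then show "\<exists>g\<in>cen P. \<forall>x\<in>R. f x = cj g x" using g by blast
qed

end

section \<open>Saturated fusion systems\<close>

locale prime_saturated = prime_fusion_system p S F + saturated_fusion_system p S F
  for p :: nat and S :: "('a, 'm) monoid_scheme" (structure) and F :: "'a homs"

context prime_saturated begin

lemma fn_sub: "fully_normalized S F P \<Longrightarrow> subgroup P S" by (simp add: fully_normalized_def)
lemma fc_sub: "fully_centralized S F P \<Longrightarrow> subgroup P S" by (simp add: fully_centralized_def)

lemma fn_automized: "fully_normalized S F P \<Longrightarrow> automized P"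
  using saturated_I Aut_S_eq fn_sub by (simp add: automized_def)

lemma fn_fc: "fully_normalized S F P \<Longrightarrow> fully_centralized S F P"
  using saturated_I by blast

lemma fc_extend:
  assumes f: "mor Q f" and fc: "fully_centralized S F (f ` Q)"
  obtains h where "mor (Nx Q f) h" "\<And>x. x \<in> Q \<Longrightarrow> h x = f x"
proof -
  let ?\<phi> = "restrict f Q"
  have "?\<phi> \<in> F Q (carrier S)" "?\<phi> ` Q = f ` Q" "mor Q ?\<phi>" using f mor_cong[OF f, of ?\<phi>] by (auto simp: mor_def)
  then obtain h where h: "h \<in> F (N_phi S Q ?\<phi>) (carrier S)" "restrict h Q = ?\<phi>" using saturated_II fc by metis
  have "N_phi S Q ?\<phi> = Nx Q f" using N_phi_eq[OF \<open>mor Q ?\<phi>\<close>] Nx_cong[of Q ?\<phi> f] by simp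
  then have "mor (Nx Q f) h" using h F_eq_mor[OF subgroup_self] by auto
  moreover have "h x = f x" if "x \<in> Q" for x using fun_cong[OF h(2), of x] that by simp
  ultimately show ?thesis using that by blast
qed

lemma fc_receptive: "fully_centralized S F P \<Longrightarrow> receptive P"
  unfolding receptive_def using fc_extend by metis

lemma fc_extend_PC:
  assumes f: "mor Q f" and fc: "fully_centralized S F (f ` Q)"
  obtains h where "mor (Q <#> cen Q) h" "\<And>x. x \<in> Q \<Longrightarrow> h x = f x"
proof -
  have Q: "subgroup Q S" using f mor_subgroup by auto
  obtain h where h: "mor (Nx Q f) h" "\<And>x. x \<in> Q \<Longrightarrow> h x = f x" using fc_extend[OF f fc] by blast
  have "Q <#> cen Q \<subseteq> Nx Q f"
    by (rule set_mult_least[OF Nx_subgroup[OF f] Nx_superset[OF f] cen_Nx[OF f]])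
  then show ?thesis using that h mor_restrict[OF h(1) subgroup_PC[OF Q]] by blast
qed

lemma fn_exists:
  assumes Q: "subgroup Q S"
  obtains f where "mor Q f" "fully_normalized S F (f ` Q)"
proof -
  define \<C> where "\<C> = {f ` Q | f. mor Q f}"
  have "\<C> \<subseteq> Pow (carrier S)" using mor_carrier by (auto simp: \<C>_def)
  then have fin: "finite \<C>" using finite_S finite_subset by blast
  have "mor Q id" by (rule mor_id[OF Q]) simp
  then have "Q \<in> \<C>" unfolding \<C>_def by (metis (mono_tags, lifting) image_id id_apply mem_Collect_eq)
  then obtain P where P: "P \<in> \<C>" "\<And>R. R \<in> \<C> \<Longrightarrow> card (nrm R) \<le> card (nrm P)"
    using Max_in[of "(\<lambda>R. card (nrm R)) ` \<C>"] Max_ge[of "(\<lambda>R. card (nrm R)) ` \<C>"] fin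
    by (smt (verit, best) empty_iff finite_imageI image_iff imageI)
  obtain f where f: "mor Q f" "P = f ` Q" using P by (auto simp: \<C>_def)
  have "card (nrm (g ` P)) \<le> card (nrm P)" if g: "mor P g" for g
  proof -
    have "mor Q (\<lambda>x. g (f x))" by (rule mor_comp[OF f(1) g]) (simp add: f)
    moreover have "(\<lambda>x. g (f x)) ` Q = g ` P" by (auto simp: f)
    ultimately show ?thesis using P(2) by (metis (mono_tags, lifting) \<C>_def mem_Collect_eq)
  qed
  then have "fully_normalized S F P" using mor_image[OF f(1)] f by (simp add: fully_normalized_iff)
  then show ?thesis using that f by blast
qed

text \<open>Every \<open>p\<close>-group of automorphisms of \<open>Q\<close> is realized by conjugations in \<open>S\<close> on a suitable fully normalized
conjugate of \<open>Q\<close>.\<close>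

lemma fn_p_subgroup:
  assumes Q: "subgroup Q S" and U: "subgroup U (Aut_group F Q)" "card U = p ^ k"
  obtains f where "mor Q f" "fully_normalized S F (f ` Q)"
    "\<And>u. u \<in> U \<Longrightarrow> \<exists>g\<in>nrm (f ` Q). \<forall>x\<in>Q. f (u x) = cj g (f x)"
proof -
  obtain f where f: "mor Q f" "fully_normalized S F (f ` Q)" using fn_exists[OF Q] by blast
  show ?thesis using automized_absorbs[OF f(1) fn_automized[OF f(2)] U] f(2) that by metis
qed

lemma fn_frame:
  assumes "fully_normalized S F P" "mor Q f" "f ` Q = P"
  obtains h where "mor (nrm Q) h" "h ` Q = P"
  using frame_to_good[OF assms(2)] assms fn_automized fc_receptive fn_fc by metis

text \<open>Any morphism \<open>f : P \<rightarrow> f(P)\<close> becomes, between frames \<open>h\<close> of \<open>P\<close> and \<open>k\<close> of \<open>f(P)\<close>, an automorphism \<open>a\<close> of a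
fully normalized subgroup: \<open>f = k\<^sup>-\<^sup>1 a h\<close>. In inductions the frames are covered by the hypothesis
because they live on normalizers.\<close>

lemma fn_frames:
  assumes f: "mor P f"
  obtains h k a where "mor (nrm P) h" "mor (nrm (f ` P)) k" "fully_normalized S F (h ` P)" "k ` f ` P = h ` P"
    "a \<in> F (h ` P) (h ` P)" "a = restrict (\<lambda>z. k (f (inv_into P h z))) (h ` P)" "\<forall>z\<in>P. a (h z) = k (f z)"
proof -
  let ?Q = "f ` P"
  have P: "subgroup P S" and Q: "subgroup ?Q S" using f mor_subgroup mor_image by auto
  obtain h where h: "mor (nrm P) h" "fully_normalized S F (h ` P)" using fn_exists[OF P] fn_frame by metis
  have hP: "mor P h" by (rule mor_restrict[OF h(1) P subgroup_subset_nrm[OF P]])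
  have i: "mor ?Q (inv_into P f)" "inv_into P f ` ?Q = P" using mor_inv_into[OF f] inv_into_image[OF f] by auto
  have m: "mor ?Q (\<lambda>z. h (inv_into P f z))" by (rule mor_comp[OF i(1) hP]) (use i in simp)
  have "(\<lambda>z. h (inv_into P f z)) ` ?Q = h ` inv_into P f ` ?Q" by (simp only: image_image)
  then have "(\<lambda>z. h (inv_into P f z)) ` ?Q = h ` P" unfolding i(2) .
  then obtain k where k: "mor (nrm ?Q) k" "k ` ?Q = h ` P" using fn_frame[OF h(2) m] by blast
  have kQ: "mor ?Q k" by (rule mor_restrict[OF k(1) Q subgroup_subset_nrm[OF Q]])
  let ?a = "\<lambda>z. k (f (inv_into P h z))"
  have ih: "mor (h ` P) (inv_into P h)" "inv_into P h ` h ` P = P" using mor_inv_into[OF hP] inv_into_image[OF hP] by auto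
  have "mor (h ` P) (\<lambda>z. f (inv_into P h z))" by (rule mor_comp[OF ih(1) f]) (use ih in simp)
  then have "mor (h ` P) ?a" by (rule mor_comp[OF _ kQ]) (use ih(2) in auto)
  moreover have "?a ` h ` P = k ` f ` inv_into P h ` h ` P" by (simp only: image_image)
  then have "?a ` h ` P = h ` P" unfolding ih(2) k(2) .
  ultimately have "restrict ?a (h ` P) \<in> F (h ` P) (h ` P)" by (rule aut_restrict)
  then show ?thesis using that[OF h(1) k(1) h(2) k(2) _ refl] mor_inj[OF hP] by simp
qed

lemma fn_frame_exists:
  assumes "subgroup Q S"
  obtains h where "mor (nrm Q) h" "fully_normalized S F (h ` Q)"
  using fn_exists[OF assms] fn_frame by metis

text \<open>Between two fully centralized conjugates the triviality of the centralizer system is transported by an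
extension of an isomorphism to \<open>P C\<^sub>S(P)\<close>.\<close>

lemma fc_cen_trivial_imp_quasicentric:
  assumes fc: "fully_centralized S F P" and t: "cen_trivial P"
  shows "quasicentric S F P"
proof -
  have P: "subgroup P S" using fc by (rule fc_sub)
  have "cen_trivial (f ` P)" if f: "mor P f" "fully_centralized S F (f ` P)" for f
  proof -
    let ?Q = "f ` P"
    have i: "mor ?Q (inv_into P f)" "inv_into P f ` ?Q = P" using mor_inv_into[OF f(1)] inv_into_image[OF f(1)] by auto
    obtain h where h: "mor (?Q <#> cen ?Q) h" "\<And>x. x \<in> ?Q \<Longrightarrow> h x = inv_into P f x"
      using fc_extend_PC[OF i(1)] i(2) fc by metis
    have hQ: "h ` ?Q = P" using h(2) i(2) by (metis image_cong)
    have "h ` cen ?Q = cen (h ` ?Q)"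
      by (rule fc_image_cen[OF f(2) h(1) P_le_PC C_le_PC]) (use mor_image[OF f(1)] in auto)
    then show ?thesis using cen_trivial_transport[OF mor_image[OF f(1)] h(1)] hQ t by simp
  qed
  then show ?thesis using P by (simp add: quasicentric_iff)
qed

text \<open>Since \<open>P C\<^sub>S(P) = P\<close>, the identity is the only morphism to consider.\<close>

lemma fc_centric_imp_quasicentric:
  assumes fc: "fully_centralized S F P" and c: "cen P \<subseteq> P"
  shows "quasicentric S F P"
proof (rule fc_cen_trivial_imp_quasicentric[OF fc])
  have P: "subgroup P S" using fc by (rule fc_sub)
  have "P <#> cen P \<subseteq> P" using set_mult_least[OF P _ c] by simp
  moreover have "\<one> \<in> cen P" using subgroup.one_closed[OF cenS[OF P]] .
  ultimately show "cen_trivial P"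
    unfolding cen_trivial_def using sub_carrier[OF P] by (metis cj_one subset_antisym subsetD)
qed

lemma quasicentric_S: "quasicentric S F (carrier S)"
proof (rule fc_centric_imp_quasicentric)
  have "f ` carrier S = carrier S" if "mor (carrier S) f" for f
    using mor_carrier[OF that] mor_card[OF that] finite_S by (simp add: card_subset_eq image_subset_iff)
  then show "fully_centralized S F (carrier S)" by (simp add: fully_centralized_iff subgroup_self)
qed (auto simp: cen_def)

lemma fc_quasicentric_cen_trivial:
  assumes "fully_centralized S F P" "quasicentric S F P" shows "cen_trivial P"
proof -
  have P: "subgroup P S" using fc_sub assms by auto
  have "mor P id" by (rule mor_id[OF P]) simp
  then show ?thesis using assms by (metis quasicentric_iff id_apply image_id)
qed

end

section \<open>Labelled morphisms\<close>

locale fusion_triple = prime_saturated p S F + T: fusion_mapping_triple S F \<Gamma> \<theta> \<Theta>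
  for p :: nat and S :: "('a, 'm) monoid_scheme" (structure) and F :: "'a homs"
    and \<Gamma> :: "('g, 'n) monoid_scheme" and \<theta> :: "'a \<Rightarrow> 'g"
    and \<Theta> :: "'a set \<Rightarrow> 'a set \<Rightarrow> ('a \<Rightarrow> 'a) \<Rightarrow> 'g set" +
  assumes \<Gamma>_order: "finite_p_group p \<Gamma> \<or> finite_p'_group p \<Gamma>"

context fusion_triple begin

lemma conj_map_eq: "conj_map S g P = restrict (cj g) P"
  unfolding conj_map_def cj_def ..

lemma quasi_sub: "quasicentric S F P \<Longrightarrow> subgroup P S" by (simp add: quasicentric_def)

text \<open>The labels given directly by the fusion mapping triple. The codomain is \<open>S\<close> because \<open>\<Theta>\<close> does not
depend on it (\<open>\<Theta>_codomain\<close>).\<close>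

definition TH :: "'a set \<Rightarrow> ('a \<Rightarrow> 'a) \<Rightarrow> 'g \<Rightarrow> bool" where
  "TH P f x \<longleftrightarrow> quasicentric S F P \<and> mor P f \<and> x \<in> \<Theta> P (carrier S) (restrict f P)"

lemma qcat_iff: "\<phi> \<in> quasicentric_category S F P Q \<longleftrightarrow> \<phi> \<in> F P Q \<and> quasicentric S F P \<and> quasicentric S F Q"
  by (simp add: quasicentric_category_def full_subcategory_def)

lemma mor_qcat: "quasicentric S F P \<Longrightarrow> mor P f \<Longrightarrow> restrict f P \<in> quasicentric_category S F P (carrier S)"
  by (simp add: qcat_iff quasicentric_S mor_def)

lemma TH_mor: "TH P f x \<Longrightarrow> mor P f" and TH_quasi: "TH P f x \<Longrightarrow> quasicentric S F P"
  by (auto simp: TH_def)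

lemma TH_carrier: "TH P f x \<Longrightarrow> x \<in> carrier \<Gamma>"
  using T.\<Theta>_nonempty_subset[OF mor_qcat] by (auto simp: TH_def)

lemma TH_ex: "quasicentric S F P \<Longrightarrow> mor P f \<Longrightarrow> \<exists>x. TH P f x"
  using T.\<Theta>_nonempty_subset[OF mor_qcat, of P f] unfolding TH_def by blast

lemma TH_cong: "TH P f x \<Longrightarrow> (\<And>z. z \<in> P \<Longrightarrow> f z = g z) \<Longrightarrow> TH P g x"
  unfolding TH_def using mor_cong by (metis restrict_ext)

lemma TH_cj: "quasicentric S F P \<Longrightarrow> g \<in> carrier S \<Longrightarrow> TH P (cj g) (\<theta> g)"
proof -
  assume q: "quasicentric S F P" and g: "g \<in> carrier S"
  have "cj g ` P \<subseteq> carrier S" using g sub_carrier[OF quasi_sub[OF q]] by auto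
  then show ?thesis
    using T.\<Theta>_conj[OF q quasicentric_S, of g] mor_cj_elem[OF quasi_sub[OF q] g] q g
    by (simp add: TH_def conj_map_eq transporter_def)
qed

lemma TH_one:
  assumes q: "quasicentric S F P" and f: "\<And>z. z \<in> P \<Longrightarrow> f z = z" shows "TH P f \<one>\<^bsub>\<Gamma>\<^esub>"
proof (rule TH_cong)
  show "TH P (cj \<one>) \<one>\<^bsub>\<Gamma>\<^esub>" using TH_cj[OF q one_closed] T.hom_one by simp
qed (use f sub_carrier[OF quasi_sub[OF q]] in simp)

text \<open>Compose with the inclusion of \<open>Q\<close> in \<open>S\<close>, which has \<open>1\<close> among its values.\<close>

lemma \<Theta>_codomain:
  assumes \<phi>: "\<phi> \<in> quasicentric_category S F P Q"
  shows "\<Theta> P (carrier S) \<phi> = \<Theta> P Q \<phi>"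
proof -
  have q: "\<phi> \<in> F P Q" "quasicentric S F P" "quasicentric S F Q" using \<phi> by (auto simp: qcat_iff)
  have "mor Q (\<lambda>x. x)" by (rule mor_id[OF quasi_sub[OF q(3)]]) simp
  then have i: "(\<lambda>x\<in>Q. x) \<in> quasicentric_category S F Q (carrier S)" using mor_qcat q by blast
  have "\<one>\<^bsub>\<Gamma>\<^esub> \<in> \<Theta> Q (carrier S) (\<lambda>x\<in>Q. x)" using TH_one[OF q(3), of "\<lambda>x. x"] by (simp add: TH_def)
  then have "\<Theta> P (carrier S) (compose P (\<lambda>x\<in>Q. x) \<phi>) = \<one>\<^bsub>\<Gamma>\<^esub> <#\<^bsub>\<Gamma>\<^esub> \<Theta> P Q \<phi>" by (rule T.\<Theta>_comp[OF \<phi> i])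
  moreover have "compose P (\<lambda>x\<in>Q. x) \<phi> = \<phi>"
  proof
    fix z show "compose P (\<lambda>x\<in>Q. x) \<phi> z = \<phi> z"
      using F_D(4)[OF q(1)] extensional_arb[OF F_D(1)[OF q(1)], of z] by (cases "z \<in> P") (auto simp: compose_def)
  qed
  moreover have "\<one>\<^bsub>\<Gamma>\<^esub> <#\<^bsub>\<Gamma>\<^esub> \<Theta> P Q \<phi> = \<Theta> P Q \<phi>"
    by (rule T.H.lcos_mult_one) (use T.\<Theta>_nonempty_subset[OF \<phi>] in blast)
  ultimately show ?thesis by simp
qed

lemma TH_comp:
  assumes f: "TH P f x" and g: "TH Q g y" and fP: "f ` P \<subseteq> Q" and h: "\<And>z. z \<in> P \<Longrightarrow> h z = g (f z)"
  shows "TH P h (y \<otimes>\<^bsub>\<Gamma>\<^esub> x)"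
proof -
  let ?f = "restrict f P" and ?g = "restrict g Q"
  have f': "?f \<in> quasicentric_category S F P Q"
    using f g fP mor_cong[of P f ?f] F_eq_mor[OF quasi_sub[of Q]] by (auto simp: TH_def qcat_iff)
  have g': "?g \<in> quasicentric_category S F Q (carrier S)" using g mor_qcat by (auto simp: TH_def)
  have "x \<in> \<Theta> P Q ?f" using \<Theta>_codomain[OF f'] f by (simp add: TH_def)
  moreover have "\<Theta> P (carrier S) (compose P ?g ?f) = y <#\<^bsub>\<Gamma>\<^esub> \<Theta> P Q ?f"
    by (rule T.\<Theta>_comp[OF f' g']) (use g in \<open>simp add: TH_def\<close>)
  moreover have "compose P ?g ?f = restrict h P" using fP h by (auto simp: compose_def fun_eq_iff)
  moreover have "mor P h" using mor_cong[OF mor_comp[OF TH_mor[OF f] TH_mor[OF g] fP]] h by simp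
  ultimately show ?thesis using f by (auto simp: TH_def l_coset_def)
qed

lemma TH_\<theta>: "TH P f x \<Longrightarrow> g \<in> P \<Longrightarrow> \<theta> (f g) = x \<otimes>\<^bsub>\<Gamma>\<^esub> \<theta> g \<otimes>\<^bsub>\<Gamma>\<^esub> inv\<^bsub>\<Gamma>\<^esub> x"
  using T.\<Theta>_\<theta>[OF mor_qcat, of P f x g] by (simp add: TH_def)

lemma TH_fc_id:
  assumes x: "TH P (\<lambda>z. z) x" and fc: "fully_centralized S F P" shows "\<exists>c\<in>cen P. x = \<theta> c"
proof -
  have q: "quasicentric S F P" using x TH_quasi by blast
  have P: "subgroup P S" using q quasi_sub by blast
  have "(\<lambda>x\<in>P. x) \<in> quasicentric_category S F P P" using q id_mem[OF P] by (simp add: qcat_iff)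
  then have "\<Theta> P (carrier S) (\<lambda>x\<in>P. x) = \<theta> ` centralizer S P" using \<Theta>_codomain T.\<Theta>_id[OF q fc] by simp
  then show ?thesis using x centralizer_eq_cen[OF subgroup.subset[OF P]] by (auto simp: TH_def)
qed

text \<open>Since \<open>1 \<in> \<Theta>(f \<circ> f\<^sup>-\<^sup>1) = x \<Theta>(f\<^sup>-\<^sup>1)\<close>, the inverse of \<open>x\<close> lies in \<open>\<Theta>(f\<^sup>-\<^sup>1)\<close>.\<close>

lemma TH_inv:
  assumes f: "TH P f x" shows "TH (f ` P) (inv_into P f) (inv\<^bsub>\<Gamma>\<^esub> x)"
proof -
  have q: "quasicentric S F (f ` P)" using f quasicentric_conj by (auto simp: TH_def)
  have m: "mor (f ` P) (inv_into P f)" using TH_mor[OF f] mor_inv_into by blast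
  have i: "inv_into P f ` f ` P = P" using inv_into_image TH_mor[OF f] by blast
  have P: "quasicentric S F P" "subgroup P S" using f quasi_sub by (auto simp: TH_def)
  let ?i = "restrict (inv_into P f) (f ` P)" and ?f = "restrict f P"
  have i': "?i \<in> quasicentric_category S F (f ` P) P"
    using q m P i mor_cong[OF m, of ?i] F_eq_mor[OF P(2)] by (auto simp: qcat_iff)
  have f': "?f \<in> quasicentric_category S F P (carrier S)" using mor_qcat P TH_mor[OF f] by blast
  have "\<Theta> (f ` P) (carrier S) (compose (f ` P) ?f ?i) = x <#\<^bsub>\<Gamma>\<^esub> \<Theta> (f ` P) P ?i"
    by (rule T.\<Theta>_comp[OF i' f']) (use f in \<open>simp add: TH_def\<close>)
  moreover have "compose (f ` P) ?f ?i = (\<lambda>z\<in>f ` P. z)"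
    using i by (auto simp: compose_def fun_eq_iff f_inv_into_f inv_into_into)
  ultimately have "\<one>\<^bsub>\<Gamma>\<^esub> \<in> x <#\<^bsub>\<Gamma>\<^esub> \<Theta> (f ` P) P ?i" using TH_one[OF q, of "\<lambda>z. z"] by (simp add: TH_def)
  then obtain y where y: "y \<in> \<Theta> (f ` P) P ?i" "\<one>\<^bsub>\<Gamma>\<^esub> = x \<otimes>\<^bsub>\<Gamma>\<^esub> y" by (auto simp: l_coset_def)
  have "y \<in> carrier \<Gamma>" using y T.\<Theta>_nonempty_subset[OF i'] by blast
  then have "y = inv\<^bsub>\<Gamma>\<^esub> x" using y TH_carrier[OF f] by (metis T.H.inv_equality T.H.inv_comm)
  then show ?thesis using q m y \<Theta>_codomain[OF i'] by (simp add: TH_def)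
qed

text \<open>In \<open>lab K P f x\<close> the map \<open>f\<close> is, on \<open>P\<close>, a composite of morphisms \<open>g\<^sub>i\<close> defined on quasicentric subgroups
containing the successive images of \<open>P\<close>, and \<open>x\<close> is the product of elements \<open>y\<^sub>i \<in> \<Theta>(g\<^sub>i) \<inter> K\<close>. In this way
morphisms on arbitrary subgroups receive labels, in general several of them.\<close>

inductive lab :: "'g set \<Rightarrow> 'a set \<Rightarrow> ('a \<Rightarrow> 'a) \<Rightarrow> 'g \<Rightarrow> bool" for K where
  lab_id: "subgroup P S \<Longrightarrow> (\<And>z. z \<in> P \<Longrightarrow> f z = z) \<Longrightarrow> lab K P f \<one>\<^bsub>\<Gamma>\<^esub>"
| lab_step: "lab K P f x \<Longrightarrow> TH Q g y \<Longrightarrow> y \<in> K \<Longrightarrow> f ` P \<subseteq> Q \<Longrightarrow> (\<And>z. z \<in> P \<Longrightarrow> h z = g (f z)) \<Longrightarrow>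
    lab K P h (y \<otimes>\<^bsub>\<Gamma>\<^esub> x)"

abbreviation L :: "'a set \<Rightarrow> ('a \<Rightarrow> 'a) \<Rightarrow> 'g \<Rightarrow> bool" where "L \<equiv> lab (carrier \<Gamma>)"
abbreviation L1 :: "'a set \<Rightarrow> ('a \<Rightarrow> 'a) \<Rightarrow> 'g \<Rightarrow> bool" where "L1 \<equiv> lab {\<one>\<^bsub>\<Gamma>\<^esub>}"

lemma lab_mor: "lab K P f x \<Longrightarrow> mor P f"
proof (induction rule: lab.induct)
  case (lab_step P f x Q g y h)
  then show ?case using mor_cong[OF mor_comp[OF _ TH_mor]] by metis
qed (rule mor_id)

lemma lab_carrier: "lab K P f x \<Longrightarrow> x \<in> carrier \<Gamma>"
  by (induction rule: lab.induct) (auto dest: TH_carrier)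

lemma lab_in: "subgroup K \<Gamma> \<Longrightarrow> lab K P f x \<Longrightarrow> x \<in> K"
  by (erule lab.induct) (auto intro: subgroup.one_closed subgroup.m_closed)

lemma lab_mono: "lab K P f x \<Longrightarrow> K \<subseteq> K' \<Longrightarrow> lab K' P f x"
  by (induction rule: lab.induct) (auto intro: lab.intros)

lemma lab_cong: "lab K P f x \<Longrightarrow> (\<And>z. z \<in> P \<Longrightarrow> f z = g z) \<Longrightarrow> lab K P g x"
  by (erule lab.cases) (auto intro: lab.intros)

lemma lab_restrict:
  assumes "lab K P f x" "subgroup Q S" "Q \<subseteq> P" shows "lab K Q f x"
  using assms
proof (induction rule: lab.induct)
  case (lab_step P f x R g y h)
  show ?case by (rule lab.lab_step[of K Q f x R g y]) (use lab_step in auto)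
qed (auto intro: lab.intros)

lemma lab_gen: assumes "TH P f x" "x \<in> K" shows "lab K P f x"
proof -
  have "lab K P f (x \<otimes>\<^bsub>\<Gamma>\<^esub> \<one>\<^bsub>\<Gamma>\<^esub>)"
    by (rule lab_step[OF lab_id[of P "\<lambda>z. z"] assms]) (use assms TH_quasi quasi_sub in auto)
  then show ?thesis using TH_carrier[OF assms(1)] by simp
qed

lemma lab_comp:
  assumes g: "lab K Q g y" and f: "lab K P f x" and "f ` P \<subseteq> Q" "\<And>z. z \<in> P \<Longrightarrow> h z = g (f z)"
  shows "lab K P h (y \<otimes>\<^bsub>\<Gamma>\<^esub> x)"
  using g assms(3,4)
proof (induction arbitrary: h rule: lab.induct)
  case (lab_id Q g)
  then show ?case using lab_cong[OF f] lab_carrier[OF f] by (simp add: image_subset_iff)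
next
  case (lab_step Q g y R k w g')
  have "lab K P (\<lambda>z. g (f z)) (y \<otimes>\<^bsub>\<Gamma>\<^esub> x)" by (rule lab_step.IH[OF lab_step.prems(1)]) simp
  then have "lab K P h (w \<otimes>\<^bsub>\<Gamma>\<^esub> (y \<otimes>\<^bsub>\<Gamma>\<^esub> x))"
    by (rule lab.lab_step[where Q = R and g = k]) (use lab_step in \<open>auto simp: image_subset_iff\<close>)
  then show ?case
    using lab_carrier[OF lab_step(1)] lab_carrier[OF f] TH_carrier[OF lab_step(2)] by (simp add: T.H.m_assoc)
qed

lemma lab_inv:
  assumes K: "subgroup K \<Gamma>" and f: "lab K P f x"
  shows "lab K (f ` P) (inv_into P f) (inv\<^bsub>\<Gamma>\<^esub> x)"
  using f
proof (induction rule: lab.induct)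
  case (lab_id P f)
  then have fP: "f ` P = P" "inj_on f P" by (auto simp: inj_on_def image_def)
  have "lab K P (inv_into P f) \<one>\<^bsub>\<Gamma>\<^esub>"
    by (rule lab.lab_id[OF lab_id(1)]) (metis fP(2) inv_into_f_f lab_id(2))
  then show ?case using fP by simp
next
  case (lab_step P f x Q g y h)
  have mf: "mor P f" using lab_mor lab_step(1) by blast
  have mh: "mor P h" using lab_mor[OF lab.lab_step[OF lab_step(1-5)]] by blast
  have hP: "h ` P = g ` f ` P" using lab_step(5) by (auto simp: image_iff)
  have 1: "lab K (g ` Q) (inv_into Q g) (inv\<^bsub>\<Gamma>\<^esub> y)"
    using lab_gen[OF TH_inv[OF lab_step(2)]] subgroup.m_inv_closed[OF K lab_step(3)] by blast
  have 2: "lab K (h ` P) (inv_into Q g) (inv\<^bsub>\<Gamma>\<^esub> y)"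
    by (rule lab_restrict[OF 1 mor_image[OF mh]]) (use hP lab_step(4) in auto)
  have "lab K (h ` P) (inv_into P h) (inv\<^bsub>\<Gamma>\<^esub> x \<otimes>\<^bsub>\<Gamma>\<^esub> inv\<^bsub>\<Gamma>\<^esub> y)"
  proof (rule lab_comp[OF lab_step(6) 2])
    have ig: "inv_into Q g (g w) = w" if "w \<in> f ` P" for w
      using that lab_step(4) mor_inj[OF TH_mor[OF lab_step(2)]] by (auto intro: inv_into_f_f)
    show "inv_into Q g ` h ` P \<subseteq> f ` P" using hP ig by auto
    show "inv_into P h z = inv_into P f (inv_into Q g z)" if z: "z \<in> h ` P" for z
    proof -
      obtain w where w: "w \<in> P" "z = h w" using z by auto
      have "inv_into P h z = w" using w mor_inj[OF mh] by simp
      moreover have "inv_into P f (inv_into Q g z) = w"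
        using ig[of "f w"] lab_step(5)[OF w(1)] w mor_inj[OF mf] by simp
      ultimately show ?thesis by simp
    qed
  qed
  then show ?case using TH_carrier[OF lab_step(2)] lab_carrier[OF lab_step(1)] by (simp add: T.H.inv_mult_group)
qed

text \<open>On a quasicentric subgroup all intermediate images are quasicentric, and the product of values is a value of
the composite.\<close>

lemma lab_TH:
  assumes "lab K P f x" "quasicentric S F P" shows "TH P f x"
  using assms
proof (induction rule: lab.induct)
  case (lab_step P f x Q g y h)
  show ?case by (rule TH_comp[OF lab_step.IH[OF lab_step.prems] lab_step.hyps(2,4,5)])
qed (rule TH_one)

lemma lab_\<theta>:
  assumes "lab K P f x" "g \<in> P" shows "\<theta> (f g) = x \<otimes>\<^bsub>\<Gamma>\<^esub> \<theta> g \<otimes>\<^bsub>\<Gamma>\<^esub> inv\<^bsub>\<Gamma>\<^esub> x"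
  using assms
proof (induction rule: lab.induct)
  case (lab_id P f)
  then have "\<theta> g \<in> carrier \<Gamma>" using T.hom_closed sub_carrier by blast
  then show ?case using lab_id by simp
next
  case (lab_step P f x Q k y h)
  have c: "x \<in> carrier \<Gamma>" "y \<in> carrier \<Gamma>" "\<theta> g \<in> carrier \<Gamma>"
    using lab_carrier[OF lab_step(1)] TH_carrier[OF lab_step(2)] lab_step(7) sub_carrier[OF mor_subgroup[OF lab_mor[OF lab_step(1)]]]
    by auto
  have "\<theta> (h g) = y \<otimes>\<^bsub>\<Gamma>\<^esub> \<theta> (f g) \<otimes>\<^bsub>\<Gamma>\<^esub> inv\<^bsub>\<Gamma>\<^esub> y"
    using TH_\<theta>[OF lab_step(2), of "f g"] lab_step(4,5,7) by auto
  also have "\<dots> = (y \<otimes>\<^bsub>\<Gamma>\<^esub> x) \<otimes>\<^bsub>\<Gamma>\<^esub> \<theta> g \<otimes>\<^bsub>\<Gamma>\<^esub> inv\<^bsub>\<Gamma>\<^esub> (y \<otimes>\<^bsub>\<Gamma>\<^esub> x)"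
    using lab_step(6,7) c by (simp add: T.H.m_assoc T.H.inv_mult_group)
  finally show ?case .
qed

lemma lab_cj:
  assumes P: "subgroup P S" and g: "g \<in> carrier S" "\<theta> g \<in> K" shows "lab K P (cj g) (\<theta> g)"
  by (rule lab_restrict[OF lab_gen[OF TH_cj[OF quasicentric_S g(1)] g(2)] P subgroup.subset[OF P]])

lemma L_inv: "L P f x \<Longrightarrow> L (f ` P) (inv_into P f) (inv\<^bsub>\<Gamma>\<^esub> x)"
  by (rule lab_inv[OF T.H.subgroup_self])

lemma L1_sub: "subgroup {\<one>\<^bsub>\<Gamma>\<^esub>} \<Gamma>" by (rule T.H.triv_subgroup)

lemma L1_L: "L1 P f x \<Longrightarrow> L P f x" by (rule lab_mono) auto

lemma L1_label: "L1 P f x \<Longrightarrow> x = \<one>\<^bsub>\<Gamma>\<^esub>" using lab_in[OF L1_sub] by auto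

lemma L1_inv: "L1 P f \<one>\<^bsub>\<Gamma>\<^esub> \<Longrightarrow> L1 (f ` P) (inv_into P f) \<one>\<^bsub>\<Gamma>\<^esub>"
  using lab_inv[OF L1_sub] by fastforce

lemma L1_comp: "L1 Q g \<one>\<^bsub>\<Gamma>\<^esub> \<Longrightarrow> L1 P f \<one>\<^bsub>\<Gamma>\<^esub> \<Longrightarrow> f ` P \<subseteq> Q \<Longrightarrow> (\<And>z. z \<in> P \<Longrightarrow> h z = g (f z)) \<Longrightarrow> L1 P h \<one>\<^bsub>\<Gamma>\<^esub>"
  using lab_comp[of "{\<one>\<^bsub>\<Gamma>\<^esub>}" Q g "\<one>\<^bsub>\<Gamma>\<^esub>" P f "\<one>\<^bsub>\<Gamma>\<^esub>" h] by simp

lemma L_div: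
  assumes g: "L Q g y" "h ` P \<subseteq> g ` Q" and h: "L P h w"
  shows "L P (\<lambda>z. inv_into Q g (h z)) (inv\<^bsub>\<Gamma>\<^esub> y \<otimes>\<^bsub>\<Gamma>\<^esub> w)"
  by (rule lab_comp[OF L_inv[OF g(1)] h g(2)]) simp

text \<open>If \<open>C\<^sub>S(P) \<le> P\<close>, then \<open>P\<close> would be quasicentric.\<close>

lemma nonquasi_fc_grows:
  assumes fc: "fully_centralized S F P" and nq: "\<not> quasicentric S F P"
  shows "P \<subset> P <#> cen P"
proof -
  have P: "subgroup P S" using fc by (rule fc_sub)
  then show ?thesis using P_le_PC[OF P] C_le_PC[OF P] fc_centric_imp_quasicentric[OF fc] nq by blast
qed

lemma nonquasi_proper: "subgroup P S \<Longrightarrow> \<not> quasicentric S F P \<Longrightarrow> P \<subset> carrier S"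
  using quasicentric_S subgroup.subset by blast

lemma nrm_strict:
  assumes "subgroup P S" "P \<subset> carrier S" shows "P \<subset> nrm P"
  using nrm_grows[OF assms(1) subgroup_self assms(2)] subgroup_subset_nrm[OF assms(1)] by blast

lemma card_psubset: "subgroup Q S \<Longrightarrow> P \<subset> Q \<Longrightarrow> card P < card Q"
  using sub_finite psubset_card_mono by blast

lemma subgroup_down_induct [consumes 1]:
  assumes P: "subgroup P S"
    and step: "\<And>P. subgroup P S \<Longrightarrow> (\<And>Q. subgroup Q S \<Longrightarrow> card P < card Q \<Longrightarrow> \<Phi> Q) \<Longrightarrow> \<Phi> P"
  shows "\<Phi> P"
  using P
proof (induction "card (carrier S) - card P" arbitrary: P rule: less_induct)
  case less
  show ?case
  proof (rule step[OF less(2)])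
    fix Q assume Q: "subgroup Q S" "card P < card Q"
    have "card Q \<le> card (carrier S)" using card_mono[OF finite_S] subgroup.subset[OF Q(1)] by blast
    then show "\<Phi> Q" using less(1)[OF _ Q(1)] Q(2) by simp
  qed
qed

text \<open>Downward induction on \<open>P\<close>, trivial for quasicentric \<open>P\<close>. Otherwise factor \<open>f = k\<^sup>-\<^sup>1 a h\<close> by \<open>fn_frames\<close>. The
frames are defined on normalizers, which are larger, and \<open>a\<close> extends to \<open>P\<^sub>0 C\<^sub>S(P\<^sub>0)\<close>, where \<open>P\<^sub>0 = h(P)\<close>; this
is larger as well because \<open>P\<^sub>0\<close> is not quasicentric.\<close>

lemma L_ex: "mor P f \<Longrightarrow> \<exists>x. L P f x"
proof -
  assume f: "mor P f"
  have "\<forall>f. mor P f \<longrightarrow> (\<exists>x. L P f x)" using mor_subgroup[OF f]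
  proof (induction rule: subgroup_down_induct)
    fix P assume P: "subgroup P S"
      and IH: "\<And>Q. subgroup Q S \<Longrightarrow> card P < card Q \<Longrightarrow> \<forall>f. mor Q f \<longrightarrow> (\<exists>x. L Q f x)"
    show "\<forall>f. mor P f \<longrightarrow> (\<exists>x. L P f x)"
    proof (cases "quasicentric S F P")
      case True
      then show ?thesis using TH_ex lab_gen TH_carrier by metis
    next
      case nq: False
      show ?thesis
      proof (intro allI impI)
        fix f assume f: "mor P f"
        define Q where "Q = f ` P"
        have Q: "subgroup Q S" "card Q = card P" using mor_image[OF f] mor_card[OF f] by (auto simp: Q_def)
        have nqc: "\<not> quasicentric S F (g ` P)" if "mor P g" for g
          using quasicentric_conj[OF _ mor_inv_into[OF that]] inv_into_image[OF that] nq by auto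
        obtain h k a where frames: "mor (nrm P) h" "mor (nrm Q) k" "fully_normalized S F (h ` P)" "k ` Q = h ` P"
          "a \<in> F (h ` P) (h ` P)" "a = restrict (\<lambda>z. k (f (inv_into P h z))) (h ` P)" "\<forall>z\<in>P. a (h z) = k (f z)"
          by (rule fn_frames[OF f, folded Q_def])
        note h = frames(1,3) and k = frames(2,4) and aF = frames(5) and ah_eq = bspec[OF frames(7)]
        have PN: "P \<subseteq> nrm P" "Q \<subseteq> nrm Q" using subgroup_subset_nrm P Q by auto
        have hP: "mor P h" by (rule mor_restrict[OF h(1) P PN(1)])
        have kQ: "mor Q k" by (rule mor_restrict[OF k(1) Q(1) PN(2)])
        define P0 where "P0 = h ` P"
        have P0: "subgroup P0 S" "card P0 = card P" "fully_centralized S F P0" "\<not> quasicentric S F P0"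
          using mor_image[OF hP] mor_card[OF hP] fn_fc[OF h(2)] nqc[OF hP] by (auto simp: P0_def)
        have "card P < card (nrm P)" "card P < card (nrm Q)"
          using card_psubset[OF nrmS[OF P] nrm_strict[OF P nonquasi_proper[OF P nq]]]
            card_psubset[OF nrmS[OF Q(1)] nrm_strict[OF Q(1) nonquasi_proper[OF Q(1)]]] nqc[OF f] Q by (auto simp: Q_def)
        then obtain w v where "L (nrm P) h w" "L (nrm Q) k v" using IH nrmS P Q h(1) k(1) by meson
        then have w: "L P h w" and v: "L Q k v" using lab_restrict PN P Q(1) by blast+
        have a: "mor P0 a" "a ` P0 = P0" using aF aut_iff[OF P0(1)] by (auto simp: P0_def)
        obtain b where b: "mor (P0 <#> cen P0) b" "\<And>x. x \<in> P0 \<Longrightarrow> b x = a x"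
          using fc_extend_PC[OF a(1)] a(2) P0(3) by metis
        have "card P < card (P0 <#> cen P0)"
          using card_psubset[OF subgroup_PC[OF P0(1)] nonquasi_fc_grows[OF P0(3,4)]] P0(2) by simp
        then obtain u where "L (P0 <#> cen P0) b u" using IH subgroup_PC[OF P0(1)] b(1) by meson
        then have "L P0 b u" using lab_restrict P0(1) P_le_PC by blast
        then have u: "L P0 a u" using lab_cong b(2) by blast
        have ah: "L P (\<lambda>z. a (h z)) (u \<otimes>\<^bsub>\<Gamma>\<^esub> w)" by (rule lab_comp[OF u w]) (simp_all add: P0_def)
        have "L P (\<lambda>z. inv_into Q k (a (h z))) (inv\<^bsub>\<Gamma>\<^esub> v \<otimes>\<^bsub>\<Gamma>\<^esub> (u \<otimes>\<^bsub>\<Gamma>\<^esub> w))"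
          by (rule L_div[OF v _ ah]) (use ah_eq Q_def in auto)
        moreover have "inv_into Q k (a (h z)) = f z" if "z \<in> P" for z
          using ah_eq[OF that] that mor_inj[OF kQ] by (simp add: Q_def)
        ultimately show "\<exists>x. L P f x" using lab_cong by blast
      qed
    qed
  qed
  then show ?thesis using f by blast
qed

end

section \<open>A Frattini argument for labels\<close>

context prime_fusion_system begin

lemma sylow_in_between:
  assumes Q: "subgroup Q S" and D: "subgroup D (Aut_group F Q)" and K: "subgroup K (Aut_group F Q)"
    and T: "sylow_subgroup p (Aut_group F Q\<lparr>carrier := D\<rparr>) T" and TK: "T \<subseteq> K" "K \<subseteq> D"
  shows "sylow_subgroup p (Aut_group F Q\<lparr>carrier := K\<rparr>) T"
proof -
  interpret A: group "Aut_group F Q" by (rule Aut_group[OF Q])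
  interpret D: group "Aut_group F Q\<lparr>carrier := D\<rparr>" by (rule A.subgroup_imp_group[OF D])
  interpret K: group "Aut_group F Q\<lparr>carrier := K\<rparr>" by (rule A.subgroup_imp_group[OF K])
  have fin: "finite D" "finite K"
    using subgroup.subset[OF D] subgroup.subset[OF K] Aut_finite[OF Q] finite_subset by auto
  have T': "subgroup T (Aut_group F Q\<lparr>carrier := D\<rparr>)"
    "card T = p ^ multiplicity p (order (Aut_group F Q\<lparr>carrier := D\<rparr>))" using T by (auto simp: sylow_subgroup_def)
  have "subgroup T (Aut_group F Q)" using A.incl_subgroup[OF D T'(1)] .
  then have TsK: "subgroup T (Aut_group F Q\<lparr>carrier := K\<rparr>)" using A.subgroup_incl[OF _ K TK(1)] by blast
  obtain U where U: "sylow_subgroup p (Aut_group F Q\<lparr>carrier := K\<rparr>) U"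
    using sylow_exists[OF prime_p K.is_group] fin by auto
  then have U': "subgroup U (Aut_group F Q\<lparr>carrier := K\<rparr>)"
    "card U = p ^ multiplicity p (order (Aut_group F Q\<lparr>carrier := K\<rparr>))" by (auto simp: sylow_subgroup_def)
  have "U \<subseteq> D" using subgroup.subset[OF U'(1)] TK by auto
  then have "subgroup U (Aut_group F Q\<lparr>carrier := D\<rparr>)"
    using A.incl_subgroup[OF K U'(1)] A.subgroup_incl[OF _ D] by blast
  then have "card U \<le> card T"
    using p_subgroup_card_le_sylow[OF prime_p D.is_group _ _ U'(2)] T'(2) fin by simp
  then show ?thesis using sylow_if_card_ge[OF prime_p K.is_group _ TsK T'(2) U] fin by simp
qed

end

context fusion_triple begin

lemma \<theta>_carrier [simp]: "g \<in> carrier S \<Longrightarrow> \<theta> g \<in> carrier \<Gamma>" by (rule T.hom_closed)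

lemma \<theta>_trivial:
  assumes \<Gamma>: "finite_p'_group p \<Gamma>" and g: "g \<in> carrier S" shows "\<theta> g = \<one>\<^bsub>\<Gamma>\<^esub>"
proof -
  obtain n where n: "order S = p ^ n" using order_S by blast
  have "g [^] (p ^ n) = \<one>" using pow_order_eq_1[OF g] n by simp
  then have "\<theta> g [^]\<^bsub>\<Gamma>\<^esub> (p ^ n) = \<one>\<^bsub>\<Gamma>\<^esub>" using T.hom_nat_pow[OF g] T.hom_one by metis
  then have 1: "T.H.ord (\<theta> g) dvd p ^ n" using T.H.pow_eq_id g by simp
  have 2: "T.H.ord (\<theta> g) dvd order \<Gamma>" using T.H.ord_dvd_group_order g by simp
  have "coprime (order \<Gamma>) (p ^ n)" using \<Gamma> by (simp add: finite_p'_group_def)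
  then have "T.H.ord (\<theta> g) = 1" using 1 2 by (metis coprime_common_divisor_nat)
  then show ?thesis using T.H.pow_ord_eq_1[of "\<theta> g"] g by (simp add: \<theta>_carrier T.H.nat_pow_eone)
qed

lemma \<Gamma>_finite: "finite (carrier \<Gamma>)"
  using \<Gamma>_order by (auto simp: finite_p_group_def finite_p'_group_def)

lemma labels_finite: "finite {x. L Q a x}"
  by (rule finite_subset[OF _ \<Gamma>_finite]) (auto dest: lab_carrier)

lemma L_shift: "L Q a x \<Longrightarrow> L Q (\<lambda>z. z) y \<Longrightarrow> L Q a (x \<otimes>\<^bsub>\<Gamma>\<^esub> y)"
  by (rule lab_comp[of "carrier \<Gamma>" Q a x Q "\<lambda>z. z" y a]) auto

lemma L_diff: assumes x: "L Q a x" and y: "L Q a y" shows "L Q (\<lambda>z. z) (inv\<^bsub>\<Gamma>\<^esub> x \<otimes>\<^bsub>\<Gamma>\<^esub> y)"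
  by (rule lab_cong[OF L_div[OF x _ y]]) (use mor_inj[OF lab_mor[OF x]] in auto)

text \<open>The labelled automorphisms in \<open>D\<close>, as a subgroup of \<open>Aut\<^sub>F(Q) \<times> \<Gamma>\<close>. It need not be the graph of a
map, since the labels of the identity form a possibly nontrivial group.\<close>

definition label_pairs :: "'a set \<Rightarrow> ('a \<Rightarrow> 'a) set \<Rightarrow> (('a \<Rightarrow> 'a) \<times> 'g) set" where
  "label_pairs Q D = (SIGMA a:D. {x. L Q a x})"

text \<open>The labels of each \<open>a\<close> form a coset of the group of labels of the identity.\<close>

lemma card_label_pairs:
  assumes Q: "subgroup Q S" and D: "D \<subseteq> F Q Q"
  shows "card (label_pairs Q D) = card D * card {x. L Q (\<lambda>z. z) x}"
proof -
  have "finite D" using D Aut_finite[OF Q] finite_subset by blast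
  moreover have "card {x. L Q a x} = card {x. L Q (\<lambda>z. z) x}" if a: "a \<in> D" for a
  proof -
    have "mor Q a" using a D aut_iff[OF Q] by blast
    then obtain x where x: "L Q a x" using L_ex by blast
    have xc: "x \<in> carrier \<Gamma>" using lab_carrier[OF x] .
    show ?thesis
      by (rule bij_betw_same_card[OF bij_betw_byWitness[where f = "\<lambda>y. inv\<^bsub>\<Gamma>\<^esub> x \<otimes>\<^bsub>\<Gamma>\<^esub> y" and f' = "\<lambda>y. x \<otimes>\<^bsub>\<Gamma>\<^esub> y"]])
         (use x xc L_shift L_diff lab_carrier in \<open>auto simp: T.H.m_assoc[symmetric]\<close>)
  qed
  ultimately show ?thesis unfolding label_pairs_def using labels_finite by (simp add: card_SigmaI)
qed

lemma label_pairs_subgroup: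
  assumes Q: "subgroup Q S" and D: "subgroup D (Aut_group F Q)"
  shows "subgroup (label_pairs Q D) (Aut_group F Q \<times>\<times> \<Gamma>)"
proof -
  interpret A: group "Aut_group F Q" by (rule Aut_group[OF Q])
  interpret AG: group "Aut_group F Q \<times>\<times> \<Gamma>" by (rule DirProd_group[OF A.is_group T.H.is_group])
  have DF: "D \<subseteq> F Q Q" using subgroup.subset[OF D] by simp
  show ?thesis
  proof (rule AG.subgroupI)
    show "label_pairs Q D \<subseteq> carrier (Aut_group F Q \<times>\<times> \<Gamma>)"
      using DF lab_carrier by (auto simp: label_pairs_def)
    have "L Q (\<lambda>z\<in>Q. z) \<one>\<^bsub>\<Gamma>\<^esub>" by (rule lab_id[OF Q]) simp
    then show "label_pairs Q D \<noteq> {}" using subgroup.one_closed[OF D] by (auto simp: label_pairs_def)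
    show "inv\<^bsub>Aut_group F Q \<times>\<times> \<Gamma>\<^esub> u \<in> label_pairs Q D" if "u \<in> label_pairs Q D" for u
    proof -
      obtain a x where u: "u = (a, x)" "a \<in> D" "L Q a x" using \<open>u \<in> label_pairs Q D\<close> by (auto simp: label_pairs_def)
      have a: "a \<in> F Q Q" "mor Q a" "a ` Q = Q" using u DF aut_iff[OF Q] by auto
      have "L Q (inv\<^bsub>Aut_group F Q\<^esub> a) (inv\<^bsub>\<Gamma>\<^esub> x)" using lab_cong[OF L_inv[OF u(3)]] a(3) by (simp add: Aut_inv[OF Q a(1)])
      moreover have "inv\<^bsub>Aut_group F Q\<^esub> a \<in> D" using subgroup.m_inv_closed[OF D u(2)] .
      moreover have "inv\<^bsub>Aut_group F Q \<times>\<times> \<Gamma>\<^esub> u = (inv\<^bsub>Aut_group F Q\<^esub> a, inv\<^bsub>\<Gamma>\<^esub> x)"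
        using inv_DirProd[OF A.is_group T.H.is_group, of a x] a lab_carrier[OF u(3)] u(1) by simp
      ultimately show ?thesis by (simp add: label_pairs_def)
    qed
    show "u \<otimes>\<^bsub>Aut_group F Q \<times>\<times> \<Gamma>\<^esub> v \<in> label_pairs Q D" if uv: "u \<in> label_pairs Q D" "v \<in> label_pairs Q D" for u v
    proof -
      obtain a x where u: "u = (a, x)" "a \<in> D" "L Q a x" using uv(1) by (auto simp: label_pairs_def)
      obtain b y where v: "v = (b, y)" "b \<in> D" "L Q b y" using uv(2) by (auto simp: label_pairs_def)
      have ab: "a \<in> F Q Q" "b \<in> F Q Q" using u v DF by auto
      have "L Q (compose Q a b) (x \<otimes>\<^bsub>\<Gamma>\<^esub> y)"
        by (rule lab_comp[OF u(3) v(3)]) (use ab F_D(4) in \<open>auto simp: compose_def\<close>)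
      moreover have "compose Q a b \<in> D" using subgroup.m_closed[OF D u(2) v(2)] Aut_mult[OF Q ab] by simp
      ultimately show ?thesis using u v Aut_mult[OF Q ab] by (simp add: label_pairs_def)
    qed
  qed
qed

definition label_kernel :: "'a set \<Rightarrow> ('a \<Rightarrow> 'a) set \<Rightarrow> ('a \<Rightarrow> 'a) set" where
  "label_kernel Q D = {a \<in> D. L Q a \<one>\<^bsub>\<Gamma>\<^esub>}"

lemma label_kernel:
  assumes Q: "subgroup Q S" and D: "subgroup D (Aut_group F Q)"
  shows "subgroup (label_kernel Q D) (Aut_group F Q)"
    and "\<And>a b. a \<in> D \<Longrightarrow> b \<in> label_kernel Q D \<Longrightarrow>
      a \<otimes>\<^bsub>Aut_group F Q\<^esub> b \<otimes>\<^bsub>Aut_group F Q\<^esub> inv\<^bsub>Aut_group F Q\<^esub> a \<in> label_kernel Q D"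
proof -
  interpret A: group "Aut_group F Q" by (rule Aut_group[OF Q])
  \<comment> \<open>A label need not be unique, so the kernel is normalized inside the group of pairs: conjugate \<open>(b, 1)\<close> by \<open>(a, x)\<close>.\<close>
  let ?G = "label_pairs Q D"
  have G: "subgroup ?G (Aut_group F Q \<times>\<times> \<Gamma>)" by (rule label_pairs_subgroup[OF Q D])
  have DF: "D \<subseteq> F Q Q" using subgroup.subset[OF D] by simp
  have mem: "(a, x) \<in> ?G \<longleftrightarrow> a \<in> D \<and> L Q a x" for a x by (auto simp: label_pairs_def)
  have K: "a \<in> label_kernel Q D \<longleftrightarrow> (a, \<one>\<^bsub>\<Gamma>\<^esub>) \<in> ?G" for a by (simp add: mem label_kernel_def)
  have mult: "(a \<otimes>\<^bsub>Aut_group F Q\<^esub> b, x \<otimes>\<^bsub>\<Gamma>\<^esub> y) \<in> ?G" if "(a, x) \<in> ?G" "(b, y) \<in> ?G" for a b x y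
    using subgroup.m_closed[OF G that] by simp
  have inv: "(inv\<^bsub>Aut_group F Q\<^esub> a, inv\<^bsub>\<Gamma>\<^esub> x) \<in> ?G" if ax: "(a, x) \<in> ?G" for a x
  proof -
    have "a \<in> carrier (Aut_group F Q)" "x \<in> carrier \<Gamma>" using ax lab_carrier DF by (auto simp: mem)
    then show ?thesis using subgroup.m_inv_closed[OF G ax] inv_DirProd[OF A.is_group T.H.is_group] by simp
  qed
  show "subgroup (label_kernel Q D) (Aut_group F Q)"
  proof (rule A.subgroupI)
    show "label_kernel Q D \<subseteq> carrier (Aut_group F Q)" using DF by (auto simp: label_kernel_def)
    have "(\<lambda>x\<in>Q. x) \<in> label_kernel Q D" using subgroup.one_closed[OF D] lab_id[OF Q] by (simp add: label_kernel_def)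
    then show "label_kernel Q D \<noteq> {}" by blast
    show "inv\<^bsub>Aut_group F Q\<^esub> a \<in> label_kernel Q D" if "a \<in> label_kernel Q D" for a
      using inv[of a "\<one>\<^bsub>\<Gamma>\<^esub>"] that by (simp add: K)
    show "a \<otimes>\<^bsub>Aut_group F Q\<^esub> b \<in> label_kernel Q D" if "a \<in> label_kernel Q D" "b \<in> label_kernel Q D" for a b
      using mult[of a "\<one>\<^bsub>\<Gamma>\<^esub>" b "\<one>\<^bsub>\<Gamma>\<^esub>"] that by (simp add: K)
  qed
  show "a \<otimes>\<^bsub>Aut_group F Q\<^esub> b \<otimes>\<^bsub>Aut_group F Q\<^esub> inv\<^bsub>Aut_group F Q\<^esub> a \<in> label_kernel Q D"
    if a: "a \<in> D" and b: "b \<in> label_kernel Q D" for a b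
  proof -
    have "mor Q a" using a DF aut_iff[OF Q] by auto
    then obtain x where x: "(a, x) \<in> ?G" using L_ex mem a by blast
    then have "x \<in> carrier \<Gamma>" using lab_carrier mem by blast
    then show ?thesis using mult[OF mult[OF x] inv[OF x], of b "\<one>\<^bsub>\<Gamma>\<^esub>"] b by (simp add: K)
  qed
qed

text \<open>The pairs over \<open>T0\<close> have the same index in the pairs over \<open>D\<close> as \<open>T0\<close> has in \<open>D\<close>. It is prime to \<open>p\<close>, so
both groups of pairs have the same image in the \<open>p\<close>-group \<open>\<Gamma>\<close>.\<close>

text \<open>If \<open>\<Gamma>\<close> is a \<open>p\<close>-group, then \<open>n\<close> can be taken from \<open>Aut\<^sub>X(Q)\<close> itself. If its order is prime to \<open>p\<close>, then
\<open>Aut\<^sub>X(Q)\<close> is a Sylow subgroup of the kernel \<open>K\<close> of the labels, so its conjugate by \<open>a\<close> is moved back by some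
\<open>k \<in> K\<close>, and \<open>n = k a\<close> still has the label \<open>x\<close>. The last conclusion says that \<open>n\<close> normalizes \<open>Aut\<^sub>X(Q)\<close>, in the
form in which it gives \<open>X \<le> N\<^sub>n\<close>.\<close>

lemma frattini_p:
  assumes \<Gamma>: "finite_p_group p \<Gamma>" and Q: "subgroup Q S" and D: "subgroup D (Aut_group F Q)"
    and T0: "sylow_subgroup p (Aut_group F Q\<lparr>carrier := D\<rparr>) T0"
    and a: "a \<in> D" "L Q a x"
  obtains t where "t \<in> T0" "L Q t x"
proof -
  interpret A: group "Aut_group F Q" by (rule Aut_group[OF Q])
  interpret AG: group "Aut_group F Q \<times>\<times> \<Gamma>" by (rule DirProd_group[OF A.is_group T.H.is_group])
  interpret D: group "Aut_group F Q\<lparr>carrier := D\<rparr>" by (rule A.subgroup_imp_group[OF D])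
  have DF: "D \<subseteq> F Q Q" using subgroup.subset[OF D] by simp
  have fD: "finite D" using DF Aut_finite[OF Q] finite_subset by blast
  have T0': "subgroup T0 (Aut_group F Q\<lparr>carrier := D\<rparr>)" using T0 by (simp add: sylow_subgroup_def)
  have T0D: "T0 \<subseteq> D" using subgroup.subset[OF T0'] by simp
  let ?G = "label_pairs Q D" and ?T = "label_pairs Q T0"
  let ?GG = "(Aut_group F Q \<times>\<times> \<Gamma>)\<lparr>carrier := label_pairs Q D\<rparr>"
  have G: "subgroup ?G (Aut_group F Q \<times>\<times> \<Gamma>)" by (rule label_pairs_subgroup[OF Q D])
  have "subgroup ?T (Aut_group F Q \<times>\<times> \<Gamma>)" by (rule label_pairs_subgroup[OF Q A.incl_subgroup[OF D T0']])
  moreover have "?T \<subseteq> ?G" using T0D by (auto simp: label_pairs_def)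
  ultimately have TG: "subgroup ?T ?GG" using AG.subgroup_incl[OF _ G] by blast
  interpret G: group ?GG by (rule AG.subgroup_imp_group[OF G])
  have fG: "finite ?G" unfolding label_pairs_def using fD labels_finite by auto
  have snd: "group_hom ?GG \<Gamma> snd"
    by unfold_locales (use lab_carrier in \<open>auto simp: hom_def label_pairs_def\<close>)
  have k: "card {x. L Q (\<lambda>z. z) x} > 0"
    using lab_id[OF Q, of "\<lambda>z. z"] labels_finite by (auto simp: card_gt_0_iff)
  have "card (rcosets\<^bsub>?GG\<^esub> ?T) * card ?T = card ?G" using G.lagrange[OF TG] by (simp add: order_def)
  moreover have "card (rcosets\<^bsub>Aut_group F Q\<lparr>carrier := D\<rparr>\<^esub> T0) * card T0 = card D"
    using D.lagrange[OF T0'] by (simp add: order_def)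
  moreover have "finite T0" "T0 \<noteq> {}" using T0D fD subgroup.one_closed[OF T0'] finite_subset by blast+
  then have "card T0 > 0" by (simp add: card_gt_0_iff)
  moreover have "card ?G = card D * card {x. L Q (\<lambda>z. z) x}" "card ?T = card T0 * card {x. L Q (\<lambda>z. z) x}"
    using card_label_pairs[OF Q DF] card_label_pairs[OF Q order_trans[OF T0D DF]] by auto
  ultimately have "card (rcosets\<^bsub>?GG\<^esub> ?T) * (card T0 * card {x. L Q (\<lambda>z. z) x})
      = card (rcosets\<^bsub>Aut_group F Q\<lparr>carrier := D\<rparr>\<^esub> T0) * (card T0 * card {x. L Q (\<lambda>z. z) x})"
    by (metis mult.assoc)
  then have "card (rcosets\<^bsub>?GG\<^esub> ?T) = card (rcosets\<^bsub>Aut_group F Q\<lparr>carrier := D\<rparr>\<^esub> T0)"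
    using k \<open>card T0 > 0\<close> by simp
  then have "\<not> p dvd card (rcosets\<^bsub>?GG\<^esub> ?T)"
    using sylow_index[OF prime_p D.is_group _ T0] fD by simp
  moreover obtain n where "order \<Gamma> = p ^ n" using \<Gamma> by (auto simp: finite_p_group_def)
  ultimately have "snd ` ?T = snd ` ?G"
    using G.image_of_subgroup_of_p'_index[OF snd _ _ prime_p TG] fG by simp
  moreover have "x \<in> snd ` ?G" using a image_eqI[of x snd "(a, x)" ?G] by (simp add: label_pairs_def)
  ultimately have "x \<in> snd ` ?T" by simp
  then show ?thesis using that by (auto simp: label_pairs_def)
qed

lemma frattini:
  assumes Q: "subgroup Q S" and X: "subgroup X S" "X \<subseteq> nrm Q" and D: "subgroup D (Aut_group F Q)"
    and T0: "sylow_subgroup p (Aut_group F Q\<lparr>carrier := D\<rparr>) (conj_auts Q X)"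
    and a: "a \<in> D" "L Q a x"
  obtains n where "n \<in> D" "L Q n x" "\<And>g. g \<in> X \<Longrightarrow> \<exists>g'\<in>X. \<forall>z\<in>Q. n (cj g z) = cj g' (n z)"
proof -
  interpret A: group "Aut_group F Q" by (rule Aut_group[OF Q])
  have DF: "D \<subseteq> F Q Q" using subgroup.subset[OF D] by simp
  have T0D: "conj_auts Q X \<subseteq> D" using T0 subgroup.subset by (fastforce simp: sylow_subgroup_def)
  show ?thesis
  proof (cases "finite_p_group p \<Gamma>")
    case True
    obtain t where t: "t \<in> conj_auts Q X" "L Q t x" using frattini_p[OF True Q D T0 a] by blast
    then obtain h where h: "h \<in> X" "t = restrict (cj h) Q" by (auto simp: conj_auts_def)
    show ?thesis
    proof (rule that[OF _ t(2)])
      show "t \<in> D" using t T0D by blast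
      fix g assume g: "g \<in> X"
      have c: "h \<in> carrier S" "g \<in> carrier S" "g \<in> nrm Q" using g h X sub_carrier by auto
      have "t (cj g z) = cj (cj h g) (t z)" if "z \<in> Q" for z
        using that c h nrm_cj[OF c(3)] sub_carrier[OF Q that] by (simp add: cj_cj_cj)
      then show "\<exists>g'\<in>X. \<forall>z\<in>Q. t (cj g z) = cj g' (t z)" using subgroup_cj[OF X(1) h(1) g] by blast
    qed
  next
    case False
    then have \<Gamma>: "finite_p'_group p \<Gamma>" using \<Gamma>_order by blast
    define K where "K = label_kernel Q D"
    have ai: "mor Q a" "a ` Q = Q" "a \<in> F Q Q" using a DF aut_iff[OF Q] by auto
    have K: "subgroup K (Aut_group F Q)" unfolding K_def by (rule label_kernel(1)[OF Q D])
    have T0K: "conj_auts Q X \<subseteq> K"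
    proof
      fix t assume t: "t \<in> conj_auts Q X"
      then obtain g where g: "g \<in> X" "t = restrict (cj g) Q" by (auto simp: conj_auts_def)
      then have "L Q (cj g) \<one>\<^bsub>\<Gamma>\<^esub>" using lab_cj[OF Q, of g "carrier \<Gamma>"] \<theta>_trivial[OF \<Gamma>] sub_carrier[OF X(1)] by fastforce
      then have "L Q t \<one>\<^bsub>\<Gamma>\<^esub>" by (rule lab_cong) (use g in simp)
      then show "t \<in> K" using t T0D by (auto simp: K_def label_kernel_def)
    qed
    have syl: "sylow_subgroup p (Aut_group F (a ` Q)\<lparr>carrier := K\<rparr>) (conj_auts Q X)"
      using sylow_in_between[OF Q D K T0 T0K] ai by (auto simp: K_def label_kernel_def)
    obtain j where j: "card (conj_auts Q X) = p ^ j" using conj_auts_p_subgroup(2)[OF Q X] by blast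
    have xc: "x \<in> carrier \<Gamma>" using lab_carrier[OF a(2)] .
    obtain k where k: "k \<in> K" "\<And>u. u \<in> conj_auts Q X \<Longrightarrow> \<exists>t\<in>conj_auts Q X. \<forall>z\<in>Q. k (a (u z)) = t (k (a z))"
    proof (rule conj_into_sylow[OF ai(1) _ syl conj_auts_p_subgroup(1)[OF Q X] j])
      show "subgroup K (Aut_group F (a ` Q))" using K ai by simp
      show "(\<lambda>y\<in>a ` Q. a (u (inv_into Q a y))) \<in> K" if u: "u \<in> conj_auts Q X" for u
      proof -
        have "u \<in> K" "u \<in> F Q Q" using u T0K T0D DF by auto
        then show ?thesis using label_kernel(2)[OF Q D a(1), of u] Aut_conj[OF Q ai(3)] ai(2) by (simp add: K_def)
      qed
    qed (use that in blast)
    have kF: "k \<in> F Q Q" "k \<in> D" "L Q k \<one>\<^bsub>\<Gamma>\<^esub>" "a \<in> F Q Q" using k DF a by (auto simp: K_def label_kernel_def)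
    show ?thesis
    proof (rule that[of "compose Q k a"])
      show "compose Q k a \<in> D" using subgroup.m_closed[OF D kF(2) a(1)] Aut_mult[OF Q kF(1,4)] by simp
      have "L Q (compose Q k a) (\<one>\<^bsub>\<Gamma>\<^esub> \<otimes>\<^bsub>\<Gamma>\<^esub> x)"
        by (rule lab_comp[OF kF(3) a(2)]) (use ai in \<open>auto simp: compose_def\<close>)
      then show "L Q (compose Q k a) x" using xc by simp
      fix g assume g: "g \<in> X"
      obtain t where t: "t \<in> conj_auts Q X" "\<forall>z\<in>Q. k (a (restrict (cj g) Q z)) = t (k (a z))"
        using k(2)[of "restrict (cj g) Q"] g unfolding conj_auts_def by blast
      then obtain g' where g': "g' \<in> X" "t = restrict (cj g') Q" by (auto simp: conj_auts_def)
      have "compose Q k a (cj g z) = cj g' (compose Q k a z)" if z: "z \<in> Q" for z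
      proof -
        have "cj g z \<in> Q" using nrm_cj z g X by blast
        moreover have "k (a z) \<in> Q" using z kF F_D(4) by blast
        ultimately show ?thesis using t(2) g' z by (auto simp: compose_def)
      qed
      then show "\<exists>g'\<in>X. \<forall>z\<in>Q. compose Q k a (cj g z) = cj g' (compose Q k a z)" using g' by blast
    qed
  qed
qed

section \<open>Extending labelled morphisms\<close>

text \<open>Two labels of the same map differ by a label of the identity. This is why extending the identity with
all its labels is what is needed in order to extend arbitrary labelled maps (\<open>labelled_extension\<close>).\<close>

definition labels_extend :: "'a set \<Rightarrow> bool" where
  "labels_extend P \<longleftrightarrow> (\<forall>y. L P (\<lambda>z. z) y \<longrightarrow> (\<exists>g. L (nrm P) g y \<and> (\<forall>z\<in>P. g z = z)))"

text \<open>Any extension \<open>h\<close> of \<open>f\<close> has some label \<open>w\<close>. Correct it by an extension of the identity of \<open>f(Q)\<close> with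
label \<open>x w\<^sup>-\<^sup>1\<close>.\<close>

lemma labelled_extension:
  assumes fc: "fully_centralized S F (f ` Q)" and l: "labels_extend (f ` Q)" and f: "L Q f x"
  obtains h where "L (Nx Q f) h x" "\<And>z. z \<in> Q \<Longrightarrow> h z = f z"
proof -
  have mf: "mor Q f" using lab_mor[OF f] .
  have Q: "subgroup Q S" using mor_subgroup[OF mf] .
  obtain h where h: "mor (Nx Q f) h" "\<And>z. z \<in> Q \<Longrightarrow> h z = f z" using fc_extend[OF mf fc] by blast
  obtain w where w: "L (Nx Q f) h w" using L_ex[OF h(1)] by blast
  have QN: "Q \<subseteq> Nx Q f" by (rule Nx_superset[OF mf])
  have wc: "w \<in> carrier \<Gamma>" "x \<in> carrier \<Gamma>" using lab_carrier w f by auto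
  have fw: "L Q f w" using lab_cong[OF lab_restrict[OF w Q QN]] h by simp
  have "L (f ` Q) (\<lambda>z. f (inv_into Q f z)) (x \<otimes>\<^bsub>\<Gamma>\<^esub> inv\<^bsub>\<Gamma>\<^esub> w)"
    by (rule lab_comp[OF f L_inv[OF fw]]) (use inv_into_image[OF mf] in auto)
  then have "L (f ` Q) (\<lambda>z. z) (x \<otimes>\<^bsub>\<Gamma>\<^esub> inv\<^bsub>\<Gamma>\<^esub> w)" by (rule lab_cong) (simp add: f_inv_into_f)
  then obtain g where g: "L (nrm (f ` Q)) g (x \<otimes>\<^bsub>\<Gamma>\<^esub> inv\<^bsub>\<Gamma>\<^esub> w)" "\<forall>z\<in>f ` Q. g z = z"
    using l unfolding labels_extend_def by blast
  have hQ: "h ` Q = f ` Q" using h(2) by (metis image_cong)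
  have "h ` Nx Q f \<subseteq> nrm (f ` Q)" using mor_nrm[OF h(1) QN] hQ by (auto simp: Nx_def)
  then have "L (Nx Q f) (\<lambda>z. g (h z)) (x \<otimes>\<^bsub>\<Gamma>\<^esub> inv\<^bsub>\<Gamma>\<^esub> w \<otimes>\<^bsub>\<Gamma>\<^esub> w)" by (rule lab_comp[OF g(1) w]) simp
  moreover have "x \<otimes>\<^bsub>\<Gamma>\<^esub> inv\<^bsub>\<Gamma>\<^esub> w \<otimes>\<^bsub>\<Gamma>\<^esub> w = x" using wc by (simp add: T.H.m_assoc)
  ultimately have "L (Nx Q f) (\<lambda>z. g (h z)) x" by metis
  moreover have "g (h z) = f z" if "z \<in> Q" for z using that g(2) h(2) by simp
  ultimately show ?thesis using that by blast
qed

text \<open>The label is \<open>\<theta>(c)\<close> with \<open>c \<in> C\<^sub>S(P)\<close>, and conjugation by \<open>c\<close> is the extension.\<close>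

lemma labels_extend_quasicentric:
  assumes fc: "fully_centralized S F P" and q: "quasicentric S F P" shows "labels_extend P"
  unfolding labels_extend_def
proof (intro allI impI)
  fix y assume "L P (\<lambda>z. z) y"
  then obtain c where c: "c \<in> cen P" "y = \<theta> c" using TH_fc_id[OF lab_TH[OF _ q] fc] by blast
  have "L (nrm P) (cj c) y" using lab_cj[OF nrmS[OF fc_sub[OF fc]] cen_carrier[OF c(1)]] c cen_carrier by simp
  then show "\<exists>g. L (nrm P) g y \<and> (\<forall>z\<in>P. g z = z)" using cen_cj[OF c(1)] by blast
qed

section \<open>Factoring out the morphisms of trivial label\<close>

text \<open>\<open>f = \<alpha> \<psi>\<close> with \<open>\<alpha> \<in> Aut\<^sub>F(S)\<close> labelled \<open>x\<close> and \<open>\<psi>\<close> of trivial label. In \<open>decomp_all\<close> this turns out to be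
equivalent to \<open>L P f x\<close>.\<close>

definition decomp :: "'a set \<Rightarrow> ('a \<Rightarrow> 'a) \<Rightarrow> 'g \<Rightarrow> bool" where
  "decomp P f x \<longleftrightarrow> (\<exists>\<alpha> \<psi>. TH (carrier S) \<alpha> x \<and> L1 P \<psi> \<one>\<^bsub>\<Gamma>\<^esub> \<and> (\<forall>z\<in>P. f z = \<alpha> (\<psi> z)))"

lemma mor_S_surj: assumes "mor (carrier S) f" shows "f ` carrier S = carrier S"
  using mor_carrier[OF assms] mor_card[OF assms] finite_S by (simp add: card_subset_eq image_subset_iff)

lemma TH_S_inv: "TH (carrier S) \<alpha> x \<Longrightarrow> TH (carrier S) (inv_into (carrier S) \<alpha>) (inv\<^bsub>\<Gamma>\<^esub> x)"
  using TH_inv mor_S_surj[OF TH_mor] by fastforce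

lemma S_inv:
  assumes "mor (carrier S) \<alpha>" "z \<in> carrier S"
  shows "inv_into (carrier S) \<alpha> (\<alpha> z) = z" "\<alpha> (inv_into (carrier S) \<alpha> z) = z" "inv_into (carrier S) \<alpha> z \<in> carrier S"
  using mor_inj[OF assms(1)] mor_S_surj[OF assms(1)] assms(2) by (auto simp: f_inv_into_f inv_into_into)

text \<open>Conjugation by \<open>\<alpha>\<close> permutes the generators of trivial label, since \<open>x\<^sup>-\<^sup>1 1 x = 1\<close>.\<close>

lemma L1_conj:
  assumes \<alpha>: "TH (carrier S) \<alpha> x" and \<chi>: "L1 Q \<chi> u"
  shows "L1 (inv_into (carrier S) \<alpha> ` Q) (\<lambda>z. inv_into (carrier S) \<alpha> (\<chi> (\<alpha> z))) \<one>\<^bsub>\<Gamma>\<^esub>"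
  using \<chi>
proof (induction rule: lab.induct)
  let ?b = "inv_into (carrier S) \<alpha>"
  have ma: "mor (carrier S) \<alpha>" "mor (carrier S) ?b" using TH_mor[OF \<alpha>] TH_mor[OF TH_S_inv[OF \<alpha>]] by auto
  { case (lab_id P f)
    have "mor P ?b" by (rule mor_restrict[OF ma(2) lab_id(1) subgroup.subset[OF lab_id(1)]])
    then have "subgroup (?b ` P) S" by (rule mor_image)
    then show ?case by (rule lab.lab_id) (use S_inv[OF ma(1)] lab_id sub_carrier in fastforce)
  next
    case (lab_step P f u R k y h)
    have y: "y = \<one>\<^bsub>\<Gamma>\<^esub>" using lab_step by simp
    have xc: "x \<in> carrier \<Gamma>" using TH_carrier[OF \<alpha>] .
    have R: "subgroup R S" "quasicentric S F R" using lab_step(2) quasi_sub TH_quasi by auto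
    have P: "subgroup P S" "mor P f" using lab_mor[OF lab_step(1)] mor_subgroup by auto
    have bR: "mor R ?b" by (rule mor_restrict[OF ma(2) R(1) subgroup.subset[OF R(1)]])
    have sbR: "subgroup (?b ` R) S" "quasicentric S F (?b ` R)" using mor_image[OF bR] quasicentric_conj[OF R(2) bR] by auto
    have k: "mor R k" using TH_mor lab_step by blast
    have 1: "L (?b ` R) \<alpha> x" using lab_restrict[OF lab_gen[OF \<alpha> xc] sbR(1) subgroup.subset[OF sbR(1)]] .
    have 2: "L R k \<one>\<^bsub>\<Gamma>\<^esub>" using lab_gen lab_step y by fastforce
    have ab: "\<alpha> (?b z) = z" if "z \<in> carrier S" for z using S_inv[OF ma(1) that] by simp
    have "L (?b ` R) (\<lambda>z. k (\<alpha> z)) (\<one>\<^bsub>\<Gamma>\<^esub> \<otimes>\<^bsub>\<Gamma>\<^esub> x)"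
      by (rule lab_comp[OF 2 1]) (use ab sub_carrier[OF R(1)] in auto)
    then have 3: "L (?b ` R) (\<lambda>z. k (\<alpha> z)) x" using xc by simp
    have "L (carrier S) ?b (inv\<^bsub>\<Gamma>\<^esub> x)" using lab_gen[OF TH_S_inv[OF \<alpha>]] xc by simp
    then have "L (?b ` R) (\<lambda>z. ?b (k (\<alpha> z))) (inv\<^bsub>\<Gamma>\<^esub> x \<otimes>\<^bsub>\<Gamma>\<^esub> x)"
      by (rule lab_comp[OF _ 3]) (use mor_carrier[OF lab_mor[OF 3]] in auto)
    then have "TH (?b ` R) (\<lambda>z. ?b (k (\<alpha> z))) \<one>\<^bsub>\<Gamma>\<^esub>" using lab_TH[OF _ sbR(2)] xc by simp
    then have "L1 (?b ` P) (\<lambda>z. ?b (h (\<alpha> z))) (\<one>\<^bsub>\<Gamma>\<^esub> \<otimes>\<^bsub>\<Gamma>\<^esub> \<one>\<^bsub>\<Gamma>\<^esub>)"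
    proof (rule lab.lab_step[OF lab_step(6)])
      show "(\<lambda>z. ?b (f (\<alpha> z))) ` ?b ` P \<subseteq> ?b ` R" using ab sub_carrier[OF P(1)] lab_step(4) by fastforce
      show "?b (h (\<alpha> z)) = ?b (k (\<alpha> (?b (f (\<alpha> z)))))" if z: "z \<in> ?b ` P" for z
      proof -
        obtain w where w: "w \<in> P" "z = ?b w" using z by auto
        then have "\<alpha> z = w" using ab sub_carrier[OF P(1)] by simp
        moreover have "\<alpha> (?b (f w)) = f w" using ab mor_carrier[OF P(2) w(1)] by simp
        ultimately show ?thesis using lab_step(5)[OF w(1)] by simp
      qed
    qed simp
    then show ?case by simp }
qed

lemma decomp_cong: "decomp P f x \<Longrightarrow> (\<And>z. z \<in> P \<Longrightarrow> f z = g z) \<Longrightarrow> decomp P g x"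
  by (auto simp: decomp_def)

lemma decomp_L: assumes "decomp P f x" shows "L P f x" "x \<in> carrier \<Gamma>"
proof -
  obtain \<alpha> \<psi> where *: "TH (carrier S) \<alpha> x" "L1 P \<psi> \<one>\<^bsub>\<Gamma>\<^esub>" "\<forall>z\<in>P. f z = \<alpha> (\<psi> z)" using assms by (auto simp: decomp_def)
  show x: "x \<in> carrier \<Gamma>" using TH_carrier * by blast
  have "L P f (x \<otimes>\<^bsub>\<Gamma>\<^esub> \<one>\<^bsub>\<Gamma>\<^esub>)"
    by (rule lab_comp[OF lab_gen[OF *(1) x] L1_L[OF *(2)]]) (use * mor_carrier[OF lab_mor[OF *(2)]] in auto)
  then show "L P f x" using x by simp
qed

lemma decomp_L1: "L1 P f \<one>\<^bsub>\<Gamma>\<^esub> \<Longrightarrow> decomp P f \<one>\<^bsub>\<Gamma>\<^esub>"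
  unfolding decomp_def using TH_one[OF quasicentric_S, of "\<lambda>z. z"] by auto

lemma decomp_TH: "TH (carrier S) f x \<Longrightarrow> decomp (carrier S) f x"
  unfolding decomp_def using lab_id[OF subgroup_self, of "\<lambda>z. z"] by auto

lemma decomp_restrict: "decomp P f x \<Longrightarrow> subgroup Q S \<Longrightarrow> Q \<subseteq> P \<Longrightarrow> decomp Q f x"
  unfolding decomp_def using lab_restrict by (meson subsetD)

text \<open>\<open>\<beta> \<chi> \<alpha> \<psi> = (\<beta> \<alpha>) (\<alpha>\<^sup>-\<^sup>1 \<chi> \<alpha>) \<psi>\<close>.\<close>

lemma decomp_comp:
  assumes f: "decomp P f x" and g: "decomp Q g y" and fP: "f ` P \<subseteq> Q" and h: "\<And>z. z \<in> P \<Longrightarrow> h z = g (f z)"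
  shows "decomp P h (y \<otimes>\<^bsub>\<Gamma>\<^esub> x)"
proof -
  obtain \<alpha> \<psi> where a: "TH (carrier S) \<alpha> x" "L1 P \<psi> \<one>\<^bsub>\<Gamma>\<^esub>" "\<forall>z\<in>P. f z = \<alpha> (\<psi> z)" using f by (auto simp: decomp_def)
  obtain \<beta> \<chi> where b: "TH (carrier S) \<beta> y" "L1 Q \<chi> \<one>\<^bsub>\<Gamma>\<^esub>" "\<forall>z\<in>Q. g z = \<beta> (\<chi> z)" using g by (auto simp: decomp_def)
  let ?i = "inv_into (carrier S) \<alpha>"
  have ma: "mor (carrier S) \<alpha>" using TH_mor a by blast
  have \<psi>P: "\<psi> z \<in> carrier S" if "z \<in> P" for z using mor_carrier[OF lab_mor[OF a(2)] that] .
  have \<psi>f: "\<psi> z = ?i (f z)" if "z \<in> P" for z using a(3) S_inv(1)[OF ma \<psi>P] that by simp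
  have 1: "L1 P (\<lambda>z. ?i (\<chi> (\<alpha> (\<psi> z)))) \<one>\<^bsub>\<Gamma>\<^esub>"
    by (rule L1_comp[OF L1_conj[OF a(1) b(2)] a(2)]) (use \<psi>f fP in auto)
  have 2: "TH (carrier S) (\<lambda>z. \<beta> (\<alpha> z)) (y \<otimes>\<^bsub>\<Gamma>\<^esub> x)"
    by (rule TH_comp[OF a(1) b(1)]) (use mor_S_surj[OF ma] in auto)
  have "h z = \<beta> (\<alpha> (?i (\<chi> (\<alpha> (\<psi> z)))))" if z: "z \<in> P" for z
  proof -
    have fz: "f z \<in> Q" "\<alpha> (\<psi> z) = f z" using fP z a(3) by auto
    have "\<chi> (f z) \<in> carrier S" using mor_carrier[OF lab_mor[OF b(2)] fz(1)] .
    then have "\<alpha> (?i (\<chi> (f z))) = \<chi> (f z)" using S_inv[OF ma] by simp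
    then show ?thesis using h[OF z] b(3) fz by simp
  qed
  then show ?thesis unfolding decomp_def using 1 2 by blast
qed

lemma decomp_inv:
  assumes f: "decomp P f x" shows "decomp (f ` P) (inv_into P f) (inv\<^bsub>\<Gamma>\<^esub> x)"
proof -
  obtain \<alpha> \<psi> where a: "TH (carrier S) \<alpha> x" "L1 P \<psi> \<one>\<^bsub>\<Gamma>\<^esub>" "\<forall>z\<in>P. f z = \<alpha> (\<psi> z)" using f by (auto simp: decomp_def)
  let ?i = "inv_into (carrier S) \<alpha>"
  have ma: "mor (carrier S) \<alpha>" using TH_mor a by blast
  have mf: "mor P f" using decomp_L[OF f] lab_mor by blast
  have m\<psi>: "mor P \<psi>" using lab_mor[OF a(2)] .
  have sub: "subgroup (f ` P) S" using mor_image[OF mf] .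
  have "decomp (carrier S) ?i (inv\<^bsub>\<Gamma>\<^esub> x)" using decomp_TH[OF TH_S_inv[OF a(1)]] .
  then have 1: "decomp (f ` P) ?i (inv\<^bsub>\<Gamma>\<^esub> x)" using decomp_restrict sub subgroup.subset[OF sub] by blast
  have 2: "decomp (\<psi> ` P) (inv_into P \<psi>) \<one>\<^bsub>\<Gamma>\<^esub>" using decomp_L1[OF L1_inv[OF a(2)]] .
  have if': "?i (f z) = \<psi> z" if "z \<in> P" for z using a(3) that S_inv(1)[OF ma] mor_carrier[OF m\<psi> that] by simp
  have "decomp (f ` P) (inv_into P f) (\<one>\<^bsub>\<Gamma>\<^esub> \<otimes>\<^bsub>\<Gamma>\<^esub> inv\<^bsub>\<Gamma>\<^esub> x)"
  proof (rule decomp_comp[OF 1 2])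
    show "?i ` f ` P \<subseteq> \<psi> ` P" using if' by auto
    show "inv_into P f z = inv_into P \<psi> (?i z)" if "z \<in> f ` P" for z
      using that if' mor_inj[OF mf] mor_inj[OF m\<psi>] by auto
  qed
  then show ?thesis using decomp_L(2)[OF f] by simp
qed

text \<open>Downward induction on \<open>P\<close>. If \<open>P\<close> is not quasicentric, then every generator of which \<open>f\<close> is composed is
defined on a larger subgroup. If \<open>P\<close> is quasicentric and \<open>P \<noteq> S\<close>, factor \<open>f = k\<^sup>-\<^sup>1 a h\<close> by \<open>fn_frames\<close>; the
frames are covered by the hypothesis. By \<open>frattini\<close> there is an automorphism \<open>n\<close> of \<open>P\<^sub>0 = h(P)\<close> with the same
label as \<open>a\<close> that normalizes \<open>Aut\<^sub>S(P\<^sub>0)\<close>. It extends to \<open>N\<^sub>S(P\<^sub>0)\<close> and is covered as well, while \<open>a n\<^sup>-\<^sup>1\<close> has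
the trivial label.\<close>

lemma decomp_all: "L P f x \<Longrightarrow> decomp P f x"
proof -
  assume f: "L P f x"
  have "\<forall>f x. L P f x \<longrightarrow> decomp P f x" using mor_subgroup[OF lab_mor[OF f]]
  proof (induction rule: subgroup_down_induct)
    fix P assume P: "subgroup P S"
      and IH: "\<And>Q. subgroup Q S \<Longrightarrow> card P < card Q \<Longrightarrow> \<forall>f x. L Q f x \<longrightarrow> decomp Q f x"
    have PN: "P \<subseteq> nrm P" using subgroup_subset_nrm P by auto
    show "\<forall>f x. L P f x \<longrightarrow> decomp P f x"
    proof (cases "quasicentric S F P")
      case nq: False
      have "decomp P f x" if "L P f x" for f x
        using that nq IH
      proof (induction rule: lab.induct)
        case (lab_id P f)
        then show ?case by (intro decomp_L1 lab.lab_id)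
      next
        case (lab_step P f x Q g y h)
        have m: "mor P f" using lab_mor lab_step(1) by blast
        have "quasicentric S F Q" "subgroup Q S" using lab_step(2) TH_quasi quasi_sub by auto
        moreover have "\<not> quasicentric S F (f ` P)"
          using quasicentric_conj[OF _ mor_inv_into[OF m]] inv_into_image[OF m] lab_step(7) by auto
        ultimately have "f ` P \<subset> Q" "subgroup Q S" using lab_step(4) by auto
        then have "card P < card Q" using card_psubset mor_card[OF m] by metis
        then have "decomp Q g y" using lab_step(8) \<open>subgroup Q S\<close> lab_gen[OF lab_step(2,3)] by blast
        moreover have "decomp P f x" by (rule lab_step(6)[OF lab_step(7,8)])
        ultimately show ?case using decomp_comp lab_step(4,5) by blast
      qed
      then show ?thesis by blast
    next
      case q: True
      show ?thesis
      proof (cases "P = carrier S")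
        case True
        then show ?thesis using lab_TH[OF _ q] decomp_TH by blast
      next
        case False
        then have PS: "P \<subset> carrier S" using subgroup.subset[OF P] by auto
        show ?thesis
        proof (intro allI impI)
          fix f x assume Lf: "L P f x"
          have f: "mor P f" using lab_mor[OF Lf] .
          define Q where "Q = f ` P"
          have Q: "subgroup Q S" "card Q = card P" using mor_image[OF f] mor_card[OF f] by (auto simp: Q_def)
          have QS: "Q \<subset> carrier S" using subgroup.subset[OF Q(1)] Q(2) psubset_card_mono[OF finite_S PS] by auto
          obtain h k a where frames: "mor (nrm P) h" "mor (nrm Q) k" "fully_normalized S F (h ` P)" "k ` Q = h ` P"
            "a \<in> F (h ` P) (h ` P)" "a = restrict (\<lambda>z. k (f (inv_into P h z))) (h ` P)" "\<forall>z\<in>P. a (h z) = k (f z)"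
            by (rule fn_frames[OF f, folded Q_def])
          note h = frames(1,3) and k = frames(2,4) and aF' = frames(5) and a_def = frames(6) and ah = bspec[OF frames(7)]
          have QN: "Q \<subseteq> nrm Q" using subgroup_subset_nrm Q by auto
          have hP: "mor P h" by (rule mor_restrict[OF h(1) P PN(1)])
          have kQ: "mor Q k" by (rule mor_restrict[OF k(1) Q(1) QN])
          define P0 where "P0 = h ` P"
          have P0: "subgroup P0 S" "card P0 = card P" "fully_centralized S F P0" "quasicentric S F P0" "fully_normalized S F P0"
            using mor_image[OF hP] mor_card[OF hP] fn_fc[OF h(2)] quasicentric_conj[OF q hP] h by (auto simp: P0_def)
          have aF: "a \<in> F P0 P0" using aF' by (simp add: P0_def)
          have P0S: "P0 \<subset> carrier S" using subgroup.subset[OF P0(1)] P0(2) psubset_card_mono[OF finite_S PS] by auto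
          have big: "card P < card (nrm P)" "card P < card (nrm Q)" "card P < card (nrm P0)"
            using card_psubset[OF nrmS[OF P] nrm_strict[OF P PS]] card_psubset[OF nrmS[OF Q(1)] nrm_strict[OF Q(1) QS]]
              card_psubset[OF nrmS[OF P0(1)] nrm_strict[OF P0(1) P0S]] Q P0 by auto
          obtain w v where "L (nrm P) h w" "L (nrm Q) k v" using L_ex h(1) k(1) by meson
          then have "decomp (nrm P) h w" "decomp (nrm Q) k v" using IH nrmS P Q(1) big by blast+
          then have w: "decomp P h w" and v: "decomp Q k v" using decomp_restrict PN QN P Q(1) by blast+
          have wv: "w \<in> carrier \<Gamma>" "v \<in> carrier \<Gamma>" "x \<in> carrier \<Gamma>" using decomp_L(2) w v lab_carrier[OF Lf] by auto
          define l where "l = v \<otimes>\<^bsub>\<Gamma>\<^esub> (x \<otimes>\<^bsub>\<Gamma>\<^esub> inv\<^bsub>\<Gamma>\<^esub> w)"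
          have ih: "inv_into P h ` P0 = P" using inv_into_image[OF hP] by (simp add: P0_def)
          have "L P0 (inv_into P h) (inv\<^bsub>\<Gamma>\<^esub> w)" using L_inv[OF decomp_L(1)[OF w]] by (simp add: P0_def)
          then have "L P0 (\<lambda>z. f (inv_into P h z)) (x \<otimes>\<^bsub>\<Gamma>\<^esub> inv\<^bsub>\<Gamma>\<^esub> w)"
            by (rule lab_comp[OF Lf]) (use ih in auto)
          then have "L P0 (\<lambda>z. k (f (inv_into P h z))) l" unfolding l_def
            by (rule lab_comp[OF decomp_L(1)[OF v]]) (use ih in \<open>auto simp: Q_def\<close>)
          then have La: "L P0 a l" by (rule lab_cong) (simp add: a_def P0_def)
          interpret A: group "Aut_group F P0" by (rule Aut_group[OF P0(1)])
          have DA: "subgroup (F P0 P0) (Aut_group F P0)" using A.subgroup_self by simp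
          have e: "Aut_group F P0\<lparr>carrier := F P0 P0\<rparr> = Aut_group F P0" by (simp add: Aut_group_def)
          obtain n where n: "n \<in> F P0 P0" "L P0 n l" "\<And>g. g \<in> nrm P0 \<Longrightarrow> \<exists>g'\<in>nrm P0. \<forall>z\<in>P0. n (cj g z) = cj g' (n z)"
            using frattini[OF P0(1) nrmS[OF P0(1)] order_refl DA _ aF La] fn_automized[OF P0(5)]
            unfolding e automized_def by blast
          have nP0: "n ` P0 = P0" "mor P0 n" using n(1) aut_iff[OF P0(1)] by auto
          have "nrm P0 \<subseteq> Nx P0 n" unfolding Nx_def using n(3) nP0(1) by auto
          moreover obtain n' where n': "L (Nx P0 n) n' l" "\<And>z. z \<in> P0 \<Longrightarrow> n' z = n z"
            using labelled_extension[of n P0 l] n(2) nP0 P0(3) labels_extend_quasicentric[OF P0(3,4)] by auto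
          ultimately have "L (nrm P0) n' l" using lab_restrict nrmS[OF P0(1)] by blast
          then have "decomp (nrm P0) n' l" using IH nrmS[OF P0(1)] big by blast
          then have "decomp P0 n' l" using decomp_restrict P0(1) subgroup_subset_nrm by blast
          then have nd: "decomp P0 n l" by (rule decomp_cong) (rule n'(2))
          have lc: "l \<in> carrier \<Gamma>" using lab_carrier La by blast
          have "L P0 (inv_into P0 n) (inv\<^bsub>\<Gamma>\<^esub> l)" using L_inv[OF n(2)] nP0 by simp
          then have "L P0 (\<lambda>z. a (inv_into P0 n z)) (l \<otimes>\<^bsub>\<Gamma>\<^esub> inv\<^bsub>\<Gamma>\<^esub> l)"
            by (rule lab_comp[OF La]) (use inv_into_image[OF nP0(2)] nP0 in auto)
          then have "TH P0 (\<lambda>z. a (inv_into P0 n z)) \<one>\<^bsub>\<Gamma>\<^esub>" using lab_TH[OF _ P0(4)] lc by simp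
          then have cd: "decomp P0 (\<lambda>z. a (inv_into P0 n z)) \<one>\<^bsub>\<Gamma>\<^esub>" using decomp_L1 lab_gen by blast
          have "decomp P0 a (\<one>\<^bsub>\<Gamma>\<^esub> \<otimes>\<^bsub>\<Gamma>\<^esub> l)"
            by (rule decomp_comp[OF nd cd]) (use nP0 mor_inj[OF nP0(2)] in auto)
          then have ad: "decomp P0 a l" using lc by simp
          have ahd: "decomp P (\<lambda>z. k (f z)) (l \<otimes>\<^bsub>\<Gamma>\<^esub> w)"
            by (rule decomp_comp[OF w ad]) (use ah in \<open>auto simp: P0_def\<close>)
          have "decomp (k ` Q) (inv_into Q k) (inv\<^bsub>\<Gamma>\<^esub> v)" by (rule decomp_inv[OF v])
          then have "decomp P f (inv\<^bsub>\<Gamma>\<^esub> v \<otimes>\<^bsub>\<Gamma>\<^esub> (l \<otimes>\<^bsub>\<Gamma>\<^esub> w))"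
            by (rule decomp_comp[OF ahd]) (use mor_inj[OF kQ] in \<open>auto simp: Q_def\<close>)
          moreover have "l \<otimes>\<^bsub>\<Gamma>\<^esub> w = v \<otimes>\<^bsub>\<Gamma>\<^esub> x" using wv by (simp add: l_def T.H.m_assoc)
          then have "inv\<^bsub>\<Gamma>\<^esub> v \<otimes>\<^bsub>\<Gamma>\<^esub> (l \<otimes>\<^bsub>\<Gamma>\<^esub> w) = x" using wv by (simp add: T.H.m_assoc[symmetric])
          ultimately show "decomp P f x" by simp
        qed
      qed
    qed
  qed
  then show ?thesis using f by blast
qed

section \<open>The restrictive subcategory of a subgroup\<close>

text \<open>Although the factors of \<open>f\<close> may have labels outside \<open>H\<close>, \<open>decomp_all\<close> offers a composite in which only one
factor has a nontrivial label, namely \<open>x\<close>.\<close>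

lemma lab_of_L:
  assumes H: "subgroup H \<Gamma>" and f: "L P f x" and x: "x \<in> H" shows "lab H P f x"
proof -
  obtain \<alpha> \<psi> where a: "TH (carrier S) \<alpha> x" "L1 P \<psi> \<one>\<^bsub>\<Gamma>\<^esub>" "\<forall>z\<in>P. f z = \<alpha> (\<psi> z)"
    using decomp_all[OF f] by (auto simp: decomp_def)
  have "lab H P \<psi> \<one>\<^bsub>\<Gamma>\<^esub>" using lab_mono[OF a(2)] subgroup.one_closed[OF H] by simp
  then have "lab H P f (x \<otimes>\<^bsub>\<Gamma>\<^esub> \<one>\<^bsub>\<Gamma>\<^esub>)"
    by (rule lab_comp[OF lab_gen[OF a(1) x]]) (use a mor_carrier[OF lab_mor[OF a(2)]] in auto)
  then show ?thesis using lab_carrier[OF f] by simp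
qed

lemma F_bullet_facts:
  fixes H
  defines "X \<equiv> (\<lambda>P Q. {\<phi> \<in> quasicentric_category S F P Q. \<Theta> P Q \<phi> \<inter> H \<noteq> {}})"
  shows "restrictive_category S (F_bullet S F \<Theta> H)" "F_bullet S F \<Theta> H \<le> F" "X \<le> F_bullet S F \<Theta> H"
    "\<lbrakk>restrictive_category S C; C \<le> F; X \<le> C\<rbrakk> \<Longrightarrow> F_bullet S F \<Theta> H \<le> C"
proof -
  have "X \<le> F" by (auto simp: X_def le_fun_def qcat_iff)
  note s = smallest_restrictive[OF restrictive this]
  show "restrictive_category S (F_bullet S F \<Theta> H)" "F_bullet S F \<Theta> H \<le> F" "X \<le> F_bullet S F \<Theta> H"
    "\<lbrakk>restrictive_category S C; C \<le> F; X \<le> C\<rbrakk> \<Longrightarrow> F_bullet S F \<Theta> H \<le> C"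
    using s(1-3) s(4)[of C] unfolding F_bullet_def X_def by blast+
qed

text \<open>The right-hand side defines a restrictive category that contains the generators. Conversely, by \<open>lab_of_L\<close>
its morphisms are composites of restrictions of generators.\<close>

lemma F_bullet_iff:
  assumes H: "subgroup H \<Gamma>"
  shows "\<phi> \<in> F_bullet S F \<Theta> H P Q \<longleftrightarrow> \<phi> \<in> F P Q \<and> (\<exists>h\<in>H. L P \<phi> h)"
proof
  define C where "C = (\<lambda>P Q. {\<phi> \<in> F P Q. \<exists>h\<in>H. L P \<phi> h})"
  interpret R: restrictive_category S F by (rule restrictive)
  have "restrictive_category S C"
  proof (intro restrictive_category.intro subgroup_category.intro restrictive_category_axioms.intro)
    show "group S" by (rule group_S)
    show "C P Q \<subseteq> Inj S P Q" for P Q using homs_Inj by (auto simp: C_def)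
    show "(\<lambda>x\<in>P. x) \<in> C P P" if "subgroup P S" for P
      using id_mem[OF that] lab_id[OF that, of "\<lambda>x\<in>P. x"] subgroup.one_closed[OF H] by (auto simp: C_def)
    show "compose P \<psi> \<phi> \<in> C P R" if c: "\<phi> \<in> C P Q" "\<psi> \<in> C Q R" for \<phi> \<psi> P Q R
    proof -
      obtain h k where hk: "\<phi> \<in> F P Q" "\<psi> \<in> F Q R" "h \<in> H" "k \<in> H" "L P \<phi> h" "L Q \<psi> k" using c by (auto simp: C_def)
      have "L P (compose P \<psi> \<phi>) (k \<otimes>\<^bsub>\<Gamma>\<^esub> h)"
        by (rule lab_comp[OF hk(6,5)]) (use F_D(4)[OF hk(1)] in \<open>auto simp: compose_def\<close>)
      then show ?thesis using comp_mem[OF hk(1,2)] subgroup.m_closed[OF H hk(4,3)] by (auto simp: C_def)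
    qed
    show "restrict \<phi> P' \<in> C P' Q'"
      if c: "\<phi> \<in> C P Q" and "subgroup P' S" "P' \<subseteq> P" "subgroup Q' S" "Q' \<subseteq> Q" "\<phi> ` P' \<subseteq> Q'" for \<phi> P Q P' Q'
    proof -
      obtain h where h: "\<phi> \<in> F P Q" "h \<in> H" "L P \<phi> h" using c by (auto simp: C_def)
      have "L P' (restrict \<phi> P') h" using lab_cong[OF lab_restrict[OF h(3) that(2,3)]] by simp
      then show ?thesis using R.restrict_mem[OF h(1) that(2-6)] h(2) by (auto simp: C_def)
    qed
  qed
  moreover have "C \<le> F" by (auto simp: C_def le_fun_def)
  moreover have "(\<lambda>P Q. {\<phi> \<in> quasicentric_category S F P Q. \<Theta> P Q \<phi> \<inter> H \<noteq> {}}) \<le> C"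
  proof (intro le_funI subsetI)
    fix P Q \<phi> assume "\<phi> \<in> {\<phi> \<in> quasicentric_category S F P Q. \<Theta> P Q \<phi> \<inter> H \<noteq> {}}"
    then obtain h where h: "\<phi> \<in> quasicentric_category S F P Q" "h \<in> \<Theta> P Q \<phi>" "h \<in> H" by auto
    have F: "\<phi> \<in> F P Q" "quasicentric S F P" using h qcat_iff by auto
    have "TH P \<phi> h" using h \<Theta>_codomain[OF h(1)] F F_eq_mor[OF F_D(3)[OF F(1)]] by (auto simp: TH_def extensional_restrict)
    then have "L P \<phi> h" using lab_gen TH_carrier by blast
    then show "\<phi> \<in> C P Q" using F h by (auto simp: C_def)
  qed
  ultimately have le: "F_bullet S F \<Theta> H \<le> C" by (rule F_bullet_facts(4))
  show "\<phi> \<in> F P Q \<and> (\<exists>h\<in>H. L P \<phi> h)" if "\<phi> \<in> F_bullet S F \<Theta> H P Q"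
    using le that by (auto simp: C_def le_fun_def)
next
  let ?B = "F_bullet S F \<Theta> H"
  interpret B: restrictive_category S ?B by (rule F_bullet_facts(1))
  have gen: "restrict f P \<in> ?B P (carrier S)" if "lab H P f x" for P f x
    using that
  proof (induction rule: lab.induct)
    case (lab_id P f)
    have "restrict (\<lambda>x\<in>carrier S. x) P \<in> ?B P (carrier S)"
      by (rule B.restrict_mem[OF B.id_mem[OF subgroup_self] lab_id(1) subgroup.subset[OF lab_id(1)] subgroup_self])
         (use sub_carrier[OF lab_id(1)] in auto)
    moreover have "restrict (\<lambda>x\<in>carrier S. x) P = restrict f P"
      using lab_id sub_carrier by (auto simp: fun_eq_iff)
    ultimately show ?case by (simp only:)
  next
    case (lab_step P f x Q g y h)
    have Q: "subgroup Q S" "quasicentric S F Q" using lab_step(2) TH_quasi quasi_sub by auto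
    have P: "subgroup P S" using mor_subgroup[OF lab_mor[OF lab_step(1)]] .
    have "restrict g Q \<in> quasicentric_category S F Q (carrier S)" "y \<in> \<Theta> Q (carrier S) (restrict g Q)"
      using lab_step(2) mor_qcat by (auto simp: TH_def)
    then have "restrict g Q \<in> {\<phi> \<in> quasicentric_category S F Q (carrier S). \<Theta> Q (carrier S) \<phi> \<inter> H \<noteq> {}}"
      using lab_step(3) by auto
    then have g: "restrict g Q \<in> ?B Q (carrier S)" using F_bullet_facts(3)[of H] unfolding le_fun_def by blast
    have "restrict (restrict f P) P \<in> ?B P Q"
      by (rule B.restrict_mem[OF lab_step(6) P _ Q(1) subgroup.subset[OF Q(1)]]) (use lab_step(4) in auto)
    then have "compose P (restrict g Q) (restrict f P) \<in> ?B P (carrier S)" using B.comp_mem[OF _ g] by simp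
    moreover have "compose P (restrict g Q) (restrict f P) = restrict h P"
      using lab_step(4,5) by (auto simp: compose_def fun_eq_iff)
    ultimately show ?case by (simp only:)
  qed
  assume "\<phi> \<in> F P Q \<and> (\<exists>h\<in>H. L P \<phi> h)"
  then obtain h where h: "\<phi> \<in> F P Q" "h \<in> H" "L P \<phi> h" by auto
  have "restrict \<phi> P \<in> ?B P (carrier S)" by (rule gen[OF lab_of_L[OF H h(3,2)]])
  then have "restrict (restrict \<phi> P) P \<in> ?B P Q"
    by (rule B.restrict_mem) (use F_D[OF h(1)] subgroup.subset[OF F_D(3)[OF h(1)]] in auto)
  then show "\<phi> \<in> ?B P Q" using F_D(1)[OF h(1)] by (simp add: extensional_restrict)
qed

end

section \<open>Morphisms centralizing a subgroup\<close>

context prime_fusion_system begin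

text \<open>If \<open>u(z) = z v\<close> with \<open>v \<in> V\<close>, then \<open>u\<^sup>n(z) = z v\<^sup>n\<close> because \<open>u\<close> fixes \<open>v\<close>.\<close>

lemma stable_power:
  assumes R: "subgroup R S" and V: "subgroup V S" "V \<subseteq> R" and u: "u \<in> F R R"
    and fix_V: "\<And>z. z \<in> V \<Longrightarrow> u z = z" and mod_V: "\<And>z. z \<in> R \<Longrightarrow> inv z \<otimes> u z \<in> V"
  shows "u [^]\<^bsub>Aut_group F R\<^esub> order S = \<one>\<^bsub>Aut_group F R\<^esub>"
proof -
  interpret A: group "Aut_group F R" by (rule Aut_group[OF R])
  have uF: "u [^]\<^bsub>Aut_group F R\<^esub> n \<in> F R R" for n :: nat using A.nat_pow_closed[of u n] u by simp
  have m: "mor R u" using u aut_iff[OF R] by blast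
  have pw: "(u [^]\<^bsub>Aut_group F R\<^esub> n) z = z \<otimes> (inv z \<otimes> u z) [^] n" if z: "z \<in> R" for z and n :: nat
    using z
  proof (induction n)
    case 0
    then show ?case using sub_carrier[OF R] by (simp add: A.nat_pow_0)
  next
    case (Suc n)
    let ?v = "inv z \<otimes> u z"
    have c: "z \<in> carrier S" "?v \<in> carrier S" "?v \<in> V" "u z \<in> R" "u z \<in> carrier S"
      using Suc sub_carrier[OF R] mod_V sub_carrier[OF V(1)] F_D(4)[OF u] by auto
    have vn: "?v [^] n \<in> V" for n :: nat
      by (induction n) (use c V in \<open>auto intro: subgroup.one_closed subgroup.m_closed\<close>)
    have uz: "u z = z \<otimes> ?v" using c by (simp add: m_assoc[symmetric])
    have "u [^]\<^bsub>Aut_group F R\<^esub> Suc n = u \<otimes>\<^bsub>Aut_group F R\<^esub> (u [^]\<^bsub>Aut_group F R\<^esub> n)"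
      using A.nat_pow_Suc2[of u n] u by simp
    then have "(u [^]\<^bsub>Aut_group F R\<^esub> Suc n) z = u ((u [^]\<^bsub>Aut_group F R\<^esub> n) z)"
      using Aut_mult[OF R u uF] Suc by (simp add: compose_def)
    also have "\<dots> = u z \<otimes> ?v [^] n"
      using Suc vn[of n] V mor_mult[OF m] fix_V by auto
    also have "u z \<otimes> ?v [^] n = z \<otimes> ?v \<otimes> ?v [^] n" using uz by (rule arg_cong)
    also have "\<dots> = z \<otimes> (?v \<otimes> ?v [^] n)" using c by (intro m_assoc nat_pow_closed)
    also have "?v \<otimes> ?v [^] n = ?v [^] Suc n" using nat_pow_Suc2[OF c(2)] by (rule sym)
    finally show ?case .
  qed
  show ?thesis
  proof (rule extensionalityI[of _ R])
    show "u [^]\<^bsub>Aut_group F R\<^esub> order S \<in> extensional R" using F_D(1)[OF uF] .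
    fix z assume z: "z \<in> R"
    have c: "z \<in> carrier S" "inv z \<otimes> u z \<in> carrier S"
      using z sub_carrier[OF R] mod_V sub_carrier[OF V(1)] by auto
    then show "(u [^]\<^bsub>Aut_group F R\<^esub> order S) z = \<one>\<^bsub>Aut_group F R\<^esub> z"
      using pw[OF z] pow_order_eq_1[OF c(2)] z by simp
  qed simp
qed

lemma card_p_of_exponent:
  assumes R: "subgroup R S" and U: "subgroup U (Aut_group F R)"
    and e: "\<And>u. u \<in> U \<Longrightarrow> u [^]\<^bsub>Aut_group F R\<^esub> (p ^ m) = \<one>\<^bsub>Aut_group F R\<^esub>"
  shows "\<exists>k. card U = p ^ k"
proof -
  interpret A: group "Aut_group F R" by (rule Aut_group[OF R])
  interpret U: group "Aut_group F R\<lparr>carrier := U\<rparr>" by (rule A.subgroup_imp_group[OF U])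
  have "finite U" using subgroup.subset[OF U] Aut_finite[OF R] finite_subset by auto
  moreover have "u [^]\<^bsub>Aut_group F R\<lparr>carrier := U\<rparr>\<^esub> (p ^ m) = \<one>\<^bsub>Aut_group F R\<^esub>" if "u \<in> U" for u
    using e[OF that] A.nat_pow_consistent[of u "p ^ m" U] by simp
  ultimately show ?thesis
    using U.prime_power_orders_imp_p_group[OF prime_p, of m] by (simp add: order_def)
qed

definition fixing_auts :: "'a set \<Rightarrow> 'a set \<Rightarrow> ('a \<Rightarrow> 'a) set" where
  "fixing_auts P R = {a \<in> F R R. \<forall>z\<in>P. a z = z}"

text \<open>The Sylow condition for \<open>R\<close> in the centralizer of \<open>P\<close>, for \<open>P \<le> R \<le> P C\<^sub>S(P)\<close>.\<close>

abbreviation cen_automized :: "'a set \<Rightarrow> 'a set \<Rightarrow> bool" where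
  "cen_automized P R \<equiv>
     sylow_subgroup p (Aut_group F R\<lparr>carrier := fixing_auts P R\<rparr>) (conj_auts R (cen P \<inter> nrm R))"

lemma inv_into_fix: "mor R f \<Longrightarrow> P \<subseteq> R \<Longrightarrow> (\<And>z. z \<in> P \<Longrightarrow> f z = z) \<Longrightarrow> z \<in> P \<Longrightarrow> inv_into R f z = z"
  using mor_inj by (metis inv_into_f_f subsetD)

lemma fixing_auts_subgroup:
  assumes R: "subgroup R S" and P: "P \<subseteq> R"
  shows "subgroup (fixing_auts P R) (Aut_group F R)"
proof (rule aut_subgroupI[OF R])
  show "(\<lambda>x\<in>R. x) \<in> fixing_auts P R" using id_mem[OF R] P by (auto simp: fixing_auts_def)
  show "compose R a b \<in> fixing_auts P R" if "a \<in> fixing_auts P R" "b \<in> fixing_auts P R" for a b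
    using that comp_mem P by (auto simp: fixing_auts_def compose_def)
  show "restrict (inv_into R a) R \<in> fixing_auts P R" if a: "a \<in> fixing_auts P R" for a
  proof -
    have "a \<in> F R R" "mor R a" "\<And>z. z \<in> P \<Longrightarrow> a z = z" using a aut_iff[OF R] by (auto simp: fixing_auts_def)
    then show ?thesis using inv_into_aut[OF R] inv_into_fix[of R a P] P by (auto simp: fixing_auts_def)
  qed
qed (auto simp: fixing_auts_def)

lemma fix_image: "(\<And>z. z \<in> P \<Longrightarrow> f z = z) \<Longrightarrow> f ` P = P" by force

lemma fix_PC: "mor R f \<Longrightarrow> subgroup P S \<Longrightarrow> P \<subseteq> R \<Longrightarrow> R \<subseteq> P <#> cen P \<Longrightarrow> f ` P = P \<Longrightarrow> f ` R \<subseteq> P <#> cen P"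
  using mor_PC by metis

lemma cenR_subgroup: "subgroup P S \<Longrightarrow> subgroup R S \<Longrightarrow> subgroup (cen P \<inter> nrm R) S"
  by (rule subgroups_Inter_pair[OF cenS nrmS])

text \<open>Normalizers grow in \<open>P C\<^sub>S(P)\<close>, and modulo \<open>P \<le> R\<close> the new elements can be taken from \<open>C\<^sub>S(P)\<close>.\<close>

lemma cenR_grows:
  assumes P: "subgroup P S" and R: "subgroup R S" "P \<subseteq> R" "R \<subset> P <#> cen P"
  shows "subgroup (R <#> (cen P \<inter> nrm R)) S" "R \<subset> R <#> (cen P \<inter> nrm R)" "R <#> (cen P \<inter> nrm R) \<subseteq> P <#> cen P"
proof -
  let ?C = "cen P \<inter> nrm R"
  have C: "subgroup ?C S" by (rule cenR_subgroup[OF P R(1)])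
  show "subgroup (R <#> ?C) S" by (rule subgroup_set_mult[OF R(1) C]) simp
  show "R <#> ?C \<subseteq> P <#> cen P"
    by (rule set_mult_least[OF subgroup_PC[OF P]]) (use R C_le_PC[OF P] in auto)
  obtain g where g: "g \<in> P <#> cen P" "g \<notin> R" "g \<in> nrm R" using nrm_grows[OF R(1) subgroup_PC[OF P] R(3)] by blast
  obtain u c where uc: "u \<in> P" "c \<in> cen P" "g = u \<otimes> c" using g by (auto simp: set_mult_def)
  have car: "u \<in> carrier S" "c \<in> carrier S" using uc sub_carrier[OF P] cen_carrier by auto
  have uR: "u \<in> R" "u \<in> nrm R" using uc R subgroup_subset_nrm[OF R(1)] by auto
  have "c = inv u \<otimes> g" using uc car by (simp add: m_assoc[symmetric])
  then have "c \<in> nrm R" using uR g nrmS[OF R(1)] by (simp add: subgroup.m_closed subgroup.m_inv_closed)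
  moreover have "c \<notin> R" using uc uR g subgroup.m_closed[OF R(1)] by auto
  moreover have "R \<subseteq> R <#> ?C" "?C \<subseteq> R <#> ?C" using set_mult_left[OF R(1) C] set_mult_right[OF R(1) C] by auto
  ultimately show "R \<subset> R <#> ?C" using uc by auto
qed

text \<open>This is \<open>conj_into_sylow\<close> for the group of automorphisms that fix \<open>P\<close>, so that \<open>f'\<close> still fixes \<open>P\<close>.\<close>

lemma fixing_conj_into:
  assumes P: "P \<subseteq> R" and R: "subgroup R S" and f: "mor R f" "\<And>z. z \<in> P \<Longrightarrow> f z = z"
    and T: "cen_automized P (f ` R)"
    and sP: "subgroup P S"
  obtains f' where "mor R f'" "f' ` R = f ` R" "\<And>z. z \<in> P \<Longrightarrow> f' z = z"
    "\<And>g. g \<in> cen P \<inter> nrm R \<Longrightarrow> \<exists>g'\<in>cen P \<inter> nrm (f ` R). \<forall>z\<in>R. f' (cj g z) = cj g' (f' z)"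
proof -
  have fR: "subgroup (f ` R) S" using mor_image f by blast
  have PfR: "P \<subseteq> f ` R" using P f(2) by force
  note D = fixing_auts_subgroup[OF fR PfR]
  let ?U = "conj_auts R (cen P \<inter> nrm R)"
  note U = conj_auts_p_subgroup[OF R cenR_subgroup[OF sP R] Int_lower2]
  obtain k where k: "card ?U = p ^ k" using U(2) by blast
  interpret c: group_hom "Aut_group F R" "Aut_group F (f ` R)" "\<lambda>u. restrict (\<lambda>y. f (u (inv_into R f y))) (f ` R)"
    by (rule conj_aut_hom(1)[OF f(1)])
  have UF: "?U \<subseteq> F R R" using subgroup.subset[OF U(1)] by simp
  obtain a where a: "a \<in> fixing_auts P (f ` R)"
    "\<And>u. u \<in> ?U \<Longrightarrow> \<exists>t\<in>conj_auts (f ` R) (cen P \<inter> nrm (f ` R)). \<forall>x\<in>R. a (f (u x)) = t (a (f x))"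
  proof (rule conj_into_sylow[OF f(1) D T U(1) k])
    fix u assume u: "u \<in> ?U"
    then obtain g where g: "g \<in> cen P" "u = restrict (cj g) R" by (auto simp: conj_auts_def)
    have "f (u (inv_into R f z)) = z" if z: "z \<in> P" for z
      using inv_into_fix[OF f(1) P f(2) z] z P g cen_cj[OF g(1) z] f(2) by auto
    then show "(\<lambda>y\<in>f ` R. f (u (inv_into R f y))) \<in> fixing_auts P (f ` R)"
      using c.hom_closed[of u] u UF PfR by (auto simp: fixing_auts_def)
  qed (use that in blast)
  have a': "mor (f ` R) a" "a ` f ` R = f ` R" "\<And>z. z \<in> P \<Longrightarrow> a z = z" "a \<in> F (f ` R) (f ` R)"
    using a aut_iff[OF fR] by (auto simp: fixing_auts_def)
  show ?thesis
  proof (rule that[of "\<lambda>x. a (f x)"])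
    show "mor R (\<lambda>x. a (f x))" by (rule mor_comp[OF f(1) a'(1)]) simp
    have "(\<lambda>x. a (f x)) ` R = a ` f ` R" by (simp only: image_image)
    then show "(\<lambda>x. a (f x)) ` R = f ` R" using a' by simp
    show "a (f z) = z" if "z \<in> P" for z using a'(3) f(2) that by simp
    show "\<exists>g'\<in>cen P \<inter> nrm (f ` R). \<forall>z\<in>R. a (f (cj g z)) = cj g' (a (f z))" if g: "g \<in> cen P \<inter> nrm R" for g
    proof -
      have "restrict (cj g) R \<in> ?U" using g by (auto simp: conj_auts_def)
      then obtain t where t: "t \<in> conj_auts (f ` R) (cen P \<inter> nrm (f ` R))" "\<forall>x\<in>R. a (f (restrict (cj g) R x)) = t (a (f x))"
        using a(2) by blast
      obtain g' where g': "g' \<in> cen P \<inter> nrm (f ` R)" "t = restrict (cj g') (f ` R)" using t(1) by (auto simp: conj_auts_def)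
      have "a (f x) \<in> f ` R" if "x \<in> R" for x using a'(2) that by blast
      then show ?thesis using t(2) g' by (intro bexI[of _ g']) auto
    qed
  qed
qed

end

context fusion_triple begin

text \<open>The part of receptivity of \<open>R1\<close> in the centralizer of \<open>P\<close> that Alperin's theorem needs, with labels.\<close>

definition cen_extends :: "'a set \<Rightarrow> 'a set \<Rightarrow> bool" where
  "cen_extends P R1 \<longleftrightarrow> (\<forall>R f x. L R f x \<longrightarrow> f ` R = R1 \<longrightarrow> P \<subseteq> R \<longrightarrow> R \<subseteq> P <#> cen P \<longrightarrow> (\<forall>z\<in>P. f z = z) \<longrightarrow>
     (\<forall>g\<in>cen P \<inter> nrm R. \<exists>g'\<in>cen P \<inter> nrm R1. \<forall>z\<in>R. f (cj g z) = cj g' (f z)) \<longrightarrow>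
     (\<exists>h. L (R <#> (cen P \<inter> nrm R)) h x \<and> (\<forall>z\<in>R. h z = f z)))"

text \<open>Every \<open>R\<close> between \<open>P\<close> and \<open>P C\<^sub>S(P)\<close> has a conjugate under maps fixing \<open>P\<close> that is fully automized and
receptive in the centralizer of \<open>P\<close>. To find it, let \<open>\<chi>\<close> map \<open>R\<close> to a fully normalized \<open>R\<^sub>0\<close> so that a Sylow
subgroup \<open>U\<close> of the automorphisms fixing \<open>P\<close> becomes a group of conjugations, and bring \<open>P\<^sub>0 = \<chi>(P)\<close> back to
\<open>P\<close> by an extension \<open>\<rho>\<close> of \<open>(\<chi>|\<^bsub>P\<^esub>)\<^sup>-\<^sup>1\<close> to \<open>P\<^sub>0 C\<^sub>S(P\<^sub>0)\<close>. Then \<open>\<kappa> = \<rho> \<chi>\<close> carries \<open>U\<close> into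
conjugations by elements of \<open>C\<^sub>S(P)\<close>, and maps onto \<open>\<kappa>(R)\<close> are extended with their labels by passing to \<open>R\<^sub>0\<close>
and back through \<open>\<rho>\<close>.\<close>

lemma cen_full_exists:
  assumes fc: "fully_centralized S F P" and R: "subgroup R S" "P \<subseteq> R" "R \<subseteq> P <#> cen P"
    and above: "\<And>R0. fully_normalized S F R0 \<Longrightarrow> card R0 = card R \<Longrightarrow> labels_extend R0"
  obtains \<kappa> where "mor R \<kappa>" "\<And>z. z \<in> P \<Longrightarrow> \<kappa> z = z"
    "cen_automized P (\<kappa> ` R)"
    "cen_extends P (\<kappa> ` R)"
proof -
  have P: "subgroup P S" using fc by (rule fc_sub)
  let ?A = "Aut_group F R\<lparr>carrier := fixing_auts P R\<rparr>"
  interpret A: group "Aut_group F R" by (rule Aut_group[OF R(1)])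
  note DR = fixing_auts_subgroup[OF R(1,2)]
  interpret AD: group ?A by (rule A.subgroup_imp_group[OF DR])
  have DF: "fixing_auts P R \<subseteq> F R R" by (auto simp: fixing_auts_def)
  have fD: "finite (fixing_auts P R)" using DF Aut_finite[OF R(1)] finite_subset by blast
  obtain U where U: "sylow_subgroup p ?A U" using sylow_exists[OF prime_p AD.is_group] fD by auto
  then have U': "subgroup U ?A" "card U = p ^ multiplicity p (order ?A)" by (auto simp: sylow_subgroup_def)
  have UD: "U \<subseteq> fixing_auts P R" using subgroup.subset[OF U'(1)] by simp
  have UA: "subgroup U (Aut_group F R)" by (rule A.incl_subgroup[OF DR U'(1)])
  obtain \<chi> where \<chi>: "mor R \<chi>" "fully_normalized S F (\<chi> ` R)"
    "\<And>u. u \<in> U \<Longrightarrow> \<exists>g\<in>nrm (\<chi> ` R). \<forall>x\<in>R. \<chi> (u x) = cj g (\<chi> x)"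
    using fn_p_subgroup[OF R(1) UA U'(2)] by blast
  define R0 where "R0 = \<chi> ` R"
  define P0 where "P0 = \<chi> ` P"
  have \<chi>P: "mor P \<chi>" by (rule mor_restrict[OF \<chi>(1) P R(2)])
  have P0: "subgroup P0 S" "P0 \<subseteq> R0" using mor_image[OF \<chi>P] R(2) by (auto simp: P0_def R0_def)
  have R0: "subgroup R0 S" "card R0 = card R" "R0 \<subseteq> P0 <#> cen P0"
    using mor_image[OF \<chi>(1)] mor_card[OF \<chi>(1)] mor_PC[OF \<chi>(1) P R(2,3)] by (auto simp: P0_def R0_def)
  let ?N0 = "P0 <#> cen P0"
  obtain \<rho> where \<rho>: "mor ?N0 \<rho>" "\<And>x. x \<in> P0 \<Longrightarrow> \<rho> x = inv_into P \<chi> x"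
    using fc_extend_PC[OF mor_inv_into[OF \<chi>P]] inv_into_image[OF \<chi>P] fc by (metis P0_def)
  have \<rho>\<chi>: "\<rho> (\<chi> z) = z" if "z \<in> P" for z using \<rho>(2)[of "\<chi> z"] that mor_inj[OF \<chi>P] by (simp add: P0_def)
  have \<rho>P0: "\<rho> ` P0 = P" using \<rho>\<chi> by (force simp: P0_def)
  have \<rho>R0: "mor R0 \<rho>" by (rule mor_restrict[OF \<rho>(1) R0(1,3)])
  define \<kappa> where "\<kappa> = (\<lambda>z. \<rho> (\<chi> z))"
  have \<kappa>: "mor R \<kappa>" unfolding \<kappa>_def by (rule mor_comp[OF \<chi>(1) \<rho>R0]) (simp add: R0_def)
  have \<kappa>P: "\<kappa> z = z" if "z \<in> P" for z using \<rho>\<chi> that by (simp add: \<kappa>_def)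
  define R1 where "R1 = \<kappa> ` R"
  have R1: "subgroup R1 S" using mor_image[OF \<kappa>] by (simp add: R1_def)
  have R1\<rho>: "R1 = \<rho> ` R0" by (auto simp: R1_def R0_def \<kappa>_def)
  have PR1: "P \<subseteq> R1" using \<kappa>P R(2) by (force simp: R1_def)
  interpret B: group "Aut_group F R1" by (rule Aut_group[OF R1])
  note D1 = fixing_auts_subgroup[OF R1 PR1]
  let ?B = "Aut_group F R1\<lparr>carrier := fixing_auts P R1\<rparr>"
  interpret BD: group ?B by (rule B.subgroup_imp_group[OF D1])
  have D1F: "fixing_auts P R1 \<subseteq> F R1 R1" by (auto simp: fixing_auts_def)
  have fD1: "finite (fixing_auts P R1)" using D1F Aut_finite[OF R1] finite_subset by blast
  have i: "mor R1 (inv_into R \<kappa>)" "inv_into R \<kappa> ` R1 = R" using mor_inv_into[OF \<kappa>] inv_into_image[OF \<kappa>] by (auto simp: R1_def)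
  have iP: "inv_into R \<kappa> z = z" if "z \<in> P" for z by (rule inv_into_fix[OF \<kappa> R(2) \<kappa>P that])
  \<comment> \<open>\<open>U\<close> has the largest possible order also in the isomorphic group of automorphisms of \<open>R1\<close>.\<close>
  have leU: "card W \<le> card U" if W: "subgroup W ?B" "card W = p ^ j" for W j
  proof -
    have WD: "W \<subseteq> fixing_auts P R1" using subgroup.subset[OF W(1)] by simp
    have WB: "subgroup W (Aut_group F R1)" by (rule B.incl_subgroup[OF D1 W(1)])
    define d where "d = (\<lambda>u. restrict (\<lambda>y. inv_into R \<kappa> (u (inv_into R1 (inv_into R \<kappa>) y))) R)"
    have d: "group_hom (Aut_group F R1) (Aut_group F R) d" "inj_on d (F R1 R1)"
      using conj_aut_hom(1,2)[OF i(1)] i(2) by (auto simp: d_def)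
    have dap: "d u (inv_into R \<kappa> x) = inv_into R \<kappa> (u x)" if "u \<in> F R1 R1" "x \<in> R1" for u x
      using conj_aut_hom(3)[OF i(1) that] i(2) by (simp add: d_def)
    interpret d: group_hom "Aut_group F R1" "Aut_group F R" d by (rule d(1))
    have dW: "subgroup (d ` W) (Aut_group F R)" by (rule d.subgroup_img_is_subgroup[OF WB])
    have "d w \<in> fixing_auts P R" if w: "w \<in> W" for w
    proof -
      have wF: "w \<in> F R1 R1" "\<And>z. z \<in> P \<Longrightarrow> w z = z" using w WD by (auto simp: fixing_auts_def)
      have "d w z = z" if "z \<in> P" for z using dap[OF wF(1), of z] wF(2) iP that PR1 by auto
      then show ?thesis using d.hom_closed[of w] wF by (simp add: fixing_auts_def)
    qed
    then have "subgroup (d ` W) ?A" using A.subgroup_incl[OF dW DR] by blast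
    moreover have "card (d ` W) = card W" using d(2) WD D1F by (meson card_image inj_on_subset order_trans)
    ultimately show ?thesis
      using p_subgroup_card_le_sylow[OF prime_p AD.is_group, of "d ` W" j] fD W(2) U'(2) by simp
  qed
  let ?T = "conj_auts R1 (cen P \<inter> nrm R1)"
  note T = conj_auts_p_subgroup[OF R1 cenR_subgroup[OF P R1] Int_lower2]
  obtain k where k: "card ?T = p ^ k" using T(2) by blast
  have TD: "?T \<subseteq> fixing_auts P R1"
  proof
    fix t assume t: "t \<in> ?T"
    have "t \<in> F R1 R1" using t subgroup.subset[OF T(1)] by auto
    then show "t \<in> fixing_auts P R1" using t PR1 cen_cj by (auto simp: fixing_auts_def conj_auts_def)
  qed
  have TB: "subgroup ?T ?B" by (rule B.subgroup_incl[OF T(1) D1 TD])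
  define c where "c = (\<lambda>u. restrict (\<lambda>y. \<kappa> (u (inv_into R \<kappa> y))) R1)"
  have c: "inj_on c (F R R)" using conj_aut_hom(2)[OF \<kappa>] by (simp add: c_def R1_def)
  have cap: "c u (\<kappa> x) = \<kappa> (u x)" if "u \<in> F R R" "x \<in> R" for u x
    using conj_aut_hom(3)[OF \<kappa> that] by (simp add: c_def R1_def)
  \<comment> \<open>As \<open>u\<close> fixes \<open>P\<close>, the element that realizes it on \<open>R0\<close> centralizes \<open>P0\<close> and lies in the domain of \<open>\<rho>\<close>.\<close>
  have cU: "\<exists>g\<in>nrm R0. \<rho> g \<in> cen P \<inter> nrm R1 \<and> (\<forall>x\<in>R. \<chi> (u x) = cj g (\<chi> x)) \<and> c u = restrict (cj (\<rho> g)) R1"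
    if u: "u \<in> U" for u
  proof -
    obtain g where g: "g \<in> nrm R0" "\<forall>x\<in>R. \<chi> (u x) = cj g (\<chi> x)" using \<chi>(3)[OF u] by (auto simp: R0_def)
    have uF: "u \<in> F R R" "\<And>z. z \<in> P \<Longrightarrow> u z = z" using u UD by (auto simp: fixing_auts_def)
    have "cj g y = y" if y: "y \<in> P0" for y
    proof -
      obtain x where x: "x \<in> P" "y = \<chi> x" using y by (auto simp: P0_def)
      then have "\<chi> (u x) = cj g (\<chi> x)" using g(2) R(2) by blast
      then show ?thesis using x uF(2) by simp
    qed
    then have gC: "g \<in> cen P0" using g(1) nrm_carrier by (auto simp: cen_def)
    then have gN: "g \<in> ?N0" using C_le_PC[OF P0(1)] by auto
    have "\<rho> g \<in> cen P" using mor_cen[OF \<rho>(1) P_le_PC[OF P0(1)] gN gC] \<rho>P0 by simp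
    moreover have "\<rho> g \<in> nrm R1" using mor_nrm[OF \<rho>(1) R0(3) gN g(1)] R1\<rho> by simp
    moreover have "c u = restrict (cj (\<rho> g)) R1"
    proof
      fix y show "c u y = restrict (cj (\<rho> g)) R1 y"
      proof (cases "y \<in> R1")
        case True
        then obtain x where x: "x \<in> R" "y = \<kappa> x" by (auto simp: R1_def)
        have "c u y = \<rho> (\<chi> (u x))" using cap[OF uF(1) x(1)] x by (simp add: \<kappa>_def)
        also have "\<dots> = \<rho> (cj g (\<chi> x))" using g(2) x by simp
        also have "\<dots> = cj (\<rho> g) (\<rho> (\<chi> x))" using mor_cj[OF \<rho>(1) gN, of "\<chi> x"] R0(3) x by (auto simp: R0_def)
        finally show ?thesis using x True by (simp add: \<kappa>_def)
      qed (simp add: c_def)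
    qed
    ultimately show ?thesis using g by blast
  qed
  have cUT: "c ` U \<subseteq> ?T"
  proof
    fix t assume "t \<in> c ` U"
    then obtain u where u: "u \<in> U" "t = c u" by auto
    obtain g where "\<rho> g \<in> cen P \<inter> nrm R1" "c u = restrict (cj (\<rho> g)) R1" using cU[OF u(1)] by blast
    then show "t \<in> ?T" using u by (simp add: conj_auts_def)
  qed
  have ccard: "card (c ` U) = card U" using c UD DF by (meson card_image inj_on_subset order_trans)
  have fT: "finite ?T" using TD fD1 finite_subset by blast
  have "card U \<le> card ?T" using card_mono[OF fT cUT] ccard by simp
  have cUeq: "c ` U = ?T" by (rule card_seteq[OF fT cUT]) (use leU[OF TB k] ccard in simp)
  obtain V where V: "sylow_subgroup p ?B V" using sylow_exists[OF prime_p BD.is_group] fD1 by auto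
  then have "subgroup V ?B" "card V = p ^ multiplicity p (order ?B)" by (auto simp: sylow_subgroup_def)
  then have "card V \<le> card ?T" using leU[of V] \<open>card U \<le> card ?T\<close> by (meson order_trans)
  then have syl: "sylow_subgroup p ?B ?T"
    using sylow_if_card_ge[OF prime_p BD.is_group _ TB k V] fD1 by simp
  have "cen_extends P R1"
    unfolding cen_extends_def
  proof (intro allI impI)
    fix R' f x
    assume f: "L R' f x" "f ` R' = R1" and R': "P \<subseteq> R'" "R' \<subseteq> P <#> cen P" and fP: "\<forall>z\<in>P. f z = z"
      and nor: "\<forall>g\<in>cen P \<inter> nrm R'. \<exists>g'\<in>cen P \<inter> nrm R1. \<forall>z\<in>R'. f (cj g z) = cj g' (f z)"
    have mf: "mor R' f" using lab_mor[OF f(1)] .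
    have sR': "subgroup R' S" using mor_subgroup[OF mf] .
    have xc: "x \<in> carrier \<Gamma>" using lab_carrier[OF f(1)] .
    obtain r where r: "L ?N0 \<rho> r" using L_ex[OF \<rho>(1)] by blast
    have rc: "r \<in> carrier \<Gamma>" using lab_carrier[OF r] .
    let ?i = "inv_into R0 \<rho>"
    define f0 where "f0 = (\<lambda>z. ?i (f z))"
    have rR0: "L R0 \<rho> r" by (rule lab_restrict[OF r R0(1,3)])
    have f0: "L R' f0 (inv\<^bsub>\<Gamma>\<^esub> r \<otimes>\<^bsub>\<Gamma>\<^esub> x)" unfolding f0_def
      by (rule L_div[OF rR0 _ f(1)]) (use f(2) R1\<rho> in auto)
    have iim: "?i ` R1 = R0" using inv_into_image[OF \<rho>R0] R1\<rho> by simp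
    have "f0 ` R' = ?i ` f ` R'" unfolding f0_def by (simp only: image_image)
    then have f0R: "f0 ` R' = R0" using f(2) iim by simp
    have \<rho>f0: "\<rho> (f0 z) = f z" if "z \<in> R'" for z
      using that f(2) R1\<rho> by (auto simp: f0_def intro!: f_inv_into_f)
    have i\<kappa>: "?i (\<kappa> w) = \<chi> w" if "w \<in> R" for w
      using that mor_inj[OF \<rho>R0] by (simp add: \<kappa>_def R0_def)
    have i\<rho>: "?i (\<rho> y) = y" if "y \<in> R0" for y using that mor_inj[OF \<rho>R0] by simp
    let ?X = "cen P \<inter> nrm R'"
    have sub: "?X \<subseteq> Nx R' f0"
    proof
      fix g assume g: "g \<in> ?X"
      obtain g' where g': "g' \<in> cen P \<inter> nrm R1" "\<forall>z\<in>R'. f (cj g z) = cj g' (f z)" using nor g by blast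
      then have "restrict (cj g') R1 \<in> c ` U" using cUeq by (simp add: conj_auts_def)
      then obtain u where u: "u \<in> U" "c u = restrict (cj g') R1" by auto
      obtain g0 where g0: "g0 \<in> nrm R0" "\<forall>x\<in>R. \<chi> (u x) = cj g0 (\<chi> x)" using cU[OF u(1)] by blast
      have uF: "u \<in> F R R" using u UD DF by auto
      have "f0 (cj g z) = cj g0 (f0 z)" if z: "z \<in> R'" for z
      proof -
        have "f z \<in> R1" using z f(2) by auto
        then obtain w where w: "w \<in> R" "f z = \<kappa> w" by (auto simp: R1_def)
        have "f (cj g z) = c u (\<kappa> w)" using g'(2) z u(2) w \<open>f z \<in> R1\<close> by simp
        also have "\<dots> = \<kappa> (u w)" by (rule cap[OF uF w(1)])
        finally have "f0 (cj g z) = \<chi> (u w)" using i\<kappa>[of "u w"] F_D(4)[OF uF] w(1) by (auto simp: f0_def)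
        also have "\<dots> = cj g0 (f0 z)" using g0(2) w i\<kappa> by (simp add: f0_def)
        finally show ?thesis .
      qed
      then show "g \<in> Nx R' f0" using g g0(1) f0R by (auto simp: Nx_def)
    qed
    have mf0: "mor R' f0" using lab_mor[OF f0] .
    have C': "subgroup ?X S" by (rule cenR_subgroup[OF P sR'])
    let ?K = "R' <#> ?X"
    have K: "subgroup ?K S" by (rule subgroup_set_mult[OF sR' C']) simp
    have KN: "?K \<subseteq> P <#> cen P" by (rule set_mult_least[OF subgroup_PC[OF P] R'(2)]) (use C_le_PC[OF P] in auto)
    have KNx: "?K \<subseteq> Nx R' f0" by (rule set_mult_least[OF Nx_subgroup[OF mf0] Nx_superset[OF mf0] sub])
    have R'K: "R' \<subseteq> ?K" by (rule set_mult_left[OF sR' C'])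
    have fnR0: "fully_normalized S F R0" using \<chi>(2) by (simp add: R0_def)
    obtain e where e: "L (Nx R' f0) e (inv\<^bsub>\<Gamma>\<^esub> r \<otimes>\<^bsub>\<Gamma>\<^esub> x)" "\<And>z. z \<in> R' \<Longrightarrow> e z = f0 z"
      using labelled_extension[of f0 R'] f0 f0R fn_fc[OF fnR0] above[OF fnR0 R0(2)] by metis
    have eK: "L ?K e (inv\<^bsub>\<Gamma>\<^esub> r \<otimes>\<^bsub>\<Gamma>\<^esub> x)" by (rule lab_restrict[OF e(1) K KNx])
    have "e z = \<chi> z" if z: "z \<in> P" for z
    proof -
      have "e z = f0 z" using e(2) z R'(1) by auto
      also have "\<dots> = ?i (\<kappa> z)" using fP \<kappa>P z by (simp add: f0_def)
      finally show ?thesis using i\<kappa> z R(2) by auto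
    qed
    then have "e ` P = P0" by (auto simp: P0_def)
    then have "e ` ?K \<subseteq> ?N0" using mor_PC[OF lab_mor[OF eK] P _ KN] R'(1) R'K by auto
    then have "L ?K (\<lambda>z. \<rho> (e z)) (r \<otimes>\<^bsub>\<Gamma>\<^esub> (inv\<^bsub>\<Gamma>\<^esub> r \<otimes>\<^bsub>\<Gamma>\<^esub> x))" by (rule lab_comp[OF r eK]) simp
    moreover have "r \<otimes>\<^bsub>\<Gamma>\<^esub> (inv\<^bsub>\<Gamma>\<^esub> r \<otimes>\<^bsub>\<Gamma>\<^esub> x) = x" using rc xc by (simp add: T.H.m_assoc[symmetric])
    ultimately have "L ?K (\<lambda>z. \<rho> (e z)) x" by metis
    moreover have "\<rho> (e z) = f z" if "z \<in> R'" for z using e(2) \<rho>f0 that by simp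
    ultimately show "\<exists>h. L ?K h x \<and> (\<forall>z\<in>R'. h z = f z)" by blast
  qed
  then show ?thesis using that \<kappa> \<kappa>P syl by (simp add: R1_def)
qed

text \<open>Alperin's fusion theorem in the centralizer of \<open>P\<close> as an induction principle for a property \<open>\<G>\<close> of labelled
maps that fix \<open>P\<close>. Such a map on \<open>R < P C\<^sub>S(P)\<close> is compared with an automorphism of the conjugate \<open>R\<^sub>1\<close>
of \<open>cen_full_exists\<close>. The comparison maps extend to larger subgroups, and so do the automorphisms of \<open>R\<^sub>1\<close>
that normalize its group of conjugations by \<open>C\<^sub>S(P)\<close>; the premise \<open>aut\<close> asks to deduce \<open>\<G>\<close> for all automorphisms of
\<open>R\<^sub>1\<close> from these. The bound \<open>m\<close> restricts the use of label extension to large subgroups, so that the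
principle can serve in the proof of label extension by downward induction.\<close>

lemma centralizer_alperin:
  fixes \<G> :: "'a set \<Rightarrow> ('a \<Rightarrow> 'a) \<Rightarrow> 'g \<Rightarrow> bool"
  assumes fc: "fully_centralized S F P"
    and above: "\<And>R0. fully_normalized S F R0 \<Longrightarrow> m \<le> card R0 \<Longrightarrow> labels_extend R0"
    and cong: "\<And>R f g x. \<G> R f x \<Longrightarrow> (\<And>z. z \<in> R \<Longrightarrow> f z = g z) \<Longrightarrow> \<G> R g x"
    and comp: "\<And>R f g x y. L R f x \<Longrightarrow> \<G> R f x \<Longrightarrow> \<G> (f ` R) g y \<Longrightarrow> \<G> R (\<lambda>z. g (f z)) (y \<otimes>\<^bsub>\<Gamma>\<^esub> x)"
    and inv: "\<And>R f x. L R f x \<Longrightarrow> P \<subseteq> R \<Longrightarrow> R \<subseteq> P <#> cen P \<Longrightarrow> (\<And>z. z \<in> P \<Longrightarrow> f z = z) \<Longrightarrow> \<G> R f x \<Longrightarrow>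
      \<G> (f ` R) (inv_into R f) (inv\<^bsub>\<Gamma>\<^esub> x)"
    and restr: "\<And>R R' f x. \<G> R' f x \<Longrightarrow> R \<subseteq> R' \<Longrightarrow> \<G> R f x"
    and top: "\<And>f x. L (P <#> cen P) f x \<Longrightarrow> (\<And>z. z \<in> P \<Longrightarrow> f z = z) \<Longrightarrow> \<G> (P <#> cen P) f x"
    and aut: "\<And>R a x. subgroup R S \<Longrightarrow> P \<subseteq> R \<Longrightarrow> R \<subseteq> P <#> cen P \<Longrightarrow>
      cen_automized P R \<Longrightarrow>
      a \<in> fixing_auts P R \<Longrightarrow> L R a x \<Longrightarrow>
      (\<And>n y. n \<in> fixing_auts P R \<Longrightarrow> L R n y \<Longrightarrow>
        (\<And>g. g \<in> cen P \<inter> nrm R \<Longrightarrow> \<exists>g'\<in>cen P \<inter> nrm R. \<forall>z\<in>R. n (cj g z) = cj g' (n z)) \<Longrightarrow> \<G> R n y) \<Longrightarrow> \<G> R a x"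
    and R: "P \<subseteq> R" "R \<subseteq> P <#> cen P" "m \<le> card R" and f: "L R f x" "\<And>z. z \<in> P \<Longrightarrow> f z = z"
  shows "\<G> R f x"
proof -
  have P: "subgroup P S" using fc by (rule fc_sub)
  let ?N = "P <#> cen P"
  have N: "subgroup ?N S" by (rule subgroup_PC[OF P])
  have "P \<subseteq> R \<longrightarrow> R \<subseteq> ?N \<longrightarrow> m \<le> card R \<longrightarrow> (\<forall>f x. L R f x \<longrightarrow> (\<forall>z\<in>P. f z = z) \<longrightarrow> \<G> R f x)"
    using mor_subgroup[OF lab_mor[OF f(1)]]
  proof (induction rule: subgroup_down_induct)
    fix R assume R: "subgroup R S"
      and IH: "\<And>Q. subgroup Q S \<Longrightarrow> card R < card Q \<Longrightarrow>
        P \<subseteq> Q \<longrightarrow> Q \<subseteq> ?N \<longrightarrow> m \<le> card Q \<longrightarrow> (\<forall>f x. L Q f x \<longrightarrow> (\<forall>z\<in>P. f z = z) \<longrightarrow> \<G> Q f x)"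
    show "P \<subseteq> R \<longrightarrow> R \<subseteq> ?N \<longrightarrow> m \<le> card R \<longrightarrow> (\<forall>f x. L R f x \<longrightarrow> (\<forall>z\<in>P. f z = z) \<longrightarrow> \<G> R f x)"
    proof (cases "R = ?N")
      case True
      then show ?thesis using top by blast
    next
      case False
      show ?thesis
      proof (intro impI allI)
        fix f x assume PR: "P \<subseteq> R" and RN: "R \<subseteq> ?N" and mR: "m \<le> card R" and f: "L R f x" and fP: "\<forall>z\<in>P. f z = z"
        have mf: "mor R f" using lab_mor[OF f] .
        have RN': "card R < card ?N" using False RN card_psubset[OF N] by blast
        obtain \<kappa> where \<kappa>: "mor R \<kappa>" "\<And>z. z \<in> P \<Longrightarrow> \<kappa> z = z"
          "cen_automized P (\<kappa> ` R)"
          "cen_extends P (\<kappa> ` R)"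
          using cen_full_exists[OF fc R PR RN] above mR by metis
        define R1 where "R1 = \<kappa> ` R"
        have R1: "subgroup R1 S" "P \<subseteq> R1" "R1 \<subseteq> ?N" "card R1 = card R"
        proof -
          show "subgroup R1 S" "card R1 = card R" using mor_image[OF \<kappa>(1)] mor_card[OF \<kappa>(1)] by (auto simp: R1_def)
          show "P \<subseteq> R1" using \<kappa>(2) PR by (force simp: R1_def)
          show "R1 \<subseteq> ?N" using fix_PC[OF \<kappa>(1) P PR RN fix_image[OF \<kappa>(2)]] by (simp add: R1_def)
        qed
        have syl: "cen_automized P R1"
          and ext: "cen_extends P R1" using \<kappa> by (auto simp: R1_def)
        \<comment> \<open>Such a map extends to a larger subgroup, where the induction hypothesis applies.\<close>
        have good: "\<G> R' g y" if g: "L R' g y" "g ` R' = R1" and R': "P \<subseteq> R'" "R' \<subseteq> ?N" and gP: "\<forall>z\<in>P. g z = z"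
          and nor: "\<forall>c\<in>cen P \<inter> nrm R'. \<exists>g'\<in>cen P \<inter> nrm R1. \<forall>z\<in>R'. g (cj c z) = cj g' (g z)" for R' g y
        proof -
          have sR': "subgroup R' S" using mor_subgroup[OF lab_mor[OF g(1)]] .
          have cR': "card R' = card R" using mor_card[OF lab_mor[OF g(1)]] g(2) R1 by simp
          then have "R' \<subset> ?N" using RN' R'(2) by auto
          note K = cenR_grows[OF P sR' R'(1) this]
          obtain h where h: "L (R' <#> (cen P \<inter> nrm R')) h y" "\<forall>z\<in>R'. h z = g z"
            using ext[unfolded cen_extends_def, rule_format, OF g R'] gP nor by blast
          have "card R < card (R' <#> (cen P \<inter> nrm R'))" using card_psubset[OF K(1,2)] cR' by simp
          moreover have "\<forall>z\<in>P. h z = z" using h(2) gP R'(1) by auto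
          ultimately have "\<G> (R' <#> (cen P \<inter> nrm R')) h y" using IH[OF K(1)] h(1) K(2,3) R'(1) mR by auto
          then have "\<G> R' h y" using restr K(2) by blast
          then show ?thesis using cong h(2) by blast
        qed
        have conn: "\<exists>g y. L R' g y \<and> g ` R' = R1 \<and> (\<forall>z\<in>P. g z = z) \<and> \<G> R' g y"
          if g0: "mor R' g0" "g0 ` R' = R1" "\<And>z. z \<in> P \<Longrightarrow> g0 z = z" and R': "P \<subseteq> R'" "R' \<subseteq> ?N" for R' g0
        proof -
          obtain g where g: "mor R' g" "g ` R' = R1" "\<And>z. z \<in> P \<Longrightarrow> g z = z"
            "\<And>c. c \<in> cen P \<inter> nrm R' \<Longrightarrow> \<exists>g'\<in>cen P \<inter> nrm R1. \<forall>z\<in>R'. g (cj c z) = cj g' (g z)"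
            using fixing_conj_into[OF R'(1) mor_subgroup[OF g0(1)] g0(1,3) _ P] syl g0(2) by metis
          obtain y where y: "L R' g y" using L_ex[OF g(1)] by blast
          then have "\<G> R' g y" using good[OF y g(2) R'] g(3,4) by blast
          then show ?thesis using y g by blast
        qed
        obtain k l where k: "L R k l" "k ` R = R1" "\<forall>z\<in>P. k z = z" "\<G> R k l"
          using conn[OF \<kappa>(1) _ \<kappa>(2) PR RN] R1_def by blast
        let ?R2 = "f ` R"
        have R2: "P \<subseteq> ?R2" "?R2 \<subseteq> ?N" using fP PR fix_PC[OF mf P PR RN fix_image] by (force, metis)
        have i: "mor ?R2 (inv_into R f)" "inv_into R f ` ?R2 = R" "\<And>z. z \<in> P \<Longrightarrow> inv_into R f z = z"
          using mor_inv_into[OF mf] inv_into_image[OF mf] inv_into_fix[OF mf PR] fP by auto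
        have m2: "mor ?R2 (\<lambda>z. \<kappa> (inv_into R f z))" by (rule mor_comp[OF i(1) \<kappa>(1)]) (use i in simp)
        have "(\<lambda>z. \<kappa> (inv_into R f z)) ` ?R2 = \<kappa> ` inv_into R f ` ?R2" by (simp only: image_image)
        then have m2i: "(\<lambda>z. \<kappa> (inv_into R f z)) ` ?R2 = R1" using i(2) by (simp add: R1_def)
        obtain k' l' where k': "L ?R2 k' l'" "k' ` ?R2 = R1" "\<forall>z\<in>P. k' z = z" "\<G> ?R2 k' l'"
          using conn[OF m2 m2i _ R2] i(3) \<kappa>(2) by auto
        have c: "l \<in> carrier \<Gamma>" "l' \<in> carrier \<Gamma>" "x \<in> carrier \<Gamma>" using lab_carrier k(1) k'(1) f by auto
        have mk: "mor R k" "mor ?R2 k'" using lab_mor k(1) k'(1) by auto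
        define a where "a = restrict (\<lambda>z. k' (f (inv_into R k z))) R1"
        have ik: "L R1 (inv_into R k) (inv\<^bsub>\<Gamma>\<^esub> l)" "inv_into R k ` R1 = R" using L_inv[OF k(1)] inv_into_image[OF mk(1)] k(2) by auto
        have "L R1 (\<lambda>z. f (inv_into R k z)) (x \<otimes>\<^bsub>\<Gamma>\<^esub> inv\<^bsub>\<Gamma>\<^esub> l)"
          by (rule lab_comp[OF f ik(1)]) (use ik in auto)
        then have "L R1 (\<lambda>z. k' (f (inv_into R k z))) (l' \<otimes>\<^bsub>\<Gamma>\<^esub> (x \<otimes>\<^bsub>\<Gamma>\<^esub> inv\<^bsub>\<Gamma>\<^esub> l))"
          by (rule lab_comp[OF k'(1)]) (use ik in auto)
        then have La: "L R1 a (l' \<otimes>\<^bsub>\<Gamma>\<^esub> (x \<otimes>\<^bsub>\<Gamma>\<^esub> inv\<^bsub>\<Gamma>\<^esub> l))" by (rule lab_cong) (simp add: a_def)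
        have "a ` R1 = k' ` f ` inv_into R k ` R1" by (simp add: a_def image_image)
        then have aR1: "a ` R1 = R1" using ik(2) k'(2) by simp
        have "a \<in> F R1 R1" using aut_iff[OF R1(1)] lab_mor[OF La] aR1 by (simp add: a_def)
        moreover have "a z = z" if z: "z \<in> P" for z
          using z inv_into_fix[OF mk(1) PR _ z] k(3) fP k'(3) R1(2) by (auto simp: a_def)
        ultimately have aD: "a \<in> fixing_auts P R1" by (simp add: fixing_auts_def)
        have Ga: "\<G> R1 a (l' \<otimes>\<^bsub>\<Gamma>\<^esub> (x \<otimes>\<^bsub>\<Gamma>\<^esub> inv\<^bsub>\<Gamma>\<^esub> l))"
        proof (rule aut[OF R1(1-3) syl aD La])
          fix n y assume n: "n \<in> fixing_auts P R1" "L R1 n y"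
            "\<And>g. g \<in> cen P \<inter> nrm R1 \<Longrightarrow> \<exists>g'\<in>cen P \<inter> nrm R1. \<forall>z\<in>R1. n (cj g z) = cj g' (n z)"
          have "n ` R1 = R1" using n(1) aut_iff[OF R1(1)] by (auto simp: fixing_auts_def)
          then show "\<G> R1 n y" using good[OF n(2) _ R1(2,3)] n(1,3) by (simp add: fixing_auts_def)
        qed
        have "\<G> R (\<lambda>z. a (k z)) (l' \<otimes>\<^bsub>\<Gamma>\<^esub> (x \<otimes>\<^bsub>\<Gamma>\<^esub> inv\<^bsub>\<Gamma>\<^esub> l) \<otimes>\<^bsub>\<Gamma>\<^esub> l)"
          using comp[OF k(1,4)] Ga k(2) by simp
        then have G1: "\<G> R (\<lambda>z. a (k z)) (l' \<otimes>\<^bsub>\<Gamma>\<^esub> x)" using c by (simp add: T.H.m_assoc)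
        have G2: "\<G> R1 (inv_into ?R2 k') (inv\<^bsub>\<Gamma>\<^esub> l')"
          using inv[OF k'(1) R2 _ k'(4)] k'(2,3) by simp
        have ak: "a (k z) = k' (f z)" if "z \<in> R" for z
          using that k(2) mor_inj[OF mk(1)] by (auto simp: a_def)
        have Lak: "L R (\<lambda>z. a (k z)) (l' \<otimes>\<^bsub>\<Gamma>\<^esub> x)"
          by (rule lab_comp[OF k'(1) f]) (use ak in auto)
        have aki: "(\<lambda>z. a (k z)) ` R = R1"
        proof -
          have "(\<lambda>z. a (k z)) ` R = a ` k ` R" by (simp only: image_image)
          then show ?thesis using k(2) aR1 by simp
        qed
        have "\<G> R (\<lambda>z. inv_into ?R2 k' (a (k z))) (inv\<^bsub>\<Gamma>\<^esub> l' \<otimes>\<^bsub>\<Gamma>\<^esub> (l' \<otimes>\<^bsub>\<Gamma>\<^esub> x))"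
          using comp[OF Lak G1] G2 unfolding aki by blast
        moreover have "inv\<^bsub>\<Gamma>\<^esub> l' \<otimes>\<^bsub>\<Gamma>\<^esub> (l' \<otimes>\<^bsub>\<Gamma>\<^esub> x) = x" using c by (simp add: T.H.m_assoc[symmetric])
        ultimately have "\<G> R (\<lambda>z. inv_into ?R2 k' (a (k z))) x" by metis
        then show "\<G> R f x" by (rule cong) (use ak mor_inj[OF mk(2)] in simp)
      qed
    qed
  qed
  then show ?thesis using R f by blast
qed

text \<open>Here the property \<open>\<G>\<close> of \<open>centralizer_alperin\<close> concerns the label alone, and \<open>frattini\<close> provides the
premise on automorphisms.\<close>

lemma centralizer_label_lifts:
  assumes fc: "fully_centralized S F P"
    and above: "\<And>R0. fully_normalized S F R0 \<Longrightarrow> m \<le> card R0 \<Longrightarrow> labels_extend R0"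
    and R: "P \<subseteq> R" "R \<subseteq> P <#> cen P" "m \<le> card R" and f: "L R f x" "\<And>z. z \<in> P \<Longrightarrow> f z = z"
  obtains \<gamma> where "L (P <#> cen P) \<gamma> x" "\<And>z. z \<in> P \<Longrightarrow> \<gamma> z = z"
proof -
  let ?N = "P <#> cen P"
  have P: "subgroup P S" using fc by (rule fc_sub)
  have PN: "P \<subseteq> ?N" by (rule P_le_PC[OF P])
  have stay: "\<gamma> ` ?N \<subseteq> ?N" if "L ?N \<gamma> x" "\<forall>z\<in>P. \<gamma> z = z" for \<gamma> x
    using fix_PC[OF lab_mor[OF that(1)] P PN order_refl] fix_image[of P \<gamma>] that(2) by blast
  have "\<exists>\<gamma>. L ?N \<gamma> x \<and> (\<forall>z\<in>P. \<gamma> z = z)"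
  proof (rule centralizer_alperin[where \<G> = "\<lambda>_ _ x. \<exists>\<gamma>. L ?N \<gamma> x \<and> (\<forall>z\<in>P. \<gamma> z = z)" and R = R and f = f and m = m, OF fc above])
    show "\<exists>\<gamma>. L ?N \<gamma> (y \<otimes>\<^bsub>\<Gamma>\<^esub> x) \<and> (\<forall>z\<in>P. \<gamma> z = z)"
      if x: "\<exists>\<gamma>. L ?N \<gamma> x \<and> (\<forall>z\<in>P. \<gamma> z = z)" and y: "\<exists>\<gamma>. L ?N \<gamma> y \<and> (\<forall>z\<in>P. \<gamma> z = z)" for x y
    proof -
      obtain \<gamma> \<delta> where g: "L ?N \<gamma> x" "\<forall>z\<in>P. \<gamma> z = z" "L ?N \<delta> y" "\<forall>z\<in>P. \<delta> z = z" using x y by blast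
      have "L ?N (\<lambda>z. \<delta> (\<gamma> z)) (y \<otimes>\<^bsub>\<Gamma>\<^esub> x)" by (rule lab_comp[OF g(3,1) stay[OF g(1,2)]]) simp
      then show ?thesis using g by (intro exI[of _ "\<lambda>z. \<delta> (\<gamma> z)"]) simp
    qed
    show "\<exists>\<gamma>. L ?N \<gamma> (inv\<^bsub>\<Gamma>\<^esub> x) \<and> (\<forall>z\<in>P. \<gamma> z = z)"
      if x: "\<exists>\<gamma>. L ?N \<gamma> x \<and> (\<forall>z\<in>P. \<gamma> z = z)" for x
    proof -
      obtain \<gamma> where g: "L ?N \<gamma> x" "\<forall>z\<in>P. \<gamma> z = z" using x by blast
      have m: "mor ?N \<gamma>" using lab_mor[OF g(1)] .
      have "\<gamma> ` ?N = ?N"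
        using card_subset_eq[OF sub_finite[OF subgroup_PC[OF P]] stay[OF g]] mor_card[OF m] by simp
      then have "L ?N (inv_into ?N \<gamma>) (inv\<^bsub>\<Gamma>\<^esub> x)" using L_inv[OF g(1)] by simp
      then show ?thesis using inv_into_fix[OF m PN] g(2) by blast
    qed
    fix R a x assume R: "subgroup R S" "P \<subseteq> R"
      and syl: "cen_automized P R"
      and a: "a \<in> fixing_auts P R" "L R a x"
      and nor: "\<And>n y. n \<in> fixing_auts P R \<Longrightarrow> L R n y \<Longrightarrow>
        (\<And>g. g \<in> cen P \<inter> nrm R \<Longrightarrow> \<exists>g'\<in>cen P \<inter> nrm R. \<forall>z\<in>R. n (cj g z) = cj g' (n z)) \<Longrightarrow>
        \<exists>\<gamma>. L ?N \<gamma> y \<and> (\<forall>z\<in>P. \<gamma> z = z)"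
    obtain n where "n \<in> fixing_auts P R" "L R n x"
      "\<And>g. g \<in> cen P \<inter> nrm R \<Longrightarrow> \<exists>g'\<in>cen P \<inter> nrm R. \<forall>z\<in>R. n (cj g z) = cj g' (n z)"
      using frattini[OF R(1) cenR_subgroup[OF P R(1)] Int_lower2 fixing_auts_subgroup[OF R] syl a] by blast
    then show "\<exists>\<gamma>. L ?N \<gamma> x \<and> (\<forall>z\<in>P. \<gamma> z = z)" by (rule nor)
  qed (use R f in auto)
  then show ?thesis using that by blast
qed

end

context fusion_triple begin

section \<open>Labels extend from fully normalized subgroups\<close>

text \<open>For a morphism \<open>f\<close> on \<open>P C\<^sub>S(P)\<close> the centralizer of the image lies in \<open>C\<^sub>S(f(P)) = f(C\<^sub>S(P))\<close>, so it is
the image of the centralizer.\<close>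

lemma fc_PC:
  assumes fc: "fully_centralized S F P"
  shows "fully_centralized S F (P <#> cen P)" "quasicentric S F (P <#> cen P)" "cen (P <#> cen P) \<subseteq> cen P"
proof -
  let ?N = "P <#> cen P"
  have P: "subgroup P S" using fc by (rule fc_sub)
  have N: "subgroup ?N S" by (rule subgroup_PC[OF P])
  have PN: "P \<subseteq> ?N" "cen P \<subseteq> ?N" using P_le_PC[OF P] C_le_PC[OF P] by auto
  show cc: "cen ?N \<subseteq> cen P" by (rule cen_antimono[OF PN(1)])
  have "card (cen (f ` ?N)) \<le> card (cen ?N)" if f: "mor ?N f" for f
  proof -
    have fC: "f ` cen P = cen (f ` P)" by (rule fc_image_cen[OF fc f PN])
    have "cen (f ` ?N) \<subseteq> f ` cen ?N"
    proof
      fix y assume y: "y \<in> cen (f ` ?N)"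
      have "y \<in> cen (f ` P)" using y cen_antimono[OF image_mono[OF PN(1)], of f] by blast
      then obtain c where c: "c \<in> cen P" "y = f c" using fC by blast
      have cN: "c \<in> ?N" using c PN by blast
      have "cj c z = z" if z: "z \<in> ?N" for z
      proof -
        have "f (cj c z) = f z" using mor_cj[OF f cN z] cen_cj[OF y, of "f z"] z c by simp
        moreover have "cj c z \<in> ?N" using subgroup_cj[OF N cN z] .
        ultimately show ?thesis using mor_inj[OF f] z by (meson inj_onD)
      qed
      then have "c \<in> cen ?N" using cen_carrier[OF c(1)] by (simp add: cen_def)
      then show "y \<in> f ` cen ?N" using c by blast
    qed
    then have "card (cen (f ` ?N)) \<le> card (f ` cen ?N)"
      by (rule card_mono[OF finite_imageI[OF sub_finite[OF cenS[OF N]]]])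
    also have "\<dots> \<le> card (cen ?N)" by (rule card_image_le[OF sub_finite[OF cenS[OF N]]])
    finally show ?thesis .
  qed
  then show fcN: "fully_centralized S F ?N" using N by (simp add: fully_centralized_iff)
  show "quasicentric S F ?N" by (rule fc_centric_imp_quasicentric[OF fcN]) (use cc PN in blast)
qed

text \<open>For \<open>R = P C\<^sub>S(P)\<close> the map \<open>\<kappa>\<close> of \<open>cen_full_exists\<close> maps \<open>R\<close> to itself.\<close>

lemma PC_sylow:
  assumes fc: "fully_centralized S F P"
    and above: "\<And>R0. fully_normalized S F R0 \<Longrightarrow> card R0 = card (P <#> cen P) \<Longrightarrow> labels_extend R0"
  defines "N \<equiv> P <#> cen P"
  shows "cen_automized P N"
proof -
  have P: "subgroup P S" using fc by (rule fc_sub)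
  have N: "subgroup N S" "P \<subseteq> N" unfolding N_def by (rule subgroup_PC[OF P], rule P_le_PC[OF P])
  obtain \<kappa> where \<kappa>: "mor N \<kappa>" "\<And>z. z \<in> P \<Longrightarrow> \<kappa> z = z"
    "cen_automized P (\<kappa> ` N)"
    using cen_full_exists[OF fc N _ above] N_def by blast
  have "\<kappa> ` N \<subseteq> N" unfolding N_def using fix_PC[OF \<kappa>(1) P N(2) _ fix_image[OF \<kappa>(2)]] N_def by blast
  then have "\<kappa> ` N = N" using card_subset_eq[OF sub_finite[OF N(1)]] mor_card[OF \<kappa>(1)] by blast
  then show ?thesis using \<kappa>(3) by simp
qed

text \<open>By \<open>frattini_p\<close> the label \<open>y\<close> occurs on conjugation by some \<open>c \<in> C\<^sub>S(P)\<close>, which also has the label \<open>\<theta>(c)\<close>. The two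
labels differ by a label of the identity of the quasicentric subgroup \<open>P C\<^sub>S(P)\<close>, which is \<open>\<theta>(d)\<close> for some
\<open>d \<in> C\<^sub>S(P C\<^sub>S(P))\<close>.\<close>

lemma label_of_fixing_map:
  assumes \<Gamma>: "finite_p_group p \<Gamma>" and fc: "fully_centralized S F P"
    and above: "\<And>R0. fully_normalized S F R0 \<Longrightarrow> card R0 = card (P <#> cen P) \<Longrightarrow> labels_extend R0"
    and b: "L (P <#> cen P) b y" "\<And>z. z \<in> P \<Longrightarrow> b z = z"
  obtains c where "c \<in> cen P" "y = \<theta> c"
proof -
  let ?N = "P <#> cen P"
  have P: "subgroup P S" using fc by (rule fc_sub)
  have N: "subgroup ?N S" "P \<subseteq> ?N" by (rule subgroup_PC[OF P], rule P_le_PC[OF P])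
  have m: "mor ?N b" using lab_mor[OF b(1)] .
  have "b ` ?N = ?N"
    using card_subset_eq[OF sub_finite[OF N(1)] fix_PC[OF m P N(2) order_refl fix_image[OF b(2)]]] mor_card[OF m] by simp
  then have bF: "restrict b ?N \<in> fixing_auts P ?N" using aut_restrict[OF m] b(2) N(2) by (auto simp: fixing_auts_def)
  have "L ?N (restrict b ?N) y" using lab_cong[OF b(1)] by simp
  then obtain t where t: "t \<in> conj_auts ?N (cen P \<inter> nrm ?N)" "L ?N t y"
    using frattini_p[OF \<Gamma> N(1) fixing_auts_subgroup[OF N] PC_sylow[OF fc above] bF] by blast
  then obtain c where c: "c \<in> cen P" "t = restrict (cj c) ?N" by (auto simp: conj_auts_def)
  have cc: "c \<in> carrier S" using cen_carrier[OF c(1)] .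
  have "L ?N t (\<theta> c)" by (rule lab_cong[OF lab_cj[OF N(1) cc]]) (use c cc in auto)
  then have "L ?N (\<lambda>z. z) (inv\<^bsub>\<Gamma>\<^esub> \<theta> c \<otimes>\<^bsub>\<Gamma>\<^esub> y)" using L_diff t(2) by blast
  then obtain d where d: "d \<in> cen ?N" "inv\<^bsub>\<Gamma>\<^esub> \<theta> c \<otimes>\<^bsub>\<Gamma>\<^esub> y = \<theta> d"
    using TH_fc_id[OF lab_TH] fc_PC[OF fc] by blast
  have dc: "d \<in> carrier S" "d \<in> cen P" using cen_carrier[OF d(1)] d(1) fc_PC(3)[OF fc] by auto
  have yc: "y \<in> carrier \<Gamma>" using lab_carrier b(1) by blast
  have "\<theta> (c \<otimes> d) = \<theta> c \<otimes>\<^bsub>\<Gamma>\<^esub> (inv\<^bsub>\<Gamma>\<^esub> \<theta> c \<otimes>\<^bsub>\<Gamma>\<^esub> y)" using T.hom_mult[OF cc dc(1)] d(2) by simp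
  also have "\<dots> = y" using cc yc by (simp add: T.H.m_assoc[symmetric])
  finally have "y = \<theta> (c \<otimes> d)" by (rule sym)
  moreover have "c \<otimes> d \<in> cen P" by (rule subgroup.m_closed[OF cenS[OF P] c(1) dc(2)])
  ultimately show ?thesis using that by blast
qed

lemma nrm_le_nrm_PC: "subgroup P S \<Longrightarrow> nrm P \<subseteq> nrm (P <#> cen P)"
proof
  fix g assume P: "subgroup P S" and g: "g \<in> nrm P"
  have "cj g x \<in> P <#> cen P" if x: "x \<in> P <#> cen P" for x
  proof -
    obtain u c where uc: "u \<in> P" "c \<in> cen P" "x = u \<otimes> c" using x by (auto simp: set_mult_def)
    then have "cj g x = cj g u \<otimes> cj g c"
      using cj_mult[OF nrm_carrier[OF g]] sub_carrier[OF P] cen_carrier by blast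
    then show ?thesis using nrm_cj[OF g uc(1)] nrm_cen[OF P g uc(2)] by (auto simp: set_mult_def)
  qed
  then show "g \<in> nrm (P <#> cen P)" using nrm_carrier[OF g] by (simp add: nrm_def)
qed

text \<open>Apply \<open>frattini\<close> to the group \<open>D\<close> of automorphisms of \<open>P C\<^sub>S(P)\<close> that act on \<open>P\<close> as elements of \<open>N\<^sub>S(P)\<close>. As
\<open>P\<close> is fully normalized, the conjugations by \<open>N\<^sub>S(P)\<close> form a Sylow \<open>p\<close>-subgroup of \<open>D\<close>. The resulting
automorphism \<open>n\<close> becomes trivial on \<open>P\<close> after composing it with a conjugation, which has the trivial label, and
it extends to \<open>N\<^sub>S(P)\<close> because it normalizes the group of conjugations.\<close>

lemma labels_extend_nrm_p':
  assumes \<Gamma>: "finite_p'_group p \<Gamma>" and fn: "fully_normalized S F P"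
    and b: "L (P <#> cen P) b y" "\<And>z. z \<in> P \<Longrightarrow> b z = z"
  shows "\<exists>g. L (nrm P) g y \<and> (\<forall>z\<in>P. g z = z)"
proof -
  let ?N = "P <#> cen P"
  have fc: "fully_centralized S F P" using fn_fc[OF fn] .
  have P: "subgroup P S" using fc by (rule fc_sub)
  have N: "subgroup ?N S" "P \<subseteq> ?N" by (rule subgroup_PC[OF P], rule P_le_PC[OF P])
  have NP: "subgroup (nrm P) S" using nrmS[OF P] .
  have NN: "nrm P \<subseteq> nrm ?N" by (rule nrm_le_nrm_PC[OF P])
  interpret A: group "Aut_group F ?N" by (rule Aut_group[OF N(1)])
  \<comment> \<open>\<open>D\<close> is larger than the group of automorphisms fixing \<open>P\<close>, so that \<open>Aut\<^bsub>N\<^sub>S(P)\<^esub>(P C\<^sub>S(P))\<close> fits into it.\<close>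
  define D where "D = {a \<in> F ?N ?N. \<exists>g\<in>nrm P. \<forall>z\<in>P. a z = cj g z}"
  have DF: "D \<subseteq> F ?N ?N" by (auto simp: D_def)
  have D: "subgroup D (Aut_group F ?N)"
  proof (rule aut_subgroupI[OF N(1) DF])
    have "\<one> \<in> nrm P" using subgroup.one_closed[OF NP] .
    then show "(\<lambda>x\<in>?N. x) \<in> D" using id_mem[OF N(1)] N(2) sub_carrier[OF P] by (force simp: D_def)
    show "compose ?N a b \<in> D" if ab: "a \<in> D" "b \<in> D" for a b
    proof -
      obtain g h where gh: "a \<in> F ?N ?N" "g \<in> nrm P" "\<forall>z\<in>P. a z = cj g z" "b \<in> F ?N ?N" "h \<in> nrm P" "\<forall>z\<in>P. b z = cj h z"
        using ab by (auto simp: D_def)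
      have "compose ?N a b z = cj (g \<otimes> h) z" if z: "z \<in> P" for z
        using z N(2) gh nrm_cj[OF gh(5) z] nrm_carrier sub_carrier[OF P z] by (auto simp: compose_def cj_cj)
      then show ?thesis using comp_mem[OF gh(4,1)] subgroup.m_closed[OF NP gh(2,5)] by (auto simp: D_def)
    qed
    show "restrict (inv_into ?N a) ?N \<in> D" if a: "a \<in> D" for a
    proof -
      obtain g where g: "a \<in> F ?N ?N" "g \<in> nrm P" "\<forall>z\<in>P. a z = cj g z" using a by (auto simp: D_def)
      have i: "inv g \<in> nrm P" using subgroup.m_inv_closed[OF NP g(2)] .
      have m: "mor ?N a" using g aut_iff[OF N(1)] by blast
      have "inv_into ?N a z = cj (inv g) z" if z: "z \<in> P" for z
      proof -
        have w: "cj (inv g) z \<in> P" using nrm_cj[OF i z] .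
        have "a (cj (inv g) z) = z" using g(3) w sub_carrier[OF P z] nrm_carrier[OF g(2)] by simp
        then show ?thesis using mor_inj[OF m] w N(2) by (metis inv_into_f_f subsetD)
      qed
      then show ?thesis using inv_into_aut[OF N(1) g(1)] i N(2) by (auto simp: D_def)
    qed
  qed
  interpret AD: group "Aut_group F ?N\<lparr>carrier := D\<rparr>" by (rule A.subgroup_imp_group[OF D])
  have fD: "finite D" using DF Aut_finite[OF N(1)] finite_subset by blast
  let ?T = "conj_auts ?N (nrm P)"
  note T = conj_auts_p_subgroup[OF N(1) NP NN]
  obtain k where k: "card ?T = p ^ k" using T(2) by blast
  have TD: "?T \<subseteq> D"
  proof
    fix t assume t: "t \<in> ?T"
    then obtain g where g: "g \<in> nrm P" "t = restrict (cj g) ?N" by (auto simp: conj_auts_def)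
    have "t \<in> F ?N ?N" using t subgroup.subset[OF T(1)] by auto
    then show "t \<in> D" using g N(2) by (auto simp: D_def)
  qed
  have TA: "subgroup ?T (Aut_group F ?N\<lparr>carrier := D\<rparr>)" by (rule A.subgroup_incl[OF T(1) D TD])
  obtain V where V: "sylow_subgroup p (Aut_group F ?N\<lparr>carrier := D\<rparr>) V" using sylow_exists[OF prime_p AD.is_group] fD by auto
  then have V': "subgroup V (Aut_group F ?N\<lparr>carrier := D\<rparr>)"
    "card V = p ^ multiplicity p (order (Aut_group F ?N\<lparr>carrier := D\<rparr>))" by (auto simp: sylow_subgroup_def)
  have VD: "V \<subseteq> D" using subgroup.subset[OF V'(1)] by simp
  obtain \<chi> where \<chi>: "mor ?N \<chi>" "fully_normalized S F (\<chi> ` ?N)"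
    "\<And>v. v \<in> V \<Longrightarrow> \<exists>g\<in>nrm (\<chi> ` ?N). \<forall>x\<in>?N. \<chi> (v x) = cj g (\<chi> x)"
    using fn_p_subgroup[OF N(1) A.incl_subgroup[OF D V'(1)] V'(2)] by blast
  define P0 where "P0 = \<chi> ` P"
  have \<chi>P: "mor P \<chi>" by (rule mor_restrict[OF \<chi>(1) P N(2)])
  have P0: "subgroup P0 S" using mor_image[OF \<chi>P] by (simp add: P0_def)
  obtain \<rho> where \<rho>: "mor (nrm P0) \<rho>" "\<rho> ` P0 = P"
    using fn_frame[OF fn mor_inv_into[OF \<chi>P]] inv_into_image[OF \<chi>P] by (auto simp: P0_def)
  have \<chi>N: "\<chi> ` ?N \<subseteq> nrm P0" using mor_nrm[OF \<chi>(1) N(2)] PC_le_nrm[OF P] by (auto simp: P0_def)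
  define \<tau> where "\<tau> = (\<lambda>z. \<rho> (\<chi> z))"
  have \<tau>: "mor ?N \<tau>" unfolding \<tau>_def by (rule mor_comp[OF \<chi>(1) \<rho>(1) \<chi>N])
  have \<tau>P: "\<tau> ` P = P" using \<rho>(2) by (simp add: \<tau>_def P0_def image_image)
  have \<tau>N: "\<tau> ` ?N = ?N"
    using card_subset_eq[OF sub_finite[OF N(1)] fix_PC[OF \<tau> P N(2) order_refl \<tau>P]] mor_card[OF \<tau>] by simp
  define c where "c = (\<lambda>u. restrict (\<lambda>y. \<tau> (u (inv_into ?N \<tau> y))) ?N)"
  have c: "inj_on c (F ?N ?N)" using conj_aut_hom(2)[OF \<tau>] \<tau>N by (simp add: c_def)
  have cap: "c u (\<tau> x) = \<tau> (u x)" if "u \<in> F ?N ?N" "x \<in> ?N" for u x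
    using conj_aut_hom(3)[OF \<tau> that] \<tau>N by (simp add: c_def)
  have "c ` V \<subseteq> ?T"
  proof
    fix t assume "t \<in> c ` V"
    then obtain v where v: "v \<in> V" "t = c v" by auto
    then have vD: "v \<in> D" "v \<in> F ?N ?N" using VD DF by auto
    then obtain h where h: "h \<in> nrm P" "\<forall>z\<in>P. v z = cj h z" by (auto simp: D_def)
    obtain g where g: "g \<in> nrm (\<chi> ` ?N)" "\<forall>x\<in>?N. \<chi> (v x) = cj g (\<chi> x)" using \<chi>(3)[OF v(1)] by blast
    have "cj g y \<in> P0" if y: "y \<in> P0" for y
    proof -
      obtain z where z: "z \<in> P" "y = \<chi> z" using y by (auto simp: P0_def)
      have "\<chi> (v z) = cj g y" using g(2) z N(2) by blast
      moreover have "v z \<in> P" using h z nrm_cj by auto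
      ultimately show ?thesis unfolding P0_def by (metis imageI)
    qed
    then have gP0: "g \<in> nrm P0" using nrm_carrier[OF g(1)] by (simp add: nrm_def)
    have P0n: "P0 \<subseteq> nrm P0" using subgroup_subset_nrm[OF P0] .
    have \<rho>g: "\<rho> g \<in> nrm P" using mor_nrm[OF \<rho>(1) P0n gP0 gP0] \<rho>(2) by simp
    have "c v = restrict (cj (\<rho> g)) ?N"
    proof
      fix y show "c v y = restrict (cj (\<rho> g)) ?N y"
      proof (cases "y \<in> ?N")
        case True
        then have "y \<in> \<tau> ` ?N" using \<tau>N by simp
        then obtain x where x: "x \<in> ?N" "y = \<tau> x" by auto
        have "c v y = \<rho> (\<chi> (v x))" using cap[OF vD(2) x(1)] x by (simp add: \<tau>_def)
        also have "\<dots> = \<rho> (cj g (\<chi> x))" using g(2) x by simp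
        also have "\<dots> = cj (\<rho> g) (\<rho> (\<chi> x))" using mor_cj[OF \<rho>(1) gP0, of "\<chi> x"] \<chi>N x by auto
        finally show ?thesis using x True by (simp add: \<tau>_def)
      qed (simp add: c_def)
    qed
    then show "t \<in> ?T" using v \<rho>g by (auto simp: conj_auts_def)
  qed
  moreover have "finite ?T" using TD fD finite_subset by blast
  moreover have "card (c ` V) = card V" using c VD DF by (meson card_image inj_on_subset order_trans)
  ultimately have "card V \<le> card ?T" using card_mono by metis
  then have syl: "sylow_subgroup p (Aut_group F ?N\<lparr>carrier := D\<rparr>) ?T"
    using sylow_if_card_ge[OF prime_p AD.is_group _ TA k V] fD by simp
  have mb: "mor ?N b" using lab_mor[OF b(1)] .
  have "b ` ?N = ?N"
    using card_subset_eq[OF sub_finite[OF N(1)] fix_PC[OF mb P N(2) order_refl fix_image[OF b(2)]]] mor_card[OF mb] by simp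
  then have "restrict b ?N \<in> F ?N ?N" using aut_restrict[OF mb] by simp
  then have bD: "restrict b ?N \<in> D"
    using b(2) N(2) subgroup.one_closed[OF NP] sub_carrier[OF P] by (force simp: D_def)
  have "L ?N (restrict b ?N) y" using lab_cong[OF b(1)] by simp
  then obtain n where n: "n \<in> D" "L ?N n y" "\<And>g. g \<in> nrm P \<Longrightarrow> \<exists>g'\<in>nrm P. \<forall>z\<in>?N. n (cj g z) = cj g' (n z)"
    using frattini[OF N(1) NP NN D syl bD] by blast
  obtain g where g: "n \<in> F ?N ?N" "g \<in> nrm P" "\<forall>z\<in>P. n z = cj g z" using n(1) by (auto simp: D_def)
  have gc: "g \<in> carrier S" "inv g \<in> carrier S" "inv g \<in> nrm P"
    using nrm_carrier[OF g(2)] subgroup.m_inv_closed[OF NP g(2)] by auto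
  define n' where "n' = (\<lambda>z. cj (inv g) (n z))"
  have nN: "n z \<in> ?N" if "z \<in> ?N" for z using F_D(4)[OF g(1)] that by blast
  have "L ?N (cj (inv g)) \<one>\<^bsub>\<Gamma>\<^esub>" using lab_cj[OF N(1) gc(2), of "carrier \<Gamma>"] \<theta>_trivial[OF \<Gamma> gc(2)] by simp
  then have "L ?N n' (\<one>\<^bsub>\<Gamma>\<^esub> \<otimes>\<^bsub>\<Gamma>\<^esub> y)" unfolding n'_def by (rule lab_comp[OF _ n(2)]) (use nN in auto)
  then have n': "L ?N n' y" using lab_carrier[OF n(2)] by simp
  have n'P: "n' z = z" if "z \<in> P" for z using g(3) that gc(1) sub_carrier[OF P that] by (simp add: n'_def)
  have mn': "mor ?N n'" using lab_mor[OF n'] .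
  have n'N: "n' ` ?N = ?N"
    using card_subset_eq[OF sub_finite[OF N(1)] fix_PC[OF mn' P N(2) order_refl fix_image[OF n'P]]] mor_card[OF mn'] by simp
  have "nrm P \<subseteq> Nx ?N n'"
  proof
    fix h assume h: "h \<in> nrm P"
    obtain h' where h': "h' \<in> nrm P" "\<forall>z\<in>?N. n (cj h z) = cj h' (n z)" using n(3)[OF h] by blast
    have "n' (cj h z) = cj (cj (inv g) h') (n' z)" if z: "z \<in> ?N" for z
      using h'(2) z nrm_carrier[OF h'(1)] gc(2) sub_carrier[OF N(1) nN[OF z]] by (simp add: n'_def cj_cj_cj)
    moreover have "cj (inv g) h' \<in> nrm ?N" using subgroup_cj[OF NP gc(3) h'(1)] NN by blast
    ultimately show "h \<in> Nx ?N n'" using h NN n'N unfolding Nx_def by auto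
  qed
  moreover obtain e where "L (Nx ?N n') e y" "\<And>z. z \<in> ?N \<Longrightarrow> e z = n' z"
    using labelled_extension[of n' ?N y] n' n'N fc_PC[OF fc] labels_extend_quasicentric by metis
  ultimately have "L (nrm P) e y" "\<forall>z\<in>P. e z = z" using lab_restrict[OF _ NP] n'P N(2) by auto
  then show ?thesis by blast
qed

text \<open>These pairs form a group. Label extension from \<open>P\<close> comes down to showing that it contains all labelled
automorphisms of \<open>P\<close>.\<close>

definition PC_lifts :: "'a set \<Rightarrow> ('a \<Rightarrow> 'a) \<Rightarrow> 'g \<Rightarrow> bool" where
  "PC_lifts P a x \<longleftrightarrow> (\<exists>b. L (P <#> cen P) b x \<and> b ` P = P \<and> (\<forall>z\<in>P. b z = a z))"

lemma PC_lifts_stay: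
  assumes P: "subgroup P S" and b: "mor (P <#> cen P) b" "b ` P = P"
  shows "b ` (P <#> cen P) = P <#> cen P"
  using card_subset_eq[OF sub_finite[OF subgroup_PC[OF P]] fix_PC[OF b(1) P P_le_PC[OF P] order_refl b(2)]] mor_card[OF b(1)]
  by simp

lemma PC_lifts_cong: "PC_lifts P a x \<Longrightarrow> (\<And>z. z \<in> P \<Longrightarrow> a z = a' z) \<Longrightarrow> PC_lifts P a' x"
  unfolding PC_lifts_def by metis

lemma PC_lifts_comp:
  assumes P: "subgroup P S" and a: "PC_lifts P a x" and b: "PC_lifts P b y"
  shows "PC_lifts P (\<lambda>z. b (a z)) (y \<otimes>\<^bsub>\<Gamma>\<^esub> x)"
proof -
  obtain a' b' where *: "L (P <#> cen P) a' x" "a' ` P = P" "\<forall>z\<in>P. a' z = a z"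
    "L (P <#> cen P) b' y" "b' ` P = P" "\<forall>z\<in>P. b' z = b z" using a b by (auto simp: PC_lifts_def)
  have "L (P <#> cen P) (\<lambda>z. b' (a' z)) (y \<otimes>\<^bsub>\<Gamma>\<^esub> x)"
    by (rule lab_comp[OF *(4,1)]) (use PC_lifts_stay[OF P lab_mor[OF *(1)] *(2)] in auto)
  moreover have "(\<lambda>z. b' (a' z)) ` P = b' ` a' ` P" by (simp only: image_image)
  moreover have "b' (a' z) = b (a z)" if "z \<in> P" for z
  proof -
    have "a' z \<in> P" using *(2) that by blast
    then show ?thesis using * that by auto
  qed
  ultimately show ?thesis unfolding PC_lifts_def using *(2,5) by (metis (no_types, lifting))
qed

lemma PC_lifts_div:
  assumes P: "subgroup P S" and a: "PC_lifts P a x" and b: "PC_lifts P b y"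
    and f: "\<And>z. z \<in> P \<Longrightarrow> f z \<in> P" "\<And>z. z \<in> P \<Longrightarrow> b (f z) = a z"
  shows "PC_lifts P f (inv\<^bsub>\<Gamma>\<^esub> y \<otimes>\<^bsub>\<Gamma>\<^esub> x)"
proof -
  let ?N = "P <#> cen P"
  obtain b' where b': "L ?N b' y" "b' ` P = P" "\<forall>z\<in>P. b' z = b z" using b by (auto simp: PC_lifts_def)
  have m: "mor ?N b'" using lab_mor[OF b'(1)] .
  have PN: "P \<subseteq> ?N" by (rule P_le_PC[OF P])
  have "L ?N (inv_into ?N b') (inv\<^bsub>\<Gamma>\<^esub> y)" using L_inv[OF b'(1)] PC_lifts_stay[OF P m b'(2)] by simp
  moreover have ib: "inv_into ?N b' (b' z) = z" if "z \<in> P" for z using mor_inj[OF m] that PN by auto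
  then have "inv_into ?N b' ` b' ` P = P" by force
  then have "inv_into ?N b' ` P = P" using b'(2) by simp
  ultimately have "PC_lifts P (inv_into ?N b') (inv\<^bsub>\<Gamma>\<^esub> y)" by (auto simp: PC_lifts_def)
  then have "PC_lifts P (\<lambda>z. inv_into ?N b' (a z)) (inv\<^bsub>\<Gamma>\<^esub> y \<otimes>\<^bsub>\<Gamma>\<^esub> x)" by (rule PC_lifts_comp[OF P a])
  then show ?thesis
  proof (rule PC_lifts_cong)
    fix z assume z: "z \<in> P"
    have "a z = b' (f z)" using f[OF z] b'(3) by simp
    then show "inv_into ?N b' (a z) = f z" using ib[OF f(1)[OF z]] by simp
  qed
qed

text \<open>Extend \<open>f|\<^bsub>P\<^esub>\<close> to a map \<open>\<phi>\<close> on \<open>P C\<^sub>S(P)\<close>. The quotient \<open>\<phi>\<^sup>-\<^sup>1 f\<close> fixes \<open>P\<close>, and its label is found on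
\<open>P C\<^sub>S(P)\<close> by \<open>centralizer_label_lifts\<close>.\<close>

lemma PC_lifts_of_PC:
  assumes fc: "fully_centralized S F P" and nq: "\<not> quasicentric S F P"
    and above: "\<And>R0. fully_normalized S F R0 \<Longrightarrow> card P < card R0 \<Longrightarrow> labels_extend R0"
    and f: "L R f y" "P \<subset> R" "R \<subseteq> P <#> cen P" "f ` P = P"
  shows "PC_lifts P f y"
proof -
  let ?N = "P <#> cen P"
  have P: "subgroup P S" using fc by (rule fc_sub)
  have N: "subgroup ?N S" "P \<subseteq> ?N" by (rule subgroup_PC[OF P], rule P_le_PC[OF P])
  have m: "mor R f" using lab_mor[OF f(1)] .
  have R: "subgroup R S" using mor_subgroup[OF m] .
  have mP: "mor P f" by (rule mor_restrict[OF m P]) (use f in auto)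
  obtain \<phi> where \<phi>: "mor ?N \<phi>" "\<And>z. z \<in> P \<Longrightarrow> \<phi> z = f z" using fc_extend_PC[OF mP] f(4) fc by auto
  obtain z where z: "L ?N \<phi> z" using L_ex[OF \<phi>(1)] by blast
  have \<phi>P: "\<phi> ` P = P" using \<phi>(2) f(4) by (metis image_cong)
  have \<phi>N: "\<phi> ` ?N = ?N" by (rule PC_lifts_stay[OF P \<phi>(1) \<phi>P])
  have fR: "f ` R \<subseteq> ?N" using fix_PC[OF m P _ f(3,4)] f(2) by auto
  have zc: "z \<in> carrier \<Gamma>" "y \<in> carrier \<Gamma>" using lab_carrier z f(1) by auto
  have 1: "L R (\<lambda>w. inv_into ?N \<phi> (f w)) (inv\<^bsub>\<Gamma>\<^esub> z \<otimes>\<^bsub>\<Gamma>\<^esub> y)"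
    by (rule L_div[OF z _ f(1)]) (use fR \<phi>N in simp)
  have 2: "inv_into ?N \<phi> (f w) = w" if "w \<in> P" for w
    using \<phi>(2)[OF that] mor_inj[OF \<phi>(1)] that N(2) by (metis inv_into_f_f subsetD)
  have "Suc (card P) \<le> card R" using card_psubset[OF R f(2)] by simp
  then obtain \<gamma> where \<gamma>: "L ?N \<gamma> (inv\<^bsub>\<Gamma>\<^esub> z \<otimes>\<^bsub>\<Gamma>\<^esub> y)" "\<And>w. w \<in> P \<Longrightarrow> \<gamma> w = w"
    using centralizer_label_lifts[OF fc _ _ f(3) _ 1 2, of "Suc (card P)"] above f(2) by auto
  have "\<gamma> ` P = P" by (rule fix_image[OF \<gamma>(2)])
  then have "PC_lifts P \<gamma> (inv\<^bsub>\<Gamma>\<^esub> z \<otimes>\<^bsub>\<Gamma>\<^esub> y)" using \<gamma> by (auto simp: PC_lifts_def)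
  moreover have "PC_lifts P \<phi> z" using z \<phi>P by (auto simp: PC_lifts_def)
  ultimately have "PC_lifts P (\<lambda>w. \<phi> (\<gamma> w)) (z \<otimes>\<^bsub>\<Gamma>\<^esub> (inv\<^bsub>\<Gamma>\<^esub> z \<otimes>\<^bsub>\<Gamma>\<^esub> y))" using PC_lifts_comp[OF P] by blast
  moreover have "z \<otimes>\<^bsub>\<Gamma>\<^esub> (inv\<^bsub>\<Gamma>\<^esub> z \<otimes>\<^bsub>\<Gamma>\<^esub> y) = y" using zc by (simp add: T.H.m_assoc[symmetric])
  ultimately have "PC_lifts P (\<lambda>w. \<phi> (\<gamma> w)) y" by metis
  then show ?thesis by (rule PC_lifts_cong) (use \<gamma>(2) \<phi>(2) in simp)
qed

lemma nrm_le_nrm_cen: "subgroup P S \<Longrightarrow> nrm P \<subseteq> nrm (cen P)"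
proof
  fix g assume "subgroup P S" and g: "g \<in> nrm P"
  then have "\<forall>c\<in>cen P. cj g c \<in> cen P" using nrm_cen by blast
  then show "g \<in> nrm (cen P)" using nrm_carrier[OF g] unfolding nrm_def[of "cen P"] by blast
qed

text \<open>If \<open>R\<close> meets \<open>C\<^sub>S(P)\<close> outside \<open>P\<close>, restrict \<open>f\<close> to \<open>R \<inter> P C\<^sub>S(P)\<close>. Otherwise \<open>[R, N\<^bsub>C\<^sub>S(P)\<^esub>(R)]\<close> lies in
\<open>R \<inter> C\<^sub>S(P) \<le> P\<close>, so the elements of \<open>C\<^sub>S(P)\<close> that normalize \<open>R\<close> act on it through the \<open>p\<close>-group \<open>U\<close> of
automorphisms trivial on \<open>P\<close> and modulo \<open>P\<close>; likewise on \<open>R' = f(R)\<close>. Let \<open>\<chi>\<close> map \<open>R\<close> to a fully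
normalized subgroup so that \<open>U\<close> becomes a group of conjugations. Then \<open>\<chi>\<close> and \<open>\<chi>' = \<chi> f\<^sup>-\<^sup>1\<close> extend, with their
labels, to those elements of \<open>C\<^sub>S(P)\<close>. Brought back to \<open>P\<close> by a map \<open>\<rho>\<close>, both extensions fall under
\<open>PC_lifts_of_PC\<close>, and \<open>f|\<^bsub>P\<^esub>\<close> is their quotient.\<close>

lemma PC_lifts_of_nrm:
  assumes fn: "fully_normalized S F P" and nq: "\<not> quasicentric S F P"
    and above: "\<And>R0. fully_normalized S F R0 \<Longrightarrow> card P < card R0 \<Longrightarrow> labels_extend R0"
    and f: "L R f y" "P \<subset> R" "R \<subseteq> nrm P" "f ` P = P"
  shows "PC_lifts P f y"
proof -
  let ?N = "P <#> cen P"
  have fc: "fully_centralized S F P" using fn_fc[OF fn] .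
  have P: "subgroup P S" using fc by (rule fc_sub)
  have N: "subgroup ?N S" "P \<subseteq> ?N" by (rule subgroup_PC[OF P], rule P_le_PC[OF P])
  have m: "mor R f" using lab_mor[OF f(1)] .
  have R: "subgroup R S" using mor_subgroup[OF m] .
  have PR: "P \<subseteq> R" using f(2) by auto
  have C: "subgroup (cen P) S" by (rule cenS[OF P])
  have CnP: "\<not> cen P \<subseteq> P" using fc_centric_imp_quasicentric[OF fc] nq by blast
  have onPC: "PC_lifts P g v" if "L X g v" "P \<subset> X" "X \<subseteq> ?N" "g ` P = P" for X g v
    by (rule PC_lifts_of_PC[OF fc nq _ that]) (rule above)
  show ?thesis
  proof (cases "R \<inter> cen P \<subseteq> P")
    case False
    have RN: "subgroup (R \<inter> ?N) S" by (rule subgroups_Inter_pair[OF R N(1)])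
    have "P \<subset> R \<inter> ?N" using False PR N(2) C_le_PC[OF P] by blast
    then show ?thesis using onPC[OF lab_restrict[OF f(1) RN]] f(4) by blast
  next
    case True
    define R' where "R' = f ` R"
    have R': "subgroup R' S" "card R' = card R" "P \<subset> R'" "R' \<subseteq> nrm P"
    proof -
      show "subgroup R' S" "card R' = card R" using mor_image[OF m] mor_card[OF m] by (auto simp: R'_def)
      have "P \<subseteq> R'" using f(4) PR by (auto simp: R'_def)
      moreover have "card P < card R'" using card_psubset[OF R f(2)] \<open>card R' = card R\<close> by simp
      ultimately show "P \<subset> R'" by auto
      show "R' \<subseteq> nrm P" using mor_nrm[OF m PR] f(3,4) by (auto simp: R'_def)
    qed
    have True': "R' \<inter> cen P \<subseteq> P"
    proof
      fix y assume y: "y \<in> R' \<inter> cen P"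
      then obtain x where x: "x \<in> R" "y = f x" by (auto simp: R'_def)
      have "cj x z = z" if z: "z \<in> P" for z
      proof -
        have "f z \<in> P" using f(4) z by blast
        then have "f (cj x z) = f z" using mor_cj[OF m x(1), of z] z PR cen_cj[of y P "f z"] y x by auto
        moreover have "cj x z \<in> R" using nrm_cj[of x P z] x f(3) z PR by blast
        ultimately show ?thesis using mor_inj[OF m] z PR by (meson inj_onD subsetD)
      qed
      then have "x \<in> cen P" using sub_carrier[OF R x(1)] by (simp add: cen_def)
      then have "x \<in> P" using True x by blast
      then show "y \<in> P" using f(4) x by blast
    qed
    \<comment> \<open>Normalizers grow in \<open>C\<^sub>S(P) X\<close>, which is larger than \<open>X\<close> because \<open>X \<inter> C\<^sub>S(P)\<close> lies in \<open>P\<close> and \<open>C\<^sub>S(P)\<close> does not.\<close>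
    have E: "subgroup (P <#> (cen P \<inter> nrm X)) S" "P \<subset> P <#> (cen P \<inter> nrm X)" "P <#> (cen P \<inter> nrm X) \<subseteq> ?N"
      if X: "subgroup X S" "P \<subset> X" "X \<subseteq> nrm P" "X \<inter> cen P \<subseteq> P" for X
    proof -
      let ?Y = "cen P \<inter> nrm X"
      have Y: "subgroup ?Y S" by (rule cenR_subgroup[OF P X(1)])
      show "subgroup (P <#> ?Y) S" by (rule subgroup_set_mult[OF P Y]) (use cen_subset_nrm in blast)
      show "P <#> ?Y \<subseteq> ?N" by (rule set_mult_least[OF N]) (use C_le_PC[OF P] in blast)
      have CX: "subgroup (cen P <#> X) S"
        by (rule subgroup_set_mult[OF C X(1)]) (use X(3) nrm_le_nrm_cen[OF P] in blast)
      have "X \<subseteq> cen P <#> X" "cen P \<subseteq> cen P <#> X" using set_mult_right[OF C X(1)] set_mult_left[OF C X(1)] by auto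
      then have "X \<subset> cen P <#> X" using X(4) CnP by blast
      then obtain g where g: "g \<in> cen P <#> X" "g \<notin> X" "g \<in> nrm X" using nrm_grows[OF X(1) CX] by blast
      obtain c x where cx: "c \<in> cen P" "x \<in> X" "g = c \<otimes> x" using g by (auto simp: set_mult_def)
      have car: "c \<in> carrier S" "x \<in> carrier S" using cx cen_carrier sub_carrier[OF X(1)] by auto
      have "c = g \<otimes> inv x" using cx car by (simp add: m_assoc)
      moreover have "x \<in> nrm X" using cx subgroup_subset_nrm[OF X(1)] by blast
      ultimately have "c \<in> nrm X"
        using g(3) nrmS[OF X(1)] by (simp add: subgroup.m_closed subgroup.m_inv_closed)
      moreover have "c \<notin> P" using g(2) cx X(1,2) subgroup.m_closed[OF X(1)] by blast
      moreover have "P \<subseteq> P <#> ?Y" "?Y \<subseteq> P <#> ?Y" using set_mult_left[OF P Y] set_mult_right[OF P Y] by auto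
      ultimately show "P \<subset> P <#> ?Y" using cx by blast
    qed
    have comm: "inv z \<otimes> cj c z \<in> P"
      if X: "subgroup X S" "X \<subseteq> nrm P" "X \<inter> cen P \<subseteq> P" and c: "c \<in> cen P \<inter> nrm X" and z: "z \<in> X" for X c z
    proof -
      have car: "c \<in> carrier S" "z \<in> carrier S" using c z sub_carrier[OF X(1)] cen_carrier by auto
      have iz: "inv z \<in> X" "inv z \<in> nrm P" using subgroup.m_inv_closed[OF X(1) z] X(2) by auto
      have "cj c z \<in> X" using nrm_cj[of c X z] c z by blast
      then have 1: "inv z \<otimes> cj c z \<in> X" using iz subgroup.m_closed[OF X(1)] by blast
      have "inv z \<otimes> cj c z = cj (inv z) c \<otimes> inv c" using car by (simp add: cj_def m_assoc)
      moreover have "cj (inv z) c \<in> cen P" using nrm_cen[OF P iz(2)] c by blast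
      ultimately have "inv z \<otimes> cj c z \<in> cen P" using c subgroup.m_closed[OF C] subgroup.m_inv_closed[OF C] by auto
      then show ?thesis using 1 X(3) by blast
    qed
    define U where "U = {u \<in> F R R. (\<forall>z\<in>P. u z = z) \<and> (\<forall>z\<in>R. inv z \<otimes> u z \<in> P)}"
    have U: "subgroup U (Aut_group F R)"
    proof (rule aut_subgroupI[OF R])
      show "U \<subseteq> F R R" by (auto simp: U_def)
      show "(\<lambda>x\<in>R. x) \<in> U" using id_mem[OF R] PR sub_carrier[OF R] subgroup.one_closed[OF P] by (auto simp: U_def)
      show "compose R a b \<in> U" if ab: "a \<in> U" "b \<in> U" for a b
      proof -
        have "inv z \<otimes> a (b z) \<in> P" if z: "z \<in> R" for z
        proof -
          have "a ` R \<subseteq> R" "b ` R \<subseteq> R" using ab F_D(4) by (auto simp: U_def)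
          then have bz: "b z \<in> R" "a (b z) \<in> R" using z by blast+
          have car: "z \<in> carrier S" "b z \<in> carrier S" "a (b z) \<in> carrier S" using sub_carrier[OF R] z bz by auto
          have "inv z \<otimes> a (b z) = (inv z \<otimes> b z) \<otimes> (inv (b z) \<otimes> a (b z))"
            using car by (simp add: m_assoc) (simp add: m_assoc[symmetric])
          then show ?thesis using ab z bz subgroup.m_closed[OF P] by (simp add: U_def)
        qed
        then show ?thesis using ab comp_mem PR by (auto simp: U_def compose_def)
      qed
      show "restrict (inv_into R a) R \<in> U" if a: "a \<in> U" for a
      proof -
        have aF: "a \<in> F R R" "mor R a" "a ` R = R" "\<And>z. z \<in> P \<Longrightarrow> a z = z" using a aut_iff[OF R] by (auto simp: U_def)
        have "inv z \<otimes> inv_into R a z \<in> P" if z: "z \<in> R" for z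
        proof -
          have "z \<in> a ` R" using aF(3) z by simp
          then obtain w where w: "w \<in> R" "z = a w" by auto
          have car: "w \<in> carrier S" "a w \<in> carrier S" using sub_carrier[OF R] z w by auto
          have "inv z \<otimes> inv_into R a z = inv (inv w \<otimes> a w)"
            using w mor_inj[OF aF(2)] car by (simp add: inv_mult_group)
          moreover have "inv w \<otimes> a w \<in> P" using a w by (simp add: U_def)
          ultimately show ?thesis using subgroup.m_inv_closed[OF P] by simp
        qed
        then show ?thesis using inv_into_aut[OF R aF(1)] inv_into_fix[OF aF(2) PR aF(4)] PR by (auto simp: U_def)
      qed
    qed
    obtain n where n: "order S = p ^ n" using order_S by blast
    have "\<exists>k. card U = p ^ k"
    proof (rule card_p_of_exponent[OF R U])
      show "u [^]\<^bsub>Aut_group F R\<^esub> (p ^ n) = \<one>\<^bsub>Aut_group F R\<^esub>" if "u \<in> U" for u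
        using stable_power[OF R P PR, of u] that n by (simp add: U_def)
    qed
    then obtain k where k: "card U = p ^ k" by blast
    obtain \<chi> where \<chi>: "mor R \<chi>" "fully_normalized S F (\<chi> ` R)"
      "\<And>u. u \<in> U \<Longrightarrow> \<exists>g\<in>nrm (\<chi> ` R). \<forall>x\<in>R. \<chi> (u x) = cj g (\<chi> x)"
      using fn_p_subgroup[OF R U k] by blast
    define R0 where "R0 = \<chi> ` R"
    define P0 where "P0 = \<chi> ` P"
    have \<chi>P: "mor P \<chi>" by (rule mor_restrict[OF \<chi>(1) P PR])
    have P0: "subgroup P0 S" using mor_image[OF \<chi>P] by (simp add: P0_def)
    have fnR0: "fully_normalized S F R0" using \<chi>(2) by (simp add: R0_def)
    have lextR0: "labels_extend R0"
      using above[OF fnR0] card_psubset[OF R f(2)] mor_card[OF \<chi>(1)] by (simp add: R0_def)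
    \<comment> \<open>The label \<open>w\<close> of \<open>\<chi>\<close> is arbitrary and cancels in the quotient.\<close>
    obtain w where w: "L R \<chi> w" using L_ex[OF \<chi>(1)] by blast
    have car: "w \<in> carrier \<Gamma>" "y \<in> carrier \<Gamma>" using lab_carrier w f(1) by auto
    let ?i = "inv_into R f"
    define \<chi>' where "\<chi>' = (\<lambda>z. \<chi> (?i z))"
    have ii: "?i (f z) = z" if "z \<in> R" for z using mor_inj[OF m] that by simp
    have iR: "?i ` R' = R" using inv_into_image[OF m] by (simp add: R'_def)
    have "L R' ?i (inv\<^bsub>\<Gamma>\<^esub> y)" using L_inv[OF f(1)] by (simp add: R'_def)
    then have w': "L R' \<chi>' (w \<otimes>\<^bsub>\<Gamma>\<^esub> inv\<^bsub>\<Gamma>\<^esub> y)" unfolding \<chi>'_def by (rule lab_comp[OF w]) (use iR in auto)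
    have \<chi>'f: "\<chi>' (f z) = \<chi> z" if "z \<in> R" for z using ii that by (simp add: \<chi>'_def)
    have \<chi>'R: "\<chi>' ` R' = R0"
    proof -
      have "\<chi>' ` R' = \<chi> ` ?i ` R'" unfolding \<chi>'_def by (simp only: image_image)
      then show ?thesis using iR by (simp add: R0_def)
    qed
    have \<chi>'P: "\<chi>' ` P = P0"
    proof -
      have "\<chi>' ` P = \<chi>' ` f ` P" using f(4) by simp
      also have "\<dots> = \<chi> ` P" using \<chi>'f PR by force
      finally show ?thesis by (simp add: P0_def)
    qed
    have sub1: "cen P \<inter> nrm R \<subseteq> Nx R \<chi>"
    proof
      fix c assume c: "c \<in> cen P \<inter> nrm R"
      have "restrict (cj c) R \<in> F R R" using conj_auts_in_F[OF R, of "nrm R"] c by (auto simp: conj_auts_def)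
      then have "restrict (cj c) R \<in> U" using c PR comm[OF R f(3) True c] cen_cj[of c P] by (auto simp: U_def)
      then obtain g where "g \<in> nrm R0" "\<forall>x\<in>R. \<chi> (restrict (cj c) R x) = cj g (\<chi> x)"
        using \<chi>(3)[of "restrict (cj c) R"] unfolding R0_def by blast
      then show "c \<in> Nx R \<chi>" using c by (auto simp: Nx_def R0_def)
    qed
    have sub2: "cen P \<inter> nrm R' \<subseteq> Nx R' \<chi>'"
    proof
      fix c assume c: "c \<in> cen P \<inter> nrm R'"
      define u where "u = restrict (\<lambda>z. ?i (cj c (f z))) R"
      have cR': "cj c (f z) \<in> R'" if "z \<in> R" for z using that nrm_cj[of c R' "f z"] c by (auto simp: R'_def)
      have fi: "f (?i y) = y" if "y \<in> R'" for y using that by (auto simp: R'_def f_inv_into_f)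
      have "mor R (\<lambda>z. cj c (f z))"
        by (rule mor_comp[OF m, of R' "cj c"]) (use mor_cj_elem[OF R'(1)] c cen_carrier R'_def in auto)
      then have "mor R (\<lambda>z. ?i (cj c (f z)))"
        by (rule mor_comp[OF _ mor_inv_into[OF m]]) (use cR' in \<open>auto simp: R'_def\<close>)
      moreover have "(\<lambda>z. ?i (cj c (f z))) ` R = R"
      proof -
        have "(\<lambda>z. ?i (cj c (f z))) ` R = ?i ` cj c ` f ` R" by (simp only: image_image)
        also have "cj c ` f ` R = R'" using nrm_image[OF R'(1), of c] c by (simp add: R'_def)
        finally show ?thesis using iR by simp
      qed
      ultimately have uF: "u \<in> F R R" unfolding u_def by (rule aut_restrict)
      have uP: "u z = z" if z: "z \<in> P" for z
      proof -
        have "f z \<in> P" using f(4) z by blast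
        then show ?thesis using z PR c cen_cj[of c P "f z"] ii by (auto simp: u_def)
      qed
      have "inv z \<otimes> u z \<in> P" if z: "z \<in> R" for z
      proof -
        have uz: "u z \<in> R" "inv z \<in> R" using F_D(4)[OF uF] z subgroup.m_inv_closed[OF R] by auto
        have "f (inv z \<otimes> u z) = inv (f z) \<otimes> cj c (f z)"
          using mor_mult[OF m uz(2,1)] mor_m_inv[OF m z] fi[OF cR'[OF z]] z by (simp add: u_def)
        also have "\<dots> \<in> P" using comm[OF R'(1,4) True' c, of "f z"] z by (simp add: R'_def)
        finally obtain v where v: "v \<in> P" "f (inv z \<otimes> u z) = f v" using f(4) by (metis imageE)
        moreover have "inv z \<otimes> u z \<in> R" using subgroup.m_closed[OF R uz(2,1)] .
        ultimately have "inv z \<otimes> u z = v" using mor_inj[OF m] PR by (meson inj_onD subsetD)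
        then show ?thesis using v by simp
      qed
      then have "u \<in> U" using uF uP by (simp add: U_def)
      then obtain g where g: "g \<in> nrm R0" "\<forall>x\<in>R. \<chi> (u x) = cj g (\<chi> x)" using \<chi>(3)[of u] unfolding R0_def by blast
      have "\<chi>' (cj c z) = cj g (\<chi>' z)" if z: "z \<in> R'" for z
      proof -
        obtain x where x: "x \<in> R" "z = f x" using z by (auto simp: R'_def)
        then have "\<chi>' (cj c z) = \<chi> (u x)" by (simp add: \<chi>'_def u_def)
        then show ?thesis using g(2) x \<chi>'f by simp
      qed
      then show "c \<in> Nx R' \<chi>'" using c g(1) \<chi>'R by (auto simp: Nx_def)
    qed
    obtain e where e: "L (Nx R \<chi>) e w" "\<And>z. z \<in> R \<Longrightarrow> e z = \<chi> z"
      using labelled_extension[of \<chi> R w] w fn_fc[OF fnR0] lextR0 unfolding R0_def by blast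
    obtain e' where e': "L (Nx R' \<chi>') e' (w \<otimes>\<^bsub>\<Gamma>\<^esub> inv\<^bsub>\<Gamma>\<^esub> y)" "\<And>z. z \<in> R' \<Longrightarrow> e' z = \<chi>' z"
      using labelled_extension[of \<chi>' R' "w \<otimes>\<^bsub>\<Gamma>\<^esub> inv\<^bsub>\<Gamma>\<^esub> y"] w' fn_fc[OF fnR0] lextR0 unfolding \<chi>'R by blast
    obtain \<rho> where \<rho>: "mor (nrm P0) \<rho>" "\<rho> ` P0 = P"
      using fn_frame[OF fn mor_inv_into[OF \<chi>P]] inv_into_image[OF \<chi>P] by (auto simp: P0_def)
    obtain r where r: "L (nrm P0) \<rho> r" using L_ex[OF \<rho>(1)] by blast
    have rc: "r \<in> carrier \<Gamma>" using lab_carrier[OF r] .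
    have lift: "PC_lifts P (\<lambda>z. \<rho> (d z)) (r \<otimes>\<^bsub>\<Gamma>\<^esub> v)"
      if X: "subgroup X S" "P \<subset> X" "X \<subseteq> nrm P" "X \<inter> cen P \<subseteq> P" and d: "L (Nx X x) d v" "d ` P = P0"
        and x: "mor X x" "cen P \<inter> nrm X \<subseteq> Nx X x" for X x d v
    proof -
      note EX = E[OF X]
      let ?E = "P <#> (cen P \<inter> nrm X)"
      have ENx: "?E \<subseteq> Nx X x"
        by (rule set_mult_least[OF Nx_subgroup[OF x(1)]]) (use Nx_superset[OF x(1)] X(2) x(2) in auto)
      have dE: "L ?E d v" by (rule lab_restrict[OF d(1) EX(1) ENx])
      have "d ` ?E \<subseteq> nrm P0"
        using mor_nrm[OF lab_mor[OF dE], of P] EX(2,3) PC_le_nrm[OF P] d(2) by auto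
      then have "L ?E (\<lambda>z. \<rho> (d z)) (r \<otimes>\<^bsub>\<Gamma>\<^esub> v)" by (rule lab_comp[OF r dE]) simp
      moreover have "(\<lambda>z. \<rho> (d z)) ` P = P"
      proof -
        have "(\<lambda>z. \<rho> (d z)) ` P = \<rho> ` d ` P" by (simp only: image_image)
        then show ?thesis using d(2) \<rho>(2) by simp
      qed
      ultimately show ?thesis using onPC EX(2,3) by blast
    qed
    have eP: "e ` P = P0" using e(2) PR unfolding P0_def by (metis image_cong subsetD)
    have e'P: "e' ` P = P0" using e'(2) R'(3) \<chi>'P by (metis image_cong psubsetD)
    have l1: "PC_lifts P (\<lambda>z. \<rho> (e z)) (r \<otimes>\<^bsub>\<Gamma>\<^esub> w)" by (rule lift[OF R f(2,3) True e(1) eP \<chi>(1) sub1])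
    have l2: "PC_lifts P (\<lambda>z. \<rho> (e' z)) (r \<otimes>\<^bsub>\<Gamma>\<^esub> (w \<otimes>\<^bsub>\<Gamma>\<^esub> inv\<^bsub>\<Gamma>\<^esub> y))"
      by (rule lift[OF R'(1,3,4) True' e'(1) e'P lab_mor[OF w'] sub2])
    have "PC_lifts P f (inv\<^bsub>\<Gamma>\<^esub> (r \<otimes>\<^bsub>\<Gamma>\<^esub> (w \<otimes>\<^bsub>\<Gamma>\<^esub> inv\<^bsub>\<Gamma>\<^esub> y)) \<otimes>\<^bsub>\<Gamma>\<^esub> (r \<otimes>\<^bsub>\<Gamma>\<^esub> w))"
    proof (rule PC_lifts_div[OF P l1 l2])
      show "f z \<in> P" if "z \<in> P" for z using f(4) that by blast
      show "\<rho> (e' (f z)) = \<rho> (e z)" if z: "z \<in> P" for z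
      proof -
        have "f z \<in> R'" "z \<in> R" using z PR by (auto simp: R'_def)
        then show ?thesis using e(2) e'(2) \<chi>'f by simp
      qed
    qed
    moreover have "inv\<^bsub>\<Gamma>\<^esub> (r \<otimes>\<^bsub>\<Gamma>\<^esub> (w \<otimes>\<^bsub>\<Gamma>\<^esub> inv\<^bsub>\<Gamma>\<^esub> y)) \<otimes>\<^bsub>\<Gamma>\<^esub> (r \<otimes>\<^bsub>\<Gamma>\<^esub> w) = y"
    proof -
      have "r \<otimes>\<^bsub>\<Gamma>\<^esub> w = (r \<otimes>\<^bsub>\<Gamma>\<^esub> (w \<otimes>\<^bsub>\<Gamma>\<^esub> inv\<^bsub>\<Gamma>\<^esub> y)) \<otimes>\<^bsub>\<Gamma>\<^esub> y" using rc car by (simp add: T.H.m_assoc)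
      moreover have "inv\<^bsub>\<Gamma>\<^esub> a \<otimes>\<^bsub>\<Gamma>\<^esub> (a \<otimes>\<^bsub>\<Gamma>\<^esub> y) = y" if "a \<in> carrier \<Gamma>" for a
        using that car by (simp add: T.H.m_assoc[symmetric])
      ultimately show ?thesis using rc car by simp
    qed
    ultimately show ?thesis by metis
  qed
qed

end

context fusion_triple begin

text \<open>Induction on the composite \<open>f\<close>. Each of its factors is defined on a quasicentric subgroup, hence on a proper
overgroup inside the normalizer of the current image \<open>Q'\<close> of \<open>Q\<close>. Carried over to \<open>P\<close> by frames, it falls
under \<open>PC_lifts_of_nrm\<close>. Choosing a frame of each intermediate image makes the consecutive factors composable.\<close>

lemma PC_lifts_frames:
  assumes fn: "fully_normalized S F P" and nq: "\<not> quasicentric S F P"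
    and above: "\<And>R0. fully_normalized S F R0 \<Longrightarrow> card P < card R0 \<Longrightarrow> labels_extend R0"
    and f: "L Q f x" and h: "L (nrm Q) h w" "h ` Q = P"
    and k: "L (nrm (f ` Q)) k v" "k ` f ` Q = P"
  shows "PC_lifts P (\<lambda>z. k (f (inv_into Q h z))) (v \<otimes>\<^bsub>\<Gamma>\<^esub> (x \<otimes>\<^bsub>\<Gamma>\<^esub> inv\<^bsub>\<Gamma>\<^esub> w))"
proof -
  have P: "subgroup P S" using fn by (rule fn_sub)
  have on_nrm: "PC_lifts P g u" if "L X g u" "P \<subset> X" "X \<subseteq> nrm P" "g ` P = P" for X g u
    by (rule PC_lifts_of_nrm[OF fn nq _ that]) (rule above)
  show ?thesis using f h k
  proof (induction arbitrary: k v rule: lab.induct)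
    case (lab_id Q f)
    note h = lab_id(3,4) and k = lab_id(5,6)
    have Q: "subgroup Q S" by (rule lab_id(1))
    have QN: "Q \<subseteq> nrm Q" by (rule subgroup_subset_nrm[OF Q])
    have mh: "mor (nrm Q) h" using lab_mor[OF h(1)] .
    have hQ: "mor Q h" by (rule mor_restrict[OF mh Q QN])
    have fQ: "f ` Q = Q" by (rule fix_image[OF lab_id(2)])
    have "\<not> quasicentric S F Q" using quasicentric_conj[OF _ hQ] h(2) nq by auto
    then have "card Q < card (nrm Q)" using card_psubset[OF nrmS[OF Q] nrm_strict[OF Q nonquasi_proper[OF Q]]] by simp
    then have "card P < card (h ` nrm Q)" using mor_card[OF mh] mor_card[OF hQ] h(2) by simp
    moreover have "P \<subseteq> h ` nrm Q" using h(2) QN by blast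
    ultimately have PX: "P \<subset> h ` nrm Q" by auto
    have X: "h ` nrm Q \<subseteq> nrm P" using mor_nrm[OF mh QN] h(2) by auto
    let ?i = "inv_into (nrm Q) h"
    have i: "L (h ` nrm Q) ?i (inv\<^bsub>\<Gamma>\<^esub> w)" by (rule L_inv[OF h(1)])
    have kL: "L (h ` nrm Q) (\<lambda>z. k (?i z)) (v \<otimes>\<^bsub>\<Gamma>\<^esub> inv\<^bsub>\<Gamma>\<^esub> w)"
      by (rule lab_comp[OF _ i]) (use k(1) fQ inv_into_image[OF mh] in auto)
    have ii: "?i (h z) = z" if "z \<in> Q" for z using mor_inj[OF mh] that QN by auto
    have kP: "(\<lambda>z. k (?i z)) ` P = P"
    proof -
      have "?i ` h ` Q = Q" using ii by force
      then have iP: "?i ` P = Q" unfolding h(2) .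
      have "(\<lambda>z. k (?i z)) ` P = k ` ?i ` P" by (simp only: image_image)
      also have "\<dots> = k ` f ` Q" unfolding iP fQ ..
      finally show ?thesis unfolding k(2) .
    qed
    have "PC_lifts P (\<lambda>z. k (?i z)) (v \<otimes>\<^bsub>\<Gamma>\<^esub> inv\<^bsub>\<Gamma>\<^esub> w)" by (rule on_nrm[OF kL PX X kP])
    moreover have "v \<otimes>\<^bsub>\<Gamma>\<^esub> inv\<^bsub>\<Gamma>\<^esub> w = v \<otimes>\<^bsub>\<Gamma>\<^esub> (\<one>\<^bsub>\<Gamma>\<^esub> \<otimes>\<^bsub>\<Gamma>\<^esub> inv\<^bsub>\<Gamma>\<^esub> w)" using lab_carrier[OF h(1)] by simp
    ultimately have "PC_lifts P (\<lambda>z. k (?i z)) (v \<otimes>\<^bsub>\<Gamma>\<^esub> (\<one>\<^bsub>\<Gamma>\<^esub> \<otimes>\<^bsub>\<Gamma>\<^esub> inv\<^bsub>\<Gamma>\<^esub> w))" by metis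
    then show ?case
    proof (rule PC_lifts_cong)
      fix z assume "z \<in> P"
      then obtain q where q: "q \<in> Q" "z = h q" using h(2) by blast
      then show "k (?i z) = k (f (inv_into Q h z))" using ii lab_id(2) mor_inj[OF hQ] by simp
    qed
  next
    case (lab_step Q f x R g y g')
    note h = lab_step(7,8) and k = lab_step(9,10)
    have Lf: "L Q f x" by (rule lab_step(1))
    have mf: "mor Q f" using lab_mor[OF Lf] .
    have Q: "subgroup Q S" using mor_subgroup[OF mf] .
    have QN: "Q \<subseteq> nrm Q" by (rule subgroup_subset_nrm[OF Q])
    have hQ: "mor Q h" by (rule mor_restrict[OF lab_mor[OF h(1)] Q QN])
    define Q' where "Q' = f ` Q"
    have Q': "subgroup Q' S" using mor_image[OF mf] by (simp add: Q'_def)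
    have Q'N: "Q' \<subseteq> nrm Q'" by (rule subgroup_subset_nrm[OF Q'])
    have i: "mor Q' (inv_into Q f)" "inv_into Q f ` Q' = Q" using mor_inv_into[OF mf] inv_into_image[OF mf] by (auto simp: Q'_def)
    have m: "mor Q' (\<lambda>z. h (inv_into Q f z))" by (rule mor_comp[OF i(1) hQ]) (use i in simp)
    have mi: "(\<lambda>z. h (inv_into Q f z)) ` Q' = P"
    proof -
      have "(\<lambda>z. h (inv_into Q f z)) ` Q' = h ` inv_into Q f ` Q'" by (simp only: image_image)
      then show ?thesis using i(2) h(2) by simp
    qed
    have nqQ': "\<not> quasicentric S F Q'" using quasicentric_conj[OF _ m] mi nq by auto
    obtain k0 where k0: "mor (nrm Q') k0" "k0 ` Q' = P" using fn_frame[OF fn m mi] by blast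
    obtain v0 where v0: "L (nrm Q') k0 v0" using L_ex[OF k0(1)] by blast
    have R: "subgroup R S" "quasicentric S F R" using lab_step(2) TH_quasi quasi_sub by auto
    have "Q' \<subset> R" using lab_step(4) nqQ' R(2) by (auto simp: Q'_def)
    then obtain a where a: "a \<in> R" "a \<notin> Q'" "a \<in> nrm Q'" using nrm_grows[OF Q' R(1)] by blast
    define R1 where "R1 = nrm Q' \<inter> R"
    have R1: "subgroup R1 S" "Q' \<subset> R1" "R1 \<subseteq> nrm Q'"
      using subgroups_Inter_pair[OF nrmS[OF Q'] R(1)] \<open>Q' \<subset> R\<close> Q'N a by (auto simp: R1_def)
    have g: "L R1 g y" by (rule lab_restrict[OF lab_gen[OF lab_step(2,3)] R1(1)]) (auto simp: R1_def)
    have mg: "mor R1 g" using lab_mor[OF g] .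
    have gQ: "g' ` Q = g ` Q'" using lab_step(5) by (auto simp: Q'_def)
    have kg: "L (nrm (g ` Q')) k v" "k ` g ` Q' = P" using k gQ by auto
    have gR1: "g ` R1 \<subseteq> nrm (g ` Q')" using mor_nrm[OF mg, of Q'] R1(2,3) by auto
    have k0R: "L R1 k0 v0" by (rule lab_restrict[OF v0 R1(1,3)])
    have mk0: "mor R1 k0" using lab_mor[OF k0R] .
    have car: "v \<in> carrier \<Gamma>" "v0 \<in> carrier \<Gamma>" "x \<in> carrier \<Gamma>" "y \<in> carrier \<Gamma>" "w \<in> carrier \<Gamma>"
      using lab_carrier kg(1) v0 Lf g h(1) by auto
    let ?X = "k0 ` R1"
    let ?j = "inv_into R1 k0"
    have j: "L ?X ?j (inv\<^bsub>\<Gamma>\<^esub> v0)" "?j ` ?X = R1" using L_inv[OF k0R] inv_into_image[OF mk0] by auto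
    have jk: "?j (k0 z) = z" if "z \<in> Q'" for z using mor_inj[OF mk0] that R1(2) by auto
    have "L ?X (\<lambda>z. g (?j z)) (y \<otimes>\<^bsub>\<Gamma>\<^esub> inv\<^bsub>\<Gamma>\<^esub> v0)" by (rule lab_comp[OF g j(1)]) (use j in auto)
    then have 1: "L ?X (\<lambda>z. k (g (?j z))) (v \<otimes>\<^bsub>\<Gamma>\<^esub> (y \<otimes>\<^bsub>\<Gamma>\<^esub> inv\<^bsub>\<Gamma>\<^esub> v0))"
      by (rule lab_comp[OF kg(1)]) (use gR1 j(2) in auto)
    have "card P < card ?X"
      using card_psubset[OF R1(1,2)] mor_card[OF mk0] mor_card[OF mor_restrict[OF k0(1) Q' Q'N]] k0(2) by simp
    moreover have "P \<subseteq> ?X" using k0(2) R1(2) by blast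
    ultimately have PX: "P \<subset> ?X" by auto
    have XN: "?X \<subseteq> nrm P" using mor_nrm[OF mk0, of Q'] R1(2,3) k0(2) by auto
    have "?j ` k0 ` Q' = Q'" using jk by force
    then have jP: "?j ` P = Q'" unfolding k0(2) .
    have "(\<lambda>z. k (g (?j z))) ` P = k ` g ` ?j ` P" by (simp only: image_image)
    then have "(\<lambda>z. k (g (?j z))) ` P = P" unfolding jP kg(2) .
    then have 2: "PC_lifts P (\<lambda>z. k (g (?j z))) (v \<otimes>\<^bsub>\<Gamma>\<^esub> (y \<otimes>\<^bsub>\<Gamma>\<^esub> inv\<^bsub>\<Gamma>\<^esub> v0))" by (rule on_nrm[OF 1 PX XN])
    have 3: "PC_lifts P (\<lambda>z. k0 (f (inv_into Q h z))) (v0 \<otimes>\<^bsub>\<Gamma>\<^esub> (x \<otimes>\<^bsub>\<Gamma>\<^esub> inv\<^bsub>\<Gamma>\<^esub> w))"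
      by (rule lab_step(6)[OF h]) (use v0 k0(2) in \<open>auto simp: Q'_def\<close>)
    have "PC_lifts P (\<lambda>z. k (g (?j (k0 (f (inv_into Q h z))))))
        ((v \<otimes>\<^bsub>\<Gamma>\<^esub> (y \<otimes>\<^bsub>\<Gamma>\<^esub> inv\<^bsub>\<Gamma>\<^esub> v0)) \<otimes>\<^bsub>\<Gamma>\<^esub> (v0 \<otimes>\<^bsub>\<Gamma>\<^esub> (x \<otimes>\<^bsub>\<Gamma>\<^esub> inv\<^bsub>\<Gamma>\<^esub> w)))"
      by (rule PC_lifts_comp[OF P 3 2])
    moreover have "(v \<otimes>\<^bsub>\<Gamma>\<^esub> (y \<otimes>\<^bsub>\<Gamma>\<^esub> inv\<^bsub>\<Gamma>\<^esub> v0)) \<otimes>\<^bsub>\<Gamma>\<^esub> (v0 \<otimes>\<^bsub>\<Gamma>\<^esub> (x \<otimes>\<^bsub>\<Gamma>\<^esub> inv\<^bsub>\<Gamma>\<^esub> w))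
        = v \<otimes>\<^bsub>\<Gamma>\<^esub> ((y \<otimes>\<^bsub>\<Gamma>\<^esub> x) \<otimes>\<^bsub>\<Gamma>\<^esub> inv\<^bsub>\<Gamma>\<^esub> w)"
    proof -
      have "inv\<^bsub>\<Gamma>\<^esub> v0 \<otimes>\<^bsub>\<Gamma>\<^esub> (v0 \<otimes>\<^bsub>\<Gamma>\<^esub> (x \<otimes>\<^bsub>\<Gamma>\<^esub> inv\<^bsub>\<Gamma>\<^esub> w)) = x \<otimes>\<^bsub>\<Gamma>\<^esub> inv\<^bsub>\<Gamma>\<^esub> w"
        using car by (simp add: T.H.m_assoc[symmetric])
      then show ?thesis using car by (simp add: T.H.m_assoc)
    qed
    ultimately have "PC_lifts P (\<lambda>z. k (g (?j (k0 (f (inv_into Q h z)))))) (v \<otimes>\<^bsub>\<Gamma>\<^esub> ((y \<otimes>\<^bsub>\<Gamma>\<^esub> x) \<otimes>\<^bsub>\<Gamma>\<^esub> inv\<^bsub>\<Gamma>\<^esub> w))"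
      by metis
    then show ?case
    proof (rule PC_lifts_cong)
      fix z assume "z \<in> P"
      then obtain q where q: "q \<in> Q" "z = h q" using h(2) by blast
      then show "k (g (?j (k0 (f (inv_into Q h z))))) = k (g' (inv_into Q h z))"
        using jk[of "f q"] lab_step(5) mor_inj[OF hQ] by (simp add: Q'_def)
    qed
  qed
qed

text \<open>Downward induction on \<open>P\<close>. If \<open>P\<close> is not quasicentric, \<open>PC_lifts_frames\<close> with identities as frames lifts the
identity of \<open>P\<close> with label \<open>y\<close> to \<open>P C\<^sub>S(P)\<close>. From there to \<open>N\<^sub>S(P)\<close> the two kinds of \<open>\<Gamma>\<close> are treated
separately.\<close>

theorem labels_extend_fn: assumes "fully_normalized S F P" shows "labels_extend P"
proof -
  have "fully_normalized S F P \<longrightarrow> labels_extend P" using fn_sub[OF assms]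
  proof (induction rule: subgroup_down_induct)
    fix P assume P: "subgroup P S"
      and IH: "\<And>Q. subgroup Q S \<Longrightarrow> card P < card Q \<Longrightarrow> fully_normalized S F Q \<longrightarrow> labels_extend Q"
    show "fully_normalized S F P \<longrightarrow> labels_extend P"
    proof
      assume fn: "fully_normalized S F P"
      have fc: "fully_centralized S F P" using fn_fc[OF fn] .
      have above: "labels_extend R0" if "fully_normalized S F R0" "card P < card R0" for R0
        using IH[OF fn_sub[OF that(1)] that(2)] that(1) by blast
      show "labels_extend P"
      proof (cases "quasicentric S F P")
        case True
        then show ?thesis by (rule labels_extend_quasicentric[OF fc])
      next
        case nq: False
        show ?thesis unfolding labels_extend_def
        proof (intro allI impI)
          fix y assume y: "L P (\<lambda>z. z) y"
          have yc: "y \<in> carrier \<Gamma>" using lab_carrier[OF y] .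
          have id: "L (nrm P) (\<lambda>z. z) \<one>\<^bsub>\<Gamma>\<^esub>" by (rule lab_id[OF nrmS[OF P]]) simp
          have "PC_lifts P (\<lambda>z. inv_into P (\<lambda>z. z) z) (\<one>\<^bsub>\<Gamma>\<^esub> \<otimes>\<^bsub>\<Gamma>\<^esub> (y \<otimes>\<^bsub>\<Gamma>\<^esub> inv\<^bsub>\<Gamma>\<^esub> \<one>\<^bsub>\<Gamma>\<^esub>))"
            by (rule PC_lifts_frames[OF fn nq _ y id]) (use above id in auto)
          then have "PC_lifts P (\<lambda>z. z) y"
            using yc by (auto intro: PC_lifts_cong simp: f_inv_into_f[of _ "\<lambda>z. z", simplified])
          then obtain b where b: "L (P <#> cen P) b y" "\<And>z. z \<in> P \<Longrightarrow> b z = z" by (auto simp: PC_lifts_def)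
          have big: "card P < card (P <#> cen P)" using card_psubset[OF subgroup_PC[OF P] nonquasi_fc_grows[OF fc nq]] .
          show "\<exists>g. L (nrm P) g y \<and> (\<forall>z\<in>P. g z = z)"
          proof (cases "finite_p_group p \<Gamma>")
            case True
            obtain c where c: "c \<in> cen P" "y = \<theta> c"
              using label_of_fixing_map[OF True fc _ b] above big by metis
            have "L (nrm P) (cj c) y" using lab_cj[OF nrmS[OF P] cen_carrier[OF c(1)]] c cen_carrier by simp
            then show ?thesis using cen_cj[OF c(1)] by blast
          next
            case False
            then show ?thesis using labels_extend_nrm_p'[OF _ fn b] \<Gamma>_order by blast
          qed
        qed
      qed
    qed
  qed
  then show ?thesis using assms by blast
qed

text \<open>The axiom on \<open>\<Theta>(Id\<^sub>P)\<close> thus carries over from quasicentric to all fully centralized subgroups.\<close>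

lemma fc_id_label:
  assumes \<Gamma>: "finite_p_group p \<Gamma>" and fc: "fully_centralized S F P" and y: "L P (\<lambda>z. z) y"
  obtains c where "c \<in> cen P" "y = \<theta> c"
proof -
  have P: "subgroup P S" using fc by (rule fc_sub)
  have fn_case: "\<exists>c\<in>cen Q. u = \<theta> c" if fn: "fully_normalized S F Q" and u: "L Q (\<lambda>z. z) u" for Q u
  proof -
    have Q: "subgroup Q S" using fn by (rule fn_sub)
    obtain g where g: "L (nrm Q) g u" "\<forall>z\<in>Q. g z = z" using labels_extend_fn[OF fn] u by (auto simp: labels_extend_def)
    have "L (Q <#> cen Q) g u" by (rule lab_restrict[OF g(1) subgroup_PC[OF Q] PC_le_nrm[OF Q]])
    then show ?thesis using label_of_fixing_map[OF \<Gamma> fn_fc[OF fn]] g(2) labels_extend_fn by metis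
  qed
  obtain h where h: "mor (nrm P) h" "fully_normalized S F (h ` P)" using fn_frame_exists[OF P] by blast
  obtain r where r: "L (nrm P) h r" using L_ex[OF h(1)] by blast
  have PN: "P \<subseteq> nrm P" "cen P \<subseteq> nrm P" using subgroup_subset_nrm[OF P] cen_subset_nrm by auto
  have hP: "L P h r" by (rule lab_restrict[OF r P PN(1)])
  have mh: "mor P h" using lab_mor[OF hP] .
  have car: "r \<in> carrier \<Gamma>" "y \<in> carrier \<Gamma>" using lab_carrier hP y by auto
  have i: "L (h ` P) (inv_into P h) (inv\<^bsub>\<Gamma>\<^esub> r)" "inv_into P h ` h ` P = P" using L_inv[OF hP] inv_into_image[OF mh] by auto
  have "L (h ` P) (\<lambda>z. h (inv_into P h z)) (r \<otimes>\<^bsub>\<Gamma>\<^esub> y \<otimes>\<^bsub>\<Gamma>\<^esub> inv\<^bsub>\<Gamma>\<^esub> r)"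
    by (rule lab_comp[OF L_shift[OF hP y] i(1)]) (use i in auto)
  then have "L (h ` P) (\<lambda>z. z) (r \<otimes>\<^bsub>\<Gamma>\<^esub> y \<otimes>\<^bsub>\<Gamma>\<^esub> inv\<^bsub>\<Gamma>\<^esub> r)" by (rule lab_cong) (simp add: f_inv_into_f)
  then obtain c0 where c0: "c0 \<in> cen (h ` P)" "r \<otimes>\<^bsub>\<Gamma>\<^esub> y \<otimes>\<^bsub>\<Gamma>\<^esub> inv\<^bsub>\<Gamma>\<^esub> r = \<theta> c0" using fn_case[OF h(2)] by blast
  have "h ` cen P = cen (h ` P)" by (rule fc_image_cen[OF fc h(1) PN])
  then obtain c where c: "c \<in> cen P" "c0 = h c" using c0(1) by blast
  have tc: "\<theta> c \<in> carrier \<Gamma>" using cen_carrier[OF c(1)] by simp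
  have "\<theta> c0 = r \<otimes>\<^bsub>\<Gamma>\<^esub> \<theta> c \<otimes>\<^bsub>\<Gamma>\<^esub> inv\<^bsub>\<Gamma>\<^esub> r" using lab_\<theta>[OF r, of c] c PN by auto
  then have "y = \<theta> c" using c0(2) car tc by simp
  then show ?thesis using that c(1) by blast
qed

end

section \<open>Saturation of the subsystem of a subgroup of \<open>\<Gamma>\<close>\<close>

context prime_fusion_system begin

lemma receptive_imp_fc:
  assumes P: "subgroup P S" "receptive P" shows "fully_centralized S F P"
proof -
  have "card (cen (f ` P)) \<le> card (cen P)" if f: "mor P f" for f
  proof -
    let ?Q = "f ` P"
    have i: "mor ?Q (inv_into P f)" "inv_into P f ` ?Q = P" using mor_inv_into[OF f] inv_into_image[OF f] by auto
    obtain h where h: "mor (Nx ?Q (inv_into P f)) h" "\<forall>x\<in>?Q. h x = inv_into P f x"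
      using P(2) i unfolding receptive_def by blast
    have hQ: "h ` ?Q = P" using h(2) i(2) by (metis image_cong)
    show ?thesis using mor_card_image_le(2)[OF h(1) Nx_superset[OF i(1)] cen_Nx[OF i(1)]] hQ by simp
  qed
  then show ?thesis using P by (simp add: fully_centralized_iff)
qed

lemma centric_iff: "centric S F P \<longleftrightarrow> subgroup P S \<and> (\<forall>f. mor P f \<longrightarrow> cen (f ` P) \<subseteq> f ` P)"
proof -
  have eq: "centralizer S Q = center_of S Q \<longleftrightarrow> cen Q \<subseteq> Q" if Q: "subgroup Q S" for Q
  proof -
    have "center_of S Q = Q \<inter> cen Q"
      using sub_carrier[OF Q] by (auto simp: center_of_def cen_def cj_eq_iff)
    then show ?thesis using centralizer_eq_cen[OF subgroup.subset[OF Q]] by auto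
  qed
  show ?thesis unfolding centric_def F_conjugate_iff ex_image_all using eq mor_image by auto
qed

lemma S_auto_cen_nrm:
  assumes \<alpha>: "mor (carrier S) \<alpha>" and Q: "subgroup Q S"
  shows "card (cen (\<alpha> ` Q)) = card (cen Q)" "card (nrm (\<alpha> ` Q)) = card (nrm Q)"
proof -
  have sur: "\<alpha> ` carrier S = carrier S"
    using mor_carrier[OF \<alpha>] mor_card[OF \<alpha>] finite_S by (simp add: card_subset_eq image_subset_iff)
  have i: "mor (carrier S) (inv_into (carrier S) \<alpha>)" using mor_inv_into[OF \<alpha>] sur by simp
  have QS: "Q \<subseteq> carrier S" using subgroup.subset[OF Q] .
  have aQ: "subgroup (\<alpha> ` Q) S" using mor_image[OF mor_restrict[OF \<alpha> Q QS]] .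
  have "inv_into (carrier S) \<alpha> ` \<alpha> ` Q = Q" using mor_inj[OF \<alpha>] QS by simp
  then show "card (cen (\<alpha> ` Q)) = card (cen Q)" "card (nrm (\<alpha> ` Q)) = card (nrm Q)"
    using mor_card_image_le[OF \<alpha> QS] mor_card_image_le[OF i subgroup.subset[OF aQ]] cen_carrier nrm_carrier
    by (metis le_antisym subsetI)+
qed

text \<open>Map \<open>R\<close> by \<open>\<chi>\<close> to a fully normalized subgroup and bring \<open>\<chi>(P)\<close> back to \<open>P\<close> by \<open>\<rho>\<close>. The composite fixes \<open>P\<close>, so
it is conjugation by an element of \<open>S\<close>; thus \<open>\<rho>\<close> embeds \<open>C\<^sub>S(\<chi>(R))\<close> into a conjugate of \<open>C\<^sub>S(R)\<close>.\<close>

lemma cen_trivial_fc: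
  assumes "saturated_fusion_system p S F"
    and t: "cen_trivial P" and fcP: "fully_centralized S F P"
    and R: "subgroup R S" "P \<subseteq> R" "R \<subseteq> P <#> cen P"
  shows "fully_centralized S F R"
proof -
  interpret sat: prime_saturated p S F
    by (intro prime_saturated.intro prime_fusion_system_axioms assms(1))
  have P: "subgroup P S" using fcP by (rule sat.fc_sub)
  obtain \<chi> where \<chi>: "mor R \<chi>" "fully_normalized S F (\<chi> ` R)" using sat.fn_exists[OF R(1)] by blast
  have \<chi>P: "mor P \<chi>" by (rule mor_restrict[OF \<chi>(1) P R(2)])
  define P0 where "P0 = \<chi> ` P"
  have P0: "subgroup P0 S" using mor_image[OF \<chi>P] by (simp add: P0_def)
  have fc0: "fully_centralized S F (\<chi> ` R)" using sat.fn_fc[OF \<chi>(2)] .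
  let ?N0 = "P0 <#> cen P0"
  obtain \<rho> where \<rho>: "mor ?N0 \<rho>" "\<And>x. x \<in> P0 \<Longrightarrow> \<rho> x = inv_into P \<chi> x"
    using sat.fc_extend_PC[OF mor_inv_into[OF \<chi>P]] inv_into_image[OF \<chi>P] fcP by (metis P0_def)
  have R0: "\<chi> ` R \<subseteq> ?N0" using mor_PC[OF \<chi>(1) P R(2,3)] by (simp add: P0_def)
  have "mor R (\<lambda>z. \<rho> (\<chi> z))" by (rule mor_comp[OF \<chi>(1) \<rho>(1) R0])
  moreover have "\<rho> (\<chi> z) = z" if "z \<in> P" for z using \<rho>(2)[of "\<chi> z"] that mor_inj[OF \<chi>P] by (simp add: P0_def)
  ultimately obtain g where g: "g \<in> cen P" "\<forall>z\<in>R. \<rho> (\<chi> z) = cj g z" using t R unfolding cen_trivial_def by blast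
  have gc: "g \<in> carrier S" using cen_carrier[OF g(1)] .
  have "cen (\<chi> ` R) \<subseteq> ?N0"
    using cen_antimono[OF image_mono[OF R(2), of \<chi>]] C_le_PC[OF P0] by (auto simp: P0_def)
  then have "card (cen (\<chi> ` R)) \<le> card (cen (\<rho> ` \<chi> ` R))" by (rule mor_card_image_le(2)[OF \<rho>(1) R0])
  also have "\<rho> ` \<chi> ` R = cj g ` R" using g(2) by (auto simp: image_iff)
  also have "card (cen (cj g ` R)) = card (cen R)" by (rule S_auto_cen_nrm(1)[OF mor_cj_elem[OF subgroup_self gc] R(1)])
  finally have le: "card (cen (\<chi> ` R)) \<le> card (cen R)" .
  have "card (cen (f ` R)) \<le> card (cen R)" if f: "mor R f" for f
  proof -
    have i: "mor (\<chi> ` R) (inv_into R \<chi>)" "inv_into R \<chi> ` \<chi> ` R = R" using mor_inv_into[OF \<chi>(1)] inv_into_image[OF \<chi>(1)] by auto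
    have "mor (\<chi> ` R) (\<lambda>z. f (inv_into R \<chi> z))" by (rule mor_comp[OF i(1) f]) (use i in simp)
    moreover have "(\<lambda>z. f (inv_into R \<chi> z)) ` \<chi> ` R = f ` inv_into R \<chi> ` \<chi> ` R" by (simp only: image_image)
    ultimately have "card (cen (f ` R)) \<le> card (cen (\<chi> ` R))" using fc0 i(2) by (metis fully_centralized_iff)
    then show ?thesis using le by simp
  qed
  then show ?thesis using R(1) by (simp add: fully_centralized_iff)
qed

end

locale fusion_triple_subgroup = fusion_triple p S F \<Gamma> \<theta> \<Theta>
  for p :: nat and S :: "('a, 'm) monoid_scheme" (structure) and F :: "'a homs"
    and \<Gamma> :: "('g, 'n) monoid_scheme" and \<theta> :: "'a \<Rightarrow> 'g"
    and \<Theta> :: "'a set \<Rightarrow> 'a set \<Rightarrow> ('a \<Rightarrow> 'a) \<Rightarrow> 'g set" +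
  fixes H :: "'g set"
  assumes H: "subgroup H \<Gamma>"
begin

definition SHc :: "'a set" where "SHc = preimage_group S \<theta> H"

abbreviation SH where "SH \<equiv> S\<lparr>carrier := SHc\<rparr>"
abbreviation FH where "FH \<equiv> F_sub S F \<theta> \<Theta> H"

lemma SHc_iff: "s \<in> SHc \<longleftrightarrow> s \<in> carrier S \<and> \<theta> s \<in> H" by (simp add: SHc_def preimage_group_def)

lemma SHc_sub: "subgroup SHc S"
proof (rule subgroupI)
  show "SHc \<noteq> {}" using SHc_iff subgroup.one_closed[OF H] T.hom_one by (metis empty_iff one_closed)
qed (use SHc_iff subgroup.m_closed[OF H] subgroup.m_inv_closed[OF H] T.hom_mult T.hom_inv in auto)

lemma sub_SH: "subgroup P SH \<longleftrightarrow> subgroup P S \<and> P \<subseteq> SHc"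
  using incl_subgroup[OF SHc_sub] subgroup_incl[OF _ SHc_sub] subgroup.subset[of P SH] by auto

lemma FH_iff: "\<phi> \<in> FH P Q \<longleftrightarrow> \<phi> \<in> F P Q \<and> P \<subseteq> SHc \<and> Q \<subseteq> SHc \<and> (\<exists>h\<in>H. L P \<phi> h)"
proof -
  have "subgroup P S \<and> subgroup Q S" if "\<phi> \<in> F P Q" using F_D[OF that] by blast
  then show ?thesis
    unfolding F_sub_def full_subcategory_def SHc_def[symmetric] sub_SH mem_Collect_eq F_bullet_iff[OF H] by blast
qed

lemma FH_E:
  assumes "\<phi> \<in> FH P Q"
  obtains h where "\<phi> \<in> F P Q" "h \<in> H" "L P \<phi> h" "P \<subseteq> SHc" "Q \<subseteq> SHc"
  using assms[unfolded FH_iff] by (elim conjE bexE) (rule that)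

lemma FH_I: "\<phi> \<in> F P Q \<Longrightarrow> h \<in> H \<Longrightarrow> L P \<phi> h \<Longrightarrow> P \<subseteq> SHc \<Longrightarrow> Q \<subseteq> SHc \<Longrightarrow> \<phi> \<in> FH P Q"
  unfolding FH_iff by (intro conjI bexI)

lemma FH_F: "\<phi> \<in> FH P Q \<Longrightarrow> \<phi> \<in> F P Q" by (erule FH_E)

lemma L_SHc: assumes "L P f h" "h \<in> H" "P \<subseteq> SHc" shows "f ` P \<subseteq> SHc"
proof
  fix y assume "y \<in> f ` P"
  then obtain g where g: "g \<in> P" "y = f g" by auto
  have "\<theta> y = h \<otimes>\<^bsub>\<Gamma>\<^esub> \<theta> g \<otimes>\<^bsub>\<Gamma>\<^esub> inv\<^bsub>\<Gamma>\<^esub> h" using lab_\<theta>[OF assms(1) g(1)] g by simp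
  moreover have "\<theta> g \<in> H" using g assms(3) SHc_iff by blast
  ultimately have "\<theta> y \<in> H" using assms(2) subgroup.m_closed[OF H] subgroup.m_inv_closed[OF H] by simp
  then show "y \<in> SHc" using mor_carrier[OF lab_mor[OF assms(1)] g(1)] g SHc_iff by blast
qed

lemma FH_fusion: "fusion_system p SH FH"
proof (intro fusion_system.intro subgroup_category.intro fusion_system_axioms.intro)
  show SHg: "group SH" by (rule subgroup_imp_group[OF SHc_sub])
  show "FH P Q \<subseteq> Inj SH P Q" for P Q
  proof
    fix \<phi> assume \<phi>: "\<phi> \<in> FH P Q"
    then have "\<phi> \<in> Inj S P Q" using homs_Inj FH_F by blast
    moreover have "P \<subseteq> SHc" "Q \<subseteq> SHc" using \<phi> by (auto elim: FH_E)
    ultimately show "\<phi> \<in> Inj SH P Q" by (auto simp: Inj_def sub_SH)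
  qed
  show "(\<lambda>x\<in>P. x) \<in> FH P P" if P: "subgroup P SH" for P
  proof -
    have P': "subgroup P S" "P \<subseteq> SHc" using P sub_SH by auto
    have "L P (\<lambda>x\<in>P. x) \<one>\<^bsub>\<Gamma>\<^esub>" by (rule lab_id[OF P'(1)]) simp
    then show ?thesis by (rule FH_I[OF id_mem[OF P'(1)] subgroup.one_closed[OF H] _ P'(2) P'(2)])
  qed
  show "compose P \<psi> \<phi> \<in> FH P R" if c: "\<phi> \<in> FH P Q" "\<psi> \<in> FH Q R" for \<phi> \<psi> P Q R
  proof -
    obtain h where h: "\<phi> \<in> F P Q" "h \<in> H" "L P \<phi> h" "P \<subseteq> SHc" "Q \<subseteq> SHc" by (rule FH_E[OF c(1)])
    obtain k where k: "\<psi> \<in> F Q R" "k \<in> H" "L Q \<psi> k" "Q \<subseteq> SHc" "R \<subseteq> SHc" by (rule FH_E[OF c(2)])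
    have "L P (compose P \<psi> \<phi>) (k \<otimes>\<^bsub>\<Gamma>\<^esub> h)"
      by (rule lab_comp[OF k(3) h(3)]) (use F_D(4)[OF h(1)] in \<open>auto simp: compose_def\<close>)
    then show ?thesis by (rule FH_I[OF comp_mem[OF h(1) k(1)] subgroup.m_closed[OF H k(2) h(2)] _ h(4) k(5)])
  qed
  show "finite_p_group p SH"
    unfolding finite_p_group_def using SHg sub_finite[OF SHc_sub] card_p_power[OF SHc_sub] by (simp add: order_def)
  show "group_fusion SH P Q \<subseteq> FH P Q" for P Q
  proof
    fix \<phi> assume "\<phi> \<in> group_fusion SH P Q"
    then obtain g where g: "\<phi> = conj_map SH g P" "subgroup P SH" "subgroup Q SH" "g \<in> SHc" "conj_map SH g P ` P \<subseteq> Q"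
      by (auto simp: group_fusion_def transporter_def)
    have eq: "conj_map SH g P = conj_map S g P"
      unfolding conj_map_def using m_inv_consistent[OF SHc_sub g(4)] by simp
    have gc: "g \<in> carrier S" "\<theta> g \<in> H" using g(4) SHc_iff by auto
    have "\<phi> \<in> group_fusion S P Q"
      unfolding group_fusion_def using g gc sub_SH eq by (auto simp: transporter_def)
    then have "\<phi> \<in> F P Q" using group_fusion_le by blast
    moreover have "L P \<phi> (\<theta> g)"
      by (rule lab_cong[OF lab_cj[of P g]]) (use g gc sub_SH eq in \<open>auto simp: conj_map_eq\<close>)
    ultimately show "\<phi> \<in> FH P Q" by (rule FH_I[OF _ gc(2)]) (use g sub_SH in auto)
  qed
  show "\<exists>R \<psi>. R \<subseteq> Q \<and> category_iso FH P R \<psi> \<and> \<phi> = compose P (\<lambda>x\<in>R. x) \<psi>" if \<phi>: "\<phi> \<in> FH P Q" for \<phi> P Q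
  proof -
    obtain h where h: "\<phi> \<in> F P Q" "h \<in> H" "L P \<phi> h" "P \<subseteq> SHc" "Q \<subseteq> SHc" by (rule FH_E[OF \<phi>])
    have f: "mor P \<phi>" using lab_mor[OF h(3)] .
    let ?R = "\<phi> ` P" and ?\<psi> = "restrict (inv_into P \<phi>) (\<phi> ` P)"
    have R: "subgroup ?R S" "?R \<subseteq> SHc" "?R \<subseteq> Q" using mor_image[OF f] L_SHc[OF h(3,2,4)] F_D(4)[OF h(1)] by auto
    have "\<phi> \<in> F P ?R" using F_eq_mor[OF R(1), of \<phi> P] F_D(1)[OF h(1)] f by simp
    then have 1: "\<phi> \<in> FH P ?R" by (rule FH_I[OF _ h(2,3,4) R(2)])
    have i: "mor ?R (inv_into P \<phi>)" "inv_into P \<phi> ` ?R = P" using mor_inv_into[OF f] inv_into_image[OF f] by auto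
    have "?\<psi> \<in> F ?R P" using F_eq_mor[OF mor_subgroup[OF f], of ?\<psi> ?R] mor_cong[OF i(1), of ?\<psi>] i(2) by auto
    moreover have "L ?R ?\<psi> (inv\<^bsub>\<Gamma>\<^esub> h)" by (rule lab_cong[OF L_inv[OF h(3)]]) simp
    ultimately have 2: "?\<psi> \<in> FH ?R P" by (rule FH_I[OF _ subgroup.m_inv_closed[OF H h(2)] _ R(2) h(4)])
    have "compose P ?\<psi> \<phi> = (\<lambda>x\<in>P. x)" "compose ?R \<phi> ?\<psi> = (\<lambda>x\<in>?R. x)"
      using mor_inj[OF f] by (auto simp: compose_def fun_eq_iff f_inv_into_f)
    then have "category_iso FH P ?R \<phi>" unfolding category_iso_def using 1 2 by blast
    moreover have "\<phi> = compose P (\<lambda>x\<in>?R. x) \<phi>"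
    proof
      fix z show "\<phi> z = compose P (\<lambda>x\<in>?R. x) \<phi> z"
        using extensional_arb[OF F_D(1)[OF h(1)], of z] by (cases "z \<in> P") (auto simp: compose_def)
    qed
    ultimately show ?thesis using R(3) by blast
  qed
qed

end

sublocale fusion_triple_subgroup \<subseteq> K: prime_fusion_system p SH FH
  by (intro prime_fusion_system.intro FH_fusion prime_fusion_system_axioms.intro prime_p)

context fusion_triple_subgroup begin

lemma K_cj: "g \<in> SHc \<Longrightarrow> K.cj g x = cj g x"
  unfolding K.cj_def cj_def using m_inv_consistent[OF SHc_sub] by simp

lemma K_nrm: "K.nrm P = nrm P \<inter> SHc"
  unfolding K.nrm_def nrm_def using K_cj SHc_iff by auto

lemma K_cen: "K.cen P = cen P \<inter> SHc"
  unfolding K.cen_def cen_def using K_cj SHc_iff by auto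

lemma K_set_mult: "P <#>\<^bsub>SH\<^esub> C = P <#> C"
  by (simp add: set_mult_def)

lemma K_mor: "K.mor P f \<longleftrightarrow> P \<subseteq> SHc \<and> (\<exists>h\<in>H. L P f h)"
proof
  assume "K.mor P f"
  then have "restrict f P \<in> FH P SHc" by (simp add: K.mor_def)
  then obtain h where h: "P \<subseteq> SHc" "h \<in> H" "L P (restrict f P) h" by (auto elim: FH_E)
  have "L P f h" by (rule lab_cong[OF h(3)]) simp
  then show "P \<subseteq> SHc \<and> (\<exists>h\<in>H. L P f h)" using h by blast
next
  assume a: "P \<subseteq> SHc \<and> (\<exists>h\<in>H. L P f h)"
  then obtain h where h: "P \<subseteq> SHc" "h \<in> H" "L P f h" by blast
  have 1: "L P (restrict f P) h" by (rule lab_cong[OF h(3)]) simp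
  have "restrict f P \<in> F P SHc" using F_eq_mor[OF SHc_sub] lab_mor[OF 1] L_SHc[OF h(3,2,1)] by auto
  then have "restrict f P \<in> FH P SHc" by (rule FH_I[OF _ h(2) 1 h(1) order_refl])
  then show "K.mor P f" by (simp add: K.mor_def)
qed

lemma K_mor_mor: "K.mor P f \<Longrightarrow> mor P f" using K_mor lab_mor by blast

lemma K_mor_L1: "L1 P f x \<Longrightarrow> P \<subseteq> SHc \<Longrightarrow> K.mor P f"
  using L1_L[of P f x] L1_label[of P f x] subgroup.one_closed[OF H] K_mor by auto

lemma fn_S_auto:
  assumes \<alpha>: "mor (carrier S) \<alpha>" and P: "fully_normalized S F (\<alpha> ` P)" "subgroup P S"
  shows "fully_normalized S F P"
proof -
  have m: "mor P \<alpha>" by (rule mor_restrict[OF \<alpha> P(2) subgroup.subset[OF P(2)]])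
  have i: "mor (\<alpha> ` P) (inv_into P \<alpha>)" "inv_into P \<alpha> ` \<alpha> ` P = P" using mor_inv_into[OF m] inv_into_image[OF m] by auto
  have "card (nrm (f ` P)) \<le> card (nrm P)" if f: "mor P f" for f
  proof -
    have "mor (\<alpha> ` P) (\<lambda>z. f (inv_into P \<alpha> z))" by (rule mor_comp[OF i(1) f]) (use i in simp)
    moreover have "(\<lambda>z. f (inv_into P \<alpha> z)) ` \<alpha> ` P = f ` inv_into P \<alpha> ` \<alpha> ` P" by (simp only: image_image)
    ultimately have "card (nrm (f ` P)) \<le> card (nrm (\<alpha> ` P))" using P(1) i(2) by (metis fully_normalized_iff)
    then show ?thesis using S_auto_cen_nrm(2)[OF \<alpha> P(2)] by simp
  qed
  then show ?thesis using P(2) by (simp add: fully_normalized_iff)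
qed

lemma mor_decomp:
  assumes f: "mor P f"
  obtains \<alpha> \<psi> where "mor (carrier S) \<alpha>" "L1 P \<psi> \<one>\<^bsub>\<Gamma>\<^esub>" "\<And>z. z \<in> P \<Longrightarrow> f z = \<alpha> (\<psi> z)"
proof -
  obtain x where "L P f x" using L_ex[OF f] by blast
  then show ?thesis using decomp_all TH_mor that unfolding decomp_def by metis
qed

text \<open>Of a frame \<open>\<alpha> \<psi>\<close> only the factor \<open>\<psi>\<close> of trivial label is kept, since \<open>\<alpha> \<in> Aut\<^sub>F(S)\<close> preserves full
normalization.\<close>

lemma fn_frame_L1:
  assumes P: "subgroup P S"
  obtains \<psi> where "L1 (nrm P) \<psi> \<one>\<^bsub>\<Gamma>\<^esub>" "fully_normalized S F (\<psi> ` P)"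
proof -
  obtain h where h: "mor (nrm P) h" "fully_normalized S F (h ` P)" using fn_frame_exists[OF P] by blast
  obtain \<alpha> \<psi> where a: "mor (carrier S) \<alpha>" "L1 (nrm P) \<psi> \<one>\<^bsub>\<Gamma>\<^esub>" "\<And>z. z \<in> nrm P \<Longrightarrow> h z = \<alpha> (\<psi> z)"
    using mor_decomp[OF h(1)] by blast
  have PN: "P \<subseteq> nrm P" by (rule subgroup_subset_nrm[OF P])
  have "h ` P = (\<lambda>z. \<alpha> (\<psi> z)) ` P" by (rule image_cong[OF refl]) (use a(3) PN in blast)
  then have "h ` P = \<alpha> ` \<psi> ` P" by (simp only: image_image)
  then have "fully_normalized S F (\<alpha> ` \<psi> ` P)" using h(2) by metis
  then have "fully_normalized S F (\<psi> ` P)"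
    by (rule fn_S_auto[OF a(1) _ mor_image[OF mor_restrict[OF lab_mor[OF a(2)] P PN]]])
  then show ?thesis using that a(2) by blast
qed

lemma K_receptive:
  assumes fn: "fully_normalized S F P" shows "K.receptive P"
  unfolding K.receptive_def
proof (intro allI impI)
  fix Q f assume f: "K.mor Q f" "f ` Q = P"
  obtain h where h: "Q \<subseteq> SHc" "h \<in> H" "L Q f h" using f(1) K_mor by blast
  obtain e where e: "L (Nx Q f) e h" "\<And>z. z \<in> Q \<Longrightarrow> e z = f z"
    using labelled_extension[of f Q h] h(3) f(2) fn_fc[OF fn] labels_extend_fn[OF fn] by blast
  have sub: "K.Nx Q f \<subseteq> Nx Q f" "K.Nx Q f \<subseteq> SHc"
    unfolding K.Nx_def Nx_def K_nrm using K_cj by auto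
  have "subgroup (K.Nx Q f) S" using K.Nx_subgroup[OF f(1)] sub_SH by blast
  then have "L (K.Nx Q f) e h" using lab_restrict[OF e(1)] sub(1) by blast
  then have "K.mor (K.Nx Q f) e" using K_mor sub(2) h(2) by blast
  then show "\<exists>h. K.mor (K.Nx Q f) h \<and> (\<forall>x\<in>Q. h x = f x)" using e(2) by blast
qed

text \<open>If \<open>\<Gamma>\<close> is a \<open>p\<close>-group, the labels \<open>\<theta>(g)\<close> and \<open>h\<close> of the same map differ by some \<open>\<theta>(c)\<close> with \<open>c \<in> C\<^sub>S(P)\<close>, and
\<open>g c\<close> acts on \<open>P\<close> as \<open>g\<close> does. If the order of \<open>\<Gamma>\<close> is prime to \<open>p\<close>, then \<open>\<theta>\<close> is trivial.\<close>

lemma adjust_label: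
  assumes fc: "fully_centralized S F P" and g: "g \<in> nrm P" "L P (cj g) h" "h \<in> H"
  obtains g' where "g' \<in> nrm P \<inter> SHc" "\<And>z. z \<in> P \<Longrightarrow> cj g' z = cj g z"
proof -
  have P: "subgroup P S" using fc by (rule fc_sub)
  have gc: "g \<in> carrier S" using nrm_carrier[OF g(1)] .
  show ?thesis
  proof (cases "finite_p_group p \<Gamma>")
    case True
    have "L P (cj g) (\<theta> g)" using lab_cj[OF P gc] gc by simp
    then have "L P (\<lambda>z. z) (inv\<^bsub>\<Gamma>\<^esub> \<theta> g \<otimes>\<^bsub>\<Gamma>\<^esub> h)" using L_diff g(2) by blast
    then obtain c where c: "c \<in> cen P" "inv\<^bsub>\<Gamma>\<^esub> \<theta> g \<otimes>\<^bsub>\<Gamma>\<^esub> h = \<theta> c" using fc_id_label[OF True fc] by blast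
    have cc: "c \<in> carrier S" using cen_carrier[OF c(1)] .
    have hc: "h \<in> carrier \<Gamma>" using lab_carrier[OF g(2)] .
    have "\<theta> (g \<otimes> c) = \<theta> g \<otimes>\<^bsub>\<Gamma>\<^esub> (inv\<^bsub>\<Gamma>\<^esub> \<theta> g \<otimes>\<^bsub>\<Gamma>\<^esub> h)" using T.hom_mult[OF gc cc] c(2) by simp
    also have "\<dots> = h" using gc hc by (simp add: T.H.m_assoc[symmetric])
    finally have "g \<otimes> c \<in> SHc" using g(3) gc cc SHc_iff by simp
    moreover have "g \<otimes> c \<in> nrm P" using subgroup.m_closed[OF nrmS[OF P] g(1)] c(1) cen_subset_nrm by blast
    moreover have "cj (g \<otimes> c) z = cj g z" if "z \<in> P" for z
      using cj_cj[OF gc cc] sub_carrier[OF P that] cen_cj[OF c(1) that] by simp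
    ultimately show ?thesis using that by blast
  next
    case False
    then have "\<theta> g = \<one>\<^bsub>\<Gamma>\<^esub>" using \<theta>_trivial[OF _ gc] \<Gamma>_order by blast
    then have "g \<in> SHc" using gc SHc_iff subgroup.one_closed[OF H] by simp
    then show ?thesis using that g(1) by blast
  qed
qed

lemma K_Aut: "Aut_group FH Q = Aut_group F Q\<lparr>carrier := FH Q Q\<rparr>"
  by (simp add: Aut_group_def)

text \<open>Let \<open>U\<close> be a Sylow subgroup of the automorphism group of \<open>Q\<close> in \<open>F\<^sub>H\<close>, and let \<open>f\<close> map \<open>Q\<close> to a
fully normalized subgroup so that \<open>U\<close> becomes a group of conjugations in \<open>S\<close>. The factor \<open>\<psi>\<close> of \<open>f\<close> of trivial label
has the same properties and belongs to \<open>F\<^sub>H\<close>. By \<open>adjust_label\<close> the conjugations are by elements of \<open>S\<^sub>H\<close>, so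
\<open>\<psi>(Q)\<close> is fully automized in \<open>F\<^sub>H\<close>.\<close>

theorem FH_saturated: "saturated_fusion_system p SH FH"
proof (rule K.saturation_criterion)
  fix Q assume "subgroup Q SH"
  then have Q: "subgroup Q S" "Q \<subseteq> SHc" and QK: "subgroup Q SH" using sub_SH by auto
  interpret A: group "Aut_group F Q" by (rule Aut_group[OF Q(1)])
  have FHF: "FH Q Q \<subseteq> F Q Q" by (rule subsetI) (rule FH_F)
  have FHA: "subgroup (FH Q Q) (Aut_group F Q)"
  proof (rule aut_subgroupI[OF Q(1) FHF])
    show "(\<lambda>x\<in>Q. x) \<in> FH Q Q" by (rule K.id_mem[OF QK])
    show "compose Q a b \<in> FH Q Q" if "a \<in> FH Q Q" "b \<in> FH Q Q" for a b using K.comp_mem[OF that(2,1)] .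
    show "restrict (inv_into Q a) Q \<in> FH Q Q" if "a \<in> FH Q Q" for a using K.inv_into_aut[OF QK that] .
  qed
  obtain U where U: "sylow_subgroup p (Aut_group FH Q) U"
    using sylow_exists[OF prime_p K.Aut_group[OF QK]] K.Aut_finite[OF QK] by auto
  then have U': "subgroup U (Aut_group FH Q)" "card U = p ^ multiplicity p (order (Aut_group FH Q))"
    by (auto simp: sylow_subgroup_def)
  have UFH: "U \<subseteq> FH Q Q" using subgroup.subset[OF U'(1)] by simp
  have UA: "subgroup U (Aut_group F Q)" using A.incl_subgroup[OF FHA] U'(1) unfolding K_Aut by blast
  obtain f where f: "mor Q f" "fully_normalized S F (f ` Q)"
    "\<And>u. u \<in> U \<Longrightarrow> \<exists>g\<in>nrm (f ` Q). \<forall>z\<in>Q. f (u z) = cj g (f z)"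
    using fn_p_subgroup[OF Q(1) UA U'(2)] by blast
  obtain \<alpha> \<psi> where a: "mor (carrier S) \<alpha>" "L1 Q \<psi> \<one>\<^bsub>\<Gamma>\<^esub>" "\<And>z. z \<in> Q \<Longrightarrow> f z = \<alpha> (\<psi> z)"
    using mor_decomp[OF f(1)] by blast
  have m\<psi>: "mor Q \<psi>" using lab_mor[OF a(2)] .
  have K\<psi>: "K.mor Q \<psi>" by (rule K_mor_L1[OF a(2) Q(2)])
  define P where "P = \<psi> ` Q"
  have P: "subgroup P S" using mor_image[OF m\<psi>] by (simp add: P_def)
  have PK: "subgroup P SH" using K.mor_image[OF K\<psi>] by (simp add: P_def)
  have fQ: "f ` Q = \<alpha> ` P" using a(3) by (auto simp: P_def image_iff)
  have "fully_normalized S F (\<alpha> ` P)" using f(2) fQ by metis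
  then have fn: "fully_normalized S F P" by (rule fn_S_auto[OF a(1) _ P])
  let ?i = "inv_into (carrier S) \<alpha>"
  have mi: "mor (carrier S) ?i" using mor_inv_into[OF a(1)] mor_S_surj[OF a(1)] by simp
  define c where "c = (\<lambda>u. restrict (\<lambda>y. \<psi> (u (inv_into Q \<psi> y))) P)"
  have c: "inj_on c (FH Q Q)" using K.conj_aut_hom(2)[OF K\<psi>] by (simp add: c_def P_def)
  have cap: "c u (\<psi> x) = \<psi> (u x)" if "u \<in> FH Q Q" "x \<in> Q" for u x
    using K.conj_aut_hom(3)[OF K\<psi> that] by (simp add: c_def P_def)
  have "c ` U \<subseteq> K.conj_auts P (K.nrm P)"
  proof
    fix t assume "t \<in> c ` U"
    then obtain u where u: "u \<in> U" "t = c u" by auto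
    have uFH: "u \<in> FH Q Q" using u UFH by blast
    obtain h where h: "h \<in> H" "L Q u h" by (rule FH_E[OF uFH])
    have uQ: "u ` Q = Q" "mor Q u" using uFH FHF aut_iff[OF Q(1)] by auto
    obtain g where g: "g \<in> nrm (f ` Q)" "\<forall>z\<in>Q. f (u z) = cj g (f z)" using f(3)[OF u(1)] by blast
    have gc: "g \<in> carrier S" using nrm_carrier[OF g(1)] .
    define k where "k = ?i g"
    have kc: "k \<in> carrier S" using S_inv(3)[OF a(1) gc] by (simp add: k_def)
    have \<psi>u: "\<psi> (u z) = cj k (\<psi> z)" if z: "z \<in> Q" for z
    proof -
      have uz: "u z \<in> Q" using uQ z by blast
      have car: "\<psi> z \<in> carrier S" "\<psi> (u z) \<in> carrier S" using mor_carrier[OF m\<psi>] z uz by auto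
      have "\<alpha> (\<psi> (u z)) = f (u z)" using a(3)[OF uz] by simp
      also have "\<dots> = cj g (\<alpha> (\<psi> z))" using g(2) a(3)[OF z] z by simp
      also have "\<dots> = cj (\<alpha> k) (\<alpha> (\<psi> z))" using S_inv(2)[OF a(1) gc] by (simp add: k_def)
      also have "\<dots> = \<alpha> (cj k (\<psi> z))" using mor_cj[OF a(1) kc car(1)] by simp
      finally show ?thesis using mor_inj[OF a(1)] car kc by (meson cj_closed inj_onD)
    qed
    have kP: "k \<in> nrm P" using kc uQ \<psi>u by (auto simp: nrm_def P_def) (metis imageI)
    have iL: "L P (inv_into Q \<psi>) \<one>\<^bsub>\<Gamma>\<^esub>" using L_inv[OF L1_L[OF a(2)]] by (simp add: P_def)
    have im: "inv_into Q \<psi> ` P = Q" using inv_into_image[OF m\<psi>] by (simp add: P_def)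
    have "L P (\<lambda>y. u (inv_into Q \<psi> y)) (h \<otimes>\<^bsub>\<Gamma>\<^esub> \<one>\<^bsub>\<Gamma>\<^esub>)" by (rule lab_comp[OF h(2) iL]) (use im in auto)
    then have "L P (\<lambda>y. \<psi> (u (inv_into Q \<psi> y))) (\<one>\<^bsub>\<Gamma>\<^esub> \<otimes>\<^bsub>\<Gamma>\<^esub> (h \<otimes>\<^bsub>\<Gamma>\<^esub> \<one>\<^bsub>\<Gamma>\<^esub>))"
      by (rule lab_comp[OF L1_L[OF a(2)]]) (use im uQ in auto)
    then have "L P (\<lambda>y. \<psi> (u (inv_into Q \<psi> y))) h" using lab_carrier[OF h(2)] by simp
    then have "L P (cj k) h"
    proof (rule lab_cong)
      fix y assume "y \<in> P"
      then obtain z where "z \<in> Q" "y = \<psi> z" by (auto simp: P_def)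
      then show "\<psi> (u (inv_into Q \<psi> y)) = cj k y" using \<psi>u mor_inj[OF m\<psi>] by simp
    qed
    then obtain k' where k': "k' \<in> nrm P \<inter> SHc" "\<And>z. z \<in> P \<Longrightarrow> cj k' z = cj k z"
      using adjust_label[OF fn_fc[OF fn] kP _ h(1)] by blast
    have "t = restrict (K.cj k') P"
    proof
      fix y show "t y = restrict (K.cj k') P y"
      proof (cases "y \<in> P")
        case True
        then obtain z where z: "z \<in> Q" "y = \<psi> z" by (auto simp: P_def)
        then show ?thesis using cap[OF uFH z(1)] u(2) \<psi>u k'(2)[OF True] True K_cj k'(1) by simp
      qed (simp add: u c_def)
    qed
    then show "t \<in> K.conj_auts P (K.nrm P)" using k'(1) by (auto simp: K.conj_auts_def K_nrm)
  qed
  moreover have T: "subgroup (K.conj_auts P (K.nrm P)) (Aut_group FH P)" "\<exists>k. card (K.conj_auts P (K.nrm P)) = p ^ k"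
    using K.conj_auts_p_subgroup[OF PK K.nrmS[OF PK] order_refl] by auto
  moreover have "finite (K.conj_auts P (K.nrm P))"
    using subgroup.subset[OF T(1)] K.Aut_finite[OF PK] finite_subset by simp
  ultimately have "card (c ` U) \<le> card (K.conj_auts P (K.nrm P))" using card_mono by blast
  moreover have "card (c ` U) = card U" using c UFH by (meson card_image inj_on_subset)
  moreover have "order (Aut_group FH P) = order (Aut_group FH Q)" using K.Aut_order_conj[OF K\<psi>] by (simp add: P_def)
  moreover obtain k where k: "card (K.conj_auts P (K.nrm P)) = p ^ k" using T(2) by blast
  ultimately have "K.automized P"
    using p_subgroup_card_le_sylow[OF prime_p K.Aut_group[OF PK] _ T(1) k] K.Aut_finite[OF PK] U'(2) T(1)
    by (simp add: K.automized_def sylow_subgroup_def)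
  then show "\<exists>f. K.mor Q f \<and> K.automized (f ` Q) \<and> K.receptive (f ` Q)"
    using K\<psi> K_receptive[OF fn] P_def by blast
qed

end

context fusion_triple begin

section \<open>The automorphisms of trivial label\<close>

abbreviation unlabelled :: "'a set \<Rightarrow> ('a \<Rightarrow> 'a) set" where
  "unlabelled P \<equiv> label_kernel P (F P P)"

text \<open>The pairs with trivial label are the kernel of the projection of \<open>label_pairs\<close> to \<open>\<Gamma>\<close>. Counting the pairs in
two ways shows that the index of the label kernel, times the number of labels of the identity, is the
order of a subgroup of \<open>\<Gamma>\<close>.\<close>

lemma label_kernel_normal:
  assumes P: "subgroup P S"
  shows "unlabelled P \<lhd> Aut_group F P"
    and "card (rcosets\<^bsub>Aut_group F P\<^esub> unlabelled P) dvd order \<Gamma>"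
proof -
  interpret A: group "Aut_group F P" by (rule Aut_group[OF P])
  interpret AG: group "Aut_group F P \<times>\<times> \<Gamma>" by (rule DirProd_group[OF A.is_group T.H.is_group])
  have FA: "subgroup (F P P) (Aut_group F P)" using A.subgroup_self by simp
  let ?G = "label_pairs P (F P P)"
  have G: "subgroup ?G (Aut_group F P \<times>\<times> \<Gamma>)" by (rule label_pairs_subgroup[OF P FA])
  note Ks = label_kernel(1)[OF P FA]
  show "unlabelled P \<lhd> Aut_group F P" using A.normal_inv_iff Ks label_kernel(2)[OF P FA] by simp
  let ?GG = "(Aut_group F P \<times>\<times> \<Gamma>)\<lparr>carrier := ?G\<rparr>"
  interpret GG: group ?GG by (rule AG.subgroup_imp_group[OF G])
  have snd: "group_hom ?GG \<Gamma> snd"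
    by unfold_locales (use lab_carrier in \<open>auto simp: hom_def label_pairs_def\<close>)
  interpret snd: group_hom ?GG \<Gamma> snd by (rule snd)
  have finF: "finite (F P P)" by (rule Aut_finite[OF P])
  have finG: "finite ?G" unfolding label_pairs_def using finF labels_finite by auto
  have "{u \<in> ?G. snd u = \<one>\<^bsub>\<Gamma>\<^esub>} = (\<lambda>a. (a, \<one>\<^bsub>\<Gamma>\<^esub>)) ` unlabelled P" by (auto simp: label_pairs_def label_kernel_def)
  moreover have "inj_on (\<lambda>a. (a, \<one>\<^bsub>\<Gamma>\<^esub>)) (unlabelled P)" by (simp add: inj_on_def)
  ultimately have "card {u \<in> ?G. snd u = \<one>\<^bsub>\<Gamma>\<^esub>} = card (unlabelled P)" by (simp add: card_image)
  then have 1: "card ?G = card (snd ` ?G) * card (unlabelled P)"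
    using GG.order_image_times_kernel[OF snd] finG by (simp add: order_def)
  have 2: "card ?G = card (F P P) * card {x. L P (\<lambda>z. z) x}" by (rule card_label_pairs[OF P order_refl])
  have 3: "card (rcosets\<^bsub>Aut_group F P\<^esub> unlabelled P) * card (unlabelled P) = card (F P P)"
    using A.lagrange[OF Ks] by (simp add: order_def)
  have "finite (unlabelled P)" using finF by (simp add: label_kernel_def)
  moreover have "unlabelled P \<noteq> {}" using subgroup.one_closed[OF Ks] by blast
  ultimately have "card (unlabelled P) > 0" by (simp add: card_gt_0_iff)
  moreover have "(card (rcosets\<^bsub>Aut_group F P\<^esub> unlabelled P) * card {x. L P (\<lambda>z. z) x}) * card (unlabelled P)
      = card (snd ` ?G) * card (unlabelled P)"
  proof -
    have "(card (rcosets\<^bsub>Aut_group F P\<^esub> unlabelled P) * card {x. L P (\<lambda>z. z) x}) * card (unlabelled P)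
        = (card (rcosets\<^bsub>Aut_group F P\<^esub> unlabelled P) * card (unlabelled P)) * card {x. L P (\<lambda>z. z) x}"
      by (simp only: ac_simps)
    also have "\<dots> = card ?G" unfolding 3 by (rule 2[symmetric])
    finally show ?thesis unfolding 1 .
  qed
  ultimately have "card (rcosets\<^bsub>Aut_group F P\<^esub> unlabelled P) * card {x. L P (\<lambda>z. z) x} = card (snd ` ?G)" by simp
  then have "card (rcosets\<^bsub>Aut_group F P\<^esub> unlabelled P) dvd card (snd ` ?G)" by (metis dvd_triv_left)
  moreover have "card (snd ` ?G) dvd order \<Gamma>" using T.H.card_subgroup_dvd[OF snd.img_is_subgroup] by simp
  ultimately show "card (rcosets\<^bsub>Aut_group F P\<^esub> unlabelled P) dvd order \<Gamma>" by (rule dvd_trans)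
qed

lemma label_kernel_F_bullet:
  "a \<in> unlabelled P \<Longrightarrow> a \<in> F_bullet S F \<Theta> {\<one>\<^bsub>\<Gamma>\<^esub>} P P"
  by (simp add: F_bullet_iff[OF L1_sub] label_kernel_def)

lemma O_p_star_le:
  assumes \<Gamma>: "finite_p_group p \<Gamma>" shows "O_p_star p S F \<le> F_bullet S F \<Theta> {\<one>\<^bsub>\<Gamma>\<^esub>}"
proof -
  have sub: "O_upper_p p (Aut_group F P) \<subseteq> unlabelled P" if P: "subgroup P S" for P
  proof -
    obtain n where "order \<Gamma> = p ^ n" using \<Gamma> by (auto simp: finite_p_group_def)
    then obtain k where "card (rcosets\<^bsub>Aut_group F P\<^esub> unlabelled P) = p ^ k"
      using label_kernel_normal(2)[OF P] divides_primepow_nat[OF prime_p] by metis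
    then show ?thesis using label_kernel_normal(1)[OF P] unfolding O_upper_p_def by (intro Inter_lower) blast
  qed
  let ?X = "\<lambda>P Q. {\<phi>. P = Q \<and> subgroup P S \<and> \<phi> \<in> O_upper_p p (Aut_group F P)}"
  have XB: "?X \<le> F_bullet S F \<Theta> {\<one>\<^bsub>\<Gamma>\<^esub>}" using sub label_kernel_F_bullet by (auto simp: le_fun_def)
  have XF: "?X \<le> F" using XB F_bullet_facts(2) by (rule order_trans)
  show ?thesis unfolding O_p_star_def
    by (rule smallest_restrictive(4)[OF restrictive XF F_bullet_facts(1,2) XB])
qed

lemma O_p'_star_le:
  assumes \<Gamma>: "finite_p'_group p \<Gamma>" shows "O_p'_star p S F \<le> F_bullet S F \<Theta> {\<one>\<^bsub>\<Gamma>\<^esub>}"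
proof -
  have sub: "O_upper_p' p (Aut_group F P) \<subseteq> unlabelled P" if P: "subgroup P S" for P
  proof -
    have "coprime (order \<Gamma>) p" using \<Gamma> by (simp add: finite_p'_group_def)
    then have "coprime (card (rcosets\<^bsub>Aut_group F P\<^esub> unlabelled P)) p"
      using label_kernel_normal(2)[OF P] coprime_divisors dvd_refl by blast
    then show ?thesis using label_kernel_normal(1)[OF P] unfolding O_upper_p'_def by (intro Inter_lower) blast
  qed
  let ?X = "\<lambda>P Q. {\<phi>. P = Q \<and> subgroup P S \<and> \<phi> \<in> O_upper_p' p (Aut_group F P)}"
  have XB: "?X \<le> F_bullet S F \<Theta> {\<one>\<^bsub>\<Gamma>\<^esub>}" using sub label_kernel_F_bullet by (auto simp: le_fun_def)
  have XF: "?X \<le> F" using XB F_bullet_facts(2) by (rule order_trans)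
  show ?thesis unfolding O_p'_star_def
    by (rule smallest_restrictive(4)[OF restrictive XF F_bullet_facts(1,2) XB])
qed

lemma aut_pow_cj:
  assumes R: "subgroup R S" and a: "a \<in> F R R" and V: "V \<subseteq> R" and g: "g \<in> carrier S"
    and ag: "\<And>z. z \<in> V \<Longrightarrow> a z = cj g z \<and> cj g z \<in> V" and z: "z \<in> V"
  shows "(a [^]\<^bsub>Aut_group F R\<^esub> (n::nat)) z = cj (g [^] n) z"
  using z
proof (induction n arbitrary: z)
  interpret A: group "Aut_group F R" by (rule Aut_group[OF R])
  {
    case 0
    have "z \<in> R" using 0 V by auto
    then show ?case using sub_carrier[OF R] by (simp add: A.nat_pow_0)
  next
    case (Suc n)
    have zc: "z \<in> carrier S" "z \<in> R" using Suc V sub_carrier[OF R] by auto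
    have "a [^]\<^bsub>Aut_group F R\<^esub> n \<in> F R R" using A.nat_pow_closed[of a n] a by simp
    then have "(a [^]\<^bsub>Aut_group F R\<^esub> Suc n) z = (a [^]\<^bsub>Aut_group F R\<^esub> n) (a z)"
      using Aut_mult[OF R _ a] zc by (simp add: compose_def A.nat_pow_Suc)
    also have "\<dots> = cj (g [^] n) (cj g z)" using ag[OF Suc.prems] Suc.IH by metis
    also have "\<dots> = cj (g [^] Suc n) z" using zc g by (simp add: cj_cj)
    finally show ?case . }
qed

lemma aut_pow_label:
  assumes R: "subgroup R S" and a: "a \<in> F R R" "L R a x"
  shows "L R (a [^]\<^bsub>Aut_group F R\<^esub> (n::nat)) (x [^]\<^bsub>\<Gamma>\<^esub> n)"
proof (induction n)
  interpret A: group "Aut_group F R" by (rule Aut_group[OF R])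
  {
    case 0
    have "L R (\<lambda>x\<in>R. x) \<one>\<^bsub>\<Gamma>\<^esub>" by (rule lab_id[OF R]) simp
    moreover have "a [^]\<^bsub>Aut_group F R\<^esub> (0::nat) = (\<lambda>x\<in>R. x)" by (simp add: A.nat_pow_0)
    ultimately show ?case by (simp only: T.H.nat_pow_0)
  next
    case (Suc n)
    have pF: "a [^]\<^bsub>Aut_group F R\<^esub> n \<in> F R R" using A.nat_pow_closed[of a n] a by simp
    then have "a [^]\<^bsub>Aut_group F R\<^esub> Suc n = compose R (a [^]\<^bsub>Aut_group F R\<^esub> n) a"
      using Aut_mult[OF R _ a(1)] by simp
    moreover have "L R (compose R (a [^]\<^bsub>Aut_group F R\<^esub> n) a) (x [^]\<^bsub>\<Gamma>\<^esub> n \<otimes>\<^bsub>\<Gamma>\<^esub> x)"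
      by (rule lab_comp[OF Suc a(2)]) (use F_D(4)[OF a(1)] in \<open>auto simp: compose_def\<close>)
    ultimately show ?case by simp }
qed

end

context fusion_triple_subgroup begin

section \<open>Quasicentric subgroups when \<open>\<Gamma>\<close> is a \<open>p\<close>-group\<close>

text \<open>Let \<open>u\<close> be an automorphism of \<open>R\<close> that fixes \<open>P\<close>. Its power \<open>b\<close> with exponent \<open>|\<Gamma>|\<close> has the trivial label, so on
\<open>V = R \<inter> S\<^sub>H\<close> it is a morphism of \<open>F\<^sub>H\<close>, hence a conjugation. Then \<open>d\<close>, the power of \<open>b\<close> with exponent \<open>|S|\<close>, is
the identity on \<open>V\<close>; and \<open>d\<close> is the identity modulo \<open>V\<close>, since it preserves \<open>\<theta>\<close> and \<open>V\<close> contains the kernel of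
\<open>\<theta>\<close> in \<open>R\<close>. So \<open>u\<close> has \<open>p\<close>-power order by \<open>stable_power\<close>, and the automorphisms fixing \<open>P\<close> form a \<open>p\<close>-group, which
coincides with its Sylow subgroup of conjugations.\<close>

lemma fixing_auts_inner:
  assumes \<Gamma>: "finite_p_group p \<Gamma>" and P: "subgroup P S" "P \<subseteq> SHc" and t: "K.cen_trivial P"
    and R: "subgroup R S" "P \<subseteq> R" "R \<subseteq> P <#> cen P"
    and syl: "cen_automized P R"
    and a: "a \<in> fixing_auts P R"
  shows "\<exists>g\<in>cen P. \<forall>z\<in>R. a z = cj g z"
proof -
  let ?A = "Aut_group F R"
  interpret A: group ?A by (rule Aut_group[OF R(1)])
  note D = fixing_auts_subgroup[OF R(1,2)]
  obtain i j where ij: "order \<Gamma> = p ^ i" "order S = p ^ j" using \<Gamma> order_S by (auto simp: finite_p_group_def)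
  define V where "V = R \<inter> SHc"
  have V: "subgroup V S" "V \<subseteq> R" "P \<subseteq> V" "V \<subseteq> SHc"
    using subgroups_Inter_pair[OF R(1) SHc_sub] R(2) P(2) by (auto simp: V_def)
  have expo: "u [^]\<^bsub>?A\<^esub> (p ^ (i + j + j)) = \<one>\<^bsub>?A\<^esub>" if u: "u \<in> fixing_auts P R" for u
  proof -
    have uF: "u \<in> F R R" "\<And>z. z \<in> P \<Longrightarrow> u z = z" "mor R u" using u aut_iff[OF R(1)] by (auto simp: fixing_auts_def)
    obtain x where x: "L R u x" using L_ex[OF uF(3)] by blast
    define b where "b = u [^]\<^bsub>?A\<^esub> (p ^ i)"
    have bF: "b \<in> F R R" using A.nat_pow_closed[of u "p ^ i"] uF by (simp add: b_def)
    have "x [^]\<^bsub>\<Gamma>\<^esub> (p ^ i) = \<one>\<^bsub>\<Gamma>\<^esub>" using T.H.pow_order_eq_1[of x] lab_carrier[OF x] ij by simp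
    then have Lb: "L R b \<one>\<^bsub>\<Gamma>\<^esub>" using aut_pow_label[OF R(1) uF(1) x, of "p ^ i"] by (simp add: b_def)
    have bP: "b z = z" if z: "z \<in> P" for z
    proof -
      have "b z = cj (\<one> [^] (p ^ i)) z" unfolding b_def
        by (rule aut_pow_cj[OF R(1) uF(1) R(2) one_closed _ z]) (use uF(2) sub_carrier[OF P(1)] in auto)
      then show ?thesis using sub_carrier[OF P(1) z] by simp
    qed
    have "K.mor V b" using K_mor V lab_restrict[OF Lb V(1,2)] subgroup.one_closed[OF H] by blast
    moreover have "V \<subseteq> P <#> (cen P \<inter> SHc)"
    proof
      fix z assume z: "z \<in> V"
      obtain v c where vc: "v \<in> P" "c \<in> cen P" "c \<in> V" "z = v \<otimes> c"
        using PC_decompose[OF P(1) V(1,3) _ z] V(2) R(3) by blast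
      then show "z \<in> P <#> (cen P \<inter> SHc)" using V(4) by (auto simp: set_mult_def)
    qed
    ultimately obtain g where g: "g \<in> cen P \<inter> SHc" "\<forall>z\<in>V. b z = K.cj g z"
      using t[unfolded K.cen_trivial_def K_set_mult K_cen, rule_format, of V b] V(3) bP by blast
    have gc: "g \<in> carrier S" "g \<in> SHc" using g(1) cen_carrier by auto
    have bg: "b z = cj g z \<and> cj g z \<in> V" if z: "z \<in> V" for z
    proof -
      have "b z = cj g z" using g(2) z K_cj[OF gc(2)] by simp
      moreover have "b z \<in> R" using F_D(4)[OF bF] z V(2) by blast
      moreover have "cj g z \<in> SHc" using subgroup_cj[OF SHc_sub gc(2)] z V(4) by blast
      ultimately show ?thesis by (simp add: V_def)
    qed
    define d where "d = b [^]\<^bsub>?A\<^esub> order S"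
    have dF: "d \<in> F R R" using A.nat_pow_closed[of b "order S"] bF by (simp add: d_def)
    have dV: "d z = z" if z: "z \<in> V" for z
    proof -
      have "d z = cj (g [^] order S) z" unfolding d_def by (rule aut_pow_cj[OF R(1) bF V(2) gc(1) bg z])
      then show ?thesis using pow_order_eq_1[OF gc(1)] sub_carrier[OF V(1) z] by simp
    qed
    have Ld: "L R d \<one>\<^bsub>\<Gamma>\<^esub>" using aut_pow_label[OF R(1) bF Lb, of "order S"] by (simp add: d_def)
    have "inv z \<otimes> d z \<in> V" if z: "z \<in> R" for z
    proof -
      have car: "z \<in> carrier S" "d z \<in> carrier S" "d z \<in> R"
        using sub_carrier[OF R(1)] z F_D(4)[OF dF] by auto
      have "\<theta> (d z) = \<theta> z" using lab_\<theta>[OF Ld z] car by simp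
      then have "\<theta> (inv z \<otimes> d z) = \<one>\<^bsub>\<Gamma>\<^esub>" using car T.hom_mult[of "inv z" "d z"] T.hom_inv[of z] by simp
      then have "inv z \<otimes> d z \<in> SHc" using car subgroup.one_closed[OF H] SHc_iff by simp
      moreover have "inv z \<otimes> d z \<in> R" using z car subgroup.m_closed[OF R(1)] subgroup.m_inv_closed[OF R(1)] by blast
      ultimately show ?thesis by (simp add: V_def)
    qed
    then have "d [^]\<^bsub>?A\<^esub> order S = \<one>\<^bsub>?A\<^esub>" using stable_power[OF R(1) V(1,2) dF dV] by blast
    moreover have "u [^]\<^bsub>?A\<^esub> (p ^ (i + j + j)) = d [^]\<^bsub>?A\<^esub> order S"
      using uF(1) ij by (simp add: d_def b_def A.nat_pow_pow power_add)
    ultimately show ?thesis by simp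
  qed
  obtain k where k: "card (fixing_auts P R) = p ^ k" using card_p_of_exponent[OF R(1) D expo] by blast
  have "fixing_auts P R \<subseteq> F R R" by (auto simp: fixing_auts_def)
  then have fin: "finite (fixing_auts P R)" using Aut_finite[OF R(1)] finite_subset by blast
  have T: "subgroup (conj_auts R (cen P \<inter> nrm R)) (?A\<lparr>carrier := fixing_auts P R\<rparr>)"
    "card (conj_auts R (cen P \<inter> nrm R)) = p ^ multiplicity p (card (fixing_auts P R))"
    using syl by (auto simp: sylow_subgroup_def order_def)
  have "multiplicity p (p ^ k) = k" using prime_p by (simp add: multiplicity_same_power prime_gt_0_nat)
  then have "card (conj_auts R (cen P \<inter> nrm R)) = card (fixing_auts P R)" using T(2) k by simp
  moreover have "conj_auts R (cen P \<inter> nrm R) \<subseteq> fixing_auts P R" using subgroup.subset[OF T(1)] by simp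
  ultimately have "conj_auts R (cen P \<inter> nrm R) = fixing_auts P R" using fin card_subset_eq by blast
  then have "a \<in> conj_auts R (cen P \<inter> nrm R)" using a by simp
  then obtain g where "g \<in> cen P" "a = restrict (cj g) R" by (auto simp: conj_auts_def)
  then show ?thesis by auto
qed

text \<open>This is \<open>centralizer_alperin\<close> for the property of being a conjugation by an element of \<open>C\<^sub>S(P)\<close>, which by
\<open>fixing_auts_inner\<close> holds for automorphisms.\<close>

lemma cen_trivial_of_K:
  assumes \<Gamma>: "finite_p_group p \<Gamma>" and fn: "fully_normalized S F P" and PH: "P \<subseteq> SHc" and t: "K.cen_trivial P"
  shows "cen_trivial P"
  unfolding cen_trivial_def
proof (intro allI impI)
  have fc: "fully_centralized S F P" using fn_fc[OF fn] .
  have P: "subgroup P S" using fn by (rule fn_sub)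
  note inner = fixing_auts_inner[OF \<Gamma> P PH t]
  fix R f assume R: "P \<subseteq> R" "R \<subseteq> P <#> cen P" and f: "mor R f" and fP: "\<forall>z\<in>P. f z = z"
  obtain x where x: "L R f x" using L_ex[OF f] by blast
  show "\<exists>g\<in>cen P. \<forall>z\<in>R. f z = cj g z"
  proof (rule centralizer_alperin[where \<G> = "\<lambda>R f _. \<exists>g\<in>cen P. \<forall>z\<in>R. f z = cj g z" and m = 0 and R = R and f = f and x = x, OF fc])
    show "labels_extend R0" if "fully_normalized S F R0" for R0 by (rule labels_extend_fn[OF that])
    show "\<exists>h\<in>cen P. \<forall>z\<in>R. g (f z) = cj h z"
      if Lf: "L R f x" and f: "\<exists>h\<in>cen P. \<forall>z\<in>R. f z = cj h z" and g: "\<exists>h\<in>cen P. \<forall>z\<in>f ` R. g z = cj h z" for R f g x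
    proof -
      obtain h k where h: "h \<in> cen P" "\<forall>z\<in>R. f z = cj h z" "k \<in> cen P" "\<forall>z\<in>f ` R. g z = cj k z" using f g by blast
      have "g (f z) = cj (k \<otimes> h) z" if z: "z \<in> R" for z
      proof -
        have "z \<in> carrier S" using z sub_carrier[OF mor_subgroup[OF lab_mor[OF Lf]]] by blast
        then show ?thesis using h z cen_carrier by (simp add: cj_cj)
      qed
      moreover have "k \<otimes> h \<in> cen P" using subgroup.m_closed[OF cenS[OF P] h(3,1)] .
      ultimately show ?thesis by blast
    qed
    show "\<exists>h\<in>cen P. \<forall>z\<in>f ` R. inv_into R f z = cj h z"
      if Lf: "L R f x" and f: "\<exists>h\<in>cen P. \<forall>z\<in>R. f z = cj h z" for R f x
    proof -
      obtain h where h: "h \<in> cen P" "\<forall>z\<in>R. f z = cj h z" using f by blast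
      have m: "mor R f" using lab_mor[OF Lf] .
      have "inv_into R f y = cj (inv h) y" if y: "y \<in> f ` R" for y
      proof -
        obtain z where z: "z \<in> R" "y = f z" using y by blast
        have zc: "z \<in> carrier S" using sub_carrier[OF mor_subgroup[OF m] z(1)] .
        have "inv_into R f y = z" using z mor_inj[OF m] by simp
        moreover have "cj (inv h) y = z" using z zc h cen_carrier by simp
        ultimately show ?thesis by simp
      qed
      then show ?thesis using subgroup.m_inv_closed[OF cenS[OF P] h(1)] by blast
    qed
    show "\<exists>h\<in>cen P. \<forall>z\<in>P <#> cen P. f z = cj h z" if Lf: "L (P <#> cen P) f x" and fP: "\<And>z. z \<in> P \<Longrightarrow> f z = z" for f x
    proof -
      let ?N = "P <#> cen P"
      have N: "subgroup ?N S" "P \<subseteq> ?N" by (rule subgroup_PC[OF P], rule P_le_PC[OF P])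
      have m: "mor ?N f" using lab_mor[OF Lf] .
      have "f ` ?N = ?N" by (rule PC_lifts_stay[OF P m fix_image[OF fP]])
      then have "restrict f ?N \<in> fixing_auts P ?N" using aut_restrict[OF m] fP N(2) by (auto simp: fixing_auts_def)
      then obtain h where "h \<in> cen P" "\<forall>z\<in>?N. restrict f ?N z = cj h z"
        using inner[OF N order_refl PC_sylow[OF fc labels_extend_fn]] by blast
      then show ?thesis by auto
    qed
    show "\<exists>h\<in>cen P. \<forall>z\<in>R. f z = cj h z"
      if "\<exists>h\<in>cen P. \<forall>z\<in>R'. f z = cj h z" "R \<subseteq> R'" for R R' f
      using that by blast
    show "\<exists>h\<in>cen P. \<forall>z\<in>R. a z = cj h z"
      if "subgroup R S" "P \<subseteq> R" "R \<subseteq> P <#> cen P"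
        "cen_automized P R"
        "a \<in> fixing_auts P R" for R a
      by (rule inner[OF that])
  qed (use R x fP in auto)
qed

text \<open>A map of \<open>F\<^sub>H\<close> that fixes \<open>P\<close> is conjugation by some \<open>g \<in> C\<^sub>S(P)\<close>. Its labels \<open>\<theta>(g)\<close> and \<open>h \<in> H\<close> differ by some
\<open>\<theta>(c)\<close> with \<open>c \<in> C\<^sub>S(R)\<close>, because \<open>R\<close> is fully centralized, and \<open>g c \<in> S\<^sub>H\<close> induces the same map.\<close>

lemma K_cen_trivial:
  assumes \<Gamma>: "finite_p_group p \<Gamma>" and fc: "fully_centralized S F P" and PH: "P \<subseteq> SHc" and t: "cen_trivial P"
  shows "K.cen_trivial P"
  unfolding K.cen_trivial_def K_set_mult K_cen
proof (intro allI impI)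
  have P: "subgroup P S" using fc by (rule fc_sub)
  fix R f assume R: "P \<subseteq> R" "R \<subseteq> P <#> (cen P \<inter> SHc)" and f: "K.mor R f" and fP: "\<forall>z\<in>P. f z = z"
  obtain h where h: "R \<subseteq> SHc" "h \<in> H" "L R f h" using f K_mor by blast
  have "P <#> (cen P \<inter> SHc) \<subseteq> P <#> cen P" by (rule set_mult_least[OF subgroup_PC[OF P] P_le_PC[OF P]]) (use C_le_PC[OF P] in blast)
  then have R': "R \<subseteq> P <#> cen P" using R(2) by blast
  have m: "mor R f" using lab_mor[OF h(3)] .
  have sR: "subgroup R S" using mor_subgroup[OF m] .
  obtain g where g: "g \<in> cen P" "\<forall>z\<in>R. f z = cj g z" using t R(1) R' m fP unfolding cen_trivial_def by blast
  have gc: "g \<in> carrier S" using cen_carrier[OF g(1)] .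
  have fcR: "fully_centralized S F R"
    by (rule cen_trivial_fc[OF saturated_fusion_system_axioms t fc sR R(1) R'])
  have "L R f (\<theta> g)" by (rule lab_cong[OF lab_cj[OF sR gc]]) (use g gc in auto)
  then have "L R (\<lambda>z. z) (inv\<^bsub>\<Gamma>\<^esub> \<theta> g \<otimes>\<^bsub>\<Gamma>\<^esub> h)" using L_diff h(3) by blast
  then obtain c where c: "c \<in> cen R" "inv\<^bsub>\<Gamma>\<^esub> \<theta> g \<otimes>\<^bsub>\<Gamma>\<^esub> h = \<theta> c" using fc_id_label[OF \<Gamma> fcR] by blast
  have cc: "c \<in> carrier S" "c \<in> cen P" using cen_carrier[OF c(1)] c(1) cen_antimono[OF R(1)] by auto
  have hc: "h \<in> carrier \<Gamma>" using lab_carrier[OF h(3)] .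
  have "\<theta> (g \<otimes> c) = \<theta> g \<otimes>\<^bsub>\<Gamma>\<^esub> (inv\<^bsub>\<Gamma>\<^esub> \<theta> g \<otimes>\<^bsub>\<Gamma>\<^esub> h)" using T.hom_mult[OF gc cc(1)] c(2) by simp
  also have "\<dots> = h" using gc hc by (simp add: T.H.m_assoc[symmetric])
  finally have gSH: "g \<otimes> c \<in> SHc" using h(2) gc cc SHc_iff by simp
  moreover have "g \<otimes> c \<in> cen P" using subgroup.m_closed[OF cenS[OF P] g(1) cc(2)] .
  moreover have "f z = K.cj (g \<otimes> c) z" if z: "z \<in> R" for z
    using g(2) z K_cj[OF gSH] cj_cj[OF gc cc(1) sub_carrier[OF sR z]] cen_cj[OF c(1) z] by simp
  ultimately show "\<exists>g\<in>cen P \<inter> SHc. \<forall>z\<in>R. f z = K.cj g z" by blast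
qed

text \<open>Both properties are invariant under conjugacy in \<open>F\<^sub>H\<close>, so \<open>P\<close> may be replaced by a conjugate \<open>P\<^sub>1\<close> that is
fully normalized in \<open>F\<close>. It is fully centralized in both systems, so one only has to compare \<open>cen_trivial\<close>.\<close>

lemma K_quasicentric_iff:
  assumes \<Gamma>: "finite_p_group p \<Gamma>" and P: "subgroup P SH"
  shows "quasicentric SH FH P \<longleftrightarrow> quasicentric S F P"
proof -
  interpret KS: prime_saturated p SH FH
    by (intro prime_saturated.intro K.prime_fusion_system_axioms FH_saturated)
  have P': "subgroup P S" "P \<subseteq> SHc" using P sub_SH by auto
  obtain \<psi> where \<psi>: "L1 (nrm P) \<psi> \<one>\<^bsub>\<Gamma>\<^esub>" "fully_normalized S F (\<psi> ` P)" using fn_frame_L1[OF P'(1)] by blast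
  have L1: "L1 P \<psi> \<one>\<^bsub>\<Gamma>\<^esub>" by (rule lab_restrict[OF \<psi>(1) P'(1) subgroup_subset_nrm[OF P'(1)]])
  have Km: "K.mor P \<psi>" by (rule K_mor_L1[OF L1 P'(2)])
  have m: "mor P \<psi>" using lab_mor[OF L1] .
  define P1 where "P1 = \<psi> ` P"
  have P1: "subgroup P1 SH" "subgroup P1 S" "P1 \<subseteq> SHc" using K.mor_image[OF Km] sub_SH by (auto simp: P1_def)
  have fn: "fully_normalized S F P1" using \<psi>(2) by (simp add: P1_def)
  have fc: "fully_centralized S F P1" using fn_fc[OF fn] .
  have Kfc: "fully_centralized SH FH P1" by (rule K.receptive_imp_fc[OF P1(1) K_receptive[OF fn]])
  have i: "mor P1 (inv_into P \<psi>)" "K.mor P1 (inv_into P \<psi>)" "inv_into P \<psi> ` P1 = P"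
    using mor_inv_into[OF m] K.mor_inv_into[OF Km] inv_into_image[OF m] by (auto simp: P1_def)
  have "quasicentric SH FH P \<longleftrightarrow> quasicentric SH FH P1"
    using K.quasicentric_conj[OF _ Km] K.quasicentric_conj[OF _ i(2)] i(3) by (metis P1_def)
  also have "\<dots> \<longleftrightarrow> K.cen_trivial P1"
    using KS.fc_quasicentric_cen_trivial[OF Kfc] KS.fc_cen_trivial_imp_quasicentric[OF Kfc] by blast
  also have "\<dots> \<longleftrightarrow> cen_trivial P1"
    using cen_trivial_of_K[OF \<Gamma> fn P1(3)] K_cen_trivial[OF \<Gamma> fc P1(3)] by blast
  also have "\<dots> \<longleftrightarrow> quasicentric S F P1"
    using fc_quasicentric_cen_trivial[OF fc] fc_cen_trivial_imp_quasicentric[OF fc] by blast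
  also have "\<dots> \<longleftrightarrow> quasicentric S F P"
    using quasicentric_conj[OF _ m] quasicentric_conj[OF _ i(1)] i(3) by (metis P1_def)
  finally show ?thesis .
qed

section \<open>Centric and fully normalized subgroups when \<open>\<Gamma>\<close> has order prime to \<open>p\<close>\<close>

lemma SHc_eq_S: "finite_p'_group p \<Gamma> \<Longrightarrow> SHc = carrier S"
  using \<theta>_trivial subgroup.one_closed[OF H] SHc_iff by auto

lemma K_mor_decomp:
  assumes eq: "SHc = carrier S" and f: "mor P f"
  obtains \<alpha> \<psi> where "mor (carrier S) \<alpha>" "K.mor P \<psi>" "f ` P = \<alpha> ` \<psi> ` P"
proof -
  obtain \<alpha> \<psi> where a: "mor (carrier S) \<alpha>" "L1 P \<psi> \<one>\<^bsub>\<Gamma>\<^esub>" "\<And>z. z \<in> P \<Longrightarrow> f z = \<alpha> (\<psi> z)"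
    using mor_decomp[OF f] by blast
  have "f ` P = (\<lambda>z. \<alpha> (\<psi> z)) ` P" by (rule image_cong[OF refl a(3)])
  then have "f ` P = \<alpha> ` \<psi> ` P" by (simp only: image_image)
  moreover have "P \<subseteq> SHc" using subgroup.subset[OF mor_subgroup[OF f]] eq by simp
  ultimately show ?thesis using that a(1) K_mor_L1[OF a(2)] by blast
qed

text \<open>There are at most as many conjugates in \<open>F\<^sub>H\<close> as in \<open>F\<close>, but each conjugate in \<open>F\<close> is the image of a conjugate in \<open>F\<^sub>H\<close> under an
element of \<open>Aut\<^sub>F(S)\<close>.\<close>

lemma K_centric_full_iffs:
  assumes eq: "SHc = carrier S" and P: "subgroup P S"
  shows "centric SH FH P \<longleftrightarrow> centric S F P"
    and "fully_centralized SH FH P \<longleftrightarrow> fully_centralized S F P"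
    and "fully_normalized SH FH P \<longleftrightarrow> fully_normalized S F P"
proof -
  have cen: "K.cen Q = cen Q" and nrm: "K.nrm Q = nrm Q" for Q
    using K_cen K_nrm eq cen_carrier nrm_carrier by auto
  have sub: "subgroup P SH" using P sub_SH eq subgroup.subset[OF P] by simp
  have \<psi>S: "subgroup (\<psi> ` P) S" if "K.mor P \<psi>" for \<psi> using mor_image[OF K_mor_mor[OF that]] .
  show "fully_centralized SH FH P \<longleftrightarrow> fully_centralized S F P"
  proof
    assume K: "fully_centralized SH FH P"
    have "card (cen (f ` P)) \<le> card (cen P)" if f: "mor P f" for f
    proof -
      obtain \<alpha> \<psi> where a: "mor (carrier S) \<alpha>" "K.mor P \<psi>" "f ` P = \<alpha> ` \<psi> ` P" using K_mor_decomp[OF eq f] by blast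
      show ?thesis
        using K a(2) S_auto_cen_nrm(1)[OF a(1) \<psi>S[OF a(2)]] unfolding a(3) K.fully_centralized_iff cen by simp
    qed
    then show "fully_centralized S F P" using P by (simp add: fully_centralized_iff)
  next
    assume "fully_centralized S F P"
    then show "fully_centralized SH FH P"
      using sub K_mor_mor unfolding K.fully_centralized_iff fully_centralized_iff cen by blast
  qed
  show "fully_normalized SH FH P \<longleftrightarrow> fully_normalized S F P"
  proof
    assume K: "fully_normalized SH FH P"
    have "card (nrm (f ` P)) \<le> card (nrm P)" if f: "mor P f" for f
    proof -
      obtain \<alpha> \<psi> where a: "mor (carrier S) \<alpha>" "K.mor P \<psi>" "f ` P = \<alpha> ` \<psi> ` P" using K_mor_decomp[OF eq f] by blast
      show ?thesis
        using K a(2) S_auto_cen_nrm(2)[OF a(1) \<psi>S[OF a(2)]] unfolding a(3) K.fully_normalized_iff nrm by simp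
    qed
    then show "fully_normalized S F P" using P by (simp add: fully_normalized_iff)
  next
    assume "fully_normalized S F P"
    then show "fully_normalized SH FH P"
      using sub K_mor_mor unfolding K.fully_normalized_iff fully_normalized_iff nrm by blast
  qed
  show "centric SH FH P \<longleftrightarrow> centric S F P"
  proof
    assume K: "centric SH FH P"
    have "cen (f ` P) \<subseteq> f ` P" if f: "mor P f" for f
    proof -
      obtain \<alpha> \<psi> where a: "mor (carrier S) \<alpha>" "K.mor P \<psi>" "f ` P = \<alpha> ` \<psi> ` P" using K_mor_decomp[OF eq f] by blast
      let ?Q = "\<psi> ` P"
      have Q: "subgroup ?Q S" by (rule \<psi>S[OF a(2)])
      have c: "cen ?Q \<subseteq> ?Q" using K a(2) unfolding K.centric_iff cen by blast
      have QS: "?Q \<subseteq> carrier S" using subgroup.subset[OF Q] .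
      have "finite (\<alpha> ` cen ?Q)" "finite (cen (\<alpha> ` ?Q))"
        using sub_finite[OF cenS[OF Q]] sub_finite[OF cenS[OF mor_image[OF mor_restrict[OF a(1) Q QS]]]] by auto
      moreover have cc: "cen ?Q \<subseteq> carrier S" using cen_carrier by blast
      then have "\<alpha> ` cen ?Q \<subseteq> cen (\<alpha> ` ?Q)" using mor_cen[OF a(1) QS] by blast
      moreover have "card (\<alpha> ` cen ?Q) = card (cen (\<alpha> ` ?Q))"
        using S_auto_cen_nrm(1)[OF a(1) Q] card_image[OF inj_on_subset[OF mor_inj[OF a(1)] cc]] by simp
      ultimately have "\<alpha> ` cen ?Q = cen (\<alpha> ` ?Q)" by (simp add: card_subset_eq)
      then show ?thesis using c unfolding a(3) by blast
    qed
    then show "centric S F P" using P by (simp add: centric_iff)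
  next
    assume "centric S F P"
    then show "centric SH FH P" using sub K_mor_mor unfolding K.centric_iff centric_iff cen by blast
  qed
qed

end

section \<open>Fusion subsystems attached to a fusion mapping triple\<close>

theorem proposition3p8:
  fixes p :: nat
    and S :: "('a, 'm) monoid_scheme" and F :: "'a homs"
    and \<Gamma> :: "('g, 'n) monoid_scheme" and \<theta> :: "'a \<Rightarrow> 'g"
    and \<Theta> :: "'a set \<Rightarrow> 'a set \<Rightarrow> ('a \<Rightarrow> 'a) \<Rightarrow> 'g set"
    and H :: "'g set"
  defines "S\<^sub>H \<equiv> S\<lparr>carrier := preimage_group S \<theta> H\<rparr>"
    and "F\<^sub>H \<equiv> F_sub S F \<theta> \<Theta> H"
  assumes "prime p"
    and "saturated_fusion_system p S F"
    and "fusion_mapping_triple S F \<Gamma> \<theta> \<Theta>"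
    and "finite_p_group p \<Gamma> \<or> finite_p'_group p \<Gamma>"
    and "subgroup H \<Gamma>"
  shows "saturated_fusion_system p S\<^sub>H F\<^sub>H \<and>
    (finite_p_group p \<Gamma> \<longrightarrow>
      (\<forall>P. subgroup P S\<^sub>H \<longrightarrow> (quasicentric S\<^sub>H F\<^sub>H P \<longleftrightarrow> quasicentric S F P)) \<and>
      O_p_star p S F \<le> F_bullet S F \<Theta> {\<one>\<^bsub>\<Gamma>\<^esub>}) \<and>
    (finite_p'_group p \<Gamma> \<longrightarrow>
      preimage_group S \<theta> H = carrier S \<and>
      (\<forall>P. subgroup P S \<longrightarrow>
        (centric S\<^sub>H F\<^sub>H P \<longleftrightarrow> centric S F P) \<and>
        (fully_centralized S\<^sub>H F\<^sub>H P \<longleftrightarrow> fully_centralized S F P) \<and>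
        (fully_normalized S\<^sub>H F\<^sub>H P \<longleftrightarrow> fully_normalized S F P)) \<and>
      O_p'_star p S F \<le> F_bullet S F \<Theta> {\<one>\<^bsub>\<Gamma>\<^esub>})"
proof -
  have "fusion_system p S F" using assms(4) by (rule saturated_fusion_system.axioms)
  then interpret X: fusion_triple_subgroup p S F \<Gamma> \<theta> \<Theta> H
    using assms by (intro fusion_triple_subgroup.intro fusion_triple.intro prime_saturated.intro
      prime_fusion_system.intro prime_fusion_system_axioms.intro fusion_triple_axioms.intro
      fusion_triple_subgroup_axioms.intro)
  have S: "S\<^sub>H = X.SH" by (simp add: S\<^sub>H_def X.SHc_def)
  show ?thesis
    unfolding S F\<^sub>H_def
  proof (intro conjI impI allI)
    show "saturated_fusion_system p X.SH (F_sub S F \<theta> \<Theta> H)" by (rule X.FH_saturated)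
    show "preimage_group S \<theta> H = carrier S" if "finite_p'_group p \<Gamma>" using X.SHc_eq_S[OF that] by (simp add: X.SHc_def)
  qed (use X.K_quasicentric_iff X.O_p_star_le X.O_p'_star_le X.K_centric_full_iffs[OF X.SHc_eq_S] in blast)+
qed

end
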